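(* Let $A$ be a unital simple separable exact C$^*$-algebra which is approximately divisible and of real rank zero. Let $a \in A$ be a positive element such that $\langle a \rangle$ is not compact in $\mathrm{Cu}(A)$ (if $A$ is stably finite) or $\langle a\rangle$ is nonzero (if $A$ is purely infinite). Then, for every compact metric space $X$, the set $$D_{a,X} = \{ f \in C(X,A) \mid f \geq 0 \text{ and } \langle f(x) \rangle = \langle a \rangle \text{ for all } x \in X \}$$ is path connected (in the norm topology of $C(X,A)$).
   Context: Cuntz semigroup: for a C$^*$-algebra $B$ and positive $a,b\in B_+$, write $a \precsim b$ if there is a sequence $(v_n)$ in $B$ with $v_n b v_n^* \to a$ in norm, and $a\sim b$ (Cuntz equivalence) if $a\precsim b$ and $b\precsim a$. For a C$^*$-algebra $A$, with $\mathcal{K}$ the compact operators on a separable infinite-dimensional Hilbert space, set $\mathrm{Cu}(A) = (A\otimes\mathcal{K})_+/\!\sim$, and let $\langle a\rangle$ be the class of $a$; elements of $A$ are viewed in $A\otimes\mathcal{K}$ via $a\mapsto a\otimes e_{11}$. $\mathrm{Cu}(A)$ is ordered by $\langle a\rangle\le\langle b\rangle \Leftrightarrow a\precsim b$, and suprema of increasing sequences exist in it. Write $\langle a\rangle\ll\langle b\rangle$ if whenever $(\langle b_i\rangle)$ is an increasing sequence with $\sup_i\langle b_i\rangle\ge\langle b\rangle$, there is $i_0$ with $\langle a\rangle\le\langle b_{i_0}\rangle$. An element $\langle a\rangle$ is compact if $\langle a\rangle\ll\langle a\rangle$. Approximately divisible: a unital separable C$^*$-algebra $A$ is approximately divisible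 if for each $N\in\mathbb{N}$ there is an approximately central sequence of unital $*$-homomorphisms $M_N(\mathbb{C})\oplus M_{N+1}(\mathbb{C})\to A$ (i.e. the images of each fixed element asymptotically commute in norm with each element of $A$). Real rank zero: every self-adjoint element is a norm limit of self-adjoint elements with finite spectrum. $C(X,A)$ is the C$^*$-algebra of continuous functions $X\to A$ with the supremum norm. An algebra $A$ satisfying the hypotheses of the theorem is either stably finite or purely infinite. *)

theory Defs
  imports "HOL-Analysis.Analysis" "HOL-Algebra.Ideal" "HOL-Algebra.Module"
begin

section \<open>C*-algebras\<close>

text \<open>
  C*-algebras are carrier-based structures on top of the \<^typ>\<open>(complex, 'a) module\<close> records of
  HOL-Algebra.  Algebras need not be unital; the record field \<^term>\<open>monoid.one\<close> is
  meaningful only for unital ones.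
\<close>

record 'a star_alg = "(complex, 'a) module" +
  star :: "'a \<Rightarrow> 'a"

record 'a cstar = "'a star_alg" +
  cnorm :: "'a \<Rightarrow> real"

definition complex_ring :: "complex ring" where
  "complex_ring = \<lparr>carrier = UNIV, monoid.mult = (*), one = 1, ring.zero = 0, add = (+)\<rparr>"

definition cmetric :: "('a, 'm) cstar_scheme \<Rightarrow> 'a metric" where
  "cmetric A = metric (carrier A,
     \<lambda>x y. if x \<in> carrier A \<and> y \<in> carrier A then cnorm A (x \<ominus>\<^bsub>A\<^esub> y) else 0)"

locale cstar_algebra = Module.module complex_ring A for A :: "('a, 'm) cstar_scheme" (structure) +
  assumes mult_closed: "\<lbrakk>x \<in> carrier A; y \<in> carrier A\<rbrakk> \<Longrightarrow> x \<otimes> y \<in> carrier A"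
    and mult_assoc: "\<lbrakk>x \<in> carrier A; y \<in> carrier A; z \<in> carrier A\<rbrakk> \<Longrightarrow>
          (x \<otimes> y) \<otimes> z = x \<otimes> (y \<otimes> z)"
    and distr_left: "\<lbrakk>x \<in> carrier A; y \<in> carrier A; z \<in> carrier A\<rbrakk> \<Longrightarrow>
          (x \<oplus> y) \<otimes> z = (x \<otimes> z) \<oplus> (y \<otimes> z)"
    and distr_right: "\<lbrakk>x \<in> carrier A; y \<in> carrier A; z \<in> carrier A\<rbrakk> \<Longrightarrow>
          x \<otimes> (y \<oplus> z) = (x \<otimes> y) \<oplus> (x \<otimes> z)"
    and smult_mult_left: "\<lbrakk>x \<in> carrier A; y \<in> carrier A\<rbrakk> \<Longrightarrow> (c \<odot> x) \<otimes> y = c \<odot> (x \<otimes> y)"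
    and smult_mult_right: "\<lbrakk>x \<in> carrier A; y \<in> carrier A\<rbrakk> \<Longrightarrow> x \<otimes> (c \<odot> y) = c \<odot> (x \<otimes> y)"
    and star_closed: "x \<in> carrier A \<Longrightarrow> star A x \<in> carrier A"
    and star_star: "x \<in> carrier A \<Longrightarrow> star A (star A x) = x"
    and star_add: "\<lbrakk>x \<in> carrier A; y \<in> carrier A\<rbrakk> \<Longrightarrow> star A (x \<oplus> y) = star A x \<oplus> star A y"
    and star_smult: "x \<in> carrier A \<Longrightarrow> star A (c \<odot> x) = cnj c \<odot> star A x"
    and star_mult: "\<lbrakk>x \<in> carrier A; y \<in> carrier A\<rbrakk> \<Longrightarrow> star A (x \<otimes> y) = star A y \<otimes> star A x"
    and norm_nonneg: "x \<in> carrier A \<Longrightarrow> 0 \<le> cnorm A x"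
    and norm_eq_zero: "x \<in> carrier A \<Longrightarrow> cnorm A x = 0 \<longleftrightarrow> x = \<zero>"
    and norm_triangle: "\<lbrakk>x \<in> carrier A; y \<in> carrier A\<rbrakk> \<Longrightarrow> cnorm A (x \<oplus> y) \<le> cnorm A x + cnorm A y"
    and norm_smult: "x \<in> carrier A \<Longrightarrow> cnorm A (c \<odot> x) = cmod c * cnorm A x"
    and norm_mult: "\<lbrakk>x \<in> carrier A; y \<in> carrier A\<rbrakk> \<Longrightarrow> cnorm A (x \<otimes> y) \<le> cnorm A x * cnorm A y"
    and cstar_identity: "x \<in> carrier A \<Longrightarrow> cnorm A (star A x \<otimes> x) = (cnorm A x)\<^sup>2"
    and complete: "mcomplete_of (cmetric A)"

definition pos :: "('a, 'm) star_alg_scheme \<Rightarrow> 'a set" where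
  "pos A = {star A y \<otimes>\<^bsub>A\<^esub> y | y. y \<in> carrier A}"

definition star_hom :: "('a, 'm) star_alg_scheme \<Rightarrow> ('b, 'n) star_alg_scheme \<Rightarrow> ('a \<Rightarrow> 'b) \<Rightarrow> bool" where
  "star_hom A B f \<longleftrightarrow> f \<in> carrier A \<rightarrow> carrier B \<and>
     (\<forall>x \<in> carrier A. \<forall>y \<in> carrier A. f (x \<oplus>\<^bsub>A\<^esub> y) = f x \<oplus>\<^bsub>B\<^esub> f y) \<and>
     (\<forall>c. \<forall>x \<in> carrier A. f (c \<odot>\<^bsub>A\<^esub> x) = c \<odot>\<^bsub>B\<^esub> f x) \<and>
     (\<forall>x \<in> carrier A. \<forall>y \<in> carrier A. f (x \<otimes>\<^bsub>A\<^esub> y) = f x \<otimes>\<^bsub>B\<^esub> f y) \<and>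
     (\<forall>x \<in> carrier A. f (star A x) = star B (f x))"

definition cstar_subalgebra :: "'a set \<Rightarrow> ('a, 'm) cstar_scheme \<Rightarrow> bool" where
  "cstar_subalgebra B A \<longleftrightarrow> B \<subseteq> carrier A \<and> \<zero>\<^bsub>A\<^esub> \<in> B \<and>
     (\<forall>x \<in> B. \<forall>y \<in> B. x \<oplus>\<^bsub>A\<^esub> y \<in> B \<and> x \<otimes>\<^bsub>A\<^esub> y \<in> B) \<and>
     (\<forall>x \<in> B. star A x \<in> B \<and> (\<forall>c. c \<odot>\<^bsub>A\<^esub> x \<in> B)) \<and>
     closedin (mtopology_of (cmetric A)) B"

definition unital :: "('a, 'm) cstar_scheme \<Rightarrow> bool" where
  "unital A \<longleftrightarrow> Group.monoid A"

definition separable :: "('a, 'm) cstar_scheme \<Rightarrow> bool" where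
  "separable A \<longleftrightarrow> separable_space (mtopology_of (cmetric A))"

text \<open>For unital algebras the ring ideals of HOL-Algebra are automatically complex subspaces.\<close>

definition simple :: "('a, 'm) cstar_scheme \<Rightarrow> bool" where
  "simple A \<longleftrightarrow> carrier A \<noteq> {\<zero>\<^bsub>A\<^esub>} \<and>
     (\<forall>I. ideal I A \<and> closedin (mtopology_of (cmetric A)) I \<longrightarrow> I = {\<zero>\<^bsub>A\<^esub>} \<or> I = carrier A)"


section \<open>Minimal tensor products\<close>

text \<open>
  Elements of the algebraic tensor product of \<open>A\<close> and \<open>B\<close> are represented by finite formal sums,
  i.e. lists of pairs.  The product functional of two states has GNS representation the tensor product
  of the two GNS representations, with cyclic vector the tensor product of the cyclic vectors.
  Hence \<open>min_norm\<close> below, Turumaru's formula, is the norm of a formal sum in the tensor product of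
  the universal representations of \<open>A\<close> and \<open>B\<close>; formal sums representing the same
  tensor differ by a sum of norm 0.  The element 0 is inserted only because the zero algebra has no states.
\<close>

definition state :: "('a, 'm) cstar_scheme \<Rightarrow> ('a \<Rightarrow> complex) \<Rightarrow> bool" where
  "state A \<phi> \<longleftrightarrow>
     (\<forall>x \<in> carrier A. \<forall>y \<in> carrier A. \<phi> (x \<oplus>\<^bsub>A\<^esub> y) = \<phi> x + \<phi> y) \<and>
     (\<forall>c. \<forall>x \<in> carrier A. \<phi> (c \<odot>\<^bsub>A\<^esub> x) = c * \<phi> x) \<and>
     (\<forall>x \<in> pos A. \<phi> x \<in> \<real>\<^sub>\<ge>\<^sub>0) \<and>
     bdd_above {cmod (\<phi> x) | x. x \<in> carrier A \<and> cnorm A x \<le> 1} \<and>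
     Sup {cmod (\<phi> x) | x. x \<in> carrier A \<and> cnorm A x \<le> 1} = 1"

type_synonym ('a, 'b) formal = "('a \<times> 'b) list"

definition formals :: "('a, 'm) cstar_scheme \<Rightarrow> ('b, 'n) cstar_scheme \<Rightarrow> ('a, 'b) formal set" where
  "formals A B = lists (carrier A \<times> carrier B)"

definition fsmult :: "('a, 'm) cstar_scheme \<Rightarrow> complex \<Rightarrow> ('a, 'b) formal \<Rightarrow> ('a, 'b) formal" where
  "fsmult A c xs = map (\<lambda>(a, b). (c \<odot>\<^bsub>A\<^esub> a, b)) xs"

definition fdiff :: "('a, 'm) cstar_scheme \<Rightarrow> ('a, 'b) formal \<Rightarrow> ('a, 'b) formal \<Rightarrow> ('a, 'b) formal" where
  "fdiff A xs ys = xs @ fsmult A (- 1) ys"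

definition fmult :: "('a, 'm) cstar_scheme \<Rightarrow> ('b, 'n) cstar_scheme \<Rightarrow>
    ('a, 'b) formal \<Rightarrow> ('a, 'b) formal \<Rightarrow> ('a, 'b) formal" where
  "fmult A B xs ys = concat (map (\<lambda>(a, b). map (\<lambda>(a', b'). (a \<otimes>\<^bsub>A\<^esub> a', b \<otimes>\<^bsub>B\<^esub> b')) ys) xs)"

definition fstar :: "('a, 'm) cstar_scheme \<Rightarrow> ('b, 'n) cstar_scheme \<Rightarrow> ('a, 'b) formal \<Rightarrow> ('a, 'b) formal" where
  "fstar A B xs = map (\<lambda>(a, b). (star A a, star B b)) xs"

definition prod_functional :: "('a \<Rightarrow> complex) \<Rightarrow> ('b \<Rightarrow> complex) \<Rightarrow> ('a, 'b) formal \<Rightarrow> complex" where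
  "prod_functional \<phi> \<psi> xs = sum_list (map (\<lambda>(a, b). \<phi> a * \<psi> b) xs)"

definition min_norm :: "('a, 'm) cstar_scheme \<Rightarrow> ('b, 'n) cstar_scheme \<Rightarrow> ('a, 'b) formal \<Rightarrow> real" where
  "min_norm A B x = Sup (insert 0
     {sqrt (Re (prod_functional \<phi> \<psi> (fmult A B (fstar A B (fmult A B x y)) (fmult A B x y))) /
            Re (prod_functional \<phi> \<psi> (fmult A B (fstar A B y) y))) | \<phi> \<psi> y.
        state A \<phi> \<and> state B \<psi> \<and> y \<in> formals A B \<and>
        0 < Re (prod_functional \<phi> \<psi> (fmult A B (fstar A B y) y))})"

text \<open>
  The completion: elements of the tensor product are classes of \<open>min_norm\<close>-Cauchy sequences
  of formal sums.
\<close>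

definition fcauchy :: "('a, 'm) cstar_scheme \<Rightarrow> ('b, 'n) cstar_scheme \<Rightarrow> (nat \<Rightarrow> ('a, 'b) formal) set" where
  "fcauchy A B = {s. (\<forall>n. s n \<in> formals A B) \<and>
     (\<forall>e>0. \<exists>N. \<forall>m\<ge>N. \<forall>n\<ge>N. min_norm A B (fdiff A (s m) (s n)) < e)}"

definition tclass :: "('a, 'm) cstar_scheme \<Rightarrow> ('b, 'n) cstar_scheme \<Rightarrow>
    (nat \<Rightarrow> ('a, 'b) formal) \<Rightarrow> (nat \<Rightarrow> ('a, 'b) formal) set" where
  "tclass A B s = {t \<in> fcauchy A B. (\<lambda>n. min_norm A B (fdiff A (s n) (t n))) \<longlonglongrightarrow> 0}"

definition trep :: "(nat \<Rightarrow> ('a, 'b) formal) set \<Rightarrow> nat \<Rightarrow> ('a, 'b) formal" where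
  "trep X = (SOME s. s \<in> X)"

definition tens :: "('a, 'm) cstar_scheme \<Rightarrow> ('b, 'n) cstar_scheme \<Rightarrow> (nat \<Rightarrow> ('a, 'b) formal) set cstar" where
  "tens A B =
    \<lparr>carrier = tclass A B ` fcauchy A B,
     monoid.mult = (\<lambda>X Y. tclass A B (\<lambda>n. fmult A B (trep X n) (trep Y n))),
     one = tclass A B (\<lambda>n. [(\<one>\<^bsub>A\<^esub>, \<one>\<^bsub>B\<^esub>)]),
     ring.zero = tclass A B (\<lambda>n. []),
     add = (\<lambda>X Y. tclass A B (\<lambda>n. trep X n @ trep Y n)),
     smult = (\<lambda>c X. tclass A B (\<lambda>n. fsmult A c (trep X n))),
     star = (\<lambda>X. tclass A B (\<lambda>n. fstar A B (trep X n))),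
     cnorm = (\<lambda>X. lim (\<lambda>n. min_norm A B (trep X n)))\<rparr>"

definition elem_tensor :: "('a, 'm) cstar_scheme \<Rightarrow> ('b, 'n) cstar_scheme \<Rightarrow> 'a \<Rightarrow> 'b \<Rightarrow>
    (nat \<Rightarrow> ('a, 'b) formal) set" where
  "elem_tensor A B a b = tclass A B (\<lambda>n. [(a, b)])"

text \<open>The map \<open>id \<otimes> f\<close> from \<open>A \<otimes> B\<close> to \<open>A \<otimes> C\<close> induced by a *-homomorphism \<open>f\<close> from \<open>B\<close> to \<open>C\<close>.\<close>

definition tens_map :: "('a, 'm) cstar_scheme \<Rightarrow> ('c, 'n) cstar_scheme \<Rightarrow> ('b \<Rightarrow> 'c) \<Rightarrow>
    (nat \<Rightarrow> ('a, 'b) formal) set \<Rightarrow> (nat \<Rightarrow> ('a, 'c) formal) set" where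
  "tens_map A C f X = tclass A C (\<lambda>n. map (\<lambda>(a, b). (a, f b)) (trep X n))"

definition short_exact :: "('a, 'm) star_alg_scheme \<Rightarrow> ('b, 'n) star_alg_scheme \<Rightarrow> ('c, 'p) star_alg_scheme \<Rightarrow>
    ('a \<Rightarrow> 'b) \<Rightarrow> ('b \<Rightarrow> 'c) \<Rightarrow> bool" where
  "short_exact J B C i q \<longleftrightarrow> star_hom J B i \<and> star_hom B C q \<and> inj_on i (carrier J) \<and>
     i ` carrier J = {x \<in> carrier B. q x = \<zero>\<^bsub>C\<^esub>} \<and> q ` carrier B = carrier C"

text \<open>
  Exactness of \<open>A\<close>: tensoring with \<open>A\<close> preserves short exact sequences.  HOL cannot
  quantify over types inside a formula, so the sequences range over all C*-algebras carried by
  subsets of the type \<^typ>\<open>real set\<close>, of cardinality \<open>2 ^ continuum\<close>.  Up to isomorphism these are all C*-algebras of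
  at most this cardinality; they include all separable ones, to which the general case reduces since every
  element of \<open>A \<otimes> B\<close> lies in \<open>A \<otimes> B'\<close> for a separable subalgebra \<open>B'\<close> of \<open>B\<close>.
\<close>

definition exact :: "('a, 'm) cstar_scheme \<Rightarrow> bool" where
  "exact A \<longleftrightarrow> (\<forall>(J :: real set cstar) (B :: real set cstar) (C :: real set cstar) i q.
     cstar_algebra J \<and> cstar_algebra B \<and> cstar_algebra C \<and> short_exact J B C i q \<longrightarrow>
     short_exact (tens A J) (tens A B) (tens A C) (tens_map A B i) (tens_map A C q))"


section \<open>The compact operators on the sequence space\<close>

definition ell2 :: "(nat \<Rightarrow> complex) set" where
  "ell2 = {x. summable (\<lambda>i. (cmod (x i))\<^sup>2)}"

definition l2_ip :: "(nat \<Rightarrow> complex) \<Rightarrow> (nat \<Rightarrow> complex) \<Rightarrow> complex" where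
  "l2_ip x y = (\<Sum>i. x i * cnj (y i))"

definition l2_norm :: "(nat \<Rightarrow> complex) \<Rightarrow> real" where
  "l2_norm x = sqrt (\<Sum>i. (cmod (x i))\<^sup>2)"

type_synonym l2_op = "(nat \<Rightarrow> complex) \<Rightarrow> nat \<Rightarrow> complex"

definition compact_ops :: "l2_op set" where
  "compact_ops = {T \<in> ell2 \<rightarrow>\<^sub>E ell2.
     (\<forall>x \<in> ell2. \<forall>y \<in> ell2. T (\<lambda>i. x i + y i) = (\<lambda>i. T x i + T y i)) \<and>
     (\<forall>c. \<forall>x \<in> ell2. T (\<lambda>i. c * x i) = (\<lambda>i. c * T x i)) \<and>
     (\<forall>s. (\<forall>n. s n \<in> ell2 \<and> l2_norm (s n) \<le> 1) \<longrightarrow>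
       (\<exists>r y. strict_mono r \<and> y \<in> ell2 \<and> (\<lambda>n. l2_norm (\<lambda>i. T (s (r n :: nat)) i - y i)) \<longlonglongrightarrow> 0))}"

definition K_alg :: "l2_op cstar" where
  "K_alg =
    \<lparr>carrier = compact_ops,
     monoid.mult = (\<lambda>S T. \<lambda>x\<in>ell2. S (T x)),
     one = (\<lambda>x\<in>ell2. x),
     ring.zero = (\<lambda>x\<in>ell2. \<lambda>i. 0),
     add = (\<lambda>S T. \<lambda>x\<in>ell2. \<lambda>i. S x i + T x i),
     smult = (\<lambda>c T. \<lambda>x\<in>ell2. \<lambda>i. c * T x i),
     star = (\<lambda>T. THE S. S \<in> compact_ops \<and> (\<forall>x \<in> ell2. \<forall>y \<in> ell2. l2_ip (T x) y = l2_ip x (S y))),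
     cnorm = (\<lambda>T. Sup {l2_norm (T x) | x. x \<in> ell2 \<and> l2_norm x \<le> 1})\<rparr>"

definition e11 :: l2_op where
  "e11 = (\<lambda>x\<in>ell2. \<lambda>i. if i = 0 then x 0 else 0)"


section \<open>The Cuntz semigroup\<close>

definition cuntz_le :: "('b, 'm) cstar_scheme \<Rightarrow> 'b \<Rightarrow> 'b \<Rightarrow> bool" where
  "cuntz_le B a b \<longleftrightarrow> (\<exists>v :: nat \<Rightarrow> 'b. (\<forall>n. v n \<in> carrier B) \<and>
     (\<lambda>n. cnorm B ((v n \<otimes>\<^bsub>B\<^esub> b \<otimes>\<^bsub>B\<^esub> star B (v n)) \<ominus>\<^bsub>B\<^esub> a)) \<longlonglongrightarrow> 0)"

definition cuntz_rel :: "('b, 'm) cstar_scheme \<Rightarrow> ('b \<times> 'b) set" where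
  "cuntz_rel B = {(a, b). a \<in> pos B \<and> b \<in> pos B \<and> cuntz_le B a b \<and> cuntz_le B b a}"

abbreviation stab :: "('a, 'm) cstar_scheme \<Rightarrow> (nat \<Rightarrow> ('a, l2_op) formal) set cstar" where
  "stab A \<equiv> tens A K_alg"

type_synonym 'a cu = "(nat \<Rightarrow> ('a, l2_op) formal) set set"

definition Cu :: "('a, 'm) cstar_scheme \<Rightarrow> 'a cu set" where
  "Cu A = pos (stab A) // cuntz_rel (stab A)"

definition cu_class :: "('a, 'm) cstar_scheme \<Rightarrow> 'a \<Rightarrow> 'a cu" where
  "cu_class A a = cuntz_rel (stab A) `` {elem_tensor A K_alg a e11}"

definition cu_le :: "('a, 'm) cstar_scheme \<Rightarrow> 'a cu \<Rightarrow> 'a cu \<Rightarrow> bool" where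
  "cu_le A X Y \<longleftrightarrow> (\<exists>a \<in> X. \<exists>b \<in> Y. cuntz_le (stab A) a b)"

definition cu_is_sup :: "('a, 'm) cstar_scheme \<Rightarrow> (nat \<Rightarrow> 'a cu) \<Rightarrow> 'a cu \<Rightarrow> bool" where
  "cu_is_sup A b S \<longleftrightarrow> S \<in> Cu A \<and> (\<forall>i. cu_le A (b i) S) \<and>
     (\<forall>T \<in> Cu A. (\<forall>i. cu_le A (b i) T) \<longrightarrow> cu_le A S T)"

definition cu_way_below :: "('a, 'm) cstar_scheme \<Rightarrow> 'a cu \<Rightarrow> 'a cu \<Rightarrow> bool" where
  "cu_way_below A X Y \<longleftrightarrow> (\<forall>b S. (\<forall>i. b i \<in> Cu A \<and> cu_le A (b i) (b (Suc i))) \<and>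
     cu_is_sup A b S \<and> cu_le A Y S \<longrightarrow> (\<exists>i. cu_le A X (b i)))"

definition cu_compact :: "('a, 'm) cstar_scheme \<Rightarrow> 'a cu \<Rightarrow> bool" where
  "cu_compact A X \<longleftrightarrow> cu_way_below A X X"


section \<open>Regularity and finiteness properties\<close>

definition complex_star_alg :: "complex star_alg" where
  "complex_star_alg = \<lparr>carrier = UNIV, monoid.mult = (*), one = 1, ring.zero = 0, add = (+),
     smult = (*), star = cnj\<rparr>"

text \<open>The *-algebra of \<open>n \<times> n\<close> matrices over \<open>A\<close>; entries with an index \<open>\<ge> n\<close> are zero.\<close>

definition mat_alg :: "nat \<Rightarrow> ('a, 'm) star_alg_scheme \<Rightarrow> (nat \<Rightarrow> nat \<Rightarrow> 'a) star_alg" where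
  "mat_alg n A =
    \<lparr>carrier = {x. (\<forall>i<n. \<forall>j<n. x i j \<in> carrier A) \<and> (\<forall>i j. \<not> (i < n \<and> j < n) \<longrightarrow> x i j = \<zero>\<^bsub>A\<^esub>)},
     monoid.mult = (\<lambda>x y i j. if i < n \<and> j < n
                      then \<Oplus>\<^bsub>A\<^esub>k\<in>{..<n}. x i k \<otimes>\<^bsub>A\<^esub> y k j else \<zero>\<^bsub>A\<^esub>),
     one = (\<lambda>i j. if i < n \<and> i = j then \<one>\<^bsub>A\<^esub> else \<zero>\<^bsub>A\<^esub>),
     ring.zero = (\<lambda>i j. \<zero>\<^bsub>A\<^esub>),
     add = (\<lambda>x y i j. x i j \<oplus>\<^bsub>A\<^esub> y i j),
     smult = (\<lambda>c x i j. c \<odot>\<^bsub>A\<^esub> x i j),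
     star = (\<lambda>x i j. star A (x j i))\<rparr>"

definition direct_sum :: "('a, 'm) star_alg_scheme \<Rightarrow> ('b, 'n) star_alg_scheme \<Rightarrow> ('a \<times> 'b) star_alg" where
  "direct_sum A B =
    \<lparr>carrier = carrier A \<times> carrier B,
     monoid.mult = (\<lambda>(a, b) (a', b'). (a \<otimes>\<^bsub>A\<^esub> a', b \<otimes>\<^bsub>B\<^esub> b')),
     one = (\<one>\<^bsub>A\<^esub>, \<one>\<^bsub>B\<^esub>),
     ring.zero = (\<zero>\<^bsub>A\<^esub>, \<zero>\<^bsub>B\<^esub>),
     add = (\<lambda>(a, b) (a', b'). (a \<oplus>\<^bsub>A\<^esub> a', b \<oplus>\<^bsub>B\<^esub> b')),
     smult = (\<lambda>c (a, b). (c \<odot>\<^bsub>A\<^esub> a, c \<odot>\<^bsub>B\<^esub> b)),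
     star = (\<lambda>(a, b). (star A a, star B b))\<rparr>"

abbreviation CMat :: "nat \<Rightarrow> (nat \<Rightarrow> nat \<Rightarrow> complex) star_alg" where
  "CMat n \<equiv> mat_alg n complex_star_alg"

text \<open>The instance \<open>N = 0\<close> holds trivially: there the domain is \<open>0 \<oplus> \<complex>\<close>.\<close>

definition approximately_divisible :: "('a, 'm) cstar_scheme \<Rightarrow> bool" where
  "approximately_divisible A \<longleftrightarrow> unital A \<and> separable A \<and>
     (\<forall>N. \<exists>\<phi> :: nat \<Rightarrow> (nat \<Rightarrow> nat \<Rightarrow> complex) \<times> (nat \<Rightarrow> nat \<Rightarrow> complex) \<Rightarrow> 'a.
        (\<forall>k. star_hom (direct_sum (CMat N) (CMat (N + 1))) A (\<phi> k) \<and>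
             \<phi> k \<one>\<^bsub>direct_sum (CMat N) (CMat (N + 1))\<^esub> = \<one>\<^bsub>A\<^esub>) \<and>
        (\<forall>F \<in> carrier (direct_sum (CMat N) (CMat (N + 1))). \<forall>x \<in> carrier A.
           (\<lambda>k. cnorm A ((\<phi> k F \<otimes>\<^bsub>A\<^esub> x) \<ominus>\<^bsub>A\<^esub> (x \<otimes>\<^bsub>A\<^esub> \<phi> k F))) \<longlonglongrightarrow> 0))"

definition spectrum :: "('a, 'm) cstar_scheme \<Rightarrow> 'a \<Rightarrow> complex set" where
  "spectrum A a = {c. (c \<odot>\<^bsub>A\<^esub> \<one>\<^bsub>A\<^esub>) \<ominus>\<^bsub>A\<^esub> a \<notin> Units A}"

definition self_adjoint :: "('a, 'm) cstar_scheme \<Rightarrow> 'a \<Rightarrow> bool" where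
  "self_adjoint A a \<longleftrightarrow> a \<in> carrier A \<and> star A a = a"

definition real_rank_zero :: "('a, 'm) cstar_scheme \<Rightarrow> bool" where
  "real_rank_zero A \<longleftrightarrow> (\<forall>a. self_adjoint A a \<longrightarrow>
     (\<exists>s :: nat \<Rightarrow> 'a. (\<forall>n. self_adjoint A (s n) \<and> finite (spectrum A (s n))) \<and>
        (\<lambda>n. cnorm A (s n \<ominus>\<^bsub>A\<^esub> a)) \<longlonglongrightarrow> 0))"

text \<open>A unital algebra is stably finite if every isometry in a matrix algebra over it is unitary.\<close>

definition stably_finite :: "('a, 'm) cstar_scheme \<Rightarrow> bool" where
  "stably_finite A \<longleftrightarrow> (\<forall>n. \<forall>v \<in> carrier (mat_alg n A).
     star (mat_alg n A) v \<otimes>\<^bsub>mat_alg n A\<^esub> v = \<one>\<^bsub>mat_alg n A\<^esub> \<longrightarrow>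
     v \<otimes>\<^bsub>mat_alg n A\<^esub> star (mat_alg n A) v = \<one>\<^bsub>mat_alg n A\<^esub>)"

definition hereditary :: "'a set \<Rightarrow> ('a, 'm) cstar_scheme \<Rightarrow> bool" where
  "hereditary B A \<longleftrightarrow> cstar_subalgebra B A \<and>
     (\<forall>b \<in> B. \<forall>a \<in> pos A. b \<ominus>\<^bsub>A\<^esub> a \<in> pos A \<longrightarrow> a \<in> B)"

text \<open>An infinite projection is Murray--von Neumann equivalent to a proper subprojection of itself.\<close>

definition infinite_projection :: "('a, 'm) cstar_scheme \<Rightarrow> 'a \<Rightarrow> bool" where
  "infinite_projection A p \<longleftrightarrow> p \<in> carrier A \<and> star A p = p \<and> p \<otimes>\<^bsub>A\<^esub> p = p \<and>
     (\<exists>v \<in> carrier A. star A v \<otimes>\<^bsub>A\<^esub> v = p \<and>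
        p \<ominus>\<^bsub>A\<^esub> (v \<otimes>\<^bsub>A\<^esub> star A v) \<in> pos A \<and> v \<otimes>\<^bsub>A\<^esub> star A v \<noteq> p)"

text \<open>Cuntz's notion of pure infiniteness, for simple algebras.\<close>

definition purely_infinite :: "('a, 'm) cstar_scheme \<Rightarrow> bool" where
  "purely_infinite A \<longleftrightarrow> (\<forall>B. hereditary B A \<and> B \<noteq> {\<zero>\<^bsub>A\<^esub>} \<longrightarrow> (\<exists>p \<in> B. infinite_projection A p))"


section \<open>Algebras of continuous functions\<close>

definition cfun_alg :: "'x metric \<Rightarrow> ('a, 'm) cstar_scheme \<Rightarrow> ('x \<Rightarrow> 'a) cstar" where
  "cfun_alg X A =
    \<lparr>carrier = {f \<in> extensional (mspace X). continuous_map (mtopology_of X) (mtopology_of (cmetric A)) f},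
     monoid.mult = (\<lambda>f g. \<lambda>x\<in>mspace X. f x \<otimes>\<^bsub>A\<^esub> g x),
     one = (\<lambda>x\<in>mspace X. \<one>\<^bsub>A\<^esub>),
     ring.zero = (\<lambda>x\<in>mspace X. \<zero>\<^bsub>A\<^esub>),
     add = (\<lambda>f g. \<lambda>x\<in>mspace X. f x \<oplus>\<^bsub>A\<^esub> g x),
     smult = (\<lambda>c f. \<lambda>x\<in>mspace X. c \<odot>\<^bsub>A\<^esub> f x),
     star = (\<lambda>f. \<lambda>x\<in>mspace X. star A (f x)),
     cnorm = (\<lambda>f. Sup (insert 0 {cnorm A (f x) | x. x \<in> mspace X}))\<rparr>"

definition D_set :: "('a, 'm) cstar_scheme \<Rightarrow> 'x metric \<Rightarrow> 'a \<Rightarrow> ('x \<Rightarrow> 'a) set" where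
  "D_set A X a = {f \<in> pos (cfun_alg X A). \<forall>x \<in> mspace X. cu_class A (f x) = cu_class A a}"

end

(*
 A projection p has compact class in Cu(A): if p lies below the supremum x = lim w_n b_n w_n* of an
 increasing sequence (b_n), then p = r x r* is close to r w_n b_n w_n* r* for large n, so p lies below b_n.
 Moreover, slicing A tensor K by vector states of K shows that two elements of A are Cuntz equivalent in A
 if and only if they are in A tensor K. Hence in the stably finite case a is not equivalent to a projection, and 0 is
 not an isolated point of its spectrum.

 Let f be in D_{a,X}; then Y = f(X) is a compact set of positive elements equivalent to a. For fixed y, matrix
 units that asymptotically commute with A provide perturbations w of any given element such that all but the
 part of a near 0 lies below a w y w* a. By compactness and the Baire category theorem some w close to 1 works for all
 parts of a and all y in Y simultaneously, so that a w y w* a is equivalent to a. Deform y to w y w* (through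
 invertible elements), then to a w y w* a, to a w y w* a + a, and to a. This homotopy stays in the class of a,
 depends continuously on y, and hence joins f to the constant function a. In the purely infinite case all
 nonzero positive elements are equivalent and y, y + a, a suffice.
*)
theory Submission
 imports Defs "HOL-Computational_Algebra.Fundamental_Theorem_Algebra"
begin

text \<open>Everything of the form a x a + t a with x positive is below a, so the only hard relation
  is that a is below a w y w* a. To reach the part r of a away from 0, a given w is changed to w + c
  v n, where v y v* is close to a and n is a shift made of almost central matrix units. The shift is
  nilpotent, so the unknown term with w drops out of a finite geometric series, but it misses one
  diagonal matrix unit. The loss is repaid from a nonzero spectral part q of a below the cutoff,
  orthogonal to r: simplicity covers the unit by m conjugates of q^2, and this m fixes the matrix
  size. Such a q exists at every scale as soon as 0 is not isolated in the spectrum. Two obstacles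
  shape the rest. The analysis is done in a type class of unital algebras, while the theorem is
  about carriers; and the stabilisation has no unit, so facts reach it through its corners by
  finite-rank projections, with square roots expressed by polynomials whose errors do not depend on
  the algebra.\<close>

abbreviation (input) carrier_of ("C[_]") where "C[R] == carrier R"
abbreviation (input) cnorm_of ("N[_]") where "N[R] == cnorm R"
notation scaleR (infixr "*R" 75)
abbreviation tends_to (infixr "~~>" 60) where "f ~~> (l::'a::topological_space) \<equiv> f \<longlonglongrightarrow> l"

abbreviation (input) mult_in ("_ *[_] _" [70, 0, 71] 70) where "x *[R] y == x \<otimes>\<^bsub>R\<^esub> y"
abbreviation (input) add_in ("_ +[_] _" [65, 0, 66] 65) where "x +[R] y == x \<oplus>\<^bsub>R\<^esub> y"
abbreviation (input) minus_in ("_ -[_] _" [65, 0, 66] 65) where "x -[R] y == x \<ominus>\<^bsub>R\<^esub> y"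
abbreviation (input) smult_in ("_ \<odot>[_] _" [70, 0, 71] 70) where "c \<odot>[R] y == c \<odot>\<^bsub>R\<^esub> y"
abbreviation (input) zero_in ("\<zero>[_]") where "\<zero>[R] == \<zero>\<^bsub>R\<^esub>"
abbreviation (input) one_in ("\<one>[_]") where "\<one>[R] == \<one>\<^bsub>R\<^esub>"

section \<open>Unital C*-algebras as a type class\<close>

text \<open>Complex scalars are encoded over the real ones by a central skew-adjoint square root
  \<open>iu\<close> of - 1, so that limits, series and fixed points of real Banach algebras are
  available.\<close>

class ucstar = real_normed_algebra_1 + banach +
 fixes adj :: "'a => 'a" and iu :: 'a
 assumes adj_add: "adj (x + y) = adj x + adj y"
  and adj_scaleR: "adj (r *R x) = r *R adj x"
  and adj_mult: "adj (x * y) = adj y * adj x"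
  and adj_adj [simp]: "adj (adj x) = x"
  and adj_iu: "adj iu = - iu"
  and iu_sq: "iu * iu = - 1"
  and iu_central: "iu * x = x * iu"
  and cstar_norm: "norm (adj x * x) = (norm x)^2"

lemma adj_zero [simp]: "adj 0 = (0::'a::ucstar)"
 using adj_scaleR[of 0 "0::'a"] by simp

lemma adj_minus: "adj (- x::'a::ucstar) = - adj x"
 using adj_scaleR[of "-1" x] by simp

lemma adj_diff: "adj (x - y::'a::ucstar) = adj x - adj y"
 using adj_add[of x "- y"] adj_minus by simp

lemma adj_one [simp]: "adj 1 = (1::'a::ucstar)"
 using adj_mult[of "adj 1" "1::'a"] by simp

lemma adj_of_real [simp]: "adj (of_real r) = (of_real r::'a::ucstar)"
 by (simp add: of_real_def adj_scaleR)

lemma adj_sum: "adj (sum f S::'a::ucstar) = (\<Sum>i\<in>S. adj (f i))"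
 by (induction S rule: infinite_finite_induct) (simp_all add: adj_add)

lemma norm_adj [simp]: "norm (adj x) = norm (x::'a::ucstar)"
proof -
 have le: "norm y <= norm (adj y)" for y::'a
 proof (cases "norm y = 0")
  case False
  show ?thesis using cstar_norm[of y] norm_mult_ineq[of "adj y" y] False by (simp add: power2_eq_square)
 qed auto
 show ?thesis using le[of x] le[of "adj x"] by simp
qed

lemma cstar_norm': "norm (x * adj x) = (norm (x::'a::ucstar))^2"
 using cstar_norm[of "adj x"] by simp

lemma of_real_comm: "x * of_real r = of_real r * (x::'a::real_algebra_1)"
 by (simp add: of_real_def)

lemma bounded_linear_adj: "bounded_linear (adj :: 'a::ucstar => 'a)"
 by (rule bounded_linear_intro[where K=1]) (auto simp: adj_add adj_scaleR)

lemmas tendsto_adj [tendsto_intros] = bounded_linear.tendsto[OF bounded_linear_adj]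
lemmas continuous_on_adj [continuous_intros] = bounded_linear.continuous_on[OF bounded_linear_adj]
text \<open>z is the fixed point of the contraction \<open>(1/2) *R (y + z * z)\<close>. Being
  self-adjoint and commuting with everything that commutes with y are closed conditions that the map
  preserves, so they are built into the complete set on which the fixed point is sought.\<close>

lemma sqrt_near_one:
 fixes y :: "'a::ucstar"
 assumes "adj y = y" "norm y < 1"
 obtains z where "adj z = z" "(1 - z) * (1 - z) = 1 - y" "!!c. c * y = y * c ==> c * z = z * c"
proof -
 let ?b = "sqrt (1 - norm y)"
 \<comment> \<open>The smaller root of r = (norm y + r^2) / 2: the map sends the ball of radius r
   into itself and has Lipschitz constant r < 1 there.\<close>
 define r where "r = 1 - ?b"
 have r0: "0 <= r" "r < 1" using assms(2) by (auto simp: r_def)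
 have r1: "(norm y + r * r) / 2 = r"
 proof -
  have "(?b)^2 = 1 - norm y" using assms(2) by simp
  moreover have "?b = 1 - r" by (simp add: r_def)
  ultimately have "(1-r)^2 = 1 - norm y" by simp
  thus ?thesis by (simp add: power2_eq_square algebra_simps)
 qed
 define S where "S = {z. norm z <= r & adj z = z & (ALL c. c * y = y * c --> c * z = z * c)}"
 let ?a = "{z::'a. norm z <= r} \<inter> {z::'a. adj z = z} \<inter> (\<Inter>c. {z. c * y = y * c --> c * z = z * c})"
 have "closed {z. c * y = y * c --> c * z = z * c}" for c
  by (cases "c * y = y * c") (auto intro!: closed_Collect_eq continuous_intros)
 moreover have "closed {z::'a. norm z <= r}" "closed {z::'a. adj z = z}"
  by (auto intro!: closed_Collect_eq closed_Collect_le continuous_intros)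
 ultimately have "closed ?a"
  by blast
 moreover have "S = ?a"
  by (auto simp: S_def)
 ultimately have cS: "complete S" by (simp add: complete_eq_closed)
 define f where "f z = (1/2) *R (y + z * z)" for z
 have fS: "f ` S <= S"
 proof
  fix w assume "w : f ` S"
  then obtain z where z: "z : S" "w = f z" by blast
  have "norm (f z) <= (norm y + norm z * norm z) / 2"
   unfolding f_def using norm_triangle_ineq[of y "z*z"] norm_mult_ineq[of z z] by simp
  also have "... <= (norm y + r * r) / 2"
   using z(1) r0 by (auto simp: S_def intro!: mult_mono)
  finally have "norm (f z) <= r" using r1 by simp
  moreover have "adj (f z) = f z"
  proof -
   have "adj z = z" using z(1) by (simp add: S_def)
   thus ?thesis using assms(1) by (simp only: f_def adj_scaleR adj_add adj_mult)
  qed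
  moreover have "c * f z = f z * c" if "c * y = y * c" for c
  proof -
   have "c * z = z * c" using z(1) that by (auto simp: S_def)
   hence "c * (z * z) = z * z * c" by (metis mult.assoc)
   thus ?thesis using that by (simp add: f_def algebra_simps)
  qed
  ultimately show "w : S" using z by (simp add: S_def)
 qed
 have lip: "dist (f u) (f v) <= r * dist u v" if "u : S" "v : S" for u v
 proof -
  have "f u - f v = (1/2) *R (u * (u - v) + (u - v) * v)"
   by (simp add: f_def algebra_simps)
  hence "norm (f u - f v) <= (norm (u * (u - v)) + norm ((u - v) * v)) / 2"
   using norm_triangle_ineq[of "u * (u - v)" "(u-v) * v"] by simp
  also have "... <= (norm u * norm (u - v) + norm (u - v) * norm v) / 2"
   by (intro divide_right_mono add_mono norm_mult_ineq) auto
  also have "... <= (r * norm (u - v) + norm (u - v) * r) / 2"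
   using that r0 by (intro divide_right_mono add_mono mult_mono) (auto simp: S_def)
  finally show ?thesis by (simp add: dist_norm mult.commute)
 qed
 have "0 : S" using r0 by (simp add: S_def)
 then obtain z where z: "z : S" "f z = z"
  using Banach_fix[OF cS _ r0 fS] lip by blast
 have "z + z = y + z * z" using z(2) unfolding f_def by (metis scaleR_half_double scaleR_right_distrib)
 hence "(1 - z) * (1 - z) = 1 - y" by (simp add: algebra_simps)
 with z(1) show ?thesis using that by (auto simp: S_def)
qed

section \<open>Invertibility, and the norm as a spectral value\<close>

definition invb :: "'a::ring_1 => bool" where "invb x = (EX y. x * y = 1 & y * x = 1)"

lemma invb_mult: "invb x ==> invb y ==> invb (x * y)"
 unfolding invb_def by (metis mult.assoc mult.right_neutral)

text \<open>Commutation turns the inverse w of x y into a right inverse y w and a left inverse w y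
  of x, and these agree.\<close>

lemma invb_factor:
 assumes "x * y = y * x" "invb (x * y)" shows "invb x"
proof -
 obtain w where w: "x * y * w = 1" "w * (x * y) = 1" using assms by (auto simp: invb_def)
 have 1: "x * (y * w) = 1" using w by (simp add: mult.assoc)
 have 2: "(w * y) * x = 1" using w assms by (simp add: mult.assoc)
 have "y * w = w * y" using 1 2 by (metis mult.assoc mult.left_neutral mult.right_neutral)
 thus ?thesis using 1 2 by (auto simp: invb_def)
qed

text \<open>The two one-sided inverses are fixed points of \<open>%x. 1 + z * x\<close> and
  \<open>%x. 1 + x * z\<close>; the norm bound comes from the fixed point equation.\<close>

lemma invb_one_minus:
 fixes z :: "'a::{real_normed_algebra_1,banach}"
 assumes "norm z < 1"
 obtains w where "(1 - z) * w = 1" "w * (1 - z) = 1" "norm w <= 1 / (1 - norm z)"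
proof -
 obtain u where u: "1 + z * u = u" using assms Banach_fix[OF complete_UNIV, where f="%x. 1 + z * x" and c="norm z"] by (auto simp: dist_norm right_diff_distrib[symmetric] norm_mult_ineq)
 obtain v where v: "1 + v * z = v" using assms Banach_fix[OF complete_UNIV, where f="%x. 1 + x * z" and c="norm z"] by (auto simp: dist_norm left_diff_distrib[symmetric] mult.commute[of "norm z"] norm_mult_ineq)
 have 1: "(1 - z) * u = 1" using u by (simp add: algebra_simps)
 have 2: "v * (1 - z) = 1" using v by (simp add: algebra_simps)
 have "u = v" using 1 2 by (metis mult.assoc mult.left_neutral mult.right_neutral)
 have "norm u <= 1 / (1 - norm z)" using norm_triangle_ineq[of 1 "z * u"] norm_mult_ineq[of z u] u assms by (simp add: field_simps)
 thus ?thesis using that 1 2 \<open>u = v\<close> by blast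
qed

lemma invb_neumann:
 fixes x :: "'a::{real_normed_algebra_1,banach}"
 assumes "norm (of_real t - x) < t" shows "invb x"
proof -
 have t: "t > 0" using assms norm_ge_zero[of "of_real t - x"] by linarith
 define z where "z = (1/t) *R (of_real t - x)"
 have "norm z < 1" using assms t by (simp add: z_def)
 then obtain w where w: "(1 - z) * w = 1" "w * (1 - z) = 1" using invb_one_minus by metis
 have "x * ((1/t) *R w) = 1 & ((1/t) *R w) * x = 1" using t w by (simp add: z_def algebra_simps of_real_def)
 thus ?thesis unfolding invb_def by blast
qed

text \<open>Since a and b commute, u = a + iu b satisfies adj u u = a^2 + b^2, and a is the real
  part of u. This is monotonicity of the norm in a case where positivity is not yet
  available.\<close>

lemma sum_squares_norm:
 fixes a b :: "'a::ucstar"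
 assumes "adj a = a" "adj b = b" "a * b = b * a"
 shows "(norm a)^2 <= norm (a * a + b * b)"
proof -
 define u where "u = a + iu * b"
 have au: "adj u = a - iu * b"
  using assms by (simp add: u_def adj_add adj_mult adj_iu iu_central)
 have ib: "iu * b * (iu * b) = - (b * b)"
  by (metis iu_central iu_sq mult.assoc mult_minus1)
 have "adj u * u = a * a + b * b"
 proof -
  have "adj u * u = a * a + a * (iu * b) - iu * b * a - iu * b * (iu * b)"
   unfolding au by (simp add: u_def algebra_simps)
  moreover have "a * (iu * b) = iu * b * a"
   using assms(3) iu_central[of a] by (metis mult.assoc)
  ultimately show ?thesis using ib by simp
 qed
 hence n: "(norm u)^2 = norm (a * a + b * b)" using cstar_norm[of u] by simp
 have "2 *R a = u + adj u" unfolding au by (simp add: u_def scaleR_2)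
 hence "2 * norm a <= 2 * norm u"
  using norm_triangle_ineq[of u "adj u"] by (metis norm_adj norm_scaleR abs_numeral mult_2)
 hence "(norm a)^2 <= (norm u)^2" by simp
 thus ?thesis using n by simp
qed

text \<open>Positivity without spectral theory; it agrees with being of the form \<^term>\<open>adj y * y\<close>, see \<open>nonneg_iff\<close>.\<close>
definition nonneg :: "'a::ucstar => bool" where
 "nonneg x \<longleftrightarrow> adj x = x & (EX t>=norm x. norm (of_real t - x) <= t)"

text \<open>The element 1 - h^2 / t has a square root commuting with h, and adding the square of
  \<open>g\<close> to it gives 1; \<open>sum_squares_norm\<close> then bounds 1 - h^2 / t by 1. The
  factor 2 in t makes h^2 / t strictly smaller than 1, as the square root requires.\<close>

lemma nonneg_square:
 fixes h :: "'a::ucstar"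
 assumes "adj h = h" shows "nonneg (h * h)"
proof (cases "h = 0")
 case True thus ?thesis by (auto simp: nonneg_def intro!: exI[of _ 0])
next
 case False
 define t where "t = 2 * (norm h)^2"
 have t: "t > 0" using False by (simp add: t_def)
 define y where "y = (1/t) *R (h * h)"
 have ny: "norm y < 1"
 proof -
  show ?thesis using norm_mult_ineq[of h h] t by (simp add: t_def power2_eq_square y_def)
 qed
 have ay: "adj y = y" using assms by (simp add: y_def adj_scaleR adj_mult)
 obtain z where z: "adj z = z" "(1 - z) * (1 - z) = 1 - y" "!!c. c * y = y * c ==> c * z = z * c"
  using sqrt_near_one[OF ay ny] by metis
 have "h * z = z * h" by (intro z(3)) (simp add: y_def mult.assoc)
 moreover define g where "g = (1 / sqrt t) *R h"
 ultimately have gz: "(1 - z) * g = g * (1 - z)" by (simp add: algebra_simps)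
 have "(norm (1 - z))^2 <= norm ((1 - z) * (1 - z) + g * g)"
  by (rule sum_squares_norm) (use z assms gz in "auto simp: adj_diff g_def adj_scaleR")
 hence "norm (1 - y) <= 1"
  using t z(2) norm_mult_ineq[of "1 - z" "1 - z"] by (simp add: g_def y_def power2_eq_square)
 moreover have "of_real t - h * h = t *R (1 - y)" using t by (simp add: y_def algebra_simps of_real_def)
 ultimately have "norm (of_real t - h * h) <= t" using t by simp
 moreover have "norm (h * h) <= t" using norm_mult_ineq[of h h] zero_le_power2[of "norm h"] unfolding t_def power2_eq_square by linarith
 ultimately show ?thesis using assms by (auto simp: nonneg_def adj_mult)
qed

lemma nonneg_adj: "nonneg x ==> adj x = x" by (simp add: nonneg_def)

lemma nonneg_add_pos_invb:
 assumes "nonneg x" "c > 0" shows "invb (x + of_real c)"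
proof -
 obtain t where t: "norm x <= t" "norm (of_real t - x) <= t" using assms by (auto simp: nonneg_def)
 hence "norm (of_real (t + c) - (x + of_real c)) < t + c" using assms by simp
 thus ?thesis by (rule invb_neumann)
qed

text \<open>The source of all spectral information below: after scaling and factoring it says that
  the norm of a self-adjoint element, up to sign, is a spectral value.\<close>

lemma norm_one_not_invb:
 fixes h :: "'a::ucstar"
 assumes h: "adj h = h" "norm h = 1"
 shows "~ invb (1 - h * h)"
proof
 assume "invb (1 - h * h)"
 define k where "k = 1 - h * h"
 obtain ki where ki: "k * ki = 1" "ki * k = 1" using \<open>invb _\<close> by (auto simp: invb_def k_def)
 define D where "D = norm ki + 1"
 have D: "D >= 1" by (simp add: D_def)
 \<comment> \<open>c and d are small against the inverse of k: c keeps 1 + c ki invertible with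
   inverse of norm at most 2, d keeps d L of norm below 1, and c < d is what pushes the final scalar
   below 1.\<close>
 define c where "c = 1 / (8 * D)"
 define d where "d = 1 / (4 * D)"
 have cd: "0 < c" "c < d" "c <= 1/8" using D by (auto simp: c_def d_def field_simps)
 let ?b = "1 + c *R ki"
 let ?c = "norm (- c *R ki)"
 have "?c <= 1/2"
 using cd by (simp add: D_def c_def)
 then obtain w where w: "?b * w = 1" "w * ?b = 1" "norm w <= 1 / (1 - ?c)"
  using invb_one_minus[of "- c *R ki"] by auto
 have nw: "norm w <= 2"
 proof -
  have "1 / (1 - ?c) <= 2" using \<open>norm (- c *R ki) <= 1/2\<close> by (simp add: field_simps)
  thus ?thesis using w(3) by linarith
 qed
 \<comment> \<open>With l and m below, h * h + (l * m) * (l * m) is the scalar 1 + c - d < 1, although its norm is at least that of h * h.\<close>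
 define L where "L = w * ki"
 have kc: "k + of_real c = ?b * k" "k + of_real c = k * ?b"
  using ki by (simp_all add: algebra_simps of_real_def)
 let ?a = "k + of_real c"
 have L1: "L * ?a = 1" unfolding L_def kc(2)
  using ki(2) w(2) by (metis mult.assoc mult.left_neutral)
 have L2: "?a * (ki * w) = 1" unfolding kc(1)
  using ki w by (metis mult.assoc mult.right_neutral)
 have L2': "L = ki * w" using L1 L2 by (metis mult.assoc mult.left_neutral mult.right_neutral)
 have nL: "norm L <= 2 * D"
  using norm_mult_ineq[of w ki] mult_mono[OF nw order_refl[of "norm ki"]] by (simp add: L_def D_def)
 have aL: "adj L = L"
 proof -
  have "?a * adj L = 1" using h arg_cong[OF L1, of adj] by (simp add: k_def adj_diff adj_mult adj_add)
  thus ?thesis using L1 by (metis mult.assoc mult.left_neutral mult.right_neutral)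
 qed
 \<comment> \<open>h * h has norm exactly 1, outside the range of \<open>sqrt_near_one\<close>; the
   extra c leaves room and gives l * l = k + c.\<close>
 define y where "y = (1 / (1 + c)) *R (h * h)"
 have "norm y < 1" using norm_mult_ineq[of h h] h cd by (simp add: y_def)
 moreover have ay: "adj y = y" using h by (simp add: y_def adj_scaleR adj_mult)
 ultimately obtain z where z: "adj z = z" "(1 - z) * (1 - z) = 1 - y" "!!c. c * y = y * c ==> c * z = z * c"
  using sqrt_near_one by metis
 define l where "l = sqrt (1 + c) *R (1 - z)"
 have ll: "l * l = k + of_real c"
 proof -
  have "l * l = (1 + c) *R (1 - y)" using z(2) cd by (simp add: l_def)
  also have "... = k + of_real c" using cd by (simp add: y_def k_def algebra_simps of_real_def)
  finally show ?thesis .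
 qed
 have hz: "h * z = z * h" by (intro z(3)) (simp add: y_def mult.assoc)
 have hl: "h * l = l * h" by (simp add: l_def algebra_simps hz)
 have al: "adj l = l" using z by (simp add: l_def adj_scaleR adj_diff)
 have comm_L: "x * L = L * x" if "x * ?a = ?a * x" for x
 proof -
  have "x * L = L * ?a * x * L" using L1 by simp
  also have "... = L * x * (?a * L)" using that by (metis mult.assoc)
  also have "... = L * x" using L2 L2' by simp
  finally show ?thesis .
 qed
 have lL: "l * L = L * l" by (rule comm_L) (simp add: ll[symmetric] mult.assoc)
 have hL: "h * L = L * h" by (rule comm_L) (simp add: k_def algebra_simps of_real_comm)
 let ?d = "d *R L"
 have dL: "norm ?d < 1" using nL D by (simp add: d_def field_simps)
 have adL: "adj ?d = d *R L" using aL by (simp add: adj_scaleR)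
 obtain z' where z': "adj z' = z'" "(1 - z') * (1 - z') = 1 - d *R L"
   "!!c. c * ?d = ?d * c ==> c * z' = z' * c"
  using sqrt_near_one[OF adL dL] by metis
 define m where "m = 1 - z'"
 have lm: "l * m = m * l" and hm: "h * m = m * h"
  using z'(3)[of l] z'(3)[of h] lL hL by (simp_all add: m_def algebra_simps)
 have am: "adj m = m" using z' by (simp add: m_def adj_diff)
 have "(l * m) * (l * m) = (l * l) * (m * m)" using lm by (metis mult.assoc)
 also have "... = ?a * (1 - d *R L)" using ll z'(2) by (simp add: m_def)
 also have "... = k + of_real c - of_real d"
 using L2 L2' by (simp add: of_real_def right_diff_distrib)
 finally have lmlm: "h * h + (l * m) * (l * m) = of_real (1 + c - d)" by (simp add: k_def)
 have "(norm h)^2 <= norm (h * h + (l * m) * (l * m))"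
 by (metis sum_squares_norm al am lm adj_mult hl hm mult.assoc h)
 hence "1 <= \<bar>1 + c - d\<bar>" unfolding lmlm norm_of_real using h by simp
 moreover have "d <= 1/4" using D by (simp add: d_def field_simps)
 ultimately show False using cd by linarith
qed

text \<open>After normalisation the two elements multiply to 1 - g * g, which is not invertible by
  \<open>norm_one_not_invb\<close>.\<close>

lemma norm_not_invb:
 fixes h :: "'a::ucstar"
 assumes h: "adj h = h" "h ~= 0"
 shows "~ invb (of_real (norm h) - h) | ~ invb (of_real (norm h) + h)"
proof (rule ccontr)
 let ?a = "of_real (norm h)"
 assume "~ ?thesis"
 hence i: "invb (?a - h)" "invb (?a + h)" by auto
 define g where "g = (1 / norm h) *R h"
 have sc: "invb ((1 / norm h) *R x)" if "invb x" for x :: 'a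
 proof -
  obtain y where y: "x * y = 1" "y * x = 1" using \<open>invb x\<close> unfolding invb_def by blast
  have "((1 / norm h) *R x) * (norm h *R y) = 1 & (norm h *R y) * ((1 / norm h) *R x) = 1"
   using h y by auto
  thus ?thesis unfolding invb_def by blast
 qed
 let ?b = "(1 / norm h) *R (?a - h)"
 let ?c = "(1 / norm h) *R (?a + h)"
 have "invb (?b * ?c)"
  using i sc invb_mult by blast
 moreover have "?b * ?c = 1 - g * g"
  using h(2) by (simp add: g_def algebra_simps of_real_def)
 moreover have "~ invb (1 - g * g)"
  by (rule norm_one_not_invb) (use h in "auto simp: g_def adj_scaleR")
 ultimately show False by simp
qed

text \<open>One witness t in \<open>nonneg\<close> is as good as any other bound of the norm. If the
  norm of t - x exceeded t, it or its negative would be a spectral value of t - x; the first is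
  excluded because x plus a positive scalar is invertible, the second by the Neumann series.\<close>

lemma nonneg_norm:
 fixes x :: "'a::ucstar"
 assumes "nonneg x" "norm x <= t" shows "norm (of_real t - x) <= t"
proof (rule ccontr)
 define h where "h = of_real t - x"
 assume "~ norm (of_real t - x) <= t"
 hence c: "norm h > t" by (simp add: h_def)
 have t: "0 <= t" using assms(2) norm_ge_zero[of x] by linarith
 have "h ~= 0" using c t by auto
 let ?a = "of_real (norm h)"
 have "adj h = h" using assms(1) by (simp add: h_def adj_diff nonneg_adj)
 then consider "~ invb (?a - h)" | "~ invb (?a + h)"
  using norm_not_invb \<open>h ~= 0\<close> by blast
 thus False
 proof cases
  case 1
  have "?a - h = x + of_real (norm h - t)" by (simp add: h_def)
  thus False using 1 nonneg_add_pos_invb[OF assms(1), of "norm h - t"] c by (metis diff_gt_0_iff_gt)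
 next
  case 2
  have "norm (of_real (norm h + t) - (?a + h)) < norm h + t"
   using assms(2) c t by (simp add: h_def)
  thus False using invb_neumann 2 by blast
 qed
qed

lemma nonneg_zero [simp]: "nonneg 0" by (auto simp: nonneg_def intro!: exI[of _ 0])

lemma nonneg_add:
 assumes "nonneg x" "nonneg y" shows "nonneg (x + y)"
proof -
 obtain s t where st: "norm x <= s" "norm (of_real s - x) <= s" "norm y <= t" "norm (of_real t - y) <= t"
  using assms by (auto simp: nonneg_def)
 have e: "of_real (s + t) - (x + y) = (of_real s - x) + (of_real t - y)" by simp
 have "norm (of_real (s + t) - (x + y)) <= s + t"
  unfolding e using norm_triangle_ineq[of "of_real s - x" "of_real t - y"] st by linarith
 moreover have "norm (x + y) <= s + t" using norm_triangle_ineq[of x y] st by linarith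
 ultimately show ?thesis using assms by (auto simp: nonneg_def adj_add)
qed

lemma nonneg_scaleR: "nonneg x ==> 0 <= r ==> nonneg (r *R x)"
proof -
 assume "nonneg x" "0 <= r"
 then obtain t where "adj x = x" "norm x <= t" "norm (of_real t - x) <= t"
  by (auto simp: nonneg_def)
 moreover have "of_real (r * t) - r *R x = r *R (of_real t - x)" by (simp add: of_real_def scaleR_right_diff_distrib)
 ultimately show ?thesis unfolding nonneg_def using \<open>0 <= r\<close>
  by (intro conjI exI[of _ "r * t"]) (auto simp: adj_scaleR mult_left_mono)
qed

lemma nonneg_sum: "(!!i. i : S ==> nonneg (f i)) ==> nonneg (sum f S)"
 by (induction S rule: infinite_finite_induct) (auto intro: nonneg_add)

section \<open>Continuous functional calculus\<close>

definition emb :: "complex => 'a::ucstar" where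
 "emb z = of_real (Re z) + of_real (Im z) * iu"

lemma emb_add: "emb (z + w) = emb z + emb w"
 by (simp add: emb_def algebra_simps)

lemma emb_mult: "emb (z * w) = emb z * (emb w :: 'a::ucstar)"
by (simp add: emb_def algebra_simps of_real_def scaleR_left_distrib iu_sq)

lemma emb_of_real [simp]: "emb (of_real r) = of_real r" by (simp add: emb_def)
lemma emb_0 [simp]: "emb 0 = 0" and emb_1 [simp]: "emb 1 = 1" by (simp_all add: emb_def)
lemma emb_uminus: "emb (- z) = - emb z" by (simp add: emb_def)
lemma emb_central: "emb z * x = x * emb z"
 by (simp add: emb_def algebra_simps of_real_def iu_central)

definition peval :: "'a::ucstar => complex poly => 'a" where
 "peval a p = fold_coeffs (%c x. emb c + a * x) p 0"

lemma peval_0 [simp]: "peval a 0 = 0" by (simp add: peval_def)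

lemma peval_pCons [simp]: "peval a (pCons c p) = emb c + a * peval a p"
 by (cases "p = 0 & c = 0") (auto simp: peval_def)

lemma peval_add: "peval a (p + q) = peval a p + peval a q"
 by (induction p q rule: poly_induct2) (simp_all add: emb_add algebra_simps)

lemma peval_smult: "peval a (Polynomial.smult c p) = emb c * peval a p"
proof (induction p)
 case (pCons d p)
 have "a * (emb c * peval a p) = emb c * (a * peval a p)" by (metis emb_central mult.assoc)
 thus ?case by (simp add: pCons emb_mult distrib_left)
qed auto

lemma peval_mult: "peval a (p * q) = peval a p * peval a q"
 by (induction p) (simp_all add: peval_add peval_smult algebra_simps mult_pCons_left)

text \<open>One half of the spectral mapping theorem: p splits into linear factors over the complex
  numbers, and a product of invertible factors is invertible, so some factor a - z fails to
  be.\<close>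

lemma peval_not_invb:
 fixes a :: "'a::ucstar"
 assumes "~ invb (peval a p)" "p ~= 0"
 shows "EX z. poly p z = 0 & ~ invb (a - emb z)"
 using assms
proof (induction "degree p" arbitrary: p rule: less_induct)
 case less
 show ?case
 proof (cases "constant (poly p)")
  case True
  then obtain c where p: "p = [:c:]" using constant_degree degree_eq_zeroE by blast
  hence "emb c * emb (inverse c) = (1::'a)" "emb (inverse c) * emb c = (1::'a)"
   using less by (simp_all flip: emb_mult)
  thus ?thesis using less p by (auto simp: invb_def)
 next
  case False
  then obtain z where z: "poly p z = 0" using fundamental_theorem_of_algebra by blast
  then obtain q where q: "p = [:-z, 1:] * q" by (metis dvdE poly_eq_0_iff_dvd)
  show ?thesis
  proof (cases "invb (a - emb z)")
   case True
   have "peval a p = (a - emb z) * peval a q" unfolding q peval_mult by (simp add: emb_uminus)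
   hence "~ invb (peval a q)" using True less.prems(1) invb_mult by metis
   moreover have "q ~= 0" using q less.prems by auto
   moreover from this have "degree q < degree p" unfolding q by (subst degree_mult_eq) auto
   ultimately show ?thesis using less.hyps q by auto
  qed (use z in blast)
 qed
qed

definition reval :: "'a::ucstar => real poly => 'a" where
 "reval a p = peval a (map_poly of_real p)"

lemma reval_0 [simp]: "reval a 0 = 0" by (simp add: reval_def)
lemma reval_pCons [simp]: "reval a (pCons c p) = of_real c + a * reval a p"
 by (simp add: reval_def map_poly_pCons)
lemma reval_add: "reval a (p + q) = reval a p + reval a q"
 by (induction p q rule: poly_induct2) (simp_all add: algebra_simps)
lemma reval_smult: "reval a (Polynomial.smult c p) = c *R reval a p"
 by (induction p) (simp_all add: algebra_simps of_real_def)
lemma reval_minus: "reval a (- p) = - reval a p"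
 using reval_smult[of a "-1" p] by simp
lemma reval_diff: "reval a (p - q) = reval a p - reval a q"
 using reval_add[of a p "- q"] by (simp add: reval_minus)
lemma reval_mult: "reval a (p * q) = reval a p * reval a q"
 by (induction p) (simp_all add: reval_add reval_smult algebra_simps mult_pCons_left of_real_def)
lemma reval_comm: "c * a = a * c ==> c * reval a p = reval a p * c"
proof (induction p)
 case (pCons d p)
 hence "c * (a * reval a p) = a * reval a p * c" by (metis mult.assoc)
 thus ?case by (simp add: algebra_simps of_real_comm)
qed auto
lemma adj_reval: "adj a = a ==> adj (reval a p) = reval a p"
 by (induction p) (auto simp: adj_add adj_mult reval_comm)
text \<open>These are the a with 0 <= a <= 1; the symmetric form in a and 1 - a makes both visibly
  positive. Functions on the unit interval are applied to such elements.\<close>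

definition uint :: "'a::ucstar => bool" where
 "uint a \<longleftrightarrow> adj a = a & norm a <= 1 & norm (1 - a) <= 1"

lemma uint_nonneg: "uint a ==> nonneg a"
 by (auto simp: uint_def nonneg_def intro!: exI[of _ 1])
lemma uint_nonneg': "uint a ==> nonneg (1 - a)"
 by (auto simp: uint_def nonneg_def adj_diff intro!: exI[of _ 1])
lemma nonneg_uint: "nonneg a ==> norm a <= 1 ==> uint a"
 using nonneg_norm[of a 1] by (auto simp: uint_def nonneg_def)

text \<open>For z off the real axis, (a - z) (a - cnj z) is a square plus a positive scalar, hence
  invertible, and commuting factors of an invertible element are invertible. Real z outside the
  interval are excluded because a and 1 - a are positive.\<close>

lemma uint_spectrum:
 fixes a :: "'a::ucstar"
 assumes "uint a" "~ invb (a - emb z)"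
 shows "z : of_real ` {0..1}"
proof (cases "Im z = 0")
 case False
 define h where "h = a - of_real (Re z)"
 have ah: "adj h = h" using assms by (simp add: h_def uint_def adj_diff)
 let ?a = "a - emb (cnj z)"
 have "(a - emb z) * ?a = h * h - (Im z)^2 *R (iu * iu)"
 using iu_central[of h] by (simp add: h_def emb_def of_real_def algebra_simps power2_eq_square)
 hence e1: "(a - emb z) * ?a = h * h + of_real ((Im z)^2)" by (simp add: iu_sq of_real_def)
 have e2: "(a - emb z) * ?a = ?a * (a - emb z)"
 proof -
  show ?thesis using emb_central emb_central[of z a] emb_central[of "cnj z" a] by (simp add: algebra_simps)
 qed
 have "invb (h * h + of_real ((Im z)^2))"
  by (rule nonneg_add_pos_invb[OF nonneg_square[OF ah]]) (use False in auto)
 thus ?thesis using e1 e2 invb_factor assms by metis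
next
 case True
 hence z: "z = of_real (Re z)" by (simp add: complex_eq_iff)
 hence e: "emb z = (of_real (Re z) :: 'a)" by (metis emb_of_real)
 have "Re z >= 0"
 proof (rule ccontr)
  assume "~ ?thesis"
  thus False using nonneg_add_pos_invb[OF uint_nonneg[OF assms(1)], of "- Re z"] assms(2) e by simp
 qed
 moreover have "Re z <= 1"
 proof (rule ccontr)
  assume "~ ?thesis"
  hence "invb (- (a - emb z))" using nonneg_add_pos_invb[OF uint_nonneg'[OF assms(1)], of "Re z - 1"] e by simp
  hence "invb (a - emb z)" unfolding invb_def by (metis minus_mult_commute minus_minus)
  thus False using assms(2) by blast
 qed
 ultimately show ?thesis using z by auto
qed

lemma poly_map_poly_of_real: "poly (map_poly complex_of_real p) (of_real t) = of_real (poly p t)"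
 by (induction p) (simp_all add: map_poly_pCons)

text \<open>With c the norm of p(a), one of c + p(a) and c - p(a) is not invertible. By spectral
  mapping the corresponding polynomial vanishes at a point of the spectrum, which lies in the unit
  interval, so c is there a value of p up to sign.\<close>

lemma reval_norm_le:
 fixes a :: "'a::ucstar"
 assumes a: "uint a" and B: "!!t. t : {0..1} ==> \<bar>poly p t\<bar> <= B"
 shows "norm (reval a p) <= B"
proof (cases "reval a p = 0")
 case True thus ?thesis using B[of 0] by simp
next
 case False
 define c where "c = norm (reval a p)"
 have "adj (reval a p) = reval a p" using a by (simp add: adj_reval uint_def)
 hence "EX s:{1,-1}. ~ invb (reval a ([:c:] + Polynomial.smult s p))"
  using norm_not_invb False by (auto simp: c_def reval_add reval_smult)
 then obtain s where s: "s = 1 | s = -1" "~ invb (reval a ([:c:] + Polynomial.smult s p))" by blast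
 show ?thesis
 \<comment> \<open>Spectral mapping needs a nonzero polynomial; if this one is zero, p is the
   constant c up to sign.\<close>
 proof (cases "[:c:] + Polynomial.smult s p = 0")
  case True
  show ?thesis using arg_cong[OF True, of "%p. poly p 0"] s(1) B[of 0] by (auto simp: abs_mult c_def)
 next
  case nz: False
  then obtain z where z: "poly (map_poly of_real ([:c:] + Polynomial.smult s p)) z = (0::complex)" "~ invb (a - emb z)"
   using map_poly_eq_0_iff of_real_0 of_real_eq_0_iff peval_not_invb s(2) unfolding reval_def by blast
  then obtain t where t: "t : {0..1}" "z = of_real t" using uint_spectrum[OF a] by blast
  have "complex_of_real (poly ([:c:] + Polynomial.smult s p) t) = 0" using z(1) unfolding t(2) poly_map_poly_of_real .
  hence "c + s * poly p t = 0" by (metis of_real_eq_0_iff poly_add poly_pCons poly_0 poly_smult mult_zero_right add.right_neutral)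
  thus ?thesis using s(1) B[OF t(1)] by (auto simp: c_def)
 qed
qed

lemma poly_approx:
 assumes "continuous_on {0..1} f" "0 < e"
 shows "EX p::real poly. ALL t:{0..1}. \<bar>f t - poly p t\<bar> <= e"
proof -
 obtain N where N: "!!x. x : {0..1} ==> \<bar>f x - (\<Sum>k\<le>N. f(real k/real N) * Bernstein N k x)\<bar> < e"
  using Bernstein_Weierstrass[OF assms] by blast
 define p where "p = (\<Sum>k\<le>N. Polynomial.smult (f(real k/real N) * of_nat (N choose k)) ([:0,1:]^k * [:1,-1:]^(N-k)))"
 have "poly p x = (\<Sum>k\<le>N. f(real k/real N) * Bernstein N k x)" for x
  by (simp add: p_def poly_sum Bernstein_def poly_power algebra_simps)
 thus ?thesis using N by (intro exI[of _ p]) force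
qed

text \<open>The limit is pinned down by its distance from every polynomial in a, so that
  \<open>cfc\<close> does not carry along a choice of approximating sequence.\<close>

lemma cfc_exists:
 fixes a :: "'a::ucstar"
 assumes a: "uint a" and f: "continuous_on {0..1} f"
 shows "EX L. ALL p B. (ALL t:{0..1}. \<bar>f t - poly p t\<bar> <= B) --> norm (L - reval a p) <= B"
proof -
 obtain q :: "nat => real poly" where q: "!!n t. t\<in>{0..1} ==> \<bar>f t - poly (q n) t\<bar> <= inverse (real (Suc n))"
  using poly_approx[OF f] by (meson inverse_positive_iff_positive of_nat_0_less_iff zero_less_Suc)
 have d: "norm (reval a (q n) - reval a p) <= inverse (real (Suc n)) + B" if "!!t. t\<in>{0..1} ==> \<bar>f t - poly p t\<bar> <= B" for n p B
  unfolding reval_diff[symmetric]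
 proof (rule reval_norm_le[OF a])
  fix t :: real assume "t : {0..1}"
  thus "\<bar>poly (q n - p) t\<bar> <= inverse (real (Suc n)) + B" using that[of t] q[of t n] by auto
 qed
 let ?a = "%n. reval a (q n)"
 have "Cauchy ?a"
 proof (rule metric_CauchyI)
  fix e :: real assume "e > 0"
  then obtain N where N: "inverse (real (Suc N)) < e / 2" using reals_Archimedean half_gt_zero by blast
  have "dist (reval a (q m)) (reval a (q n)) < e" if "m >= N" "n >= N" for m n
  proof -
   have "inverse (real (Suc m)) <= inverse (real (Suc N))" "inverse (real (Suc n)) <= inverse (real (Suc N))"
    using that by auto
   thus ?thesis using d[of "q n" "inverse (real (Suc n))" m, OF q] N unfolding dist_norm by linarith
  qed
  thus "EX M. ALL m>=M. ALL n>=M. dist (reval a (q m)) (reval a (q n)) < e" by blast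
 qed
 then obtain L where L: "?a ~~> L" using convergent_eq_Cauchy by blast
 have "norm (L - reval a p) <= B" if "ALL t:{0..1}. \<bar>f t - poly p t\<bar> <= B" for p B
 proof -
  have "(%n. norm (reval a (q n) - reval a p)) ~~> norm (L - reval a p)" by (intro tendsto_intros L)
  moreover have "(%n. inverse (real (Suc n)) + B) ~~> 0 + B" by (intro tendsto_intros LIMSEQ_inverse_real_of_nat)
  ultimately show ?thesis using d[of p B] that by (auto intro: LIMSEQ_le)
 qed
 thus ?thesis by blast
qed

section \<open>Laws of the continuous functional calculus\<close>

definition cfc :: "'a::ucstar => (real => real) => 'a" where
 "cfc a f = (SOME L. ALL p B. (ALL t:{0..1}. \<bar>f t - poly p t\<bar> <= B) --> norm (L - reval a p) <= B)"

lemma cfc_approx: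
 assumes "uint a" "continuous_on {0..1} f" "!!t. t\<in>{0..1} ==> \<bar>f t - poly p t\<bar> <= B"
 shows "norm (cfc a f - reval a p) <= B"
 using someI_ex[OF cfc_exists[OF assms(1,2)]] assms(3) unfolding cfc_def by blast

text \<open>L only has to follow the approximating polynomials up to some factor K; sums, products
  and adjoints each bring their own K. The restriction B < 1 absorbs the quadratic error that
  products create.\<close>

lemma cfc_eqI:
 assumes a: "uint a" and f: "continuous_on {0..1} f"
  and L: "!!p B. 0 < B ==> B < 1 ==> (!!t. t\<in>{0..1} ==> \<bar>f t - poly p t\<bar> <= B) ==> norm (L - reval a p) <= K * B"
 shows "cfc a f = L"
proof (rule ccontr)
 let ?a = "norm (cfc a f - L)"
 assume "cfc a f ~= L"
 hence pos: "?a > 0" by simp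
 define K' where "K' = \<bar>K\<bar> + 1"
 have K': "K' > 0" "K <= K'" by (auto simp: K'_def)
 define B where "B = min (1/2) (?a / (4 * K'))"
 have B: "B > 0" "B < 1" "B <= ?a / (4 * K')" using pos K' by (auto simp: B_def)
 obtain p where p: "!!t. t\<in>{0..1} ==> \<bar>f t - poly p t\<bar> <= B" using poly_approx[OF f B(1)] by blast
 have "norm (cfc a f - reval a p) <= B" by (rule cfc_approx[OF a f p])
 moreover have "norm (L - reval a p) <= K * B" by (rule L[OF B(1,2) p])
 ultimately have "?a <= B + K * B"
  using norm_triangle_ineq4[of "cfc a f - reval a p" "L - reval a p"] by simp
 also have "... <= K' * B + K' * B"
  using B(1) by (intro add_mono mult_right_mono) (auto simp: K'_def)
 also have "... <= ?a / 2"
  using B(3) K' by (simp add: field_simps)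
 finally show False using pos by simp
qed

lemma cfc_cong:
 assumes "!!t. t : {0..1} ==> f t = g t" shows "cfc a f = cfc a g"
proof -
 show ?thesis using assms unfolding cfc_def by simp
qed

lemma cfc_poly: "uint a ==> cfc a (poly p) = reval a p"
proof (rule cfc_eqI[where K=1])
 fix q B assume "uint a" and "!!t. t\<in>{0..1} ==> \<bar>poly p t - poly q t\<bar> <= B"
 hence "norm (reval a (p - q)) <= B" by (intro reval_norm_le) auto
 thus "norm (reval a p - reval a q) <= 1 * B" by (simp add: reval_diff)
qed (auto intro!: continuous_intros)

lemma cfc_id: "uint a ==> cfc a (%t. t) = a"
 using cfc_poly[of a "[:0,1:]"] cfc_cong[of "poly [:0,1:]" "%t. t" a] by simp

lemma cfc_const: "uint a ==> cfc a (%t. c) = of_real c"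
 using cfc_poly[of a "[:c:]"] cfc_cong[of "poly [:c:]" "%t. c" a] by simp

lemma cfc_norm:
 assumes a: "uint a" and f: "continuous_on {0..1} f" and B: "!!t. t\<in>{0..1} ==> \<bar>f t\<bar> <= B"
 shows "norm (cfc a f) <= B"
 using cfc_approx[OF a f, of 0 B] B by simp

lemma cfc_add:
 assumes a: "uint a" and f: "continuous_on {0..1} f" "continuous_on {0..1} g"
 shows "cfc a (%t. f t + g t) = cfc a f + cfc a g"
proof (rule cfc_eqI[where K=3, OF a])
 fix p B assume B: "0 < B" and p: "!!t. t\<in>{0..1} ==> \<bar>(f t + g t) - poly p t\<bar> <= B"
 \<comment> \<open>p is given for the sum only: q approximates f, and p - q is then forced to
   approximate g within 2 B, whence the factor 3.\<close>
 obtain q where q: "!!t. t\<in>{0..1} ==> \<bar>f t - poly q t\<bar> <= B" using poly_approx[OF f(1) B] by blast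
 let ?a = "reval a (p - q)"
 have "\<bar>g t - poly (p - q) t\<bar> <= 2 * B" if "t\<in>{0..1}" for t
  using p[OF that] q[OF that] by simp
 hence "norm (cfc a g - ?a) <= 2 * B" by (rule cfc_approx[OF a f(2)])
 moreover have "norm (cfc a f - reval a q) <= B" by (rule cfc_approx[OF a f(1) q])
 ultimately have "norm ((cfc a f - reval a q) + (cfc a g - ?a)) <= 3 * B"
  using norm_triangle_ineq[of "cfc a f - reval a q" "cfc a g - ?a"] by linarith
 thus "norm (cfc a f + cfc a g - reval a p) <= 3 * B" by (simp add: reval_diff add_diff_eq)
qed (use f in "auto intro!: continuous_intros")

lemma cfc_mult:
 assumes a: "uint a" and f: "continuous_on {0..1} f" "continuous_on {0..1} g"
 shows "cfc a (%t. f t * g t) = cfc a f * cfc a g"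
proof -
 obtain M N where M: "!!t. t\<in>{0..1} ==> \<bar>f t\<bar> <= M" and N: "!!t. t\<in>{0..1} ==> \<bar>g t\<bar> <= N"
  using f compact_continuous_image compact_imp_bounded[of "f ` {0..1}"] compact_imp_bounded[of "g ` {0..1}"] unfolding bounded_iff by fastforce
 have MN: "0 <= M" "0 <= N" using M[of 0] N[of 0] by auto
 show ?thesis
 proof (rule cfc_eqI[where K="2 * (M + N) + 3", OF a])
  fix p B assume B: "0 < B" "B < 1" and p: "!!t. t\<in>{0..1} ==> \<bar>f t * g t - poly p t\<bar> <= B"
  obtain q where q: "!!t. t\<in>{0..1} ==> \<bar>f t - poly q t\<bar> <= B" using poly_approx[OF f(1) B(1)] by blast
  obtain r where r: "!!t. t\<in>{0..1} ==> \<bar>g t - poly r t\<bar> <= B" using poly_approx[OF f(2) B(1)] by blast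
  have nq: "norm (reval a q) <= M + 1"
  proof (rule reval_norm_le[OF a])
   fix t :: real assume "t : {0..1}" thus "\<bar>poly q t\<bar> <= M + 1" using M[of t] q[of t] B by linarith
  qed
  let ?a = "reval a (q * r - p)"
  have qr: "norm (?a) <= (M + N + 1) * B + B"
  proof (rule reval_norm_le[OF a])
   fix t :: real assume t: "t : {0..1}"
   have "poly q t * poly r t - f t * g t = poly q t * (poly r t - g t) + (poly q t - f t) * g t" by (simp add: algebra_simps)
   also have "\<bar>...\<bar> <= \<bar>poly q t\<bar> * \<bar>poly r t - g t\<bar> + \<bar>poly q t - f t\<bar> * \<bar>g t\<bar>"
    by (metis abs_mult abs_triangle_ineq)
   also have "... <= (M + 1) * B + B * N"
    using M[OF t] q[OF t] r[OF t] N[OF t] B by (intro add_mono mult_mono) auto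
   finally show "\<bar>poly (q * r - p) t\<bar> <= (M + N + 1) * B + B"
    using p[OF t] by (simp add: algebra_simps abs_le_iff)
  qed
  let ?b = "cfc a g - reval a r"
  let ?c = "cfc a f - reval a q"
  have "cfc a f * cfc a g - reval a p = ?c * cfc a g + reval a q * ?b + ?a"
   by (simp add: algebra_simps reval_diff reval_mult)
  also have "norm ... <= norm (?c * cfc a g) + norm (reval a q * ?b) + norm (?a)"
   by (meson add_right_mono norm_triangle_ineq norm_triangle_mono order_refl)
  also have "... <= norm ?c * norm (cfc a g) + norm (reval a q) * norm ?b + norm (?a)"
   by (intro add_mono norm_mult_ineq order_refl)
  also have "... <= B * N + (M + 1) * B + ((M + N + 1) * B + B)"
   using cfc_norm[OF a f(2) N] cfc_approx[OF a f(2) r] cfc_approx[OF a f(1) q] nq qr MN B by (intro add_mono mult_mono) auto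
  finally show "norm (cfc a f * cfc a g - reval a p) <= (2 * (M + N) + 3) * B" by (simp add: algebra_simps)
 qed (use f in "auto intro!: continuous_intros")
qed

lemma cfc_minus:
 assumes a: "uint a" and f: "continuous_on {0..1} f"
 shows "cfc a (%t. - f t) = - cfc a f"
 using cfc_mult[OF a continuous_on_const[of _ "-1"] f] cfc_const[OF a, of "-1"] by simp

lemma cfc_diff:
 assumes a: "uint a" and f: "continuous_on {0..1} f" "continuous_on {0..1} g"
 shows "cfc a (%t. f t - g t) = cfc a f - cfc a g"
 using cfc_add[OF a f(1) continuous_on_minus[OF f(2)]] cfc_minus[OF a f(2)] by simp

lemma cfc_scaleR:
 assumes a: "uint a" and f: "continuous_on {0..1} f"
 shows "cfc a (%t. c * f t) = c *R cfc a f"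
 using cfc_mult[OF a continuous_on_const[of _ c] f] cfc_const[OF a, of c] by (simp add: of_real_def)

lemma cfc_comm:
 assumes a: "uint a" and f: "continuous_on {0..1} f" and c: "c * a = a * c"
 shows "c * cfc a f = cfc a f * c"
proof -
 let ?b = "norm (c * cfc a f - cfc a f * c)"
 have "?b <= e" if "e > 0" for e
 proof -
  define d where "d = e / (2 * (norm c + 1))"
  have d: "d > 0" using that by (simp add: d_def add_nonneg_pos)
  obtain q where q: "!!t. t\<in>{0..1} ==> \<bar>f t - poly q t\<bar> <= d" using poly_approx[OF f d] by blast
  let ?a = "cfc a f - reval a q"
  have "c * cfc a f - cfc a f * c = c * ?a - ?a * c"
   using reval_comm[OF c, of q] by (simp add: algebra_simps)
  also have "norm ... <= norm (c * ?a) + norm (?a * c)"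
   by (rule norm_triangle_ineq4)
  also have "... <= norm c * norm ?a + norm ?a * norm c"
   by (intro add_mono norm_mult_ineq)
  also have "... = 2 * norm c * norm ?a" by simp
  also have "... <= 2 * (norm c + 1) * d" using cfc_approx[OF a f q] by (intro mult_mono) auto
  also have "... = e" by (simp add: d_def add_nonneg_eq_0_iff)
  finally show ?thesis .
 qed
 hence "?b <= 0" by (meson field_le_epsilon add.left_neutral order_trans dense_ge)
 thus ?thesis by simp
qed

lemma adj_cfc:
 assumes a: "uint a" and f: "continuous_on {0..1} f"
 shows "adj (cfc a f) = cfc a f"
proof -
 have "cfc a f = adj (cfc a f)"
 proof (rule cfc_eqI[OF a f, where K=1])
  fix p B assume "!!t. t\<in>{0..1} ==> \<bar>f t - poly p t\<bar> <= B"
  hence "norm (cfc a f - reval a p) <= B" by (rule cfc_approx[OF a f])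
  moreover have "adj (cfc a f) - reval a p = adj (cfc a f - reval a p)"
   using a by (simp add: adj_diff adj_reval uint_def)
  ultimately show "norm (adj (cfc a f) - reval a p) <= 1 * B" by simp
 qed
 thus ?thesis by simp
qed

lemma cfc_nonneg:
 assumes a: "uint a" and f: "continuous_on {0..1} f" "!!t. t\<in>{0..1} ==> 0 <= f t"
 shows "nonneg (cfc a f)"
proof -
 let ?a = "%t. sqrt (f t)"
 have c: "continuous_on {0..1} ?a" by (intro continuous_intros f)
 have "cfc a f = cfc a (%t. sqrt (f t) * sqrt (f t))" by (rule cfc_cong) (use f(2) in auto)
 also have "... = cfc a ?a * cfc a ?a" by (rule cfc_mult[OF a c c])
 finally show ?thesis using nonneg_square[OF adj_cfc[OF a c]] by simp
qed

text \<open>The products w w' and w' w have the same nonzero spectrum: if r inverts k + w w', then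
  (1 - w' r w) / k inverts k + w' w.\<close>

lemma invb_swap:
 fixes w :: "'a::real_algebra_1"
 assumes "invb (of_real k + w * w')" "k ~= 0"
 shows "invb (of_real k + w' * w)"
proof -
 obtain r where r: "(of_real k + w * w') * r = 1" "r * (of_real k + w * w') = 1" using assms by (auto simp: invb_def)
 define s where "s = (1/k) *R (1 - w' * r * w)"
 have e1: "w * w' * r = 1 - k *R r" using r(1) by (simp add: algebra_simps of_real_def)
 have e2: "r * (w * w') = 1 - k *R r" using r(2) by (simp add: algebra_simps of_real_def)
 let ?a = "of_real k + w' * w"
 have "w' * w * (w' * r * w) = w' * (w * w' * r) * w" by (simp add: mult.assoc)
 hence "w' * w * (w' * r * w) = w' * w - k *R (w' * r * w)" unfolding e1 by (simp add: algebra_simps)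
 hence 1: "?a * s = 1" using assms(2) by (simp add: s_def algebra_simps of_real_def)
 have "w' * r * w * (w' * w) = w' * (r * (w * w')) * w" by (simp add: mult.assoc)
 hence "w' * r * w * (w' * w) = w' * w - k *R (w' * r * w)" unfolding e2 by (simp add: algebra_simps)
 moreover have "(1 - p) * (of_real k + q) = of_real k + q - k *R p - p * q" for p q :: 'a
  by (simp add: algebra_simps of_real_def)
 ultimately have "(1 - w' * r * w) * ?a = of_real k" by simp
 hence 2: "s * ?a = 1" using assms(2) by (simp add: s_def of_real_def)
 show ?thesis using 1 2 by (auto simp: invb_def)
qed

section \<open>Positivity of adj y * y, square roots and order\<close>

lemma sa_square_zero: "adj v = v ==> v * v = 0 ==> v = (0::'a::ucstar)"
 using cstar_norm[of v] by simp

text \<open>Kaplansky's argument: w = y v satisfies w* w = - v^3, and w w* is then positive as well, so v = 0.\<close>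
lemma nonneg_adj_mult_aux:
 fixes y :: "'a::ucstar"
 assumes "norm y <= 1" shows "nonneg (adj y * y)"
proof -
 define x where "x = adj y * y"
 have nx: "norm x <= 1" using assms by (simp add: x_def cstar_norm power_le_one)
 \<comment> \<open>x has spectrum between -1 and 1; the affine change to a brings it to the unit
   interval, where u and v become the positive and negative parts of x.\<close>
 define a where "a = (1/2) *R (1 + x)"
 have "norm (1 + x) <= 2" "norm (1 - x) <= 2" using norm_triangle_ineq[of 1 x] norm_triangle_ineq4[of 1 x] nx by auto
 moreover have e: "1 - a = (1/2) *R (1 - x)"
  by (simp add: a_def algebra_simps) (metis scaleR_half_double scaleR_add_right)
 ultimately have a: "uint a" unfolding uint_def e by (simp add: x_def adj_mult a_def adj_scaleR adj_add)
 define u where "u = cfc a (%t. max 0 (2 * t - 1))"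
 define v where "v = cfc a (%t. max 0 (1 - 2 * t))"
 have cu: "continuous_on {0..1} (%t::real. max 0 (2 * t - 1))" and cv: "continuous_on {0..1} (%t::real. max 0 (1 - 2 * t))"
  by (intro continuous_intros)+
 have uv: "u - v = x"
 proof -
  have "u - v = cfc a (%t. max 0 (2 * t - 1) - max 0 (1 - 2 * t))" unfolding u_def v_def by (rule cfc_diff[OF a cu cv, symmetric])
  also have "... = cfc a (poly [:-1, 2:])" by (rule cfc_cong) auto
  also have "... = a + a - 1" unfolding cfc_poly[OF a] by (simp add: mult_2_right)
  also have "... = x" by (simp add: a_def scaleR_half_double flip: scaleR_add_right)
  finally show ?thesis .
 qed
 have vu: "v * u = 0"
 proof -
  have "v * u = cfc a (%t. max 0 (1 - 2 * t) * max 0 (2 * t - 1))" unfolding u_def v_def by (rule cfc_mult[OF a cv cu, symmetric])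
  also have "... = cfc a (%t. 0)" by (rule cfc_cong) auto
  finally show ?thesis by (simp add: cfc_const[OF a])
 qed
 have av: "adj v = v" unfolding v_def by (rule adj_cfc[OF a cv])
 define c where "c = v * v * v"
 have c: "nonneg c"
 proof -
  have "c = cfc a (%t. max 0 (1 - 2 * t) * max 0 (1 - 2 * t) * max 0 (1 - 2 * t))"
   unfolding c_def v_def
   by (subst cfc_mult[OF a], intro continuous_intros, intro continuous_intros, subst cfc_mult[OF a]) (intro continuous_intros | simp)+
  also have "nonneg ..." by (rule cfc_nonneg[OF a]) (auto intro!: continuous_intros)
  finally show ?thesis .
 qed
 define w where "w = y * v"
 have ww: "adj w * w = - c"
 proof -
  have "adj w * w = v * x * v" by (simp add: w_def adj_mult av x_def mult.assoc)
  also have "... = v * (u - v) * v" using uv by simp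
  also have "... = - c" using vu by (simp add: right_diff_distrib left_diff_distrib c_def)
  finally show ?thesis .
 qed
 \<comment> \<open>Real and imaginary part of w: w* w + w w* = 2 (b^2 + d^2), so w w* = 2 (b^2 +
   d^2) + c is positive.\<close>
 define b where "b = (1/2) *R (w + adj w)"
 define d where "d = - (1/2) *R (iu * (w - adj w))"
 have ab: "adj b = b" by (simp add: b_def adj_scaleR adj_add add.commute)
 have ad: "adj d = d"
  by (simp add: d_def adj_scaleR adj_diff adj_mult adj_iu iu_central[of w] iu_central[of "adj w"] algebra_simps)
 have i2: "iu * p * (iu * q) = - (p * q)" for p q :: 'a
  by (metis iu_central iu_sq mult.assoc mult_minus1)
 have dd: "d * d = - (1/4) *R ((w - adj w) * (w - adj w))" by (simp add: d_def i2)
 have bb: "b * b = (1/4) *R ((w + adj w) * (w + adj w))" by (simp add: b_def)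
 have bd: "b * b + d * d = (1/4) *R ((w + adj w) * (w + adj w) - (w - adj w) * (w - adj w))"
  unfolding bb dd by (simp add: scaleR_diff_right)
 have "(w + adj w) * (w + adj w) - (w - adj w) * (w - adj w) = 2 *R (adj w * w + w * adj w)"
  by (simp add: algebra_simps scaleR_2)
 hence "w * adj w = 2 *R (b * b + d * d) + c" using bd ww by simp
 hence wn: "nonneg (w * adj w)"
  using nonneg_square[OF ab] nonneg_square[OF ad] c by (simp add: nonneg_add nonneg_scaleR)
 \<comment> \<open>w* w = - c and w w* have the same nonzero spectrum, so neither the norm of c nor
   its negative can be a spectral value of c.\<close>
 have "c = 0"
 proof (rule ccontr)
  assume "c ~= 0"
  hence nc: "norm c > 0" by simp
  let ?a = "of_real (norm c)"
  have "invb (?a + adj w * w)"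
   by (rule invb_swap) (use nonneg_add_pos_invb[OF wn nc] nc in "auto simp: add.commute")
  hence "invb (?a - c)" using ww by simp
  moreover have "invb (?a + c)" using nonneg_add_pos_invb[OF c nc] by (simp add: add.commute)
  ultimately show False using norm_not_invb[OF nonneg_adj[OF c] \<open>c ~= 0\<close>] by blast
 qed
 hence "(v * v) * (v * v) = 0" by (simp add: c_def mult.assoc[symmetric])
 moreover have "adj (v * v) = v * v" by (simp add: adj_mult av)
 ultimately have "v * v = 0" by (rule sa_square_zero[rotated])
 hence "x = u" using av sa_square_zero[rotated] uv by auto
 moreover have "nonneg u" unfolding u_def by (rule cfc_nonneg[OF a cu]) auto
 ultimately show ?thesis by (simp add: x_def)
qed

lemma nonneg_adj_mult: "nonneg (adj y * (y::'a::ucstar))"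
proof (cases "y = 0")
 case False
 let ?a = "adj ((1 / norm y) *R y) * ((1 / norm y) *R y)"
 have "nonneg ?a"
  by (rule nonneg_adj_mult_aux) (use False in simp)
 hence "nonneg ((norm y)^2 *R ?a)" by (rule nonneg_scaleR) simp
 moreover have "(norm y)^2 *R ?a = adj y * y"
  by (simp add: adj_scaleR power2_eq_square)
 ultimately show ?thesis by simp
qed auto

lemma nonneg_mult_adj: "nonneg (y * adj (y::'a::ucstar))"
 using nonneg_adj_mult[of "adj y"] by simp

lemma nonneg_sqrt:
 fixes x :: "'a::ucstar"
 assumes "nonneg x"
 obtains s where "nonneg s" "s * s = x" "!!c. c * x = x * c ==> c * s = s * c"
proof (cases "x = 0")
 case True thus ?thesis using that[of 0] by simp
next
 case False
 define t where "t = norm x"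
 have t: "t > 0" using False by (simp add: t_def)
 define y where "y = (1/t) *R x"
 have y: "uint y" by (rule nonneg_uint) (use assms t in "auto simp: y_def nonneg_scaleR t_def")
 have c: "continuous_on {0..1} sqrt" by (intro continuous_intros)
 define s where "s = sqrt t *R cfc y sqrt"
 have "cfc y sqrt * cfc y sqrt = cfc y (%t. sqrt t * sqrt t)" by (rule cfc_mult[OF y c c, symmetric])
 also have "... = cfc y (%t. t)" by (rule cfc_cong) auto
 finally have "s * s = t *R y" using t by (simp add: s_def cfc_id[OF y])
 hence "s * s = x" using t by (simp add: y_def)
 moreover have "nonneg s" unfolding s_def by (intro nonneg_scaleR cfc_nonneg[OF y c]) (use t in auto)
 moreover have "r * s = s * r" if "r * x = x * r" for r
  unfolding s_def using cfc_comm[OF y c, of r] that by (simp add: y_def)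
 ultimately show ?thesis using that by blast
qed

lemma nonneg_iff: "nonneg x = (EX y. x = adj y * y)"
 by (metis nonneg_adj nonneg_adj_mult nonneg_sqrt)

lemma nonneg_conj: "nonneg x ==> nonneg (adj z * x * z)"
proof -
 assume "nonneg x"
 then obtain y where "x = adj y * y" by (auto simp: nonneg_iff)
 hence "adj z * x * z = adj (y * z) * (y * z)" by (simp add: adj_mult mult.assoc)
 thus ?thesis by (simp only: nonneg_adj_mult)
qed

lemma nonneg_conj': "nonneg x ==> nonneg (z * x * adj z)"
 using nonneg_conj[of x "adj z"] by simp

lemma le_norm:
 assumes "adj x = x" "norm x <= t" shows "nonneg (of_real t - x)"
proof -
 have "norm (of_real t - x) <= 2 * t" "norm (of_real t + x) <= 2 * t"
  using norm_triangle_ineq4[of "of_real t" x] norm_triangle_ineq[of "of_real t" x] assms(2) norm_ge_zero[of x] by auto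
 moreover have "of_real (2 * t) - (of_real t - x) = of_real t + x" by (simp only: mult_2 of_real_add) simp
 ultimately show ?thesis using assms(1) unfolding nonneg_def by (metis adj_diff adj_of_real)
qed

text \<open>norm y - x is positive, so if norm x were larger, norm x - x would be invertible; norm x
  + x is invertible anyway, which leaves x without a spectral value of maximal modulus.\<close>

lemma nonneg_norm_mono:
 fixes x :: "'a::ucstar"
 assumes "nonneg x" "nonneg (y - x)" shows "norm x <= norm y"
proof (rule ccontr)
 assume n: "~ norm x <= norm y"
 hence "x ~= 0" by auto
 have y: "nonneg y" using nonneg_add[OF assms] by simp
 let ?a = "of_real (norm y)"
 have "nonneg (?a - y)" by (intro le_norm nonneg_adj y order_refl)
 hence "nonneg (?a - x)" using nonneg_add[OF _ assms(2)] by fastforce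
 hence "invb (?a - x + of_real (norm x - norm y))" by (rule nonneg_add_pos_invb) (use n in simp)
 hence "invb (of_real (norm x) - x)" by simp
 moreover have "invb (of_real (norm x) + x)" using nonneg_add_pos_invb[OF assms(1), of "norm x"] \<open>x ~= 0\<close> by (simp add: add.commute)
 ultimately show False using norm_not_invb[OF nonneg_adj[OF assms(1)] \<open>x ~= 0\<close>] by blast
qed

lemma nonneg_antisym: "nonneg x ==> nonneg (- x) ==> x = 0"
 using nonneg_norm_mono[of x 0] by simp

lemma nonneg_le_trans: "nonneg (y - x) ==> nonneg (z - y) ==> nonneg (z - x)"
 using nonneg_add[of "y - x" "z - y"] by simp

lemma nonneg_of_real: "0 <= r ==> nonneg (of_real r)"
 using nonneg_scaleR[OF nonneg_square[of 1], of r] by (simp add: of_real_def)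

lemma conj_le_norm:
 assumes "nonneg x" shows "nonneg (norm x *R (z * adj z) - z * x * adj z)"
proof -
 have "nonneg (z * (of_real (norm x) - x) * adj z)" by (intro nonneg_conj' le_norm nonneg_adj assms order_refl)
 thus ?thesis by (simp add: algebra_simps of_real_def)
qed

section \<open>Cuntz comparison in a unital algebra\<close>

definition cz :: "'a::ucstar => 'a => bool" where
 "cz a b = (ALL e>0. EX v. norm (v * b * adj v - a) < e)"

lemma cz_conj: "cz (v * b * adj v) b"
 by (auto simp: cz_def intro!: exI[of _ v])

lemma cz_refl: "cz a a" using cz_conj[of 1 a] by simp

lemma cz_scaleR: "r > 0 ==> cz a (r *R a)"
 using cz_conj[of "(1 / sqrt r) *R 1" "r *R a"] by (simp add: adj_scaleR)

lemma cz_scaleR': "r >= 0 ==> cz (r *R a) a"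
 using cz_conj[of "(sqrt r) *R 1" a] by (simp add: adj_scaleR)

lemma cz_closed: "(!!e. e > 0 ==> EX a'. norm (a' - a) < e & cz a' b) ==> cz a b"
 unfolding cz_def
proof (intro allI impI)
 fix e :: real assume *: "!!e. 0 < e ==> EX a'. norm (a' - a) < e & (ALL e>0. EX v. norm (v * b * adj v - a') < e)" and "e > 0"
 then obtain a' where a': "norm (a' - a) < e/2" "ALL e>0. EX v. norm (v * b * adj v - a') < e" by (metis half_gt_zero)
 then obtain v where "norm (v * b * adj v - a') < e/2" using \<open>e>0\<close> half_gt_zero by blast
 hence "norm ((v * b * adj v - a') + (a' - a)) < e" using a'(1) norm_triangle_ineq[of "v * b * adj v - a'" "a' - a"] by linarith
 thus "EX v. norm (v * b * adj v - a) < e" by auto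
qed

lemma norm_mult3_le: "norm (x * y * z) <= norm x * norm y * norm (z::'a::real_normed_algebra)"
 by (meson mult_right_mono norm_ge_zero norm_mult_ineq order_trans)

lemma cz_trans:
 fixes a :: "'a::ucstar"
 assumes "cz a b" "cz b c" shows "cz a c"
proof (rule cz_closed)
 fix e :: real assume "e > 0"
 then obtain v where v: "norm (v * b * adj v - a) < e/2" using assms(1) half_gt_zero unfolding cz_def by blast
 define d where "d = e / (2 * ((norm v)^2 + 1))"
 have "(norm v)^2 + 1 > 0" by (simp add: add_nonneg_pos)
 hence d: "d > 0" using \<open>e > 0\<close> by (simp add: d_def)
 then obtain w where w: "norm (w * c * adj w - b) < d" using assms(2) unfolding cz_def by blast
 let ?a = "norm (v * (w * c * adj w - b) * adj v)"
 have "?a <= norm v * norm (w * c * adj w - b) * norm v"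
  using norm_mult3_le[of v _ "adj v"] by simp
 also have "... = (norm v)^2 * norm (w * c * adj w - b)" by (simp add: power2_eq_square)
 also have "... <= ((norm v)^2 + 1) * d" using w by (intro mult_mono) auto
 also have "... = e / 2" using \<open>(norm v)^2 + 1 > 0\<close> by (simp add: d_def field_simps)
 finally have "?a <= e/2" .
 moreover have vw: "(v * w) * c * adj (v * w) - a = v * (w * c * adj w - b) * adj v + (v * b * adj v - a)"
  by (simp add: algebra_simps adj_mult)
 ultimately have "norm ((v * w) * c * adj (v * w) - a) < e"
  unfolding vw using v norm_triangle_ineq[of "v * (w * c * adj w - b) * adj v" "v * b * adj v - a"] by linarith
 thus "EX a'. norm (a' - a) < e & cz a' c" using cz_conj by blast
qed

text \<open>Let c = r^2 and let y be d scaled to norm 1. Conjugating d by a multiple of r (y +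
  k)^(-1/2) gives c up to r Q^2 r with Q^2 = k / (y + k). The norm of this error is that of Q c Q,
  which is dominated by Q d Q and hence by a multiple of k.\<close>

lemma cz_le:
 fixes c :: "'a::ucstar"
 assumes c: "nonneg c" and d: "nonneg (d - c)" shows "cz c d"
proof (cases "d = 0")
 case True thus ?thesis using nonneg_norm_mono[OF c d] cz_refl by simp
next
 case False
 have dn: "nonneg d" using nonneg_add[OF assms] by simp
 define t where "t = norm d"
 have t: "t > 0" using False by (simp add: t_def)
 define y where "y = (1/t) *R d"
 have y: "uint y" by (rule nonneg_uint) (use dn t in "auto simp: y_def nonneg_scaleR t_def")
 obtain r where r: "nonneg r" "r * r = c" using nonneg_sqrt[OF c] by metis
 show ?thesis
 proof (rule cz_closed)
  fix e :: real assume "e > 0"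
  define k where "k = e / (2 * t)"
  have k: "k > 0" using \<open>e > 0\<close> t by (simp add: k_def)
  define m where "m = (%s::real. 1 / sqrt (s + k))"
  define q where "q = (%s::real. sqrt (k / (s + k)))"
  have cm: "continuous_on {0..1} m" "continuous_on {0..1} q"
   unfolding m_def q_def using k by (auto intro!: continuous_intros)
  have ci: "continuous_on {0..1} (%t::real. t)" by simp
  define v where "v = (1 / sqrt t) *R (r * cfc y m)"
  define Q where "Q = cfc y q"
  have aQ: "adj Q = Q" unfolding Q_def by (rule adj_cfc[OF y cm(2)])
  have yt: "t *R y = d" using t by (simp add: y_def)
  have "cfc y m * y * cfc y m = cfc y (%s. m s * s * m s)"
   using cfc_mult[OF y cm(1) ci] cfc_mult[OF y continuous_on_mult[OF cm(1) ci] cm(1)] by (simp add: cfc_id[OF y])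
  also have "... = cfc y (%s. 1 - q s * q s)"
   by (rule cfc_cong) (use k in "auto simp: m_def q_def field_simps")
  also have "... = 1 - Q * Q" unfolding Q_def using cfc_diff[OF y continuous_on_const[of _ 1] continuous_on_mult[OF cm(2) cm(2)]]
   cfc_mult[OF y cm(2) cm(2)] by (simp add: cfc_const[OF y])
  finally have mm: "cfc y m * y * cfc y m = 1 - Q * Q" .
  let ?a = "cfc y (%s. q s * s * q s)"
  have "v * d * adj v = r * (cfc y m * y * cfc y m) * r"
   using t r(1) by (simp add: v_def adj_scaleR adj_mult adj_cfc[OF y cm(1)] nonneg_adj yt[symmetric] mult.assoc)
  also have "... = c - (r * Q) * (Q * r)" unfolding mm using r(2) by (simp add: algebra_simps)
  finally have "norm (v * d * adj v - c) = norm ((r * Q) * adj (r * Q))"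
   using r(1) aQ by (simp add: adj_mult nonneg_adj)
  also have "... = norm (adj (r * Q) * (r * Q))" by (simp add: cstar_norm cstar_norm')
  also have "adj (r * Q) * (r * Q) = Q * c * Q" using r aQ by (simp add: adj_mult nonneg_adj mult.assoc[symmetric]) (simp add: mult.assoc)
  also have "norm ... <= norm (Q * d * Q)"
  proof (rule nonneg_norm_mono)
   show "nonneg (Q * c * Q)" using nonneg_conj[OF c, of Q] aQ by simp
   show "nonneg (Q * d * Q - Q * c * Q)" using nonneg_conj[OF d, of Q] aQ by (simp add: algebra_simps)
  qed
  also have "Q * d * Q = t *R (Q * y * Q)" by (simp flip: yt)
  also have "Q * y * Q = ?a" unfolding Q_def
   using cfc_mult[OF y cm(2) ci] cfc_mult[OF y continuous_on_mult[OF cm(2) ci] cm(2)] by (simp add: cfc_id[OF y])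
  also have "norm (t *R ...) <= t * k"
  proof -
   have "norm (?a) <= k"
   proof (rule cfc_norm[OF y])
    fix s :: real assume s: "s : {0..1}"
    have "q s * s * q s = k * (s / (s + k))"
    using s k by (simp add: q_def algebra_simps)
    moreover have "s / (s + k) <= 1" "0 <= s / (s+k)" using s k by auto
    ultimately show "\<bar>q s * s * q s\<bar> <= k" using k mult_left_le[of "s / (s+k)" k] by (simp only: abs_mult abs_of_nonneg)
   qed (intro continuous_intros cm)
   thus ?thesis using t by simp
  qed
  also have "t * k < e" using \<open>e > 0\<close> by (simp add: k_def)
  finally show "EX a'. norm (a' - c) < e & cz a' d" using cz_conj by blast
 qed
qed

text \<open>The form in which comparisons are produced: an approximate factorisation through T of a
  local unit h of g suffices, with arbitrary outer factors. Closeness of Y to h gives g (Y + adj Y)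
  g >= (3/2) g^2, completing the square gives g (Y + adj Y) g <= 2 g Y adj Y g + g^2 / 2, and
  together g^2 <= 2 g Y adj Y g, where Y factors through T.\<close>

lemma cz_factor:
 fixes g :: "'a::ucstar"
 assumes g: "adj g = g" "h * g = g" "adj h = h" and Y: "norm (Q * T * Z - h) <= 1/4"
 shows "cz (g * g) (T * adj T)"
proof -
 define Y where "Y = Q * T * Z"
 define E where "E = (h - Y) + adj (h - Y)"
 have gh: "g * h = g"
 proof -
  have "g * h = adj g * adj h" using g by simp
  also have "... = adj (h * g)" by (simp only: adj_mult)
  finally show ?thesis using g by simp
 qed
 have "norm E <= 1/2"
  using norm_triangle_ineq[of "h - Y" "adj (h - Y)"] Y norm_minus_commute[of Y h] unfolding E_def norm_adj by (simp add: Y_def)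
 hence "nonneg (of_real (1/2) - E)" by (intro le_norm) (auto simp: E_def adj_add add.commute)
 hence "nonneg (adj g * (of_real (1/2) - E) * g)" by (rule nonneg_conj)
 hence 1: "nonneg ((1/2) *R (g * g) - g * E * g)" using g by (simp add: algebra_simps of_real_def)
 have gEg: "g * E * g = 2 *R (g * g) - g * (Y + adj Y) * g"
  using g by (simp add: E_def algebra_simps adj_diff scaleR_2)
 define S where "S = sqrt 2 *R (adj Y * g) - (1 / sqrt 2) *R g"
 let ?c = "g * Y * adj Y * g"
 have "nonneg (adj S * S)" by (rule nonneg_adj_mult)
 moreover have "adj S * S = 2 *R ?c + (1/2) *R (g * g) - g * (Y + adj Y) * g"
  using g by (simp add: S_def adj_diff adj_scaleR adj_mult algebra_simps)
 ultimately have "nonneg (2 *R ?c + (1/2) *R (g * g) - g * (Y + adj Y) * g)" by simp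
 hence 2: "nonneg (2 *R ?c - g * g)"
 proof -
  have "(1/2) *R p - (2 *R p - q) + (r + (1/2) *R p - q) = r - p" for p q r :: 'a
   using scaleR_half_double[of p] by (simp add: algebra_simps scaleR_2)
  thus ?thesis using nonneg_add[OF 1 \<open>nonneg (2 *R (g * Y * adj Y * g) + (1/2) *R (g * g) - g * (Y + adj Y) * g)\<close>]
   unfolding gEg by (simp only:)
 qed
 define K where "K = norm (Z * adj Z) + 1"
 have nK: "nonneg (K *R 1 - Z * adj Z)"
  using le_norm[of "Z * adj Z" K] by (simp add: K_def adj_mult of_real_def)
 have K: "K > 0" by (simp add: K_def add_nonneg_pos)
 let ?a = "(g * Q) * (T * adj T) * adj (g * Q)"
 let ?b = "(g * Q * T) * (K *R 1 - Z * adj Z) * adj (g * Q * T)"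
 have "nonneg (2 *R ?b)" using nonneg_conj'[OF nK] by (rule nonneg_scaleR) simp
 moreover have "2 *R ?b
  = (2 * K) *R ?a - 2 *R ?c"
  using g by (simp add: Y_def adj_mult algebra_simps)
 ultimately have "nonneg ((2 * K) *R ?a - g * g)"
  using nonneg_le_trans[OF 2] by simp
 hence "cz (g * g) ((2 * K) *R ?a)"
  using cz_le nonneg_square[OF g(1)] by blast
 moreover have "cz ((2 * K) *R ?a) ?a"
  using K by (intro cz_scaleR') simp
 ultimately show ?thesis using cz_conj cz_trans by blast
qed

section \<open>Cuntz comparison under approximate divisibility\<close>

definition csimple :: "'a::ucstar itself => bool" where
 "csimple _ = (ALL I::'a set. closed I & 0 : I & (ALL x:I. ALL y:I. x + y : I) & (ALL x:I. ALL r. r * x : I & x * r : I)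
  --> I = {0} | I = UNIV)"

lemma closure_closed_op:
 fixes f :: "'a::metric_space => 'b::metric_space => 'c::metric_space"
 assumes "x : closure S" "y : closure T" and "!!x y. x : S ==> y : T ==> f x y : U"
  and "!!X Y. X ~~> x ==> Y ~~> y ==> (%n. f (X n) (Y n)) ~~> f x y"
 shows "f x y : closure U"
proof -
 obtain X Y where "!!n. X n : S" "X ~~> x" "!!n. Y n : T" "Y ~~> y"
  using assms(1,2) unfolding closure_sequential by blast
 thus ?thesis unfolding closure_sequential using assms(3,4) by (intro exI[of _ "%n. f (X n) (Y n)"]) blast
qed

lemma sum_lessThan_add: "(\<Sum>i<m + n. f i) = (\<Sum>i<m. f i) + (\<Sum>i<n::nat. f (m + i) :: 'a::comm_monoid_add)"
 by (induction n) (simp_all add: add.assoc)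

text \<open>The ideal spanned by the x g y is dense, so it contains a z near 1. The half sums of x g
  adj x and adj y g y dominate the real part of z, so the resulting H is at least 1/2; conjugating
  by its inverse square root gives exactly 1.\<close>

lemma csimple_full:
 fixes g :: "'a::ucstar"
 assumes simp: "csimple TYPE('a)" and g: "nonneg g" "g ~= 0"
 shows "EX (m::nat) s. (\<Sum>i<m. s i * g * adj (s i)) = 1"
proof -
 define J where "J = {z. EX (m::nat) x y. z = (\<Sum>i<m. x i * g * y i)}"
 have J0: "0 : J" unfolding J_def by (auto intro!: exI[of _ "0::nat"])
 have Jadd: "z + w : J" if "z : J" "w : J" for z w
 proof -
  obtain m x y where z: "z = (\<Sum>i<m::nat. x i * g * y i)" using \<open>z : J\<close> unfolding J_def by blast
  obtain n x' y' where w: "w = (\<Sum>i<n::nat. x' i * g * y' i)" using \<open>w : J\<close> unfolding J_def by blast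
  have "z + w = (\<Sum>i<m+n. (if i < m then x i else x' (i - m)) * g * (if i < m then y i else y' (i - m)))"
   unfolding sum_lessThan_add z w by simp
  thus ?thesis unfolding J_def mem_Collect_eq
   by (intro exI[of _ "m + n"] exI[of _ "%i. if i < m then x i else x' (i - m)"] exI[of _ "%i. if i < m then y i else y' (i - m)"])
 qed
 have Jl: "r * z : J" and Jr: "z * r : J" if "z : J" for z r
 proof -
  obtain m x y where z: "z = (\<Sum>i<m::nat. x i * g * y i)" using \<open>z : J\<close> unfolding J_def by blast
  have "r * z = (\<Sum>i<m. (r * x i) * g * y i)" by (simp add: z sum_distrib_left mult.assoc)
  thus "r * z : J" unfolding J_def mem_Collect_eq by (intro exI[of _ m] exI[of _ "%i. r * x i"] exI[of _ y])
  have "z * r = (\<Sum>i<m. x i * g * (y i * r))" by (simp add: z sum_distrib_right mult.assoc)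
  thus "z * r : J" unfolding J_def mem_Collect_eq by (intro exI[of _ m] exI[of _ x] exI[of _ "%i. y i * r"])
 qed
 have gJ: "g : J" unfolding J_def by (auto intro!: exI[of _ 1] exI[of _ "%i. 1"])
 have "closure J = {0} | closure J = UNIV"
  using simp unfolding csimple_def
 proof (rule allE[of _ "closure J"], elim impE, goal_cases)
  case 1
  have "x + y : closure J" if "x : closure J" "y : closure J" for x y
   by (rule closure_closed_op[OF that]) (auto intro: Jadd tendsto_intros)
  moreover have "r * x : closure J" if "x : closure J" for x r
   by (rule closure_closed_op[OF that that, where f="%x y. r * x"]) (auto intro: Jl tendsto_intros)
  moreover have "x * r : closure J" if "x : closure J" for x r
   by (rule closure_closed_op[OF that that, where f="%x y. x * r"]) (auto intro: Jr tendsto_intros)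
  ultimately show ?case using J0 closure_subset by blast
 qed
 moreover have "closure J ~= {0}" using gJ g(2) closure_subset by blast
 ultimately have "1 : closure J" by blast
 then obtain z where z: "z : J" "dist z 1 < 1/2" unfolding closure_approachable by (meson half_gt_zero zero_less_one)
 then obtain m x y where zs: "z = (\<Sum>i<m::nat. x i * g * y i)" unfolding J_def by blast
 let ?b = "\<Sum>i<m. x i * g * adj (x i)"
 let ?c = "\<Sum>i<m. adj (y i) * g * y i"
 define H where "H = (1/2) *R (?b + ?c)"
 define K where "K = (1/2) *R (z + adj z)"
 have ag: "adj g = g" using g nonneg_adj by blast
 let ?a = "\<Sum>i<m. (x i - adj (y i)) * g * adj (x i - adj (y i))"
 have "nonneg ?a" by (intro nonneg_sum nonneg_conj' g)
 hence "nonneg ((1/2) *R ?a)" by (rule nonneg_scaleR) simp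
 moreover have "?a =
   ?b + ?c - (z + adj z)"
  by (simp add: zs adj_sum adj_mult ag adj_diff sum.distrib[symmetric] sum_subtractf[symmetric] algebra_simps)
 ultimately have HK: "nonneg (H - K)" by (simp add: H_def K_def scaleR_diff_right)
 have nK: "norm (1 - K) <= 1/2"
 proof -
  have "1 - K = (1/2) *R ((1 - z) + adj (1 - z))"
   using scaleR_half_double[of "1::'a"] by (simp add: K_def adj_diff algebra_simps)
  also have "norm ... <= (1/2) * (norm (1 - z) + norm (adj (1 - z)))"
   unfolding norm_scaleR by (intro mult_mono norm_triangle_ineq) auto
  also have "... <= 1/2" using z(2) unfolding norm_adj by (simp add: dist_norm norm_minus_commute)
  finally show ?thesis .
 qed
 have "nonneg (of_real (1/2) - (1 - K))"
  by (rule le_norm[OF _ nK]) (simp add: K_def adj_diff adj_scaleR adj_add add.commute)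
 moreover have "of_real (1/2) - (1 - K) = K - of_real (1/2)"
 proof -
  have "of_real (1/2) + of_real (1/2) = (of_real (1/2 + 1/2) :: 'a)" by (simp only: of_real_add)
  thus ?thesis by (simp add: algebra_simps)
 qed
 ultimately have "nonneg (K - of_real (1/2))" by simp
 hence H2: "nonneg (H - of_real (1/2))" using nonneg_le_trans HK by blast
 hence iH: "invb H" using nonneg_add_pos_invb[OF H2, of "1/2"] by simp
 have nH: "nonneg H" using nonneg_add[OF H2 nonneg_of_real[of "1/2"]] by simp
 obtain r where r: "nonneg r" "r * r = H" using nonneg_sqrt[OF nH] by metis
 obtain k where k: "r * k = 1" "k * r = 1" using invb_factor[of r r] r iH unfolding invb_def by blast
 have ak: "adj k = k"
 proof -
  have "adj k * r = 1" using arg_cong[OF k(1), of adj] nonneg_adj[OF r(1)] by (simp add: adj_mult)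
  thus ?thesis using k by (metis mult.assoc mult.left_neutral mult.right_neutral)
 qed
 have kHk: "k * H * k = 1" using k r(2) by (metis mult.assoc mult.left_neutral)
 define s where "s i = (1 / sqrt 2) *R (if i < m then k * x i else k * adj (y (i - m)))" for i
 have "(\<Sum>i<m+m. s i * g * adj (s i)) = (\<Sum>i<m. (1/2) *R (k * (x i * g * adj (x i)) * k)) + (\<Sum>i<m. (1/2) *R (k * (adj (y i) * g * y i) * k))"
  unfolding sum_lessThan_add by (simp add: s_def adj_scaleR adj_mult ak mult.assoc)
 also have "... = k * H * k"
  by (simp add: H_def sum_distrib_left sum_distrib_right scaleR_sum_right distrib_left distrib_right scaleR_add_right)
 finally show ?thesis using kHk by auto
qed

text \<open>Equality modulo null sequences; identities that hold in the limit can then be computed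
  with like exact ones.\<close>

definition asyeq :: "(nat => 'a::real_normed_vector) => (nat => 'a) => bool" where
 "asyeq x y \<longleftrightarrow> (%k. x k - y k) ~~> 0"

lemma asyeq_refl [simp]: "asyeq x x" by (simp add: asyeq_def)
lemma asyeq_sym: "asyeq x y ==> asyeq y x"
 unfolding asyeq_def using tendsto_minus[of "%k. x k - y k" 0] by simp
lemma asyeq_trans [trans]: "asyeq x y ==> asyeq y z ==> asyeq x z"
 unfolding asyeq_def using tendsto_add[of "%k. x k - y k" 0 sequentially "%k. y k - z k" 0] by simp
lemma asyeq_add: "asyeq x x' ==> asyeq y y' ==> asyeq (%k. x k + y k) (%k. x' k + y' k)"
 unfolding asyeq_def using tendsto_add[of "%k. x k - x' k" 0 sequentially "%k. y k - y' k" 0] by (simp add: algebra_simps)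
lemma asyeq_sum: "(!!i. i : S ==> asyeq (x i) (y i)) ==> asyeq (%k. \<Sum>i\<in>S. x i k) (%k. \<Sum>i\<in>S. y i k)"
 by (induction S rule: infinite_finite_induct) (auto intro!: asyeq_add)

lemma Bseq_mult': "Bseq x ==> Bseq y ==> Bseq (%k. x k * y k :: 'a::real_normed_algebra)"
proof -
 assume "Bseq x" "Bseq y"
 then obtain K L where KL: "K > 0" "L > 0" "!!n. norm (x n) <= K" "!!n. norm (y n) <= L" unfolding Bseq_def by blast
 have "norm (x n * y n) <= K * L" for n
  using norm_mult_ineq[of "x n" "y n"] mult_mono[OF KL(3)[of n] KL(4)[of n]] KL(1) by simp
 thus ?thesis using KL unfolding Bseq_def by (intro exI[of _ "K * L"]) auto
qed
lemma Bseq_const: "Bseq (%k. c)"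
 by simp
lemma Bseq_add': "Bseq x ==> Bseq y ==> Bseq (%k. x k + y k :: 'a::real_normed_vector)"
 unfolding Bseq_def
proof (elim exE conjE)
 fix K L assume "K > 0" "L > 0" "ALL n. norm (x n) <= K" "ALL n. norm (y n) <= L"
 thus "EX K>0. ALL n. norm (x n + y n) <= K"
  by (intro exI[of _ "K + L"]) (auto intro!: order_trans[OF norm_triangle_ineq] add_mono)
qed
lemma Bseq_sum: "(!!i. i : S ==> Bseq (x i)) ==> Bseq (%k. \<Sum>i\<in>S. x i k :: 'a::real_normed_vector)"
 by (induction S rule: infinite_finite_induct) (auto intro!: Bseq_add')
lemma Bseq_adj: "Bseq x ==> Bseq (%k. adj (x k :: 'a::ucstar))"
 by (simp add: Bseq_def)
lemma Bseq_power: "Bseq x ==> Bseq (%k. (x k :: 'a::real_normed_algebra_1) ^ j)"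
 by (induction j) (auto intro!: Bseq_mult')

lemma asyeq_mult:
 fixes x :: "nat => 'a::real_normed_algebra"
 assumes "asyeq x x'" "asyeq y y'" "Bseq x" "Bseq y'"
 shows "asyeq (%k. x k * y k) (%k. x' k * y' k)"
proof -
 have 1: "Zfun (%k. x k - x' k) sequentially" "Zfun (%k. y k - y' k) sequentially"
  using assms(1,2) by (simp_all add: asyeq_def tendsto_Zfun_iff)
 have 2: "Bfun x sequentially" "Bfun y' sequentially" using assms(3,4) by simp_all
 have "Zfun (%k. x k * (y k - y' k) + (x k - x' k) * y' k) sequentially"
  by (intro Zfun_add bounded_bilinear.Bfun_prod_Zfun[OF bounded_bilinear_mult] bounded_bilinear.Zfun_prod_Bfun[OF bounded_bilinear_mult] 1 2)
 thus ?thesis by (simp add: asyeq_def tendsto_Zfun_iff algebra_simps)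
qed

lemma asyeq_mult_left: "asyeq y y' ==> asyeq (%k. c * y k) (%k. c * y' k :: 'a::real_normed_algebra)"
 unfolding asyeq_def using tendsto_mult_left[of "%k. y k - y' k" 0 sequentially c] by (simp add: algebra_simps)
lemma asyeq_mult_right: "asyeq y y' ==> asyeq (%k. y k * c) (%k. y' k * c :: 'a::real_normed_algebra)"
 unfolding asyeq_def using tendsto_mult_right[of "%k. y k - y' k" 0 sequentially c] by (simp add: algebra_simps)

lemma asyeq_mult_seq_left: "Bseq x ==> asyeq y y' ==> asyeq (%k. x k * y k) (%k. x k * y' k :: 'a::real_normed_algebra)"
 unfolding asyeq_def using bounded_bilinear.Bfun_prod_Zfun[OF bounded_bilinear_mult, of x sequentially "%k. y k - y' k"]
 by (simp add: tendsto_Zfun_iff algebra_simps)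
lemma asyeq_mult_seq_right: "Bseq y ==> asyeq x x' ==> asyeq (%k. x k * y k) (%k. x' k * y k :: 'a::real_normed_algebra)"
 unfolding asyeq_def using bounded_bilinear.Zfun_prod_Bfun[OF bounded_bilinear_mult, of "%k. x k - x' k" sequentially y]
 by (simp add: tendsto_Zfun_iff algebra_simps)

lemmas Bseq_intros = Bseq_mult' Bseq_add' Bseq_sum Bseq_adj Bseq_power Bseq_const

text \<open>Bounded central sequences: modulo null sequences they form the commutant of the constant
  ones.\<close>

definition acent :: "(nat => 'a::ucstar) => bool" where
 "acent W \<longleftrightarrow> Bseq W & (ALL x. asyeq (%k. W k * x) (%k. x * W k))"

lemma acent_Bseq: "acent W ==> Bseq W" by (simp add: acent_def)
lemma acent_comm: "acent W ==> asyeq (%k. W k * x) (%k. x * W k)" by (simp add: acent_def)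
lemma acent_1: "acent (%k. 1)" by (simp add: acent_def)
lemma acent_0: "acent (%k. 0)" by (simp add: acent_def)
lemma acent_add: "acent V ==> acent W ==> acent (%k. V k + W k)"
 by (auto simp: acent_def Bseq_add' distrib_left distrib_right intro!: asyeq_add)
lemma acent_sum: "(!!i. i : S ==> acent (W i)) ==> acent (%k. \<Sum>i\<in>S. W i k)"
 by (induction S rule: infinite_finite_induct) (auto intro!: acent_add acent_0)
lemma acent_adj: assumes "acent W" shows "acent (%k. adj (W k))"
proof -
 have "asyeq (%k. adj (W k) * x) (%k. x * adj (W k))" for x
 proof -
  have "(%k. adj (adj x * W k - W k * adj x)) ~~> adj 0"
   using asyeq_sym[OF acent_comm[OF assms, of "adj x"]] unfolding asyeq_def by (intro tendsto_adj)
  thus ?thesis by (simp add: asyeq_def adj_diff adj_mult)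
 qed
 thus ?thesis using assms by (simp add: acent_def Bseq_adj)
qed
lemma acent_mult: assumes "acent V" "acent W" shows "acent (%k. V k * W k)"
proof -
 have "asyeq (%k. V k * W k * x) (%k. x * (V k * W k))" for x
 proof -
  have "asyeq (%k. V k * (W k * x)) (%k. V k * (x * W k))"
   by (intro asyeq_mult_seq_left acent_comm acent_Bseq assms)
  moreover have "asyeq (%k. (V k * x) * W k) (%k. (x * V k) * W k)"
   by (intro asyeq_mult_seq_right acent_comm acent_Bseq assms)
  ultimately show ?thesis using asyeq_trans by (simp add: mult.assoc)
 qed
 thus ?thesis using assms by (simp add: acent_def Bseq_mult')
qed

text \<open>The working rule for \<open>density_step\<close>: constants are collected on the left
  and central sequences on the right, so that products are computed as in a tensor product.\<close>

lemma acent_mult_asym: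
 assumes "acent V" "acent W"
 shows "asyeq (%k. (x * V k) * (y * W k)) (%k. (x * y) * (V k * W k))"
proof -
 have "asyeq (%k. x * (V k * y) * W k) (%k. x * (y * V k) * W k)"
  by (intro asyeq_mult_seq_right asyeq_mult_left acent_comm acent_Bseq assms)
 thus ?thesis by (simp add: mult.assoc)
qed

text \<open>What is needed of the matrix units: n k lowers the index by one, so its adjoint is
  nilpotent and P = n k * adj (n k) misses only the last index; V j carries index j below m to the
  last one, so the V j have orthogonal sources and the common range 1 - P.\<close>

definition ad_data :: "nat => nat => (nat => 'a::ucstar) => (nat => nat => 'a) => bool" where
 "ad_data m L n V \<longleftrightarrow> acent n & (ALL j<m. acent (V j)) &
  (ALL k. adj (n k) ^ L = 0 & adj (n k) * (n k * adj (n k)) = adj (n k) &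
   (ALL j<m. V j k * (n k * adj (n k)) = V j k & n k * adj (n k) * V j k = 0 &
    (ALL i<m. V j k * adj (V i k) = (if i = j then 1 - n k * adj (n k) else 0))))"

lemma telescope: "(\<Sum>j<L. (- z) ^ j) * (1 + z) = 1 - (- z) ^ L" for z :: "'a::ring_1"
proof (induction L)
 case (Suc L)
 have "(\<Sum>j<Suc L. (- z) ^ j) * (1 + z) = (\<Sum>j<L. (- z) ^ j) * (1 + z) + (- z) ^ L * (1 + z)" by (simp add: distrib_right)
 also have "... = 1 - (- z) ^ L * (- z)" unfolding Suc by (simp add: distrib_left)
 finally show ?case by (simp add: power_Suc2 del: power_Suc)
qed simp

lemma affine_sum_product:
 fixes p :: "'a::semiring_0"
 shows "(p + sum f S) * (p' + sum g T) = (p * p' + (\<Sum>i\<in>T. p * g i)) + ((\<Sum>j\<in>S. f j * p') + (\<Sum>j\<in>S. \<Sum>i\<in>T. f j * g i))"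
proof -
 have "(p + sum f S) * (p' + sum g T) = (p * p' + p * sum g T) + (sum f S * p' + sum f S * sum g T)"
  by (simp add: distrib_left distrib_right add_ac)
 moreover have "sum f S * sum g T = (\<Sum>j\<in>S. \<Sum>i\<in>T. f j * g i)" by (rule sum_product)
 ultimately show ?thesis by (simp only: sum_distrib_left sum_distrib_right)
qed

text \<open>
 The perturbed element compresses to M = c (1 + \<Theta>) + E N, which is invertible on the left up to an error tending to 0,
 since N is nilpotent and asymptotically central. The elements V transport the corner e P, on which this succeeds, to r.
\<close>
lemma density_step:
 fixes a :: "'a::ucstar"
 assumes ad: "ad_data m L n V"
  and kap: "\<kappa> * a * a * e = e"
  and er: "e * r = r" "r * e = r" "e * q = q" "q * e = q" "r * q = 0" "q * r = 0" "adj r = r" "adj q = q"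
  and full: "(\<Sum>j<m. s j * (q * q) * adj (s j)) = 1"
  and v: "norm (\<kappa> * a) * norm (v * b * adj v - a) < 1" and c: "c > 0"
 shows "EX Q Z. Bseq Q & Bseq Z & asyeq (%k. Q k * a * (w + c *R (v * n k)) * b * Z k) (%k. r * r)"
proof -
 define P where "P k = n k * adj (n k)" for k
 define N where "N k = adj (n k)" for k
 have acn: "acent n" and acV: "!!j. j < m ==> acent (V j)" using ad by (auto simp: ad_data_def)
 have acN: "acent N" unfolding N_def by (rule acent_adj[OF acn])
 have acP: "acent P" unfolding P_def by (intro acent_mult acn acent_adj)
 have NL: "!!k. N k ^ L = 0" and NP: "!!k. N k * P k = N k"
  and VP: "!!j k. j < m ==> V j k * P k = V j k" and PV: "!!j k. j < m ==> P k * V j k = 0"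
  and VV: "!!i j k. i < m ==> j < m ==> V j k * adj (V i k) = (if i = j then 1 - P k else 0)"
  using ad by (auto simp: ad_data_def N_def P_def)
 have aP: "!!k. adj (P k) = P k" by (simp add: P_def adj_mult)
 have PP: "P k * P k = P k" for k using NP[of k] by (simp add: P_def N_def mult.assoc)
 \<comment> \<open>The error of v b v* as a substitute for a, multiplied by \<kappa> a, which
   inverts a on e. By the assumption on v its norm is below 1, so 1 + \<Theta> is
   invertible.\<close>
 define \<Theta> where "\<Theta> = \<kappa> * a * (v * b * adj v - a)"
 let ?i = "1 + \<Theta>"
 have th: "\<kappa> * a * (v * b * adj v) * e = ?i * e"
  using kap by (simp add: \<Theta>_def algebra_simps)
 obtain G0 where G0: "G0 * ?i = 1" using v norm_mult_ineq[of "\<kappa> * a" "v * b * adj v - a"] invb_one_minus[of "- \<Theta>"] by (auto simp: \<Theta>_def)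
 define G where "G = (1/c) *R G0"
 have G: "G * (c *R ?i) = 1" using G0 c by (simp add: G_def)
 define E where "E = \<kappa> * a * w * b * adj v"
 define F where "F = G * E"
 define z where "z k = F * N k" for k
 \<comment> \<open>A geometric series stopped at L inverts 1 + z on the left: z = F N with N almost
   central, so z^L is close to F^L N^L = 0 whatever w is.\<close>
 define R where "R k = (\<Sum>j<L. (- z k) ^ j) * G" for k
 define M where "M k = c *R ?i + E * N k" for k
 have BN: "Bseq N" and BP: "Bseq P" and Bn: "Bseq n" using acN acP acn acent_Bseq by auto
 have Bz: "Bseq z" unfolding z_def by (intro Bseq_intros BN)
 have BR: "Bseq R" unfolding R_def
  by (intro Bseq_intros) (use Bz in "simp_all add: Bseq_def")
 have RM: "R k * M k = (\<Sum>j<L. (- z k) ^ j) * (1 + z k)" for k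
 proof -
  have "G * M k = 1 + z k" unfolding M_def distrib_left G by (simp add: z_def F_def mult.assoc)
  thus ?thesis by (simp add: R_def mult.assoc)
 qed
 have zp: "asyeq (%k. z k ^ j) (%k. F ^ j * N k ^ j)" for j
 proof (induction j)
  case (Suc j)
  have acNj: "acent (%k. N k ^ j)" for j by (induction j) (auto intro: acent_1 acent_mult acN)
  let ?k = "%k. z k * (F ^ j * N k ^ j)"
  have "asyeq (%k. z k * z k ^ j) ?k"
   by (intro asyeq_mult_seq_left Suc Bz)
  also have "asyeq ?k (%k. (F * F ^ j) * (N k * N k ^ j))"
   unfolding z_def by (rule acent_mult_asym[OF acN acNj])
  finally show ?case by simp
 qed simp
 have RM1: "asyeq (%k. R k * M k) (%k. 1)"
 proof -
  have "asyeq (%k. z k ^ L) (%k. 0)" using zp[of L] by (simp add: NL)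
  hence "(%k. (- 1) ^ L * z k ^ L) ~~> (- 1) ^ L * 0" unfolding asyeq_def by (intro tendsto_mult_left) simp
  thus ?thesis using tendsto_minus unfolding RM telescope asyeq_def by (fastforce simp: power_minus[of "z _"])
 qed
 \<comment> \<open>N is placed here to meet the n of the perturbation: once n has moved past b adj
   v, n N = P, so the perturbation contributes c v b adj v on e P, while w only appears together
   with the nilpotent N.\<close>
 define Z1 where "Z1 k = adj v * N k * e" for k
 have BZ1: "Bseq Z1" unfolding Z1_def by (intro Bseq_intros BN)
 have step1: "asyeq (%k. \<kappa> * a * (w + c *R (v * n k)) * b * Z1 k) (%k. M k * e * P k)"
 proof -
  let ?b = "c *R (\<kappa> * a * v)"
  let ?j = "%k. (b * adj v) * n k * N k * e"
  have "asyeq (%k. n k * (b * adj v) * N k * e) ?j"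
   by (intro asyeq_mult_right asyeq_mult_seq_right acent_comm acn BN)
  also have "asyeq ?j (%k. b * adj v * (e * P k))"
   using asyeq_mult_left[OF acent_comm[OF acP, of e], of "b * adj v"] by (simp add: P_def N_def mult.assoc)
  finally have 1: "asyeq (%k. ?b * (n k * (b * adj v) * N k * e)) (%k. ?b * (b * adj v * (e * P k)))"
   by (rule asyeq_mult_left)
  have h1: "?b * (b * adj v * (e * P k)) = c *R ?i * e * P k" for k
  proof -
   have "(\<kappa> * a * v) * (b * adj v * (e * P k)) = (\<kappa> * a * (v * b * adj v) * e) * P k" by (simp add: mult.assoc)
   thus ?thesis unfolding th by simp
  qed
  have "asyeq (%k. N k * e) (%k. e * N k)" by (rule acent_comm[OF acN])
  also have "asyeq (%k. e * N k) (%k. N k * e * P k)"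
  proof -
   have "asyeq (%k. (e * N k) * P k) (%k. (N k * e) * P k)"
    by (intro asyeq_mult_seq_right asyeq_sym[OF acent_comm[OF acN]] BP)
   thus ?thesis by (simp add: mult.assoc NP)
  qed
  finally have 2: "asyeq (%k. E * (N k * e)) (%k. E * (N k * e * P k))" by (rule asyeq_mult_left)
  have "\<kappa> * a * (w + c *R (v * n k)) * b * Z1 k = E * (N k * e) + ?b * (n k * (b * adj v) * N k * e)" for k
   by (simp add: Z1_def E_def algebra_simps)
  moreover have "M k * e * P k = E * (N k * e * P k) + ?b * (b * adj v * (e * P k))" for k
   unfolding h1 by (simp add: M_def algebra_simps)
  ultimately show ?thesis using asyeq_add[OF 2 1] by presburger
 qed
 let ?d = "asyeq (%k. R k * (\<kappa> * a * (w + c *R (v * n k)) * b * Z1 k))"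
 have step2: "?d (%k. e * P k)"
 proof -
  let ?l = "%k. R k * (M k * e * P k)"
  let ?m = "%k. 1 * (e * P k)"
  have "?d ?l"
   by (intro asyeq_mult_seq_left step1 BR)
  also have "asyeq ?l ?m"
  proof -
   have "asyeq (%k. (R k * M k) * (e * P k)) ?m"
    by (intro asyeq_mult_seq_right RM1 Bseq_intros BP)
   thus ?thesis by (simp add: mult.assoc)
  qed
  finally show ?thesis by simp
 qed
 \<comment> \<open>x j V j carries the part q at index j to the part r at the last index, which P
   misses. As r q = 0, the terms mixing it with r P vanish, and by fullness the sum over j
   contributes r^2 (1 - P).\<close>
 define x where "x j = r * s j * q" for j
 define D where "D k = r * P k + (\<Sum>j<m. x j * V j k)" for k
 have BV: "Bseq (V j)" if "j < m" for j using acV[OF that] acent_Bseq by blast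
 have BD: "Bseq D" unfolding D_def by (intro Bseq_intros BP) (auto intro: BV)
 have aD: "adj (D k) = P k * r + (\<Sum>j<m. adj (V j k) * adj (x j))" for k
  by (simp add: D_def adj_add adj_sum adj_mult aP er)
 have aD': "asyeq (%k. adj (D k)) (%k. r * P k + (\<Sum>j<m. adj (x j) * adj (V j k)))"
  unfolding aD by (intro asyeq_add asyeq_sum acent_comm[OF acP] acent_comm acent_adj acV) auto
 let ?g = "%k. r * P k + (\<Sum>j<m. (x j * e) * V j k)"
 have DeP: "asyeq (%k. D k * (e * P k)) ?g"
 proof -
  let ?f = "%k. (r * e) * (P k * P k) + (\<Sum>j<m. (x j * e) * (V j k * P k))"
  have "D k * (e * P k) = (r * P k) * (e * P k) + (\<Sum>j<m. (x j * V j k) * (e * P k))" for k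
   by (simp add: D_def distrib_right sum_distrib_right)
  moreover have "asyeq (%k. (r * P k) * (e * P k) + (\<Sum>j<m. (x j * V j k) * (e * P k)))
    ?f"
   by (intro asyeq_add asyeq_sum acent_mult_asym acP acV) auto
  moreover have "?f = ?g"
   by (intro ext arg_cong2[where f="(+)"] sum.cong) (auto simp: VP PP er)
  ultimately show ?thesis by simp
 qed
 have rx: "r * adj (x j) = 0" and xr: "x j * e * r = 0" for j
 proof -
  have "r * adj (x j) = (r * q) * (adj (s j) * r)" by (simp add: x_def adj_mult er(7,8) mult.assoc)
  thus "r * adj (x j) = 0" using er(5) by simp
  show "x j * e * r = 0" using er(1,6) by (simp add: x_def mult.assoc)
 qed
 have xx: "x j * e * adj (x j) = r * (s j * (q * q) * adj (s j)) * r" for j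
 proof -
  show ?thesis using er(4) by (simp add: x_def adj_mult er(7,8) mult.assoc)
 qed
 let ?c = "%k. (r * P k + (\<Sum>j<m. (x j * e) * V j k)) * (r * P k + (\<Sum>i<m. adj (x i) * adj (V i k)))"
 let ?h = "%k. r * r"
 have prod: "asyeq ?c ?h"
 proof -
  let ?a = "%k. ((r * r) * (P k * P k) + (\<Sum>i<m. (r * adj (x i)) * (P k * adj (V i k)))) +
    ((\<Sum>j<m. ((x j * e) * r) * (V j k * P k)) + (\<Sum>j<m. \<Sum>i<m. ((x j * e) * adj (x i)) * (V j k * adj (V i k))))"
  have "asyeq (%k. ((r * P k) * (r * P k) + (\<Sum>i<m. (r * P k) * (adj (x i) * adj (V i k)))) +
    ((\<Sum>j<m. ((x j * e) * V j k) * (r * P k)) + (\<Sum>j<m. \<Sum>i<m. ((x j * e) * V j k) * (adj (x i) * adj (V i k)))))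
   ?a"
   by (intro asyeq_add asyeq_sum acent_mult_asym acP acent_adj acV) auto
  also have "?a
   = ?h"
  proof
   fix k
   have "(\<Sum>j<m. \<Sum>i<m. ((x j * e) * adj (x i)) * (V j k * adj (V i k))) = (\<Sum>j<m. (x j * e * adj (x j)) * (1 - P k))"
   proof (intro sum.cong refl)
    fix j assume "j : {..<m}"
    hence "(\<Sum>i<m. ((x j * e) * adj (x i)) * (V j k * adj (V i k))) = (\<Sum>i<m. if i = j then ((x j * e) * adj (x j)) * (1 - P k) else 0)"
     by (intro sum.cong refl) (auto simp: VV)
    thus "(\<Sum>i<m. ((x j * e) * adj (x i)) * (V j k * adj (V i k))) = (x j * e * adj (x j)) * (1 - P k)"
     using \<open>j : {..<m}\<close> by simp
   qed
   also have "... = r * (\<Sum>j<m. s j * (q * q) * adj (s j)) * r * (1 - P k)"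
    by (simp add: xx sum_distrib_left sum_distrib_right)
   finally have e: "(\<Sum>j<m. \<Sum>i<m. ((x j * e) * adj (x i)) * (V j k * adj (V i k))) = r * r * (1 - P k)" using full by simp
   show "((r * r) * (P k * P k) + (\<Sum>i<m. (r * adj (x i)) * (P k * adj (V i k)))) +
    ((\<Sum>j<m. ((x j * e) * r) * (V j k * P k)) + (\<Sum>j<m. \<Sum>i<m. ((x j * e) * adj (x i)) * (V j k * adj (V i k)))) = r * r"
    unfolding e rx xr by (simp add: PP right_diff_distrib)
  qed
  finally show ?thesis unfolding affine_sum_product .
 qed
 let ?e = "%k. D k * (e * P k) * adj (D k)"
 have fin: "asyeq ?e ?h"
 proof -
  have "asyeq ?e ?c"
   by (intro asyeq_mult DeP aD' BD BP Bseq_intros) (auto intro: BV)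
  thus ?thesis using prod asyeq_trans by blast
 qed
 define Q where "Q k = D k * R k * \<kappa>" for k
 define Z where "Z k = Z1 k * adj (D k)" for k
 have "asyeq (%k. D k * (R k * (\<kappa> * a * (w + c *R (v * n k)) * b * Z1 k)) * adj (D k)) ?e"
  by (intro asyeq_mult_seq_right asyeq_mult_seq_left step2 Bseq_adj BD)
 hence "asyeq (%k. Q k * a * (w + c *R (v * n k)) * b * Z k) ?h" using fin asyeq_trans by (simp add: Q_def Z_def mult.assoc)
 moreover have "Bseq Q" "Bseq Z" unfolding Q_def Z_def by (intro Bseq_intros BD BR BZ1)+
 ultimately show ?thesis by blast
qed

section \<open>Open dense sets of perturbations\<close>

lemma compact_uniform_eventually:
 fixes Y :: "'a::metric_space set"
 assumes "compact Y" and loc: "!!y. y : Y ==> EX d>0. EX K. ALL k>=K. ALL y':ball y d. P k y'"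
 shows "EX K::nat. ALL k>=K. ALL y:Y. P k y"
proof -
 obtain d K where dK: "!!y. y : Y ==> d y > 0" "!!y k y'. y : Y ==> k >= K y ==> y' : ball y (d y) ==> P k y'"
  using loc by metis
 have "Y <= (\<Union>y\<in>Y. ball y (d y))" using dK(1) by auto
 then obtain T where T: "T <= Y" "finite T" "Y <= (\<Union>y\<in>T. ball y (d y))"
  using compactE_image[OF assms(1), of Y "%y. ball y (d y)"] by auto
 \<comment> \<open>The sum of the finitely many thresholds serves as a bound for each of
   them.\<close>
 have "P k y" if k: "k >= (\<Sum>y\<in>T. K y)" and y: "y : Y" for k y
 proof -
  obtain z where z: "z : T" "y : ball z (d z)" using T(3) y by auto
  show ?thesis using z T(2) member_le_sum[of z T K] dK(2)[of z k y] T(1) k by auto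
 qed
 thus ?thesis by blast
qed

text \<open>Q and Z depend on b, but they stay bounded as k grows, so the estimate at b survives in
  a ball around b that does not depend on k; compactness then gives one threshold for all of Y, with
  the same v.\<close>

lemma good_uniform:
 fixes a :: "'a::ucstar"
 assumes ad: "ad_data m L n V"
  and kap: "\<kappa> * a * a * e = e"
  and er: "e * r = r" "r * e = r" "e * q = q" "q * e = q" "r * q = 0" "q * r = 0" "adj r = r" "adj q = q"
  and full: "(\<Sum>j<m. s j * (q * q) * adj (s j)) = 1"
  and Y: "compact Y" "!!b. b : Y ==> norm (\<kappa> * a) * norm (v * b * adj v - a) < 1" and c: "c > 0"
 shows "EX K. ALL k>=K. ALL y:Y. EX Q Z. norm (Q * a * (w + c *R (v * n k)) * y * Z - r * r) < 1/4"
proof (rule compact_uniform_eventually[OF Y(1)])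
 fix b assume "b : Y"
 obtain Q Z where QZ: "Bseq Q" "Bseq Z" "asyeq (%k. Q k * a * (w + c *R (v * n k)) * b * Z k) (%k. r * r)"
  using density_step[OF ad kap er full Y(2)[OF \<open>b : Y\<close>] c] by blast
 have Bn: "Bseq n" using ad by (auto simp: ad_data_def acent_def)
 define X where "X k = Q k * a * (w + c *R (v * n k))" for k
 have "Bseq (%k. Q k * a * (w + (c *R v) * n k))" by (intro Bseq_intros Bn QZ)
 then obtain C where C: "C > 0" "!!k. norm (X k) <= C" unfolding Bseq_def by (auto simp: X_def)
 obtain D where D: "D > 0" "!!k. norm (Z k) <= D" using QZ(2) unfolding Bseq_def by blast
 obtain K where K: "!!k. k >= K ==> norm (X k * b * Z k - r * r) < 1/8"
  using QZ(3) LIMSEQ_D[of _ 0 "1/8"] by (auto simp: asyeq_def X_def)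
 \<comment> \<open>Replacing b by y then costs at most C d D = 1/8, which together with the 1/8 left
   at b gives 1/4.\<close>
 define d where "d = 1 / (8 * C * D)"
 have d: "d > 0" using C D by (simp add: d_def)
 have "norm (X k * y * Z k - r * r) < 1/4" if "k >= K" "y : ball b d" for k y
 proof -
  let ?a = "norm (X k * (y - b) * Z k)"
  have "?a <= norm (X k) * norm (y - b) * norm (Z k)" by (rule norm_mult3_le)
  also have "... <= C * d * D"
   using C D d that(2) by (intro mult_mono) (auto simp: dist_norm norm_minus_commute)
  also have "... = 1/8" using C D by (simp add: d_def)
  finally have "?a <= 1/8" .
  moreover have e: "X k * y * Z k - r * r = X k * (y - b) * Z k + (X k * b * Z k - r * r)" by (simp add: algebra_simps)
  ultimately show ?thesis unfolding e using K[OF that(1)] norm_triangle_ineq[of "X k * (y - b) * Z k" "X k * b * Z k - r * r"] by linarith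
 qed
 thus "EX d>0. EX K. ALL k>=K. ALL y:ball b d. EX Q Z. norm (Q * a * (w + c *R (v * n k)) * y * Z - r * r) < 1/4"
  using d unfolding X_def by blast
qed

text \<open>For each bad w of a convergent sequence pick a bad y; a limit point of these y in the
  compact Y is bad for the limit of the w, so the complement is closed.\<close>

lemma good_open:
 fixes a :: "'a::real_normed_algebra_1"
 assumes "compact Y"
 shows "open {w. ALL y:Y. EX Q Z. norm (Q * a * w * y * Z - h) < e}"
proof -
 have "closed {w. EX y:Y. ALL Q Z. norm (Q * a * w * y * Z - h) >= e}"
  unfolding closed_sequential_limits
 proof (intro allI impI CollectI, elim conjE, unfold mem_Collect_eq)
  fix s w assume "ALL n. EX y:Y. ALL Q Z. norm (Q * a * s n * y * Z - h) >= e" and s: "s ~~> w"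
  then obtain y where y: "!!n. y n : Y" "!!n Q Z. norm (Q * a * s n * y n * Z - h) >= e" by metis
  then obtain l r where l: "l : Y" "strict_mono (r :: nat => nat)" "(y \<circ> r) ~~> l" using assms unfolding compact_def by metis
  have "norm (Q * a * w * l * Z - h) >= e" for Q Z
   using y(2) LIMSEQ_subseq_LIMSEQ[OF s l(2)] l(3) by (intro LIMSEQ_le_const[of "%n. norm (Q * a * s (r n) * y (r n) * Z - h)"] tendsto_intros) (auto simp: o_def)
  thus "EX y:Y. ALL Q Z. norm (Q * a * w * y * Z - h) >= e" using l(1) by blast
 qed
 thus ?thesis unfolding closed_def by (simp add: Collect_neg_eq[symmetric] not_le)
qed

text \<open>0 is an accumulation point of the spectrum of a, expressed by functions: arbitrarily
  close to 0, but away from it, lives a function that does not vanish on the spectrum.\<close>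

definition noniso :: "'a::ucstar => bool" where
 "noniso a = (ALL \<eta>>0. EX l>0. EX q. continuous_on {0..1} q & (ALL t. t <= l | t >= \<eta> --> q t = 0) & cfc a q ~= 0)"

definition ramp :: "real => real => real => real" where
 "ramp u v t = max 0 (min 1 ((t - u) / (v - u)))"

lemma ramp_cont [continuous_intros]: "continuous_on S (ramp u v)"
 unfolding ramp_def divide_inverse by (intro continuous_intros)
lemma ramp_0: "u < v ==> t <= u ==> ramp u v t = 0"
 using divide_nonpos_pos[of "t - u" "v - u"] by (simp add: ramp_def)
lemma ramp_1: "u < v ==> v <= t ==> ramp u v t = 1"
 by (simp add: ramp_def field_simps)
lemma ramp_bounds: "0 <= ramp u v t" "ramp u v t <= 1" by (auto simp: ramp_def)

lemma cfc_mult_eq: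
 assumes "uint a" "continuous_on {0..1} f" "continuous_on {0..1} g" "!!t. t : {0..1} ==> f t * g t = h t"
 shows "cfc a f * cfc a g = cfc a h"
 using cfc_mult[OF assms(1-3)] cfc_cong[of "%t. f t * g t" h a] assms(4) by simp

definition adapprox :: "'a::ucstar itself => bool" where
 "adapprox _ = (ALL m. EX L n. EX V::nat => nat => 'a. ad_data m L n V)"

text \<open>A cutoff \<eta> is treated by nested functions of a: q lives between l and \<eta>', r
  begins at \<eta>' and equals 1 from 2 \<eta>' on, where tt begins. So e is a unit for q and r, the
  parts r and q are orthogonal, and r is a unit for tt, as \<open>density_step\<close> and
  \<open>cz_factor\<close> demand.\<close>

lemma level_dense:
 fixes a :: "'a::ucstar"
 assumes simp: "csimple TYPE('a)" and ad: "adapprox TYPE('a)" and a: "uint a" and ni: "noniso a"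
  and Y: "compact Y" "!!y. y : Y ==> nonneg y & cz a y" and eta: "0 < \<eta>"
 shows "EX \<G>. finite \<G> & (ALL G:\<G>. open G & closure G = UNIV) &
  (ALL w:\<Inter>\<G>. ALL y:Y. EX x. norm (x - a) <= \<eta> & cz x (a * w * y * adj w * a))"
proof -
 \<comment> \<open>Three equal layers: one for q, one in which r rises, one in which tt rises; only
   the part of a below 3 \<eta>' = \<eta> is lost.\<close>
 define \<eta>' where "\<eta>' = \<eta> / 3"
 have e': "\<eta>' > 0" using eta by (simp add: \<eta>'_def)
 obtain l qf where l: "l > 0" and qf: "continuous_on {0..1} qf" "!!t. t <= l | t >= \<eta>' ==> qf t = 0" "cfc a qf ~= 0"
  using ni e' unfolding noniso_def by blast
 have le: "l < \<eta>'"
 proof (rule ccontr)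
  assume "~ l < \<eta>'"
  hence "cfc a qf = cfc a (%t. 0)" by (intro cfc_cong qf(2)) auto
  thus False using qf(3) by (simp add: cfc_const[OF a])
 qed
 define ef where "ef = ramp (l/2) l"
 define rf where "rf = ramp \<eta>' (2 * \<eta>')"
 define tf where "tf = ramp (2 * \<eta>') (3 * \<eta>')"
 \<comment> \<open>The inverse square of t wherever ef is nonzero; below l/2, where ef vanishes, it
   is made constant to stay continuous.\<close>
 define kf where "kf t = 1 / (max t (l/2))^2" for t :: real
 have c: "continuous_on {0..1} ef" "continuous_on {0..1} rf" "continuous_on {0..1} tf" "continuous_on {0..1} kf"
  unfolding ef_def rf_def tf_def kf_def using l
  by (intro continuous_intros continuous_on_divide continuous_on_power continuous_on_max ballI; simp add: max_def)+
 have ci: "continuous_on {0..1} (%t::real. t)" by simp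
 define e where "e = cfc a ef"
 define r where "r = cfc a rf"
 define q where "q = cfc a qf"
 define tt where "tt = cfc a tf"
 define \<kappa> where "\<kappa> = cfc a kf"
 have aid: "cfc a (%t. t) = a" by (rule cfc_id[OF a])
 have er0: "ef t * rf t = rf t" "ef t * qf t = qf t" "rf t * qf t = 0" "rf t * tf t = tf t" for t
 proof -
  consider "t <= l" | "l <= t" "t <= \<eta>'" | "\<eta>' <= t" "t <= 2*\<eta>'" | "t >= 2 * \<eta>'" by linarith
  thus "ef t * rf t = rf t" "ef t * qf t = qf t" "rf t * qf t = 0" "rf t * tf t = tf t"
   by (cases; use l le e' qf(2) in "simp add: ef_def rf_def tf_def ramp_0 ramp_1")+
 qed
 have er: "e * r = r" "r * e = r" "e * q = q" "q * e = q" "r * q = 0" "q * r = 0" "r * tt = tt"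
  using cfc_const[OF a, of 0] cfc_mult_eq[OF a c(1) c(2), of rf] cfc_mult_eq[OF a c(2) c(1), of rf] cfc_mult_eq[OF a c(1) qf(1), of qf] cfc_mult_eq[OF a qf(1) c(1), of qf] cfc_mult_eq[OF a c(2) qf(1), of "%t. 0"] cfc_mult_eq[OF a qf(1) c(2), of "%t. 0"] cfc_mult_eq[OF a c(2) c(3), of tf] er0 unfolding e_def r_def q_def tt_def
  by auto
 have sa: "adj r = r" "adj q = q" "adj tt = tt" unfolding r_def q_def tt_def by (intro adj_cfc a c qf)+
 have kap: "\<kappa> * a * a * e = e"
 proof -
  have "\<kappa> * a * a * e = cfc a (%t. kf t * t * t * ef t)" using cfc_mult_eq[OF a c(4) ci] aid cfc_mult_eq[OF a continuous_on_mult[OF c(4) ci] ci] cfc_mult_eq[OF a continuous_on_mult[OF continuous_on_mult[OF c(4) ci] ci] c(1)] unfolding e_def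
   by (simp add: \<kappa>_def)
  also have "... = e" unfolding e_def
  proof (rule cfc_cong)
   fix t :: real
   show "kf t * t * t * ef t = ef t"
   using l by (simp add: ef_def ramp_0 kf_def power2_eq_square max_def)
  qed
  finally show ?thesis .
 qed
 have "nonneg (q * q)" "q * q ~= 0" using nonneg_square[OF sa(2)] sa_square_zero[OF sa(2)] qf(3) by (auto simp: q_def)
 then obtain m s where full: "(\<Sum>j<(m::nat). s j * (q * q) * adj (s j)) = 1" using csimple_full[OF simp] by blast
 obtain L n and V :: "nat => nat => 'a" where ad': "ad_data m L n V" using ad unfolding adapprox_def by blast
 define \<mu> where "\<mu> = norm (\<kappa> * a)"
 have "EX v d. d > 0 & (ALL b:cball y d. \<mu> * norm (v * b * adj v - a) < 1)" if y: "y : Y" for y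
 proof -
  let ?c = "2 * (\<mu> + 1)"
  have "1 / ?c > 0" by (simp add: \<mu>_def add_nonneg_pos)
  then obtain v where v: "norm (v * y * adj v - a) < 1 / ?c" using Y(2)[OF y] unfolding cz_def by blast
  have "\<mu> * norm (v * y * adj v - a) <= \<mu> * (1 / ?c)" using v by (intro mult_left_mono) (auto simp: \<mu>_def)
  also have "... < 1" by (simp add: \<mu>_def field_simps add_pos_nonneg)
  finally have "\<mu> * norm (v * y * adj v - a) < 1" .
  moreover have "open {b. \<mu> * norm (v * b * adj v - a) < 1}" by (intro open_Collect_less continuous_intros)
  ultimately obtain d where "d > 0" "cball y d <= {b. \<mu> * norm (v * b * adj v - a) < 1}"
   using open_contains_cball[of "{b. \<mu> * norm (v * b * adj v - a) < 1}"] by blast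
  thus ?thesis by blast
 qed
 then obtain v d where vd: "!!y. y : Y ==> d y > 0" "!!y b. y : Y ==> b : cball y (d y) ==> \<mu> * norm (v y * b * adj (v y) - a) < 1"
  by metis
 have "Y <= (\<Union>y\<in>Y. ball y (d y))" using vd(1) by auto
 then obtain T where T: "T <= Y" "finite T" "Y <= (\<Union>y\<in>T. ball y (d y))"
  using compactE_image[OF Y(1), of Y "%y. ball y (d y)"] by auto
 \<comment> \<open>One v works on each ball; closed balls make the pieces of Y compact, which both
   the openness of G y and the uniform estimate use.\<close>
 define G where "G y = {w. ALL b:Y \<inter> cball y (d y). EX Q Z. norm (Q * a * w * b * Z - r * r) < 1/4}" for y
 have cY: "compact (Y \<inter> cball y (d y))" for y using Y(1) by auto
 have oG: "open (G y)" for y unfolding G_def by (rule good_open[OF cY])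
 have Bn: "Bseq n" using ad' by (auto simp: ad_data_def acent_def)
 then obtain C where C: "C > 0" "!!k. norm (n k) <= C" unfolding Bseq_def by blast
 have dG: "closure (G y) = UNIV" if y: "y : T" for y
 proof -
  have yY: "y : Y" using y T by auto
  have "w : closure (G y)" for w unfolding closure_approachable
  proof (intro allI impI)
   fix \<epsilon> :: real assume ep: "\<epsilon> > 0"
   \<comment> \<open>Makes the perturbation c v n of norm at most half of \<epsilon>;
     \<open>good_uniform\<close> accepts every c > 0.\<close>
   define c where "c = \<epsilon> / (2 * (norm (v y) + 1) * C)"
   have np: "norm (v y) + 1 > 0" by (simp add: add_nonneg_pos)
   have c: "c > 0" using ep C np by (simp add: c_def)
   obtain K where K: "ALL k>=K. ALL b:Y \<inter> cball y (d y). EX Q Z. norm (Q * a * (w + c *R (v y * n k)) * b * Z - r * r) < 1/4"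
    using good_uniform[OF ad' kap er(1-6) sa(1,2) full cY, of y "v y" c w] vd(2)[OF yY] c by (auto simp: \<mu>_def)
   have "norm (c *R (v y * n K)) <= c * (norm (v y) * norm (n K))" using c by (simp add: norm_mult_ineq)
   also have "... <= c * ((norm (v y) + 1) * C)" using C c by (intro mult_left_mono mult_mono) auto
   also have "... = \<epsilon> / 2"
   proof -
    have "\<epsilon> / (2 * M * C) * (M * C) = \<epsilon> / 2" if "M > 0" for M using that C(1) by simp
    from this[OF np] show ?thesis unfolding c_def .
   qed
   also have "... < \<epsilon>" using ep by simp
   finally show "EX w':G y. dist w' w < \<epsilon>" using K
    by (intro bexI[of _ "w + c *R (v y * n K)"]) (auto simp: G_def dist_norm)
  qed
  thus ?thesis by auto
 qed
 have rtt: "(r * r) * tt = tt" using er(7) by (simp add: mult.assoc)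
 define sa where "sa = cfc a sqrt"
 have cs: "continuous_on {0..1} sqrt" by (intro continuous_intros)
 \<comment> \<open>x = a tf(a)^2 differs from a by at most \<eta>; written with square roots of a on
   both sides it is visibly below tt^2.\<close>
 define x where "x = sa * (tt * tt) * sa"
 have xa: "norm (x - a) <= \<eta>"
 proof -
  have tt2: "tt * tt = cfc a (%t. tf t * tf t)" unfolding tt_def by (rule cfc_mult_eq[OF a c(3) c(3)]) simp
  have ct2: "continuous_on {0..1} (%t. tf t * tf t)" by (intro continuous_intros c)
  let ?b = "%t. t * (tf t * tf t)"
  have "sa * (tt * tt) = cfc a (%t. sqrt t * (tf t * tf t))" unfolding tt2 sa_def by (rule cfc_mult_eq[OF a cs ct2]) simp
  hence xe: "x = cfc a ?b" unfolding x_def sa_def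
   using cfc_mult_eq[OF a continuous_on_mult[OF cs ct2] cs, of "%t. t * (tf t * tf t)"] by simp
  have cx: "continuous_on {0..1} ?b" by (intro continuous_intros c)
  let ?a = "%t. t * (tf t * tf t) - t"
  have "x - a = cfc a ?a" unfolding xe using cfc_diff[OF a cx ci] aid by simp
  also have "norm ... <= \<eta>"
  proof (rule cfc_norm[OF a])
   show "continuous_on {0..1} ?a" by (intro continuous_intros c)
   fix t :: real assume t: "t : {0..1}"
   show "\<bar>t * (tf t * tf t) - t\<bar> <= \<eta>"
   proof (cases "t >= 3 * \<eta>'")
    case True thus ?thesis using e' eta by (simp add: tf_def ramp_1)
   next
    case False
    have "\<bar>t * (tf t * tf t) - t\<bar> <= t" using ramp_bounds[of "2 * \<eta>'" "3 * \<eta>'" t] t by (simp add: tf_def mult_le_one abs_le_iff mult_left_le)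
    thus ?thesis using False by (simp add: \<eta>'_def)
   qed
  qed
  finally show ?thesis .
 qed
 have "cz x (a * w * y * adj w * a)" if w: "w : \<Inter>(G ` T)" and y: "y : Y" for w y
 proof -
  obtain y0 where y0: "y0 : T" "y : ball y0 (d y0)" using T(3) y by blast
  then obtain Q Z where QZ: "norm (Q * a * w * y * Z - r * r) < 1/4" using y w unfolding G_def by fastforce
  obtain u where u: "nonneg u" "u * u = y" using nonneg_sqrt Y(2)[OF y] by metis
  have aa: "adj a = a" using a by (simp add: uint_def)
  have arr: "adj (r * r) = r * r" unfolding adj_mult sa(1) ..
  have "norm (Q * (a * w * u) * (u * Z) - r * r) <= 1/4" using QZ by (simp add: u(2)[symmetric] mult.assoc)
  hence "cz (tt * tt) ((a * w * u) * adj (a * w * u))" by (rule cz_factor[OF sa(3) rtt arr])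
  moreover have "(a * w * u) * adj (a * w * u) = a * w * y * adj w * a"
   using u aa by (simp add: adj_mult nonneg_adj mult.assoc[symmetric]) (simp add: mult.assoc)
  moreover have "cz x (tt * tt)" using adj_cfc[OF a cs] cz_conj[of sa "tt * tt"] unfolding x_def by (simp add: sa_def)
  ultimately show ?thesis using cz_trans by metis
 qed
 thus ?thesis using xa T(2) oG dG by (intro exI[of _ "G ` T"]) auto
qed

text \<open>The approximations of a at the cutoffs 1 / (k + 1) are all below a w y w* a, so a is,
  because the relation is closed in its first argument. Density puts w within 1/2 of 1, which keeps
  the segment from 1 to w invertible.\<close>

lemma generic_w:
 fixes a :: "'a::ucstar"
 assumes simp: "csimple TYPE('a)" and ad: "adapprox TYPE('a)" and a: "uint a" and ni: "noniso a"
  and Y: "compact Y" "!!y. y : Y ==> nonneg y & cz a y"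
 shows "EX w. norm (w - 1) < 1/2 & (ALL y:Y. cz a (a * w * y * adj w * a))"
proof -
 have "ALL k. EX \<G>. finite \<G> & (ALL G:\<G>. open G & closure G = UNIV) &
  (ALL w:\<Inter>\<G>. ALL y:Y. EX x. norm (x - a) <= inverse (real (Suc k)) & cz x (a * w * y * adj w * a))"
  by (intro allI level_dense[OF simp ad a ni Y]) auto
 then obtain \<G> where G: "!!k. finite (\<G> k)" "!!k G. G : \<G> k ==> open G & closure G = UNIV"
  "!!k w y. w : \<Inter>(\<G> k) ==> y : Y ==> EX x. norm (x - a) <= inverse (real (Suc k)) & cz x (a * w * y * adj w * a)"
  by metis
 let ?a = "\<Union>k. \<G> k"
 have "Met_TC.mtopology closure_of \<Inter>?a = (UNIV :: 'a set)"
  using G(1,2) by (intro Met_TC.metric_Baire_category) (auto simp: countable_finite)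
 hence "1 : closure (\<Inter>?a)" by simp
 then obtain w where w: "w : \<Inter>?a" "dist w 1 < 1/2"
  unfolding closure_approachable by (meson half_gt_zero zero_less_one)
 have "cz a (a * w * y * adj w * a)" if y: "y : Y" for y
 proof (rule cz_closed)
  fix e :: real assume "e > 0"
  then obtain k where k: "inverse (real (Suc k)) < e" using reals_Archimedean by blast
  show "EX a'. norm (a' - a) < e & cz a' (a * w * y * adj w * a)" using w(1) G(3)[of w k y] y k by force
 qed
 thus ?thesis using w(2) by (auto simp: dist_norm)
qed

section \<open>Homotopies inside a Cuntz class\<close>

definition cls :: "'a::ucstar => 'a set" where
 "cls a = {x. nonneg x & cz x a & cz a x}"

lemma homotopicI:
 fixes H :: "real => 'a::topological_space => 'b::topological_space"
 assumes "continuous_on ({0..1} \<times> Y) (%p. H (fst p) (snd p))"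
  and "!!t y. t : {0..1} ==> y : Y ==> H t y : D"
  and "!!y. y : Y ==> H 0 y = f y" "!!y. y : Y ==> H 1 y = g y"
 shows "homotopic_with_canon (%_. True) Y D f g"
 using assms by (subst homotopic_with) (auto intro!: exI[of _ "%p. H (fst p) (snd p)"])

lemma homotopicD:
 fixes f g :: "'a::topological_space => 'b::topological_space"
 assumes "homotopic_with_canon (%_. True) Y D f g"
 shows "EX H. continuous_on ({0..1} \<times> Y) (%p. H (fst p) (snd p)) & (ALL t:{0..1}. ALL y:Y. H t y : D) &
  (ALL y:Y. H (0::real) y = f y) & (ALL y:Y. H 1 y = g y)"
proof -
 obtain h :: "real \<times> 'a => 'b" where h: "continuous_on ({0..1} \<times> Y) h" "h : ({0..1} \<times> Y) \<rightarrow> D" "ALL y:Y. h (0, y) = f y" "ALL y:Y. h (1, y) = g y"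
  using assms by (subst (asm) homotopic_with) auto
 thus ?thesis by (intro exI[of _ "%t y. h (t, y)"]) (auto simp: Pi_iff)
qed

lemma cz_conj_invb:
 assumes "invb (w::'a::ucstar)" shows "cz y (w * y * adj w)"
proof -
 obtain z where z: "w * z = 1" "z * w = 1" using assms by (auto simp: invb_def)
 have "z * (w * y * adj w) * adj z = (z * w) * y * (adj w * adj z)" by (simp only: mult.assoc)
 thus ?thesis using z cz_conj[of z "w * y * adj w"] by (simp flip: adj_mult)
qed

lemma cls_conj: "invb w ==> y : cls a ==> w * y * adj w : cls a"
 using cz_conj_invb[of w y] cz_conj[of w y] cz_trans nonneg_conj' unfolding cls_def by blast

text \<open>a y a <= norm y * a^2 <= norm y * norm a * a, so the sum is dominated by a multiple of
  a.\<close>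

lemma cz_her:
 fixes a :: "'a::ucstar"
 assumes "nonneg a" "nonneg y" "s >= 0" "r >= 0" shows "cz (s *R (a * y * a) + r *R a) a"
proof -
 obtain u where u: "nonneg u" "u * u = a" using nonneg_sqrt[OF assms(1)] by metis
 have au: "adj u = u" by (rule nonneg_adj[OF u(1)])
 have "nonneg (norm y *R (a * adj a) - a * y * adj a)" by (rule conj_le_norm[OF assms(2)])
 hence 1: "nonneg (norm y *R (a * a) - a * y * a)" using assms(1) by (simp add: nonneg_adj)
 let ?a = "s *R (a * y * a) + r *R a"
 let ?b = "norm y * norm a"
 let ?c = "norm a *R a - a * a"
 let ?d = "?b *R a - a * y * a"
 have "nonneg (norm a *R (u * adj u) - u * a * adj u)" by (rule conj_le_norm[OF assms(1)])
 moreover have "u * a * adj u = a * a" unfolding au by (simp add: mult.assoc flip: u(2))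
 ultimately have "nonneg ?c" unfolding au by (simp add: u(2))
 hence "nonneg (norm y *R ?c)" by (rule nonneg_scaleR) simp
 hence "nonneg ?d" using nonneg_le_trans 1 by (simp add: scaleR_diff_right)
 hence "nonneg (s *R ?d)" using assms by (intro nonneg_scaleR)
 hence "nonneg ((s * ?b + r) *R a - ?a)"
  by (simp add: scaleR_diff_right scaleR_add_left)
 moreover have "nonneg ?a"
  using nonneg_conj[OF assms(2), of a] assms nonneg_adj[OF assms(1)] by (intro nonneg_add nonneg_scaleR) auto
 ultimately have "cz ?a ((s * ?b + r) *R a)" by (intro cz_le)
 thus ?thesis using cz_scaleR'[of "s * ?b + r" a] cz_trans assms by fastforce
qed

lemma cz_add_right:
 assumes "nonneg x" "nonneg y" "r > 0" "cz a x" shows "cz a (r *R x + y)"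
proof -
 have "cz (r *R x) (r *R x + y)" by (rule cz_le) (use assms in "auto intro: nonneg_scaleR")
 thus ?thesis using assms(4) cz_scaleR[OF assms(3), of x] cz_trans by blast
qed

lemma homotopy_noniso:
 fixes a :: "'a::ucstar"
 assumes simp: "csimple TYPE('a)" and ad: "adapprox TYPE('a)" and a: "uint a" and ni: "noniso a"
  and Y: "compact Y" "Y <= cls a"
 shows "homotopic_with_canon (%_. True) Y (cls a) (%y. y) (%y. a)"
proof -
 have na: "nonneg a" by (rule uint_nonneg[OF a])
 have aa: "adj a = a" by (rule nonneg_adj[OF na])
 obtain w where w: "norm (w - 1) < 1/2" "!!y. y : Y ==> cz a (a * w * y * adj w * a)"
  using generic_w[OF simp ad a ni Y(1)] Y(2) unfolding cls_def by blast
 define w' where "w' t = 1 + t *R (w - 1)" for t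
 have iw: "invb (w' t)" if "t : {0..1}" for t
 proof -
  have "norm (t *R (w - 1)) <= 1 * norm (w - 1)" unfolding norm_scaleR using that by (intro mult_right_mono) auto
  hence "norm (of_real 1 - w' t) < 1" using w(1) by (simp add: w'_def)
  thus ?thesis by (rule invb_neumann)
 qed
 define f where "f y = w * y * adj w" for y
 have fc: "f y : cls a" if "y : Y" for y
  using cls_conj[OF iw[of 1], of y a] that Y(2) by (auto simp: w'_def f_def)
 let ?a = "homotopic_with_canon (%_. True)"
 let ?b = "continuous_on ({0..1} \<times> Y)"
 have S1: "?a Y (cls a) (%y. y) f"
 proof (rule homotopicI[where H="%t y. w' t * y * adj (w' t)"])
  show "?b (%p. w' (fst p) * snd p * adj (w' (fst p)))"
   unfolding w'_def by (intro continuous_intros)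
  show "w' t * y * adj (w' t) : cls a" if "t : {0..1}" "y : Y" for t y
   using cls_conj[OF iw[OF that(1)]] Y(2) that(2) by blast
 qed (auto simp: w'_def f_def)
 \<comment> \<open>h t is invertible for t < 1, so conjugation by it preserves the class; at t = 1
   it is a itself, and the choice of w makes the endpoint g y equivalent to a.\<close>
 define h where "h t = of_real (1 - t) + t *R a" for t :: real
 define g where "g y = a * f y * a" for y
 have nf: "nonneg (f y)" if "y : Y" for y using fc[OF that] by (simp add: cls_def)
 have gn: "nonneg (g y)" if "y : Y" for y using nonneg_conj[OF nf[OF that], of a] aa by (simp add: g_def)
 have ag: "cz a (g y)" if "y : Y" for y using w(2)[OF that] by (simp add: g_def f_def mult.assoc)
 have gc: "g y + t *R a : cls a" if "y : Y" "t >= 0" for y t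
 proof -
  have "cz (g y + t *R a) a" using cz_her[OF na nf[OF that(1)], of 1 t] that by (simp add: g_def)
  moreover have "cz a (1 *R g y + t *R a)" by (rule cz_add_right) (use gn ag na that nonneg_scaleR in auto)
  ultimately show ?thesis using gn na that by (simp add: cls_def nonneg_add nonneg_scaleR)
 qed
 have S2: "?a Y (cls a) f g"
 proof (rule homotopicI[where H="%t y. h t * f y * h t"])
  show "?b (%p. h (fst p) * f (snd p) * h (fst p))"
   unfolding h_def f_def by (intro continuous_intros)
  show "h t * f y * h t : cls a" if "t : {0..1}" "y : Y" for t y
  proof (cases "t = 1")
   case True thus ?thesis using gc[OF that(2), of 0] by (simp add: h_def g_def)
  next
   case False
   have "invb (t *R a + of_real (1 - t))"
    using that False na by (intro nonneg_add_pos_invb nonneg_scaleR) auto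
   hence "invb (h t)" by (simp add: h_def add.commute)
   thus ?thesis using cls_conj[OF _ fc[OF that(2)], of "h t"] by (simp only: h_def adj_add adj_scaleR aa adj_of_real)
  qed
 qed (auto simp: h_def f_def g_def)
 have S3: "?a Y (cls a) g (%y. g y + a)"
 proof (rule homotopicI[where H="%t y. g y + t *R a"])
  show "?b (%p. g (snd p) + fst p *R a)"
   unfolding g_def f_def by (intro continuous_intros)
 qed (use gc in auto)
 have S4: "?a Y (cls a) (%y. g y + a) (%y. a)"
 proof (rule homotopicI[where H="%t y. (1 - t) *R g y + a"])
  show "?b (%p. (1 - fst p) *R g (snd p) + a)"
   unfolding g_def f_def by (intro continuous_intros)
  show "(1 - t) *R g y + a : cls a" if "t : {0..1}" "y : Y" for t y
  proof -
   have "cz ((1 - t) *R g y + a) a" using cz_her[OF na nf[OF that(2)], of "1 - t" 1] that by (simp add: g_def)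
   moreover have "cz a (1 *R a + (1 - t) *R g y)" by (rule cz_add_right) (use gn[OF that(2)] cz_refl na that nonneg_scaleR[of "g y" "1 - t"] in auto)
   ultimately show ?thesis using gn[OF that(2)] na that by (simp add: cls_def nonneg_add nonneg_scaleR add.commute)
  qed
 qed auto
 show ?thesis using S1 S2 S3 S4 by (meson homotopic_with_trans)
qed

lemma cls_scaleR: "r > 0 ==> cls (r *R a) = cls a"
proof -
 assume r: "r > 0"
 show ?thesis using cz_scaleR'[of r a] cz_scaleR[OF r, of a] r cz_trans unfolding cls_def by auto
qed

text \<open>If the spectrum avoids an interval to the right of 0, a ramp rising inside this interval
  takes only the values 0 and 1 on the spectrum. The resulting projection p satisfies p = m(a) a
  m(a) and a = a^(1/2) p a^(1/2).\<close>

lemma noniso_or_projection: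
 fixes a :: "'a::ucstar"
 assumes a: "uint a" and "~ noniso a"
 shows "EX p. adj p = p & p * p = p & cz a p & cz p a"
proof -
 obtain \<eta> where eta: "\<eta> > 0" and q0: "!!l q. l > 0 ==> continuous_on {0..1} q ==> (!!t. t <= l | t >= \<eta> ==> q t = 0) ==> cfc a q = 0"
  using assms(2) unfolding noniso_def by metis
 define u where "u = \<eta> / 3"
 have u: "u > 0" using eta by (simp add: u_def)
 define x where "x = ramp u (2 * u)"
 have cx: "continuous_on {0..1} x" unfolding x_def by (intro continuous_intros)
 have ci: "continuous_on {0..1} (%t::real. t)" by simp
 have cs: "continuous_on {0..1} sqrt" by (intro continuous_intros)
 define p where "p = cfc a x"
 have pp: "p * p = p"
 proof -
  let ?d = "%t. x t * x t - x t"
  have "p * p - p = cfc a ?d" unfolding p_def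
   using cfc_diff[OF a continuous_on_mult[OF cx cx] cx] cfc_mult[OF a cx cx] by simp
  also have "... = 0"
  proof (rule q0[OF u])
   show "continuous_on {0..1} ?d" by (intro continuous_intros cx)
   fix t assume "t <= u | \<eta> <= t" thus "x t * x t - x t = 0" using u by (auto simp: x_def ramp_0 ramp_1 u_def)
  qed
  finally show ?thesis by simp
 qed
 have pa: "cz p a"
 proof -
  \<comment> \<open>m^2 t = x; the maximum with u keeps the quotient continuous and differs from t
    only where x vanishes.\<close>
  define m where "m t = sqrt (x t / max t u)" for t
  have cm: "continuous_on {0..1} m" unfolding m_def using u
   by (intro continuous_intros continuous_on_divide continuous_on_max ballI cx; simp add: max_def)
  have "cfc a m * a * cfc a m = cfc a (%t. m t * t * m t)"
   using cfc_mult_eq[OF a cm ci] cfc_id[OF a] cfc_mult_eq[OF a continuous_on_mult[OF cm ci] cm] by simp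
  also have "... = p" unfolding p_def
  proof (rule cfc_cong)
   fix t :: real
   have "m t * t * m t = (m t)^2 * t" by (simp add: power2_eq_square)
   also have "(m t)^2 = x t / max t u" using u ramp_bounds[of u "2*u" t] by (simp add: m_def x_def max_def)
   also have "x t / max t u * t = x t"
    using u by (cases "t <= u") (auto simp: x_def ramp_0 max_def)
   finally show "m t * t * m t = x t" .
  qed
  finally show ?thesis using cz_conj[of "cfc a m" a] adj_cfc[OF a cm] by simp
 qed
 let ?a = "cfc a (%t. t - t * x t)"
 have ax: "?a = 0"
 proof -
  have cd: "continuous_on {0..1} (%t. t - t * x t)" by (intro continuous_intros cx)
  \<comment> \<open>\<open>q0\<close> only speaks of functions vanishing near 0, so t - t x is first
    multiplied by a ramp y starting at l; what is cut off lives below 2 l and is at most 2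
    l.\<close>
  have "norm (?a) <= 2 * l" if l: "l > 0" for l
  proof -
   define y where "y = ramp l (2 * l)"
   have cy: "continuous_on {0..1} y" unfolding y_def by (intro continuous_intros)
   let ?c = "%t. y t * (t - t * x t)"
   have cyd: "continuous_on {0..1} ?c" by (intro continuous_intros cx cy)
   let ?b = "%t. (t - t * x t) - y t * (t - t * x t)"
   have "cfc a ?c = 0"
   proof (rule q0[OF l cyd])
    fix t assume "t <= l | \<eta> <= t" thus "y t * (t - t * x t) = 0"
     using u l by (auto simp: x_def y_def ramp_0 ramp_1 u_def)
   qed
   hence "?a = cfc a ?b"
    using cfc_diff[OF a cd cyd] by simp
   also have "norm ... <= 2 * l"
   proof (rule cfc_norm[OF a])
    show "continuous_on {0..1} ?b" by (intro continuous_intros cx cy)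
    fix t :: real assume t: "t : {0..1}"
    have b: "0 <= x t" "x t <= 1" "0 <= y t" "y t <= 1" by (auto simp: x_def y_def ramp_bounds)
    have "(t - t * x t) - y t * (t - t * x t) = t * ((1 - x t) * (1 - y t))" by (simp add: algebra_simps)
    also have "\<bar>...\<bar> <= 2 * l"
    proof (cases "t >= 2 * l")
     case True thus ?thesis using l by (simp add: y_def ramp_1)
    next
     case False
     have "t * ((1 - x t) * (1 - y t)) <= t" using b t by (simp add: mult_le_one mult_left_le)
     thus ?thesis using t b False by simp
    qed
    finally show "\<bar>(t - t * x t) - y t * (t - t * x t)\<bar> <= 2 * l" .
   qed
   finally show ?thesis .
  qed
  hence "norm (?a) <= e" if "e > 0" for e
   using that[THEN half_gt_zero] by fastforce
  thus ?thesis using field_le_epsilon[of "norm (?a)" 0] by simp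
 qed
 have "cz a p"
 proof -
  let ?e = "cfc a (%t. t * x t)"
  have "cfc a sqrt * p * cfc a sqrt = ?e"
   using cfc_mult_eq[OF a cs cx] cfc_mult_eq[OF a continuous_on_mult[OF cs cx] cs, of "%t. t * x t"] by (simp add: p_def)
  moreover have "?a = a - ?e"
   using cfc_diff[OF a ci continuous_on_mult[OF ci cx]] cfc_id[OF a] by simp
  ultimately have "a = cfc a sqrt * p * adj (cfc a sqrt)" using ax adj_cfc[OF a cs] by simp
  thus ?thesis using cz_conj by metis
 qed
 thus ?thesis using adj_cfc[OF a cx] pp pa by (auto simp: p_def)
qed

theorem homotopy_noncompact:
 fixes a :: "'a::ucstar"
 assumes simp: "csimple TYPE('a)" and ad: "adapprox TYPE('a)" and a: "nonneg a"
  and nc: "~ (EX p. adj p = p & p * p = p & cz a p & cz p a)"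
  and Y: "compact Y" "Y <= cls a"
 shows "homotopic_with_canon (%_. True) Y (cls a) (%y. y) (%y. a)"
proof -
 have "a ~= 0" using nc cz_refl[of "0::'a"] by auto
 define t where "t = 1 / norm a"
 have t: "t > 0" using \<open>a ~= 0\<close> by (simp add: t_def)
 let ?a = "t *R a"
 have u: "uint ?a" by (rule nonneg_uint) (use a t \<open>a ~= 0\<close> in "auto simp: nonneg_scaleR t_def")
 have cc: "cls ?a = cls a" by (rule cls_scaleR[OF t])
 let ?b = "homotopic_with_canon (%_. True)"
 let ?c = "%y. t *R a"
 have "noniso ?a"
 proof (rule ccontr)
  assume "~ noniso ?a"
  then obtain p where p: "adj p = p" "p * p = p" "cz ?a p" "cz p ?a" using noniso_or_projection[OF u] by blast
  show False using nonneg_square[OF p(1)] p cc nc by (auto simp: cls_def)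
 qed
 hence 1: "?b Y (cls a) (%y. y) ?c"
  using homotopy_noniso[OF simp ad u _ Y(1)] Y(2) cc by simp
 have 2: "?b Y (cls a) ?c (%y. a)"
 proof (rule homotopicI[where H="%s y. ((1 - s) * t + s) *R a"])
  show "continuous_on ({0..1} \<times> Y) (%p. ((1 - fst p) * t + fst p) *R a)" by (intro continuous_intros)
  show "((1 - s) * t + s) *R a : cls a" if "s : {0..1}" for s
  proof -
   have p: "(1 - s) * t + s > 0" using that t by (cases "s = 0") (auto intro: add_nonneg_pos)
   have "((1 - s) * t + s) *R a : cls (((1 - s) * t + s) *R a)"
    using p a by (auto simp: cls_def cz_refl nonneg_scaleR)
   thus ?thesis using cls_scaleR[OF p] by blast
  qed
 qed auto
 show ?thesis using 1 2 by (meson homotopic_with_trans)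
qed

text \<open>A sum of positive elements vanishes only if both summands do, so the segments from y to
  y + a and on to a stay among the nonzero positive elements, which form a single class.\<close>

theorem homotopy_infinite:
 fixes a :: "'a::ucstar"
 assumes pi: "!!x y :: 'a. nonneg x ==> nonneg y ==> y ~= 0 ==> cz x y" and a: "nonneg a" "a ~= 0"
  and Y: "Y <= cls a"
 shows "homotopic_with_canon (%_. True) Y (cls a) (%y. y) (%y. a)"
proof -
 have nz: "y ~= 0" if "y : cls a" for y
 proof
  assume "y = 0"
  hence "cz a 0" using that by (auto simp: cls_def)
  hence "norm a < e" if "e > 0" for e using that by (simp add: cz_def)
  thus False using a(2) by (metis norm_eq_zero less_irrefl norm_ge_zero less_le)
 qed
 have c: "x : cls a" if "nonneg x" "x ~= 0" for x
  using that pi a by (simp add: cls_def)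
 have sum0: "x + y ~= 0" if "nonneg x" "nonneg y" "x ~= 0" for x y :: 'a
 proof
  assume "x + y = 0"
  hence "y = - x" by (simp add: eq_neg_iff_add_eq_0 add.commute)
  thus False using nonneg_antisym[of x] that by simp
 qed
 let ?a = "homotopic_with_canon (%_. True)"
 let ?b = "continuous_on ({0..1} \<times> Y)"
 have 1: "?a Y (cls a) (%y. y) (%y. y + a)"
 proof (rule homotopicI[where H="%t y. y + t *R a"])
  show "?b (%p. snd p + fst p *R a)" by (intro continuous_intros)
  show "y + t *R a : cls a" if "t : {0..1}" "y : Y" for t y
   using that Y nz[of y] a by (intro c nonneg_add sum0 nonneg_scaleR) (auto simp: cls_def)
 qed auto
 have 2: "?a Y (cls a) (%y. y + a) (%y. a)"
 proof (rule homotopicI[where H="%t y. a + (1 - t) *R y"])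
  show "?b (%p. a + (1 - fst p) *R snd p)" by (intro continuous_intros)
  show "a + (1 - t) *R y : cls a" if "t : {0..1}" "y : Y" for t y
   using that Y a by (intro c nonneg_add sum0 nonneg_scaleR) (auto simp: cls_def)
 qed auto
 show ?thesis using 1 2 by (meson homotopic_with_trans)
qed

section \<open>Infinite projections in simple algebras\<close>

lemma adj_power: "adj (x ^ n) = adj (x::'a::ucstar) ^ n"
 by (induction n) (simp_all add: adj_mult power_commutes)

definition cpinf :: "'a::ucstar itself => bool" where
 "cpinf _ = (ALL B::'a set. closed B & 0 : B & (ALL x:B. ALL y:B. x + y : B & x * y : B) &
   (ALL x:B. adj x : B & (ALL c. emb c * x : B)) & (ALL b:B. ALL x. nonneg x & nonneg (b - x) --> x : B) & B ~= {0} -->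
   (EX p:B. adj p = p & p * p = p & (EX v. adj v * v = p & nonneg (p - v * adj v) & v * adj v ~= p)))"

text \<open>The defect r = p - v adj v is a nonzero projection, and its translates under powers of v
  are mutually orthogonal copies of r inside p. By simplicity m conjugates of r sum to 1, and x
  collects the copies that realise them.\<close>

lemma cz_one_infinite_projection:
 fixes p :: "'a::ucstar"
 assumes simp: "csimple TYPE('a)" and p: "adj p = p" "p * p = p"
  and v: "adj v * v = p" "nonneg (p - v * adj v)" "v * adj v ~= p"
 shows "cz 1 p"
proof -
 define r where "r = p - v * adj v"
 have vp: "v * p = v"
 proof -
  have "adj (v - v * p) * (v - v * p) = adj v * v - (adj v * v) * p - p * (adj v * v) + p * (adj v * v) * p"
   by (simp add: adj_diff adj_mult p(1) algebra_simps)
  also have "... = 0" unfolding v(1) by (simp add: p(2))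
  finally have "norm (v - v * p) = 0" using cstar_norm[of "v - v * p"] by simp
  thus ?thesis by simp
 qed
 have pv: "p * v = v"
 proof -
  let ?b = "((1 - p) * v) * adj ((1 - p) * v)"
  have "nonneg (adj (1 - p) * (p - v * adj v) * (1 - p))" by (rule nonneg_conj[OF v(2)])
  moreover have "adj (1 - p) * (p - v * adj v) * (1 - p) = - ?b"
   by (simp add: adj_diff adj_mult p algebra_simps)
  ultimately have "nonneg (- ?b)" by simp
  hence "norm ((1 - p) * v) = 0" using nonneg_antisym nonneg_mult_adj cstar_norm'[of "(1 - p) * v"] by fastforce
  thus ?thesis by (simp add: left_diff_distrib)
 qed
 have rv: "r * v = 0" using v(1) vp pv by (simp add: r_def left_diff_distrib mult.assoc)
 have avp: "adj v * p = adj v" using arg_cong[OF pv, of adj] p by (simp add: adj_mult)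
 have rp: "r * p = r" by (simp add: r_def left_diff_distrib p mult.assoc avp)
 have ar: "adj r = r" by (simp add: r_def adj_diff adj_mult p)
 have rr: "r * r = r"
 proof -
  have "r * r = r * p - r * v * adj v" by (simp add: r_def[symmetric] right_diff_distrib mult.assoc) (simp add: r_def right_diff_distrib mult.assoc)
  thus ?thesis using rp rv by simp
 qed
 have r: "nonneg r" "r ~= 0" using v by (auto simp: r_def)
 obtain m s where s: "(\<Sum>i<(m::nat). s i * r * adj (s i)) = 1" using csimple_full[OF simp r] by blast
 have vv: "adj v ^ i * p * v ^ i = p" for i
 proof (induction i)
  case (Suc i)
  have "adj v ^ Suc i * p * v ^ Suc i = adj v ^ i * (adj v * p * v) * v ^ i" unfolding power_Suc2[of "adj v"] power_Suc[of v] by (simp only: mult.assoc)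
  thus ?case using avp v(1) Suc by simp
 qed simp
 \<comment> \<open>adj v^i p v^i = p cancels the common powers and leaves r v = 0; this is the
   orthogonality of the translates.\<close>
 have cross: "r * adj v ^ i * p * v ^ (i + Suc d) * r = 0" for i d
 proof -
  have "r * adj v ^ i * p * v ^ (i + Suc d) * r = r * (adj v ^ i * p * v ^ i) * v * v ^ d * r"
   unfolding power_add[of v] power_Suc[of v] by (simp only: mult.assoc)
  also have "... = r * v * v ^ d * r" using vv rp by simp
  finally show ?thesis using rv by simp
 qed
 have cross': "r * adj v ^ (i + Suc d) * p * v ^ i * r = 0" for i d
 proof -
  have "r * adj v ^ (i + Suc d) * p * v ^ i * r = adj (r * adj v ^ i * p * v ^ (i + Suc d) * r)"
   by (simp only: adj_mult adj_power adj_adj ar p(1) mult.assoc)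
  thus ?thesis unfolding cross by simp
 qed
 define x where "x = (\<Sum>i<m. s i * r * adj v ^ i)"
 let ?a = "\<Sum>i<m. \<Sum>j<m. s i * (r * adj v ^ i * p * v ^ j * r) * adj (s j)"
 have "x * p * adj x = ?a"
 proof -
  let ?c = "\<Sum>j<m. v ^ j * r * adj (s j)"
  have ax: "adj x = ?c" by (simp add: x_def adj_sum adj_mult adj_power ar mult.assoc)
  have "x * p * adj x = (\<Sum>i<m. s i * r * adj v ^ i * p) * ?c"
   unfolding ax by (simp add: x_def sum_distrib_right)
  also have "... = ?a"
   unfolding sum_product by (simp only: mult.assoc)
  finally show ?thesis .
 qed
 also have "... = (\<Sum>i<m. \<Sum>j<m. if j = i then s i * r * adj (s i) else 0)"
 proof (intro sum.cong refl)
  fix i j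
  show "s i * (r * adj v ^ i * p * v ^ j * r) * adj (s j) = (if j = i then s i * r * adj (s i) else 0)"
  proof (cases i j rule: linorder_cases)
   case less
   then obtain d where "j = i + Suc d" by (metis less_iff_Suc_add add_Suc_right)
   thus ?thesis using cross[of i d] by simp
  next
   case greater
   then obtain d where "i = j + Suc d" by (metis less_iff_Suc_add add_Suc_right)
   thus ?thesis using cross'[of j d] by simp
  next
   case equal
   have "r * adj v ^ i * p * v ^ i * r = r * (adj v ^ i * p * v ^ i) * r" by (simp only: mult.assoc)
   thus ?thesis using equal by (simp add: rp rr vv)
  qed
 qed
 also have "... = 1" using s by simp
 finally show ?thesis using cz_conj[of x p] by simp
qed

section \<open>Purely infinite algebras\<close>

text \<open>The hereditary subalgebra generated by b contains an infinite projection p, and 1 is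
  below p. Since b G n acts on it as an approximate unit, p is approximately b (G n p), a
  factorisation through b.\<close>

lemma cpinf_cz_uint:
 fixes b :: "'a::ucstar"
 assumes simp: "csimple TYPE('a)" and pi: "cpinf TYPE('a)" and b: "uint b" "b ~= 0"
 shows "cz 1 b"
proof -
 have nb: "nonneg b" and ab: "adj b = b" using uint_nonneg[OF b(1)] nonneg_adj by auto
 define k where "k n = inverse (real (Suc n))" for n
 have k: "k n > 0" for n by (simp add: k_def)
 define F where "F n = cfc b (%t. k n / (t + k n))" for n
 define G where "G n = cfc b (%t. 1 / (t + k n))" for n
 have cf: "continuous_on {0..1} (%t. k n / (t + k n))" and cg: "continuous_on {0..1} (%t. 1 / (t + k n))"
  and ci: "continuous_on {0..1} (%t::real. t)" for n
  using k[of n] by (auto intro!: continuous_intros)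
 have aF: "adj (F n) = F n" and nF: "norm (F n) <= 1" for n unfolding F_def
  by (rule adj_cfc[OF b(1) cf], rule cfc_norm[OF b(1) cf]) (use k[of n] in auto)
 have F1: "1 - F n = b * G n" for n
 proof -
  have "1 - F n = cfc b (%t. 1 - k n / (t + k n))" unfolding F_def using cfc_diff[OF b(1) continuous_on_const[of _ 1] cf] cfc_const[OF b(1), of 1] by simp
  also have "... = b * G n" unfolding G_def using cfc_mult_eq[OF b(1) ci cg, where h="%t. 1 - k n / (t + k n)"] cfc_id[OF b(1)] k[of n]
   by (auto simp: field_simps)
  finally show ?thesis .
 qed
 have nFb: "norm (F n * b) <= k n" for n
 proof -
  have "F n * b = cfc b (%t. k n / (t + k n) * t)" unfolding F_def using cfc_mult_eq[OF b(1) cf ci] cfc_id[OF b(1)] by simp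
  also have "norm ... <= k n"
   by (rule cfc_norm[OF b(1) continuous_on_mult[OF cf ci]]) (use k[of n] in "auto simp: divide_le_eq mult_left_mono")
  finally show ?thesis .
 qed
 \<comment> \<open>1 - F n = b G n is an approximate unit of the hereditary subalgebra generated by
   b. Describing that algebra by F n x tending to 0, for x and its adjoint, makes closedness and
   heredity direct.\<close>
 define Z where "Z x \<longleftrightarrow> (%n. F n * x) ~~> 0" for x
 define B where "B = {x. Z x & Z (adj x)}"
 have Zadd: "Z x ==> Z y ==> Z (x + y)" for x y unfolding Z_def distrib_left by (rule tendsto_add_zero)
 have Zmult: "Z x ==> Z (x * y)" for x y unfolding Z_def mult.assoc[symmetric] by (rule tendsto_mult_left_zero)
 have bB: "b : B"
 proof -
  have "(%n. F n * b) ~~> 0"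
   by (rule Lim_null_comparison[OF _ LIMSEQ_inverse_real_of_nat]) (use nFb in "simp add: k_def")
  thus ?thesis by (simp add: B_def Z_def ab)
 qed
 have her: "x : B" if c: "c : B" and x: "nonneg x" "nonneg (c - x)" for c x
 proof -
  obtain s where s: "nonneg s" "s * s = x" using nonneg_sqrt[OF x(1)] by metis
  have as: "adj s = s" using s nonneg_adj by blast
  have "(norm (F n * s))^2 <= norm (F n * c)" for n
  proof -
   have "(norm (F n * s))^2 = norm (F n * s * adj (F n * s))" by (rule cstar_norm'[symmetric])
   also have "F n * s * adj (F n * s) = F n * x * F n" unfolding adj_mult as aF s(2)[symmetric] by (simp only: mult.assoc)
   also have "norm (F n * x * F n) <= norm (F n * c * F n)"
    using nonneg_conj[OF x(1), of "F n"] nonneg_conj[OF x(2), of "F n"] by (intro nonneg_norm_mono) (simp_all add: aF algebra_simps)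
   also have "... <= norm (F n * c) * 1" using norm_mult_ineq[of "F n * c" "F n"] mult_left_mono[OF nF, of "norm (F n * c)" n] by simp
   finally show ?thesis by simp
  qed
  hence "(%n. (norm (F n * s))^2) ~~> 0"
   using c by (rule_tac Lim_null_comparison[OF _ tendsto_norm_zero[of "%n. F n * c"]]) (auto simp: B_def Z_def)
  thus ?thesis using Zmult[of s s] s(2) nonneg_adj[OF x(1)] by (simp add: tendsto_norm_zero_iff Z_def B_def)
 qed
 have cl: "closed {x. Z x}" unfolding closed_sequential_limits
 proof (intro allI impI CollectI, elim conjE, unfold Z_def)
  fix x l assume x: "ALL j. x j : {x. (%n. F n * x) ~~> 0}" and l: "x ~~> l"
  show "(%n. F n * l) ~~> 0"
  proof (rule LIMSEQ_I)
   fix e :: real assume "e > 0"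
   then obtain j where j: "norm (x j - l) < e / 2" using LIMSEQ_D[OF l, of "e/2"] by auto
   have "(%n. F n * x j) ~~> 0" using x by simp
   from LIMSEQ_D[OF this, of "e/2"] \<open>e > 0\<close> obtain N where N: "!!n. n >= N ==> norm (F n * x j) < e / 2" by auto
   have "norm (F n * l) < e" if "n >= N" for n
   proof -
    have "norm (F n * (x j - l)) <= 1 * norm (x j - l)" by (intro order_trans[OF norm_mult_ineq] mult_right_mono nF) simp
    thus ?thesis using N[OF that] j norm_triangle_ineq4[of "F n * x j" "F n * (x j - l)"] by (simp add: algebra_simps)
   qed
   thus "EX N. ALL n>=N. norm (F n * l - 0) < e" by auto
  qed
 qed
 have "closed B" unfolding B_def Collect_conj_eq
  using cl closed_vimage[OF cl continuous_on_adj[OF continuous_on_id]] by auto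
 moreover have "0 : B" by (simp add: B_def Z_def)
 moreover have "ALL x:B. ALL y:B. x + y : B & x * y : B" by (simp add: B_def Zadd Zmult adj_add adj_mult)
 moreover have "emb c * x : B" if "x : B" for c x
  using that Zmult[of x "emb c"] Zmult[of "adj x" "adj (emb c)"] emb_central[of c x] by (simp add: B_def flip: adj_mult)
 moreover have "ALL b:B. ALL x. nonneg x & nonneg (b - x) --> x : B" using her by blast
 moreover have "ALL x:B. adj x : B" by (simp add: B_def)
 moreover have "B ~= {0}" using bB b(2) by auto
 ultimately obtain p v where p: "p : B" "adj p = p" "p * p = p" and v: "adj v * v = p" "nonneg (p - v * adj v)" "v * adj v ~= p"
  using pi[unfolded cpinf_def, rule_format, of B] by blast
 have 1: "cz 1 p" by (rule cz_one_infinite_projection[OF simp p(2,3) v])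
 have "(%n. F n * p) ~~> 0" using p(1) by (simp add: B_def Z_def)
 from LIMSEQ_D[OF this, of "1/4"] obtain n where "norm (F n * p) < 1/4" by auto
 moreover have "1 * b * (G n * p) - p = - (F n * p)" using arg_cong[OF F1[of n], of "%y. y * p"] by (simp add: left_diff_distrib mult.assoc) (simp add: algebra_simps)
 ultimately have "norm (1 * b * (G n * p) - p) <= 1/4" by simp
 hence "cz (p * p) (b * adj b)" by (rule cz_factor[OF p(2,3,2)])
 moreover have "cz (b * b) b"
 proof -
  obtain s where s: "nonneg s" "s * s = b" using nonneg_sqrt[OF nb] by metis
  thus ?thesis using mult.assoc nonneg_adj cz_conj by metis
 qed
 ultimately show ?thesis using 1 p(3) ab cz_trans by metis
qed

lemma cpinf_cz:
 fixes x y :: "'a::ucstar"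
 assumes simp: "csimple TYPE('a)" and pi: "cpinf TYPE('a)" and x: "nonneg x" and y: "nonneg y" "y ~= 0"
 shows "cz x y"
proof -
 define t where "t = 1 / norm y"
 have t: "t > 0" using y by (simp add: t_def)
 let ?a = "t *R y"
 have "uint ?a" by (rule nonneg_uint) (use y t in "auto simp: nonneg_scaleR t_def")
 hence 1: "cz 1 ?a" using cpinf_cz_uint[OF simp pi] t y by simp
 have 2: "cz ?a y" using cz_scaleR'[of t y] t by simp
 obtain s where s: "nonneg s" "s * s = x" using nonneg_sqrt[OF x] by metis
 have "cz (s * 1 * adj s) 1" by (rule cz_conj)
 hence "cz x 1" using s by (simp add: nonneg_adj)
 thus ?thesis using 1 2 cz_trans by blast
qed

section \<open>Matrix units from approximate divisibility\<close>

definition munits :: "nat => (nat \<times> nat) set" where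
 "munits m = {(b, i). b < 2 & i < m + 1 + b}"

text \<open>Approximate divisibility for N = m + 1, spelled out by the images of matrix units:
  \<open>munits m\<close> indexes the rows of both blocks, of sizes m + 1 and m + 2, and a matrix
  unit needs two rows of the same block.\<close>

definition cad :: "'a::ucstar itself => bool" where
 "cad _ = (ALL m. EX U :: nat => nat \<times> nat => nat \<times> nat => 'a.
  (ALL k. ALL p:munits m. ALL q:munits m. fst p = fst q -->
    adj (U k p q) = U k q p &
    (ALL p':munits m. ALL q':munits m. fst p' = fst q' --> U k p q * U k p' q' = (if q = p' then U k p q' else 0))) &
  (ALL k. (\<Sum>p\<in>munits m. U k p p) = 1) &
  (ALL p:munits m. ALL q:munits m. fst p = fst q --> (ALL x. (%k. U k p q * x - x * U k p q) ~~> 0)))"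

lemma finite_munits: "finite (munits m)"
proof -
 have "munits m <= {..<2} \<times> {..<m + 3}" by (auto simp: munits_def)
 thus ?thesis by (rule finite_subset) simp
qed

text \<open>n and V j are defined in both blocks at once: the shift lowers the row, and V j sends
  row j to the last row m + b of block b. Both blocks have at least m rows before the last, which is
  where the m conjugates find room.\<close>

lemma cad_adapprox:
 assumes "cad TYPE('a::ucstar)" shows "adapprox TYPE('a)"
 unfolding adapprox_def
proof
 fix m
 define I where "I = munits m"
 have fI: "finite I" by (simp add: I_def finite_munits)
 obtain U :: "nat => nat \<times> nat => nat \<times> nat => 'a" where
  aU: "!!k p q. p : I ==> q : I ==> fst p = fst q ==> adj (U k p q) = U k q p" and
  UU: "!!k p q p' q'. p : I ==> q : I ==> fst p = fst q ==> p' : I ==> q' : I ==> fst p' = fst q' ==>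
    U k p q * U k p' q' = (if q = p' then U k p q' else 0)" and
  U1: "!!k. (\<Sum>p\<in>I. U k p p) = 1" and
  Uc: "!!p q x. p : I ==> q : I ==> fst p = fst q ==> (%k. U k p q * x - x * U k p q) ~~> 0"
 proof -
  obtain U :: "nat => nat \<times> nat => nat \<times> nat => 'a" where U:
  "(ALL k. ALL p:munits m. ALL q:munits m. fst p = fst q -->
    adj (U k p q) = U k q p &
    (ALL p':munits m. ALL q':munits m. fst p' = fst q' --> U k p q * U k p' q' = (if q = p' then U k p q' else 0)))"
  "(ALL k. (\<Sum>p\<in>munits m. U k p p) = 1)"
  "(ALL p:munits m. ALL q:munits m. fst p = fst q --> (ALL x. (%k. U k p q * x - x * U k p q) ~~> 0))"
   using assms[unfolded cad_def, rule_format, of m] by auto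
  show thesis by (rule that[of U]) (use U in "auto simp: I_def")
 qed
 have nU: "norm (U k p q) <= 1" if "p : I" "q : I" "fst p = fst q" for k p q
 proof -
  have n: "norm (U k q q) <= 1"
  proof -
   have "norm (U k q q) = 0 | norm (U k q q) = 1" using cstar_norm[of "U k q q"] UU[of q q q q k] aU[of q q k] that by (metis power2_eq_square mult_cancel_right1 mult_eq_0_iff)
   thus ?thesis by auto
  qed
  show ?thesis using cstar_norm[of "U k p q"] UU[of q p p q k] aU[of p q k] that n by (metis abs_norm_cancel abs_square_le_1)
 qed
 have acU: "acent (%k. U k p q)" if "p : I" "q : I" "fst p = fst q" for p q
  unfolding acent_def asyeq_def using Uc[OF that] nU[OF that] by (auto intro!: BseqI[of 1])
 \<comment> \<open>For injective f, the partial isometry that moves row p in A to row f p. Products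
   become compositions of partial maps and adjoints become inverses, so all relations reduce to
   facts about index sets.\<close>
 define T where "T f A k = (\<Sum>p\<in>A. U k (f p) p)" for f A k
 define ok where "ok f A \<longleftrightarrow> A <= I & (ALL p:A. f p : I & fst (f p) = fst p)" for f A
 have acT: "acent (T f A)" if "ok f A" for f A
  unfolding T_def by (intro acent_sum acU) (use that in "auto simp: ok_def")
 have TT: "T f A k * T g B k = T (f \<circ> g) {q\<in>B. g q : A} k" if "ok f A" "ok g B" for f g A B k
 proof -
  have fin: "finite A" "finite B" using that fI by (auto simp: ok_def intro: finite_subset)
  have "T f A k * T g B k = (\<Sum>q\<in>B. \<Sum>p\<in>A. U k (f p) p * U k (g q) q)"
   unfolding T_def sum_product by (rule sum.swap)
  also have "... = (\<Sum>q\<in>B. \<Sum>p\<in>A. if p = g q then U k (f (g q)) q else 0)"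
   using that by (intro sum.cong refl) (auto simp: UU ok_def subset_iff)
  also have "... = (\<Sum>q\<in>B. if g q : A then U k (f (g q)) q else 0)" using fin by simp
  also have "... = T (f \<circ> g) {q\<in>B. g q : A} k"
   unfolding T_def using fin by (simp add: sum.inter_filter)
  finally show ?thesis .
 qed
 have Tcong: "T f A k = T g B k" if "A = B" "!!p. p : B ==> f p = g p" for f g A B k
  unfolding T_def using that by simp
 have adjT: "adj (T f A k) = T g (f ` A) k" if "ok f A" "!!p. p : A ==> g (f p) = p" for f g A k
 proof -
  have "inj_on f A" using that(2) by (metis inj_on_inverseI)
  hence "T g (f ` A) k = (\<Sum>p\<in>A. U k (g (f p)) (f p))" unfolding T_def by (simp add: sum.reindex)
  also have "... = (\<Sum>p\<in>A. U k p (f p))" using that(2) by simp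
  also have "... = (\<Sum>p\<in>A. adj (U k (f p) p))" using that(1) by (intro sum.cong) (auto simp: aU ok_def subset_iff)
  finally show ?thesis by (simp add: T_def adj_sum)
 qed
 define J where "J = {(b, i). b < 2 & i < m + b}"
 define J' where "J' = {(b, i). b < (2::nat) & 1 <= i & i < m + 1 + b}"
 define L where "L = {(b, i). b < (2::nat) & i = m + b}"
 define K where "K j = {(b, i). b < (2::nat) & i = (j::nat)}" for j
 define sh where "sh = (%(b::nat, i::nat). (b, i + 1))"
 define pr where "pr = (%(b::nat, i::nat). (b, i - 1))"
 define top where "top = (%(b::nat, i::nat). (b, m + b))"
 define to where "to j = (%(b::nat, i::nat). (b, j::nat))" for j
 note defs = I_def munits_def J_def J'_def L_def K_def sh_def pr_def top_def to_def ok_def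
 have oks: "ok sh J" "ok pr J'" "ok id J" "ok id I" "ok id L" and okj: "!!j. j < m ==> ok top (K j)" "!!j. j < m ==> ok (to j) L"
  by (auto simp: defs)
 define n where "n = T pr J'"
 define V where "V j = T top (K j)" for j
 have an: "adj (n k) = T sh J k" for k
 proof -
  have "sh ` J = J'"
  proof
   show "J' <= sh ` J"
   proof
    fix x assume "x : J'"
    hence "x = sh (pr x)" "pr x : J" by (auto simp: defs)
    thus "x : sh ` J" by blast
   qed
  qed (auto simp: defs)
  moreover have "adj (T sh J k) = T pr (sh ` J) k" by (rule adjT[OF oks(1)]) (auto simp: defs)
  ultimately show ?thesis unfolding n_def by (metis adj_adj)
 qed
 have aV: "adj (V j k) = T (to j) L k" if "j < m" for j k
 proof -
  have "top ` K j = L"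
  by (auto simp: defs)
  moreover have "adj (T top (K j) k) = T (to j) (top ` K j) k" by (rule adjT[OF okj(1)[OF that]]) (auto simp: defs)
  ultimately show ?thesis unfolding V_def by simp
 qed
 have P: "n k * adj (n k) = T id J k" for k
  unfolding an unfolding n_def TT[OF oks(2,1)] by (rule Tcong) (auto simp: defs)
 have one: "1 = T id I k" for k using U1 by (simp add: T_def)
 have PL: "1 - T id J k = T id L k" for k
 proof -
  have "I = J \<union> L" "J \<inter> L = {}" by (auto simp: defs)
  moreover have "finite J" "finite L" using fI \<open>I = J \<union> L\<close> by auto
  ultimately have "T id I k = T id J k + T id L k" unfolding T_def by (simp add: sum.union_disjoint)
  thus ?thesis using one[of k] by (metis add_diff_cancel_left')
 qed
 have Tempty: "A = {} ==> T f A k = 0" for f A k by (simp add: T_def)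
 have pow: "adj (n k) ^ r = T (%(b, i). (b, i + r)) {(b, i). b < 2 & i + r < m + 1 + b} k" for r k
 proof (induction r)
  case 0
  show ?case unfolding power_0 one[of k] by (rule Tcong) (auto simp: defs)
 next
  case (Suc r)
  have "ok (%(b, i). (b, i + r)) {(b, i). b < 2 & i + r < m + 1 + b}" by (auto simp: defs)
  thus ?case unfolding power_Suc Suc unfolding an by (subst TT[OF oks(1)], assumption) (rule Tcong, auto simp: defs)
 qed
 \<comment> \<open>The larger block has m + 2 rows, so m + 2 upward shifts leave nothing.\<close>
 have "adj (n k) ^ (m + 2) = 0" for k
 proof -
  have "{(b::nat, i::nat). b < 2 & i + (m + 2) < m + 1 + b} = {}" by auto
  thus ?thesis unfolding pow by (rule Tempty)
 qed
 moreover have "adj (n k) * (n k * adj (n k)) = adj (n k)" for k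
  unfolding P unfolding an TT[OF oks(1,3)] by simp
 moreover have "V j k * (n k * adj (n k)) = V j k" if "j < m" for j k
  unfolding P V_def TT[OF okj(1)[OF that] oks(3)] by (rule Tcong) (use that in "auto simp: defs")
 moreover have "n k * adj (n k) * V j k = 0" if "j < m" for j k
 proof -
  have "{q : K j. top q : J} = {}" by (auto simp: defs)
  thus ?thesis unfolding P V_def TT[OF oks(3) okj(1)[OF that]] by (rule Tempty)
 qed
 moreover have "V j k * adj (V i k) = (if i = j then 1 - n k * adj (n k) else 0)" if "j < m" "i < m" for i j k
 proof (cases "i = j")
  case True
  thus ?thesis unfolding P PL aV[OF that(2)] unfolding V_def TT[OF okj(1)[OF that(1)] okj(2)[OF that(2)]]
   by simp (rule Tcong, auto simp: defs)
 next
  case False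
  hence "{q : L. to i q : K j} = {}" by (auto simp: defs)
  hence "V j k * adj (V i k) = 0"
   unfolding aV[OF that(2)] unfolding V_def TT[OF okj(1)[OF that(1)] okj(2)[OF that(2)]] by (rule Tempty)
  thus ?thesis using False by simp
 qed
 moreover have "acent n" unfolding n_def by (rule acT[OF oks(2)])
 moreover have "acent (V j)" if "j < m" for j unfolding V_def by (rule acT[OF okj(1)[OF that]])
 ultimately have "ad_data m (m + 2) n V" unfolding ad_data_def by blast
 thus "EX L n. EX V::nat => nat => 'a. ad_data m L n V" by blast
qed

section \<open>Polynomial square roots with uniform error bounds\<close>

primrec sqi :: "'a::real_algebra_1 => nat => 'a" where
 "sqi x 0 = 0"
| "sqi x (Suc m) = sqi x m + (1/2) *R (x - sqi x m * sqi x m)"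

text \<open>Each step multiplies the error sqrt t - sqi t m by 1 - (sqrt t + sqi t m) / 2. The
  invariant is chosen so that it yields the error bound 2 / m for all t at once, although the factor
  is close to 1 near t = 0.\<close>

lemma sqi_real:
 fixes t :: real
 assumes "0 <= t" "t <= 1"
 shows "0 <= sqi t m & sqi t m <= sqrt t & (sqrt t - sqi t m) * (2 + m * sqrt t) <= 2 * sqrt t"
proof (induction m)
 case (Suc m)
 define s where "s = sqrt t"
 define r where "r = sqi t m"
 define e where "e = s - r"
 have s: "0 <= s" "s <= 1" "s * s = t" using assms by (auto simp: s_def)
 have r: "0 <= r" "r <= s" "e * (2 + m * s) <= 2 * s" using Suc by (auto simp: r_def s_def e_def)
 let ?b = "1 - (s + r) / 2"
 have r': "sqi t (Suc m) = r + (s - r) * (s + r) / 2"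
 proof -
  have "sqi t (Suc m) = r + (1/2) * (s * s - r * r)" by (simp add: r_def s(3))
  also have "... = r + (s - r) * (s + r) / 2" by (simp add: square_diff_square_factored)
  finally show ?thesis .
 qed
 hence e': "s - sqi t (Suc m) = e * ?b" by (simp add: e_def field_simps)
 have e0: "0 <= e" using r by (simp add: e_def)
 have "0 <= e * ?b" using e0 r s by simp
 hence 1: "sqi t (Suc m) <= s" using e' by linarith
 have 2: "0 <= sqi t (Suc m)" unfolding r' using r by simp
 let ?a = "2 + (real m + 1) * s"
 have "e * ?b * ?a <= e * (1 - s / 2) * ?a"
  using e0 r by (intro mult_right_mono mult_left_mono) auto
 also have "... = e * ((1 - s / 2) * ?a)" by simp
 also have "(1 - s / 2) * ?a = 2 + m * s - (real m + 1) * (s * s) / 2" by (simp add: field_simps)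
 also have "e * ... <= e * (2 + m * s)" using e0 by (intro mult_left_mono) auto
 also have "... <= 2 * s" by (rule r(3))
 finally have 3: "(s - sqi t (Suc m)) * (2 + real (Suc m) * s) <= 2 * s" unfolding e' by (simp add: add.commute)
 show ?case using 1 2 3 by (simp add: s_def del: sqi.simps)
qed (use assms in auto)

lemma sqi_real_err:
 assumes "0 <= t" "t <= 1" "m >= 1"
 shows "sqrt t - sqi t m <= 2 / m"
proof (cases "t = 0")
 case False
 define s where "s = sqrt t"
 have "(s - sqi t m) * (m * s) <= (s - sqi t m) * (2 + m * s)"
  using sqi_real[OF assms(1,2), of m] by (intro mult_left_mono) (auto simp: s_def)
 also have "... <= 2 * s" using sqi_real[OF assms(1,2), of m] by (simp add: s_def)
 finally have "(s - sqi t m) * m <= 2" using False assms by (simp add: s_def)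
 thus ?thesis using assms(3) by (simp add: field_simps s_def)
qed (use sqi_real[of t m] assms in auto)

lemma sqi_cfc:
 assumes "uint x" shows "sqi x m = cfc x (%t. sqi t m) & continuous_on {0..1} (%t::real. sqi t m)"
proof (induction m)
 case 0
 thus ?case using cfc_const[OF assms, of 0] by simp
next
 case (Suc m)
 let ?c = "cfc x (%t. sqi t m)"
 have c: "continuous_on {0..1} (%t::real. sqi t m)" and e: "sqi x m = ?c" using Suc by auto
 have c2: "continuous_on {0..1} (%t::real. t - sqi t m * sqi t m)" by (intro continuous_intros c)
 let ?a = "%t. sqi t m + (1/2) * (t - sqi t m * sqi t m)"
 let ?b = "cfc x (%t. (1/2) * (t - sqi t m * sqi t m))"
 have "?b = (1/2) *R (x - sqi x m * sqi x m)"
  using cfc_diff[OF assms continuous_on_id continuous_on_mult[OF c c]] cfc_mult[OF assms c c] cfc_id[OF assms] e cfc_scaleR[OF assms c2, of "1/2"] by simp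
 moreover have "cfc x ?a = ?c + ?b"
  by (rule cfc_add[OF assms c continuous_on_mult[OF continuous_on_const c2]])
 ultimately have "cfc x ?a = sqi x (Suc m)"
  by (simp only: sqi.simps e)
 moreover have s: "(%t::real. sqi t (Suc m)) = ?a" by simp
 ultimately show ?case unfolding s using c by (auto intro!: continuous_intros)
qed

text \<open>The bounds involve m alone, neither x nor the algebra, which lets them survive limits
  taken over corners. The constant 4 is the error 2 / m times the bound 2 of sqrt t + sqi t
  m.\<close>

lemma sqi_props:
 fixes x :: "'a::ucstar"
 assumes "nonneg x" "norm x <= 1" "m >= 1"
 shows "adj (sqi x m) = sqi x m" "norm (sqi x m * sqi x m - x) <= 4 / m" "l >= m ==> norm (sqi x l - sqi x m) <= 4 / m"
proof -
 have u: "uint x" by (rule nonneg_uint[OF assms(1,2)])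
 have c: "continuous_on {0..1} (%t::real. sqi t m)" for m using sqi_cfc[OF u] by blast
 have e: "sqi x m = cfc x (%t. sqi t m)" for m using sqi_cfc[OF u] by blast
 show "adj (sqi x m) = sqi x m" unfolding e by (rule adj_cfc[OF u c])
 have "sqi x m * sqi x m - x = cfc x (%t. sqi t m * sqi t m - t)"
  using cfc_diff[OF u continuous_on_mult[OF c c] continuous_on_id] cfc_mult[OF u c c] cfc_id[OF u] e by simp
 also have "norm ... <= 4 / m"
 proof (rule cfc_norm[OF u])
  show "continuous_on {0..1} (%t::real. sqi t m * sqi t m - t)" by (intro continuous_intros c)
  fix t :: real assume t: "t : {0..1}"
  define s where "s = sqrt t"
  have s: "0 <= s" "s <= 1" "t = s * s" using t by (auto simp: s_def)
  have r: "0 <= sqi t m" "sqi t m <= s" "s - sqi t m <= 2 / m" using sqi_real[of t m] sqi_real_err[of t m] t assms(3) by (auto simp: s_def)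
  have "t - sqi t m * sqi t m = (s - sqi t m) * (s + sqi t m)" unfolding s(3) by (simp add: algebra_simps)
  also have "... <= (2 / m) * 2" using r s by (intro mult_mono) auto
  finally have "t - sqi t m * sqi t m <= 4 / m" by simp
  moreover have "sqi t m * sqi t m <= s * s" using r by (intro mult_mono) auto
  ultimately show "\<bar>sqi t m * sqi t m - t\<bar> <= 4 / m" using s by simp
 qed
 finally show "norm (sqi x m * sqi x m - x) <= 4 / m" .
 assume lm: "l >= m"
 have "sqi x l - sqi x m = cfc x (%t. sqi t l - sqi t m)" using cfc_diff[OF u c c] e by simp
 also have "norm ... <= 4 / m"
 proof (rule cfc_norm[OF u])
  show "continuous_on {0..1} (%t::real. sqi t l - sqi t m)" by (intro continuous_intros c)
  fix t :: real assume t: "t : {0..1}"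
  have "2 / real l <= 2 / real m" "2 / real m <= 4 / real m" using lm assms(3) by (auto intro!: divide_left_mono divide_right_mono)
  thus "\<bar>sqi t l - sqi t m\<bar> <= 4 / m"
   using sqi_real[of t m] sqi_real_err[of t m] sqi_real[of t l] sqi_real_err[of t l] t assms(3) lm by auto
 qed
 finally show "norm (sqi x l - sqi x m) <= 4 / m" .
qed

text \<open>c is the inverse of the square root of b. In a corner whose unit is a projection, this
  turns an approximation of the projection into an exact conjugate.\<close>

lemma near_one_conj:
 fixes b :: "'a::ucstar"
 assumes "adj b = b" "norm (1 - b) < 1" shows "EX c. c * b * adj c = 1"
proof -
 have "adj (1 - b) = 1 - b" using assms(1) by (simp add: adj_diff)
 then obtain z where z: "adj z = z" "(1 - z) * (1 - z) = 1 - (1 - b)" using sqrt_near_one[of "1 - b"] assms(2) by metis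
 define r where "r = 1 - z"
 have r: "adj r = r" "r * r = b" using z by (auto simp: r_def adj_diff)
 obtain k where k: "r * k = 1" "k * r = 1" using invb_neumann[of 1 b] assms(2) invb_factor[of r r] r unfolding invb_def by auto
 have "adj k * r = 1" using arg_cong[OF k(1), of adj] r by (simp add: adj_mult)
 hence ak: "adj k = k" using k by (metis mult.assoc mult.left_neutral mult.right_neutral)
 have "k * b * adj k = (k * r) * (r * k)" by (simp only: ak r(2)[symmetric] mult.assoc)
 thus ?thesis using k by auto
qed

section \<open>States\<close>

text \<open>The Hahn-Banach theorem for functionals dominated by the norm. Functionals are kept as
  their graphs, linear subspaces of the product, so that extension is inclusion and Zorn's lemma
  applies to unions of chains.\<close>

lemma hahn_banach_graph:
 fixes G0 :: "('a::real_normed_vector \<times> real) set"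
 assumes "subspace G0" and le: "!!x r. (x, r) : G0 ==> r <= norm x"
 shows "EX g. linear g & (ALL x. g x <= norm x) & (ALL (x, r):G0. g x = r)"
proof -
 define \<A> where "\<A> = {G. subspace G & G0 <= G & (ALL (x, r):G. r <= norm x)}"
 have "EX M:\<A>. ALL X:\<A>. M <= X --> X = M"
 proof (rule subset_Zorn_nonempty)
  show "\<A> ~= {}" using assms by (auto simp: \<A>_def)
  fix \<C> assume C: "\<C> ~= {}" "subset.chain \<A> \<C>"
  hence sub: "!!G. G : \<C> ==> G : \<A>" and tot: "!!G H. G : \<C> ==> H : \<C> ==> G <= H | H <= G"
   unfolding subset.chain_def by blast+
  have "subspace (\<Union>\<C>)"
   unfolding subspace_def
  proof (intro conjI ballI allI)
   show "0 : \<Union>\<C>" using C(1) sub by (auto simp: \<A>_def subspace_def)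
   fix x y assume "x : \<Union>\<C>" "y : \<Union>\<C>"
   then obtain G where "G : \<C>" "x : G" "y : G" using tot by blast
   thus "x + y : \<Union>\<C>" using sub[of G] by (auto simp: \<A>_def subspace_def)
  next
   fix c x assume "x : \<Union>\<C>"
   then obtain G where "G : \<C>" "x : G" by blast
   moreover from this have "c *R x : G" using sub[of G] by (simp add: \<A>_def subspace_def)
   ultimately show "c *R x : \<Union>\<C>" by blast
  qed
  thus "\<Union>\<C> : \<A>" using C(1) sub unfolding \<A>_def by blast
 qed
 then obtain M where M: "M : \<A>" "!!X. X : \<A> ==> M <= X ==> X = M" by blast
 have sM: "subspace M" and GM: "G0 <= M" and leM: "!!x r. (x, r) : M ==> r <= norm x" using M(1) by (auto simp: \<A>_def)
 have full: "EX c. (x, c) : M" for x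
 proof -
  have bnd: "r - norm (u - x) <= norm (u' + x) - r'" if "(u, r) : M" "(u', r') : M" for u r u' r'
  proof -
   have "r + r' <= norm ((u - x) + (u' + x))" using subspace_add[OF sM that] leM by simp
   thus ?thesis using norm_triangle_ineq[of "u - x" "u' + x"] by linarith
  qed
  have z: "(0, 0) : M" using subspace_0[OF sM] by (simp add: zero_prod_def)
  \<comment> \<open>The value at x may be any number between all r - norm (u - x) and all norm (u +
    x) - r; the supremum of the lower bounds is taken.\<close>
  define c where "c = Sup {r - norm (u - x) | u r. (u, r) : M}"
  have c1: "r - norm (u - x) <= c" if "(u, r) : M" for u r
   unfolding c_def by (rule cSup_upper) (use that bnd[OF _ z] in "auto intro!: bdd_aboveI")
  have c2: "c <= norm (u + x) - r" if "(u, r) : M" for u r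
   unfolding c_def by (rule cSup_least) (use z bnd[OF _ that] in auto)
  define X where "X = {(u + t *R x, r + t * c) | u r t. (u, r) : M}"
  have "X : \<A>"
  proof -
   have "subspace X" unfolding subspace_def
   proof (intro conjI ballI allI)
    show "0 : X" unfolding X_def using z by (auto intro!: exI[of _ 0] simp: zero_prod_def)
    fix p q assume "p : X" "q : X"
    then obtain u r t u' r' t' where pq: "p = (u + t *R x, r + t * c)" "(u, r) : M" "q = (u' + t' *R x, r' + t' * c)" "(u', r') : M"
     unfolding X_def by blast
    have "p + q = ((u + u') + (t + t') *R x, (r + r') + (t + t') * c)" unfolding pq by (simp add: algebra_simps)
    moreover have "(u + u', r + r') : M" using subspace_add[OF sM pq(2,4)] by simp
    ultimately show "p + q : X" unfolding X_def by blast
   next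
    fix s p assume "p : X"
    then obtain u r t where p: "p = (u + t *R x, r + t * c)" "(u, r) : M" unfolding X_def by blast
    have "s *R p = (s *R u + (s * t) *R x, s * r + (s * t) * c)" unfolding p by (simp add: algebra_simps)
    moreover have "(s *R u, s * r) : M" using subspace_scale[OF sM p(2), of s] by simp
    ultimately show "s *R p : X" unfolding X_def by blast
   qed
   moreover have "M <= X" unfolding X_def by (force intro: exI[of _ 0])
   moreover have "r + t * c <= norm (u + t *R x)" if ur: "(u, r) : M" for u r t
   proof (cases "t = 0")
    case False
    define s where "s = \<bar>t\<bar>"
    have s: "s > 0" using False by (simp add: s_def)
    have uM: "(inverse s *R u, inverse s * r) : M" using subspace_scale[OF sM ur, of "inverse s"] by simp
    have "s * (inverse s * r + sgn t * c) <= norm (s *R (inverse s *R u + sgn t *R x))" using c1[OF uM] c2[OF uM] False s by (simp add: sgn_real_def mult_left_mono)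
    moreover have "s * sgn t = t" by (simp add: s_def sgn_real_def)
    ultimately show ?thesis using s by (simp add: distrib_left scaleR_right_distrib flip: mult.assoc)
   qed (use leM ur in simp)
   ultimately show ?thesis using GM unfolding \<A>_def X_def by blast
  qed
  moreover have "M <= X" unfolding X_def by (force intro: exI[of _ 0])
  ultimately have "X = M" using M(2) by blast
  moreover have "(0 + 1 *R x, 0 + 1 * c) : X" unfolding X_def using z by blast
  ultimately show ?thesis by auto
 qed
 have uniq: "r = r'" if "(x, r) : M" "(x, r') : M" for x r r'
 using subspace_diff[OF sM that] subspace_diff[OF sM that(2,1)] leM[of 0 "r - r'"] leM[of 0 "r' - r"] by auto
 define g where "g x = (THE r. (x, r) : M)" for x
 have gM: "(x, g x) : M" for x unfolding g_def by (rule theI') (use full uniq in blast)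
 have gI: "g x = r" if "(x, r) : M" for x r using uniq gM that by blast
 have "linear g"
 proof (rule linearI)
  show "g (x + y) = g x + g y" for x y using subspace_add[OF sM gM[of x] gM[of y]] by (intro gI) simp
  show "g (c *R x) = c *R g x" for c x using subspace_scale[OF sM gM[of x], of c] by (intro gI) simp
 qed
 thus ?thesis using leM gM GM gI by blast
qed

lemma norm_emb: "norm (emb z :: 'a::ucstar) = cmod z"
proof -
 have "adj (emb z) = (emb (cnj z) :: 'a)" by (simp add: emb_def adj_add adj_mult adj_iu of_real_comm)
 hence "adj (emb z) * emb z = (of_real ((cmod z)^2) :: 'a)"
  using complex_norm_square[of z] by (simp flip: emb_mult emb_of_real add: mult.commute)
 thus ?thesis using cstar_norm[of "emb z :: 'a"] by (simp del: of_real_power)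
qed

text \<open>On the span of 1 and h, sending s + t h to s + t is evaluation at a spectral value,
  hence dominated by the norm. The functional is extended, averaged with the adjoint and
  complexified; positivity follows because norm x - x has norm at most norm x.\<close>

lemma state_exists:
 fixes h :: "'a::ucstar"
 assumes h: "nonneg h" "norm h = 1"
 shows "EX \<phi>::'a => complex. (ALL x y. \<phi> (x + y) = \<phi> x + \<phi> y) & (ALL c x. \<phi> (emb c * x) = c * \<phi> x) &
  (ALL x. nonneg x --> \<phi> x : \<real>\<^sub>\<ge>\<^sub>0) & (ALL x. cmod (\<phi> x) <= norm x) & \<phi> 1 = 1 & \<phi> h = 1"
proof -
 have ah: "adj h = h" using h nonneg_adj by blast
 \<comment> \<open>Since h is positive, of the two candidates 1 and -1 for a spectral value only 1
   remains.\<close>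
 have ninv: "~ invb (1 - h)"
  using norm_not_invb[OF ah] nonneg_add_pos_invb[OF h(1), of 1] h(2) by (force simp: add.commute)
 define G0 where "G0 = {(of_real s + t *R h, s + t) | s t. True}"
 have sub: "subspace G0" unfolding subspace_def
 proof (intro conjI ballI allI)
  show "0 : G0" unfolding G0_def by (auto simp: zero_prod_def intro!: exI[of _ 0])
  fix p q assume "p : G0" "q : G0"
  then obtain s t s' t' where "p = (of_real s + t *R h, s + t)" "q = (of_real s' + t' *R h, s' + t')" unfolding G0_def by blast
  hence "p + q = (of_real (s + s') + (t + t') *R h, (s + s') + (t + t'))" by (simp add: algebra_simps)
  thus "p + q : G0" unfolding G0_def by blast
 next
  fix c p assume "p : G0"
  then obtain s t where "p = (of_real s + t *R h, s + t)" unfolding G0_def by blast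
  thus "c *R p : G0" unfolding G0_def by (auto simp: algebra_simps of_real_def)
 qed
 have le: "r <= norm x" if xr: "(x, r) : G0" for x r
 proof (rule ccontr)
  assume "~ r <= norm x"
  obtain s t where st: "x = of_real s + t *R h" "r = s + t" using xr unfolding G0_def by blast
  have "norm (of_real r - (of_real r - x)) < r" using \<open>~ r <= norm x\<close> by simp
  hence i: "invb (of_real r - x)" by (rule invb_neumann)
  have e: "of_real r - x = t *R (1 - h)" unfolding st by (simp add: of_real_def algebra_simps)
  show False
  proof (cases "t = 0")
   case True thus False using i e by (simp add: invb_def)
  next
   case False
   obtain y where "t *R (1 - h) * y = 1" "y * (t *R (1 - h)) = 1" using i e unfolding invb_def by metis
   hence "(1 - h) * (t *R y) = 1" "(t *R y) * (1 - h) = 1" by simp_all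
   thus False using ninv unfolding invb_def by blast
  qed
 qed
 obtain k where k: "linear k" "!!x. k x <= norm x" "!!x r. (x, r) : G0 ==> k x = r"
  using hahn_banach_graph[OF sub le] by fast
 define g where "g x = (k x + k (adj x)) / 2" for x
 have g: "linear g" unfolding g_def
  by (rule linearI) (simp_all add: adj_add adj_scaleR linear_add[OF k(1)] linear_scale[OF k(1)] field_simps)
 have gn: "g x <= norm x" for x using k(2)[of x] k(2)[of "adj x"] by (simp add: g_def)
 have "(of_real 1 + 0 *R h, 1 + 0) : G0" "(of_real 0 + 1 *R h, 0 + 1) : G0" unfolding G0_def by blast+
 from k(3)[OF this(1)] k(3)[OF this(2)] have g1: "g 1 = 1" and gh: "g h = 1" by (simp_all add: g_def ah)
 \<comment> \<open>The complex functional with real part g; multiplication by a phase transfers the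
   bound on g to the modulus.\<close>
 define \<phi> where "\<phi> x = Complex (g x) (- g (iu * x))" for x
 have add: "\<phi> (x + y) = \<phi> x + \<phi> y" for x y
  by (simp add: \<phi>_def complex_eq_iff distrib_left linear_add[OF g])
 have iu2: "iu * (iu * x) = - x" for x :: 'a by (metis iu_sq mult.assoc mult_minus1)
 have emb: "\<phi> (emb c * x) = c * \<phi> x" for c x
 proof -
  have e: "emb c * x = Re c *R x + Im c *R (iu * x)" by (simp add: emb_def distrib_right of_real_def)
  have e2: "iu * (emb c * x) = Re c *R (iu * x) - Im c *R x" unfolding e by (simp add: distrib_left iu2)
  show ?thesis unfolding \<phi>_def e2 unfolding e
   by (simp add: complex_eq_iff linear_add[OF g] linear_diff[OF g] linear_scale[OF g] algebra_simps)
 qed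
 have bnd: "cmod (\<phi> x) <= norm x" for x
 proof (cases "\<phi> x = 0")
  case False
  define z where "z = cnj (\<phi> x) / cmod (\<phi> x)"
  have "\<phi> (emb z * x) = of_real (cmod (\<phi> x))"
   unfolding emb z_def using False complex_norm_square[of "\<phi> x"] by (simp add: field_simps power2_eq_square)
  hence "g (emb z * x) = cmod (\<phi> x)" by (metis \<phi>_def Re_complex_of_real complex.sel(1))
  moreover have "norm (emb z * x) <= norm x" using False norm_mult_ineq[of "emb z" x] by (simp add: z_def norm_divide norm_emb)
  ultimately show ?thesis using gn[of "emb z * x"] by simp
 qed simp
 have p1: "\<phi> 1 = 1"
 proof -
  have "(cmod (\<phi> 1))^2 <= 1" using bnd[of 1] by (simp add: power_le_one)
  hence "(Re (\<phi> 1))^2 + (Im (\<phi> 1))^2 <= 1" by (simp add: cmod_power2)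
  moreover have "Re (\<phi> 1) = 1" by (simp add: \<phi>_def g1)
  ultimately show ?thesis by (simp add: complex_eq_iff)
 qed
 have real: "Im (\<phi> x) = 0" if "adj x = x" for x
  using iu_central[of x] that linear_neg[OF k(1), of "iu * x"] by (simp add: \<phi>_def g_def adj_mult adj_iu)
 have pos: "\<phi> x : \<real>\<^sub>\<ge>\<^sub>0" if x: "nonneg x" for x
 proof -
  have "g (of_real (norm x) - x) <= norm (of_real (norm x) - x)" by (rule gn)
  also have "... <= norm x" by (rule nonneg_norm[OF x order_refl])
  finally have "norm x - g x <= norm x"
   by (simp add: linear_diff[OF g] of_real_def linear_scale[OF g] g1)
  thus ?thesis using real[OF nonneg_adj[OF x]] by (simp add: \<phi>_def complex_nonneg_Reals_iff)
 qed
 have "\<phi> h = 1" using real[OF ah] gh by (simp add: \<phi>_def complex_eq_iff)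
 thus ?thesis using add emb pos bnd p1 by blast
qed

section \<open>Transfer to carrier-based algebras\<close>

context cstar_algebra begin

lemma ring_simps [simp]: "C[complex_ring] = UNIV" "a +[complex_ring] b = a + b"
 "a *[complex_ring] b = a * b" "\<one>[complex_ring] = 1" "\<zero>[complex_ring] = 0"
 by (simp_all add: complex_ring_def)

declare mult_closed [simp, intro] star_closed [simp, intro]

lemma sm_closed [simp, intro]: "x : C[A] ==> c \<odot> x : C[A]"
 by simp
lemma sm_add_left: "x : C[A] ==> (c + d) \<odot> x = c \<odot> x +[A] d \<odot> x"
 using smult_l_distr[of c d x] by simp
lemma sm_add_right: "x : C[A] ==> y : C[A] ==> c \<odot> (x +[A] y) = c \<odot> x +[A] c \<odot> y"
 using smult_r_distr[of c x y] by simp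
lemma sm_assoc: "x : C[A] ==> (c * d) \<odot> x = c \<odot> (d \<odot> x)"
 using smult_assoc1[of c d x] by simp
lemma sm_1 [simp]: "x : C[A] ==> 1 \<odot> x = x"
 using smult_one[of x] by simp
lemma sm_0 [simp]: "x : C[A] ==> 0 \<odot> x = \<zero>"
 using smult_l_null[of x] by simp
lemma sm_zero [simp]: "c \<odot> \<zero> = \<zero>"
 by simp
lemma sm_neg1: "x : C[A] ==> (- 1) \<odot> x = \<ominus> x"
 using sm_add_left[of x 1 "-1"] by (metis M.add.inv_equality M.add.m_comm add.right_inverse sm_0 sm_1 sm_closed)
lemma sub_closed [simp, intro]: "x : C[A] ==> y : C[A] ==> x -[A] y : C[A]"
 by simp
lemma zero_mult [simp]: "x : C[A] ==> \<zero> *[A] x = \<zero>" "x : C[A] ==> x *[A] \<zero> = \<zero>"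
 using smult_mult_left[of \<zero> x 0] smult_mult_right[of x \<zero> 0] by simp_all
lemma minus_mult: "x : C[A] ==> y : C[A] ==> (\<ominus> x) *[A] y = \<ominus> (x *[A] y)"
  "x : C[A] ==> y : C[A] ==> x *[A] (\<ominus> y) = \<ominus> (x *[A] y)"
 using smult_mult_left[of x y "-1"] smult_mult_right[of x y "-1"] by (simp_all add: sm_neg1)
lemma diff_distr: "x : C[A] ==> y : C[A] ==> z : C[A] ==> (x -[A] y) *[A] z = (x *[A] z) -[A] (y *[A] z)"
  "x : C[A] ==> y : C[A] ==> z : C[A] ==> z *[A] (x -[A] y) = (z *[A] x) -[A] (z *[A] y)"
 by (simp_all add: a_minus_def distr_left distr_right minus_mult)
lemma star_zero [simp]: "star A \<zero> = \<zero>" using star_smult[of \<zero> 0] by simp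
lemma star_minus: "x : C[A] ==> star A (\<ominus> x) = \<ominus> star A x"
 using star_smult[of x "-1"] by (simp add: sm_neg1)
lemma star_diff: "x : C[A] ==> y : C[A] ==> star A (x -[A] y) = star A x -[A] star A y"
 by (simp add: a_minus_def star_add star_minus)
lemma norm_zero [simp]: "N[A] \<zero> = 0" using norm_eq_zero[of \<zero>] by simp
lemma norm_minus [simp]: "x : C[A] ==> N[A] (\<ominus> x) = N[A] x"
 using norm_smult[of x "-1"] by (simp add: sm_neg1)
lemma norm_minus_commute: "x : C[A] ==> y : C[A] ==> N[A] (x -[A] y) = N[A] (y -[A] x)"
 using norm_minus[of "x -[A] y"] by (simp add: M.minus_minus a_minus_def M.minus_add M.a_comm)
lemma dist_triangle: "x : C[A] ==> y : C[A] ==> z : C[A] ==>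
  N[A] (x -[A] z) <= N[A] (x -[A] y) + N[A] (y -[A] z)"
using norm_triangle[of "x -[A] y" "y -[A] z"] by (simp add: a_minus_def M.a_assoc M.r_neg1 M.r_neg2)
lemma diff_self [simp]: "x : C[A] ==> x -[A] x = \<zero>" by (simp add: a_minus_def M.r_neg)
lemma diff_zero_iff: "x : C[A] ==> y : C[A] ==> N[A] (x -[A] y) = 0 \<longleftrightarrow> x = y"
proof -
 assume c: "x : C[A]" "y : C[A]"
 have "x = (x -[A] y) +[A] y" using c by (simp add: a_minus_def M.a_assoc M.l_neg)
 thus ?thesis using c norm_eq_zero[of "x -[A] y"] by auto
qed
lemma norm_star [simp]: assumes "x : C[A]" shows "N[A] (star A x) = N[A] x"
proof -
 have le: "N[A] y <= N[A] (star A y)" if y: "y : C[A]" for y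
 proof (cases "N[A] y = 0")
  case False
  show ?thesis using cstar_identity[OF y] norm_mult[of "star A y" y] y False norm_nonneg[OF y] by (simp add: power2_eq_square mult_le_cancel_right)
 qed (use y norm_nonneg[of "star A y"] in simp)
 show ?thesis using le[of x] le[of "star A x"] assms by (simp add: star_star)
qed

lemma metric_space: "Metric_space (C[A]) (%x y. if x : C[A] & y : C[A] then N[A] (x -[A] y) else 0)"
proof
 show "(if x : C[A] & y : C[A] then N[A] (x -[A] y) else 0) = (if y : C[A] & x : C[A] then N[A] (y -[A] x) else 0)" for x y
  using norm_minus_commute by simp
qed (auto simp: norm_nonneg diff_zero_iff dist_triangle)

sublocale MS: Metric_space "C[A]" "%x y. if x : C[A] & y : C[A] then N[A] (x -[A] y) else 0"
 by (rule metric_space)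

lemma cm_space [simp]: "mspace (cmetric A) = C[A]" by (simp add: cmetric_def)
lemma cm_topology: "mtopology_of (cmetric A) = MS.mtopology" by (simp add: cmetric_def)

lemma cauchy_limit:
 assumes "!!n. s n : C[A]" "!!e. e > 0 ==> EX N. ALL m>=N. ALL n>=N. N[A] (s m -[A] s n) < e"
 shows "EX x:C[A]. (%n. N[A] (s n -[A] x)) ~~> 0"
proof -
 have "MS.mcomplete" using complete by (simp add: mcomplete_of_def cmetric_def)
 moreover have "MS.MCauchy s" unfolding MS.MCauchy_def using assms by auto
 ultimately obtain x where "limitin MS.mtopology s x sequentially" unfolding MS.mcomplete_def by blast
 thus ?thesis unfolding MS.limitin_metric_dist_null using assms(1) by auto
qed

lemma closed_iff: "closedin (mtopology_of (cmetric A)) S \<longleftrightarrow>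
 S <= C[A] & (ALL s x. (ALL n. s n : S) & x : C[A] & (%n. N[A] (s n -[A] x)) ~~> 0 --> x : S)"
 unfolding cm_topology MS.metric_closedin_iff_sequentially_closed
proof (intro conj_cong refl all_cong1)
 fix s :: "nat => 'a" and x assume S: "S <= C[A]"
 thus "(range s <= S & limitin MS.mtopology s x sequentially --> x : S) =
  ((ALL n. s n : S) & x : C[A] & (%n. N[A] (s n -[A] x)) ~~> 0 --> x : S)"
  unfolding MS.limitin_metric_dist_null by (auto simp: image_subset_iff subset_iff)
qed

end

text \<open>The zero algebra is excluded because its unit has norm 0, which the type class
  forbids.\<close>

definition ucs :: "'a cstar => bool" where
 "ucs A \<longleftrightarrow> cstar_algebra A & unital A & C[A] ~= {\<zero>[A]}"

lemma ucs_one: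
 assumes "ucs A"
 shows "\<one>[A] : C[A]" "x : C[A] ==> \<one>[A] *[A] x = x" "x : C[A] ==> x *[A] \<one>[A] = x" "star A \<one>[A] = \<one>[A]"
  "\<one>[A] ~= \<zero>[A]" "N[A] \<one>[A] = 1"
proof -
 interpret cstar_algebra A using assms by (simp add: ucs_def)
 have m: "Group.monoid A" using assms by (simp add: ucs_def unital_def)
 show 1: "\<one>[A] : C[A]" and 2: "x : C[A] ==> \<one>[A] *[A] x = x" and 3: "x : C[A] ==> x *[A] \<one>[A] = x" for x
  using m by (simp_all add: monoid.one_closed monoid.l_one monoid.r_one)
 show 4: "star A \<one>[A] = \<one>[A]" using star_mult[of "star A \<one>[A]" "\<one>[A]"] 1 2 3 by (simp add: star_star)
 show 5: "\<one>[A] ~= \<zero>[A]"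
 proof
  assume "\<one>[A] = \<zero>[A]"
  hence "x = \<zero>[A]" if "x : C[A]" for x using that 2[of x] by simp
  thus False using assms M.zero_closed unfolding ucs_def by blast
 qed
 show "N[A] \<one>[A] = 1" using cstar_identity[OF 1] 1 2 4 5 norm_eq_zero[OF 1] by (simp add: power2_eq_square)
qed

text \<open>Square roots as limits of *-polynomials, uniformly on the positive unit ball: they make sense without a unit.\<close>
primrec sq_iter :: "('a, 'm) cstar_scheme => 'a => nat => 'a" where
 "sq_iter A x 0 = \<zero>[A]"
| "sq_iter A x (Suc m) = sq_iter A x m +[A] (1/2) \<odot>[A] (x -[A] (sq_iter A x m *[A] sq_iter A x m))"

text \<open>This and the following \<open>_facts\<close> are the results to be carried from the type
  class to carrier sets. They are predicates of one algebra A, so that an algebra violating them can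
  be named and made into a type.\<close>

definition sq_facts :: "'a cstar => bool" where
 "sq_facts A = (ALL x:pos A. N[A] x <= 1 --> (ALL m>=1. star A (sq_iter A x m) = sq_iter A x m &
  N[A] (sq_iter A x m *[A] sq_iter A x m -[A] x) <= 4 / m &
  (ALL l>=m. N[A] (sq_iter A x l -[A] sq_iter A x m) <= 4 / m)))"

definition ccls :: "'a cstar => 'a => 'a set" where
 "ccls A a = {x : pos A. cuntz_le A x a & cuntz_le A a x}"

text \<open>The homotopy is continuous jointly in t and y; epsilon and delta express this by the
  norm on the carrier alone.\<close>

definition homotopy_facts :: "'a cstar => bool" where
 "homotopy_facts A = (ALL a:pos A. simple A &
  (approximately_divisible A & (ALL p:C[A]. star A p = p & p *[A] p = p --> ~ (cuntz_le A a p & cuntz_le A p a)) \<or>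
   purely_infinite A & a ~= \<zero>[A]) -->
  (ALL Y. compactin (mtopology_of (cmetric A)) Y & Y <= ccls A a -->
   (EX H :: real => 'a => 'a.
     (ALL t:{0..1}. ALL y:Y. H t y : ccls A a & H 0 y = y & H 1 y = a &
      (ALL e>0. EX d>0. ALL t':{0..1}. ALL y':Y. \<bar>t' - t\<bar> < d & N[A] (y' -[A] y) < d --> N[A] (H t' y' -[A] H t y) < e)))))"

text \<open>States that detect the norm; they serve to show that the embedding of A into its
  stabilisation is isometric.\<close>

definition state_facts :: "'a cstar => bool" where
 "state_facts A = (ALL x:C[A]. EX \<phi>. state A \<phi> & \<phi> \<one>[A] = 1 & \<phi> (star A x *[A] x) = (N[A] x)^2)"

definition near_one_facts :: "'a cstar => bool" where
 "near_one_facts A = (ALL b:C[A]. star A b = b & N[A] (\<one>[A] -[A] b) < 1 -->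
  (EX c:C[A]. c *[A] b *[A] star A c = \<one>[A]))"

definition cstar_facts :: "'a cstar => bool" where
 "cstar_facts A \<longleftrightarrow> sq_facts A & homotopy_facts A & state_facts A & near_one_facts A"

locale calg_iso = cstar_algebra A for A :: "'a cstar" (structure) +
 fixes f :: "'a => 't::ucstar" and g :: "'t => 'a"
 assumes ucsA: "ucs A"
  and gc [simp, intro]: "g z : C[A]" and fg [simp]: "f (g z) = z" and gf [simp]: "x : C[A] ==> g (f x) = x"
  and f_add: "x : C[A] ==> y : C[A] ==> f (x +[A] y) = f x + f y"
  and f_mult: "x : C[A] ==> y : C[A] ==> f (x *[A] y) = f x * f y"
  and f_smult: "x : C[A] ==> f (c \<odot> x) = emb c * f x"
  and f_star: "x : C[A] ==> f (star A x) = adj (f x)"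
  and f_one: "f \<one> = 1"
  and f_norm: "x : C[A] ==> norm (f x) = N[A] x"
begin

lemma f_zero: "f \<zero> = 0" using f_norm[of \<zero>] by simp
lemma f_minus: "x : C[A] ==> f (\<ominus> x) = - f x"
 using f_smult[of x "-1"] emb_uminus[of 1, where 'a='t] by (simp add: sm_neg1)
lemma f_diff: "x : C[A] ==> y : C[A] ==> f (x -[A] y) = f x - f y"
 by (simp add: a_minus_def f_add f_minus)
lemma f_inj: "x : C[A] ==> y : C[A] ==> f x = f y \<longleftrightarrow> x = y"
 by (metis gf)
lemma f_dist: "x : C[A] ==> y : C[A] ==> N[A] (x -[A] y) = norm (f x - f y)"
 by (simp add: f_norm flip: f_diff)
lemmas f_hom = f_add f_mult f_smult f_star f_one f_zero f_minus f_diff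

lemma g_hom: "g (x + y) = g x +[A] g y" "g (x * y) = g x *[A] g y" "g (adj x) = star A (g x)" "g (emb c * x) = c \<odot> g x" "g 0 = \<zero>" "g 1 = \<one>" "g (x - y) = g x -[A] g y"
 by (simp_all add: f_hom ucs_one[OF ucsA] flip: f_inj)

lemma pos_iff: "x : pos A \<longleftrightarrow> x : C[A] & nonneg (f x)"
proof
 assume "x : pos A"
 then obtain y where "y : C[A]" "x = star A y *[A] y" by (auto simp: pos_def)
 thus "x : C[A] & nonneg (f x)" by (simp add: f_hom nonneg_adj_mult)
next
 assume x: "x : C[A] & nonneg (f x)"
 then obtain z where "f x = adj z * z" by (auto simp: nonneg_iff)
 hence "f x = f (star A (g z) *[A] g z)" by (simp add: f_hom)
 hence "x = star A (g z) *[A] g z" using x by (subst (asm) f_inj) auto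
 thus "x : pos A" by (auto simp: pos_def)
qed

lemma cuntz_iff:
 assumes c: "a : C[A]" "b : C[A]"
 shows "cuntz_le A a b \<longleftrightarrow> cz (f a) (f b)"
proof
 assume "cuntz_le A a b"
 then obtain v where v: "!!n::nat. v n : C[A]" "(%n. N[A] ((v n *[A] b *[A] star A (v n)) -[A] a)) ~~> 0" by (auto simp: cuntz_le_def)
 show "cz (f a) (f b)" unfolding cz_def
 proof (intro allI impI)
  fix e :: real assume "e > 0"
  then obtain n where "N[A] ((v n *[A] b *[A] star A (v n)) -[A] a) < e" using order_tendstoD(2)[OF v(2)] by force
  thus "EX w. norm (w * f b * adj w - f a) < e" using v(1) c by (intro exI[of _ "f (v n)"]) (simp add: f_dist f_hom)
 qed
next
 assume cz: "cz (f a) (f b)"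
 have "EX w. norm (w * f b * adj w - f a) < inverse (real (Suc n))" for n using cz unfolding cz_def by simp
 then obtain w where w: "!!n. norm (w n * f b * adj (w n) - f a) < inverse (real (Suc n))" by metis
 have "(%n. N[A] ((g (w n) *[A] b *[A] star A (g (w n))) -[A] a)) ~~> 0"
 proof (rule real_tendsto_sandwich[OF _ _ tendsto_const LIMSEQ_inverse_real_of_nat])
  show "\<forall>\<^sub>F n in sequentially. 0 <= N[A] ((g (w n) *[A] b *[A] star A (g (w n))) -[A] a)" using c by (simp add: norm_nonneg)
  show "\<forall>\<^sub>F n in sequentially. N[A] ((g (w n) *[A] b *[A] star A (g (w n))) -[A] a) <= inverse (real (Suc n))"
   using w c by (intro always_eventually allI less_imp_le) (simp add: f_dist f_hom)
 qed
 thus "cuntz_le A a b" unfolding cuntz_le_def by auto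
qed

lemma ccls_iff: "a : C[A] ==> x : ccls A a \<longleftrightarrow> x : C[A] & f x : cls (f a)"
 by (auto simp: ccls_def cls_def pos_iff cuntz_iff)

lemma sq_facts: "sq_facts A"
proof -
 have s: "sq_iter A x m : C[A] & f (sq_iter A x m) = sqi (f x) m" if "x : C[A]" for x m
 proof (induction m)
  case (Suc m)
  have "emb (1/2) * z = (1/2) *R z" for z :: 't
  proof -
   have "complex_of_real (1/2) = 1/2" by simp
   thus ?thesis using emb_of_real[of "1/2", where 'a='t] by (metis scaleR_conv_of_real)
  qed
  thus ?case using Suc that by (simp only: sq_iter.simps sqi.simps f_add f_smult f_diff f_mult sub_closed mult_closed sm_closed M.a_closed simp_thms)
 qed (simp add: f_zero)
 show ?thesis unfolding sq_facts_def
 proof (intro ballI allI impI conjI, goal_cases)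
  case (1 x m) thus ?case using s[of x m] sqi_props(1)[of "f x" m] by (auto simp: pos_iff f_norm f_star simp flip: f_inj)
 next
  case (2 x m) thus ?case using s[of x m] sqi_props(2)[of "f x" m] by (auto simp: pos_iff f_norm f_dist f_hom)
 next
  case (3 x m l) thus ?case using s[of x m] s[of x l] sqi_props(3)[of "f x" m l] by (auto simp: pos_iff f_norm f_dist f_hom)
 qed
qed

lemma near_one_facts: "near_one_facts A"
 unfolding near_one_facts_def
proof (intro ballI impI)
 fix b assume b: "b : C[A]" "star A b = b & N[A] (\<one> \<ominus> b) < 1"
 have "adj (f b) = f b" "norm (1 - f b) < 1" using b f_star[of b] by (auto simp: f_dist ucs_one[OF ucsA] f_one)
 then obtain c where "c * f b * adj c = 1" using near_one_conj by blast
 hence "g c *[A] b *[A] star A (g c) = \<one>" using b by (subst f_inj[symmetric]) (simp_all add: f_hom ucs_one[OF ucsA])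
 thus "EX c:C[A]. c *[A] b *[A] star A c = \<one>" by blast
qed

lemma state_facts: "state_facts A"
 unfolding state_facts_def
proof
 fix x assume x: "x : C[A]"
 define h :: 't where "h = (if x = \<zero> then 1 else (1 / (N[A] x)^2) *R (adj (f x) * f x))"
 have "nonneg h" using nonneg_square[of "1::'t"] by (simp add: h_def nonneg_scaleR nonneg_adj_mult)
 moreover have "norm h = 1" using x norm_eq_zero[OF x] by (simp add: h_def cstar_norm f_norm)
 ultimately obtain \<phi> :: "'t => complex" where p: "!!x y. \<phi> (x + y) = \<phi> x + \<phi> y" "!!c x. \<phi> (emb c * x) = c * \<phi> x"
  "!!x. nonneg x ==> \<phi> x : \<real>\<^sub>\<ge>\<^sub>0" "!!x. cmod (\<phi> x) <= norm x" "\<phi> 1 = 1" "\<phi> h = 1" using state_exists by metis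
 define \<psi> where "\<psi> x = \<phi> (f x)" for x
 have b: "cmod (\<psi> y) <= 1" if "y : C[A]" "N[A] y <= 1" for y
  using p(4)[of "f y"] that by (simp add: \<psi>_def f_norm)
 let ?a = "star A x *[A] x"
 have "Sup {cmod (\<psi> x) |x. x : C[A] & N[A] x <= 1} = 1"
 proof (rule cSup_eq_maximum)
  show "1 : {cmod (\<psi> x) |x. x : C[A] & N[A] x <= 1}"
   using ucs_one[OF ucsA] by (auto simp: \<psi>_def f_one p intro!: exI[of _ \<one>])
 qed (use b in auto)
 hence "state A \<psi>" unfolding state_def using b by (auto simp: \<psi>_def f_hom p pos_iff intro!: bdd_aboveI[of _ 1])
 moreover have "\<psi> ?a = (N[A] x)^2"
 proof (cases "x = \<zero>")
  case True thus ?thesis using p(2)[of 0 0] by (simp add: \<psi>_def f_zero)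
 next
  case False
  hence "f ?a = emb (of_real ((N[A] x)^2)) * h"
   using x norm_eq_zero[OF x] unfolding emb_of_real by (simp add: h_def f_hom scaleR_conv_of_real) (simp add: mult.assoc[symmetric] flip: of_real_mult of_real_power of_real_inverse)
  thus ?thesis unfolding \<psi>_def by (simp only: p(2,6)) simp
 qed
 ultimately show "EX \<phi>. state A \<phi> & \<phi> \<one> = 1 & \<phi> ?a = (N[A] x)^2" by (intro exI[of _ \<psi>]) (simp add: \<psi>_def f_one p)
qed

lemma lim_iff: "(!!n. s n : C[A]) ==> x : C[A] ==> (%n. N[A] (s n -[A] x)) ~~> 0 \<longleftrightarrow> (%n. f (s n)) ~~> f x"
 by (subst LIM_zero_iff[symmetric], subst tendsto_norm_zero_iff[symmetric]) (simp add: f_dist)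

lemma closed_transfer: "closed I ==> closedin (mtopology_of (cmetric A)) (g ` I)"
 unfolding closed_iff
proof (intro conjI allI impI)
 fix s x assume I: "closed I" and s: "(ALL n. s n : g ` I) & x : C[A] & (%n. N[A] (s n -[A] x)) ~~> 0"
 hence c: "!!n. s n : C[A]" and fI: "!!n. f (s n) : I" by (metis gc imageE, metis fg imageE)
 have "f x : I" using closed_sequentially[OF I, of "%n. f (s n)"] fI lim_iff[OF c] s by auto
 thus "x : g ` I" using s by (metis gf image_eqI)
qed auto

lemma csimple_transfer: assumes "simple A" shows "csimple TYPE('t)"
 unfolding csimple_def
proof (intro allI impI)
 fix I :: "'t set"
 assume I: "closed I & 0 : I & (ALL x:I. ALL y:I. x + y : I) & (ALL x:I. ALL r. r * x : I & x * r : I)"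
 have m: "Group.monoid A" using ucsA by (simp add: ucs_def unital_def)
 have "ring A" using m by (intro ringI M.abelian_group_axioms) (auto simp: distr_left distr_right)
 moreover have "additive_subgroup (g ` I) A"
 proof (rule additive_subgroup.intro, rule subgroup.intro)
  show "inv\<^bsub>add_monoid A\<^esub> x : g ` I" if x: "x : g ` I" for x
  proof -
   obtain z where z: "z : I" "x = g z" using x by blast
   have "\<ominus> x = g ((- 1) * z)" using z by (subst f_inj[symmetric]) (auto simp: f_minus)
   thus ?thesis using I z unfolding a_inv_def by blast
  qed
  show "x *[add_monoid A] y : g ` I" if "x : g ` I" "y : g ` I" for x y
   using that I by (auto simp: g_hom(1)[symmetric])
  show "\<one>[add_monoid A] : g ` I" using I by (auto simp: g_hom(5)[symmetric])
 qed auto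
 moreover have "r *[A] x : g ` I" "x *[A] r : g ` I" if "x : g ` I" "r : C[A]" for x r
 proof -
  obtain z where z: "z : I" "x = g z" using \<open>x : g ` I\<close> by blast
  have "r *[A] x = g (f r * z)" "x *[A] r = g (z * f r)" using z that by (simp_all add: g_hom)
  thus "r *[A] x : g ` I" "x *[A] r : g ` I" using I z by blast+
 qed
 ultimately have "ideal (g ` I) A" by (intro ideal.intro ideal_axioms.intro)
 moreover have "closedin (mtopology_of (cmetric A)) (g ` I)" using I closed_transfer by blast
 ultimately have "g ` I = {\<zero>} | g ` I = C[A]" using assms unfolding simple_def by blast
 thus "I = {0} | I = UNIV"
 proof
  assume e: "g ` I = {\<zero>}"
  hence "z = 0" if "z : I" for z using that by (metis f_zero fg image_eqI singletonD)
  thus ?thesis using I by blast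
 next
  assume "g ` I = C[A]"
  hence "z : I" for z using gc[of z] by (metis fg imageE)
  thus ?thesis by blast
 qed
qed

lemma cpinf_transfer: assumes "purely_infinite A" shows "cpinf TYPE('t)"
 unfolding cpinf_def
proof (intro allI impI, elim conjE)
 fix B :: "'t set"
 assume B: "closed B" "0 : B" "ALL x:B. ALL y:B. x + y : B & x * y : B" "ALL x:B. adj x : B & (ALL c. emb c * x : B)"
   "ALL b:B. ALL x. nonneg x & nonneg (b - x) --> x : B" "B ~= {0}"
 have mem: "x : g ` B \<longleftrightarrow> x : C[A] & f x : B" for x by (metis fg gc gf imageE image_eqI)
 have "hereditary (g ` B) A" using B(2-4) closed_transfer[OF B(1)] B(5) unfolding hereditary_def mem by (auto simp: f_hom cstar_subalgebra_def mem pos_iff)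
 moreover have "g ` B ~= {\<zero>}"
 proof
  assume "g ` B = {\<zero>}"
  hence "z = 0" if "z : B" for z using that by (metis f_zero fg image_eqI singletonD)
  thus False using B by blast
 qed
 ultimately obtain p where p: "p : g ` B" "infinite_projection A p" using assms unfolding purely_infinite_def by blast
 then obtain v where v: "p : C[A]" "star A p = p" "p *[A] p = p" "v : C[A]" "star A v *[A] v = p"
   "p -[A] v *[A] star A v : pos A" "v *[A] star A v ~= p" unfolding infinite_projection_def by blast
 have e: "adj (f p) = f p" "f p * f p = f p" "adj (f v) * f v = f p" using v by (simp_all flip: f_star f_mult)
 have ne: "f v * adj (f v) ~= f p"
 proof
  assume "f v * adj (f v) = f p"
  hence "f (v *[A] star A v) = f p" using v by (simp add: f_hom)
  thus False using v by (simp add: f_inj)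
 qed
 show "EX p:B. adj p = p & p * p = p & (EX v. adj v * v = p & nonneg (p - v * adj v) & v * adj v ~= p)"
  using v e ne p(1) by (auto simp: pos_iff f_hom)
qed

end

section \<open>Matrix units of a direct sum of two matrix algebras\<close>

lemma finsum_complex: "finite S ==> finsum complex_star_alg h S = sum h S"
proof -
 interpret abelian_monoid complex_star_alg
  by (rule abelian_monoidI) (auto simp: complex_star_alg_def)
 show "finite S ==> finsum complex_star_alg h S = sum h S"
 proof (induction S rule: finite_induct)
  case (insert x F)
  thus ?case by (subst finsum_insert) (auto simp: complex_star_alg_def)
 next
  case empty
  show ?case unfolding finsum_empty sum.empty by (simp add: complex_star_alg_def)
 qed
qed

text \<open>The flag P blanks the matrix: a matrix unit of the direct sum is a genuine one in one
  block and zero in the other.\<close>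

definition eunit :: "bool => nat => nat => nat => nat => complex" where
 "eunit P i j = (%r s. if P & r = i & s = j then 1 else 0)"

lemma eunit_mult:
 assumes "P ==> i < n & j < n" "Q ==> i' < n & j' < n"
 shows "eunit P i j *[CMat n] eunit Q i' j' = eunit (P & Q & j = i') i j'"
proof (intro ext)
 fix r s
 have "(\<Sum>k<n. eunit P i j r k * eunit Q i' j' k s) = (\<Sum>k<n. if k = j then if P & Q & j = i' & r = i & s = j' then 1 else 0 else 0)"
  by (rule sum.cong) (auto simp: eunit_def)
 thus "(eunit P i j *[CMat n] eunit Q i' j') r s = eunit (P & Q & j = i') i j' r s"
  using assms by (auto simp: mat_alg_def finsum_complex) (auto simp: complex_star_alg_def eunit_def)
qed

definition munit :: "nat \<times> nat => nat \<times> nat => (nat => nat => complex) \<times> (nat => nat => complex)" where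
 "munit p q = (eunit (fst p = 0) (snd p) (snd q), eunit (fst p = 1) (snd p) (snd q))"

lemma munit_alg:
 fixes m defines "D == direct_sum (CMat (m + 1)) (CMat (m + 1 + 1))"
 assumes p: "p : munits m" "q : munits m" "fst p = fst q" and p': "p' : munits m" "q' : munits m" "fst p' = fst q'"
 shows "munit p q : C[D]" "star D (munit p q) = munit q p"
  "munit p q *[D] munit p' q' = (if q = p' then munit p q' else \<zero>[D])"
proof -
 show "munit p q : C[D]" "star D (munit p q) = munit q p"
  using p by (auto simp: munits_def munit_def eunit_def D_def direct_sum_def mat_alg_def complex_star_alg_def fun_eq_iff)
 let ?a = "if q = p' then munit p q' else \<zero>[D]"
 have "munit p q *[D] munit p' q' = (eunit (fst p = 0) (snd p) (snd q) *[CMat (m + 1)] eunit (fst p' = 0) (snd p') (snd q'),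
   eunit (fst p = 1) (snd p) (snd q) *[CMat (m + 1 + 1)] eunit (fst p' = 1) (snd p') (snd q'))"
  by (simp add: D_def munit_def direct_sum_def)
 also have "... = (eunit (fst p = 0 & fst p' = 0 & snd q = snd p') (snd p) (snd q'), eunit (fst p = 1 & fst p' = 1 & snd q = snd p') (snd p) (snd q'))"
  by (intro arg_cong2[where f=Pair] eunit_mult) (use p p' in "auto simp: munits_def")
 also have "... = ?a"
  using p by (cases p; cases q; cases p'; cases q')
   (auto simp: munits_def munit_def eunit_def D_def direct_sum_def mat_alg_def complex_star_alg_def fun_eq_iff less_2_cases_iff)
 finally show "munit p q *[D] munit p' q' = ?a" .
qed

text \<open>h is only known to be additive on the carrier, so the identity is built up from diagonal
  units one at a time, through the diagonal matrices G S.\<close>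

lemma munit_sum:
 fixes m defines "D == direct_sum (CMat (m + 1)) (CMat (m + 1 + 1))"
 assumes add: "!!x y. x : C[D] ==> y : C[D] ==> h (x +[D] y) = h x + h y" and z: "h \<zero>[D] = (0::'b::comm_monoid_add)"
 shows "h \<one>[D] = (\<Sum>p\<in>munits m. h (munit p p))"
proof -
 define G where "G S = (%i j. if i = j & (0::nat, i) : S then 1 else 0::complex, %i j. if i = j & (1::nat, i::nat) : S then 1 else 0::complex)" for S
 have "finite S ==> S <= munits m ==> G S : C[D] & h (G S) = (\<Sum>p\<in>S. h (munit p p))" for S
 proof (induction S rule: finite_induct)
  case empty
  have "G {} = \<zero>[D]" by (simp add: G_def D_def direct_sum_def mat_alg_def complex_star_alg_def)
  moreover have "G {} : C[D]" by (simp add: G_def D_def direct_sum_def mat_alg_def complex_star_alg_def)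
  ultimately show ?case using z by simp
 next
  case (insert p F)
  have u: "munit p p : C[D]" using munit_alg(1)[of p m p p p] insert by (simp add: D_def)
  have "fst p = 0 | fst p = 1" using insert by (auto simp: munits_def)
  hence e: "G (insert p F) = munit p p +[D] G F" using insert(2)
   by (cases p) (auto simp: G_def D_def direct_sum_def mat_alg_def complex_star_alg_def munit_def eunit_def fun_eq_iff)
  have "G (insert p F) : C[D]" using insert.prems
   by (auto simp: G_def D_def direct_sum_def mat_alg_def complex_star_alg_def munits_def)
  thus ?case using insert e u by (simp add: add)
 qed
 moreover have "G (munits m) = \<one>[D]"
  by (auto simp: G_def D_def direct_sum_def mat_alg_def complex_star_alg_def munits_def fun_eq_iff)
 ultimately show ?thesis using finite_munits[of m] by (metis order_refl)
qed

context calg_iso begin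

lemma cad_transfer: assumes "approximately_divisible A" shows "cad TYPE('t)"
 unfolding cad_def
proof
 fix m
 define D where "D = direct_sum (CMat (m + 1)) (CMat (m + 1 + 1))"
 have "EX \<phi>. (ALL k::nat. star_hom D A (\<phi> k) & \<phi> k \<one>[D] = \<one>) &
   (ALL F:C[D]. ALL x:C[A]. (%k. N[A] ((\<phi> k F *[A] x) -[A] (x *[A] \<phi> k F))) ~~> 0)"
  using assms unfolding approximately_divisible_def D_def by simp
 then obtain \<phi> where \<phi>: "(ALL k::nat. star_hom D A (\<phi> k) & \<phi> k \<one>[D] = \<one>) &
   (ALL F:C[D]. ALL x:C[A]. (%k. N[A] ((\<phi> k F *[A] x) -[A] (x *[A] \<phi> k F))) ~~> 0)" ..
 have h: "star_hom D A (\<phi> k)" and one: "\<phi> k \<one>[D] = \<one>" for k using \<phi> by auto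
 have c: "(%k. N[A] ((\<phi> k F *[A] x) -[A] (x *[A] \<phi> k F))) ~~> 0" if "F : C[D]" "x : C[A]" for F x
  using \<phi> that by auto
 have cl: "\<phi> k x : C[A]" if "x : C[D]" for k x using h[of k] that unfolding star_hom_def by blast
 have ph: "\<phi> k (x +[D] y) = \<phi> k x +[A] \<phi> k y" "\<phi> k (x *[D] y) = \<phi> k x *[A] \<phi> k y" "\<phi> k (star D x) = star A (\<phi> k x)" "\<phi> k (c \<odot>[D] x) = c \<odot> \<phi> k x"
  if "x : C[D]" "y : C[D]" for x y k c using h[of k] that unfolding star_hom_def by blast+
 have zc: "\<zero>[D] : C[D]" and z0: "0 \<odot>[D] \<zero>[D] = \<zero>[D]"
  by (auto simp: D_def direct_sum_def mat_alg_def complex_star_alg_def)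
 have z: "\<phi> k \<zero>[D] = \<zero>" for k using ph(4)[OF zc zc, of k 0] cl[OF zc, of k] z0 by simp
 define U where "U k p q = f (\<phi> k (munit p q))" for k p q
 note mu = munit_alg[where m=m, folded D_def]
 have mc: "munit p q : C[D]" if "p : munits m" "q : munits m" "fst p = fst q" for p q using mu(1)[OF that that] .
 have "adj (U k p q) = U k q p" if "p : munits m" "q : munits m" "fst p = fst q" for k p q
  using mu(2)[OF that that] ph(3)[OF mc mc, OF that that, of k] mc[OF that] cl by (simp add: U_def f_star)
 moreover have "U k p q * U k p' q' = (if q = p' then U k p q' else 0)"
  if "p : munits m" "q : munits m" "fst p = fst q" "p' : munits m" "q' : munits m" "fst p' = fst q'" for k p q p' q'
  using mu(3)[OF that] ph(2)[OF mc mc, OF that, of k] mc[OF that(1-3)] mc[OF that(4-6)] cl z f_zero by (auto simp: U_def simp flip: f_mult)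
 moreover have "(\<Sum>p\<in>munits m. U k p p) = 1" for k
  using munit_sum[of m "%x. f (\<phi> k x)", folded D_def] z one f_zero f_one cl ph(1) by (simp add: U_def f_add)
 moreover have "(%k. U k p q * x - x * U k p q) ~~> 0" if "p : munits m" "q : munits m" "fst p = fst q" for p q x
  using c[OF mc[OF that] gc[of x]] cl[OF mc[OF that]] by (subst tendsto_norm_zero_iff[symmetric]) (simp add: U_def f_dist f_mult)
 ultimately show "EX U. (ALL k. ALL p:munits m. ALL q:munits m. fst p = fst q -->
    adj (U k p q) = U k q p &
    (ALL p':munits m. ALL q':munits m. fst p' = fst q' --> U k p q * U k p' q' = (if q = p' then U k p q' else 0))) &
  (ALL k. (\<Sum>p\<in>munits m. U k p p) = 1) &
  (ALL p:munits m. ALL q:munits m. fst p = fst q --> (ALL x::'t. (%k. U k p q * x - x * U k p q) ~~> 0))"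
  by blast
qed

lemma compact_transfer: assumes "compactin (mtopology_of (cmetric A)) Y" shows "compact (f ` Y)" "Y <= C[A]"
proof -
 show Y: "Y <= C[A]" using compactin_subset_topspace[OF assms] by simp
 have sc: "EX l:Y. EX r. strict_mono r & limitin MS.mtopology (s \<circ> r) l sequentially" if "range s <= Y" for s :: "nat => 'a"
  using assms that unfolding cm_topology MS.compactin_sequentially by blast
 show "compact (f ` Y)" unfolding compact_eq_seq_compact_metric seq_compact_def
 proof (intro allI impI)
  fix s :: "nat => 't" assume s: "ALL n. s n : f ` Y"
  have gs: "g (s n) : Y" "f (g (s n)) = s n" for n using s Y by (metis gf image_iff subsetD, simp)
  then obtain l r where l: "l : Y" "strict_mono r" "limitin MS.mtopology ((%n. g (s n)) \<circ> r) l sequentially"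
   using sc[of "%n. g (s n)"] by auto
  have "(%n. N[A] (g (s (r n)) -[A] l)) ~~> 0"
   using l(1,3) unfolding MS.limitin_metric_dist_null by auto
  hence "(%n. f (g (s (r n)))) ~~> f l" by (subst (asm) lim_iff) (use l Y in auto)
  thus "EX l:f ` Y. EX r. strict_mono r & (s \<circ> r) ~~> l" using l by (intro bexI[of _ "f l"] exI[of _ r]) (auto simp: o_def)
 qed
qed

lemma homotopy_facts: "homotopy_facts A"
 unfolding homotopy_facts_def
proof (intro ballI impI allI, elim conjE)
 fix a Y assume a: "a : pos A" and s: "simple A"
  and h: "approximately_divisible A & (ALL p:C[A]. star A p = p & p *[A] p = p --> ~ (cuntz_le A a p & cuntz_le A p a)) \<or>
   purely_infinite A & a ~= \<zero>"
  and Y: "compactin (mtopology_of (cmetric A)) Y" "Y <= ccls A a"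
 have ac: "a : C[A]" and an: "nonneg (f a)" using a by (auto simp: pos_iff)
 have Yc: "Y <= C[A]" and cY: "compact (f ` Y)" using compact_transfer[OF Y(1)] by auto
 have Ycls: "f ` Y <= cls (f a)" using Y(2) ccls_iff[OF ac] by blast
 have sm: "csimple TYPE('t)" by (rule csimple_transfer[OF s])
 let ?a = "continuous_on ({0..1} \<times> f ` Y)"
 have "homotopic_with_canon (%_. True) (f ` Y) (cls (f a)) (%y. y) (%y. f a)"
  using h
 proof (elim disjE conjE)
  assume ad: "approximately_divisible A" and nc: "ALL p:C[A]. star A p = p & p *[A] p = p --> ~ (cuntz_le A a p & cuntz_le A p a)"
  show ?thesis
  proof (rule homotopy_noncompact[OF sm cad_adapprox[OF cad_transfer[OF ad]] an _ cY Ycls], rule notI)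
   assume "EX p. adj p = p & p * p = p & cz (f a) p & cz p (f a)"
   then obtain p where "adj p = p" "p * p = p" "cz (f a) p" "cz p (f a)" by blast
   thus False using nc[rule_format, of "g p"] ac by (auto simp: cuntz_iff simp flip: g_hom)
  qed
 next
  assume pi: "purely_infinite A" and nz: "a ~= \<zero>"
  show ?thesis using nz f_zero f_inj[OF ac M.zero_closed] homotopy_infinite[OF cpinf_cz[OF sm cpinf_transfer[OF pi]] an _ Ycls] by simp
 qed
 from homotopicD[OF this] obtain K where hK: "?a (%p. K (fst p) (snd p)) & (ALL t:{0..1}. ALL y:f ` Y. K t y : cls (f a)) &
  (ALL y:f ` Y. K (0::real) y = y) & (ALL y:f ` Y. K 1 y = f a)" ..
 have K: "?a (%p. K (fst p) (snd p))"
  "!!t y. t : {0..1} ==> y : f ` Y ==> K t y : cls (f a)" "!!y. y : f ` Y ==> K (0::real) y = y" "!!y. y : f ` Y ==> K 1 y = f a"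
  using hK by auto
 define H where "H t y = g (K t (f y))" for t y
 show "EX H :: real => 'a => 'a. (ALL t:{0..1}. ALL y:Y. H t y : ccls A a & H 0 y = y & H 1 y = a &
      (ALL e>0. EX d>0. ALL t':{0..1}. ALL y':Y. \<bar>t' - t\<bar> < d & N[A] (y' -[A] y) < d --> N[A] (H t' y' -[A] H t y) < e))"
 proof (intro exI[of _ H] ballI conjI allI impI)
  fix t :: real and y assume t: "t : {0..1}" and y: "y : Y"
  have yc: "y : C[A]" using y Yc by blast
  show "H t y : ccls A a" using K(2)[OF t imageI[OF y]] by (simp add: ccls_iff[OF ac] H_def)
  show "H 0 y = y" "H 1 y = a" using K(3,4)[OF imageI[OF y]] yc ac by (simp_all add: H_def)
  fix e :: real assume "e > 0"
  then obtain d where d: "d > 0" "!!p. p : {0..1} \<times> f ` Y ==> dist p (t, f y) < d ==> dist (K (fst p) (snd p)) (K t (f y)) < e"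
   using K(1)[unfolded continuous_on_iff, rule_format, of "(t, f y)" e] t y by (metis SigmaI fst_conv imageI snd_conv)
  show "EX d>0. ALL t':{0..1}. ALL y':Y. \<bar>t' - t\<bar> < d & N[A] (y' -[A] y) < d --> N[A] (H t' y' -[A] H t y) < e"
  proof (intro exI[of _ "d / 2"] conjI ballI impI)
   fix t' y' assume "t' : {0..1}" and y': "y' : Y" and l: "\<bar>t' - t\<bar> < d / 2 & N[A] (y' -[A] y) < d / 2"
   have "dist (t', f y') (t, f y) <= \<bar>t' - t\<bar> + N[A] (y' -[A] y)"
    unfolding dist_prod_def using sqrt_sum_squares_le_sum[of "dist t' t" "dist (f y') (f y)"] y' Yc yc by (auto simp: dist_norm f_dist)
   thus "N[A] (H t' y' -[A] H t y) < e" using l d(2)[of "(t', f y')"] \<open>t' : {0..1}\<close> y' by (simp add: H_def f_dist dist_norm)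
  qed (use d in simp)
 qed
qed

lemma cstar_facts: "cstar_facts A"
 unfolding cstar_facts_def by (intro conjI sq_facts homotopy_facts state_facts near_one_facts)

end

text \<open>
 Type classes only speak about whole types. To instantiate the class by an arbitrary algebra, the type calg is
 the carrier of a counterexample to the facts to be transferred; if there is none, it is a copy of the complex numbers.
\<close>
definition bad :: "'a itself => bool" where
 "bad _ = (EX A::'a cstar. ucs A & ~ cstar_facts A)"

definition bad_alg :: "'a cstar" where
 "bad_alg = (SOME A. ucs A & ~ cstar_facts A)"

lemma bad_alg: "bad TYPE('a) ==> ucs (bad_alg :: 'a cstar)" "bad TYPE('a) ==> ~ cstar_facts (bad_alg :: 'a cstar)"
 unfolding bad_def bad_alg_def by (metis (mono_tags, lifting) someI_ex)+

lemma bad_cstar: "bad TYPE('a) ==> cstar_algebra (bad_alg :: 'a cstar)"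
 using bad_alg(1) unfolding ucs_def by blast

typedef 'a calg = "if bad TYPE('a) then Inl ` C[bad_alg :: 'a cstar] else range (Inr :: complex => 'a + complex)"
proof (cases "bad TYPE('a)")
 case True
 thus ?thesis using ucs_one(1)[OF bad_alg(1)] by auto
qed auto

definition cl :: "'a calg => 'a" where "cl x = projl (Rep_calg x)"
definition cr :: "'a calg => complex" where "cr x = projr (Rep_calg x)"
definition mkl :: "'a => 'a calg" where "mkl x = Abs_calg (Inl x)"
definition mkr :: "complex => 'a calg" where "mkr x = Abs_calg (Inr x)"

lemma cl: "bad TYPE('a) ==> cl (x::'a calg) : C[bad_alg]" "bad TYPE('a) ==> mkl (cl x) = (x :: 'a calg)"
  "bad TYPE('a) ==> a : C[bad_alg] ==> cl (mkl a :: 'a calg) = a"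
 using Rep_calg[of x] Rep_calg_inverse[of x] by (auto simp: cl_def mkl_def Abs_calg_inverse)

lemma cr: "~ bad TYPE('a) ==> mkr (cr x) = (x :: 'a calg)" "~ bad TYPE('a) ==> cr (mkr a :: 'a calg) = a"
 using Rep_calg[of x] Rep_calg_inverse[of x] by (auto simp: cr_def mkr_def Abs_calg_inverse)

lemma calg_eqI: "(bad TYPE('a) ==> cl x = cl y) ==> (~ bad TYPE('a) ==> cr x = cr y) ==> x = (y :: 'a calg)"
 by (metis cl(2) cr(1))

instantiation calg :: (type) real_normed_algebra_1
begin

definition "x + y = (if bad TYPE('a) then mkl (cl x +[bad_alg] cl y) else mkr (cr x + cr y))" for x y :: "'a calg"
definition "x * y = (if bad TYPE('a) then mkl (cl x *[bad_alg] cl y) else mkr (cr x * cr y))" for x y :: "'a calg"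
definition "x - y = (if bad TYPE('a) then mkl (cl x -[bad_alg] cl y) else mkr (cr x - cr y))" for x y :: "'a calg"
definition "- x = (if bad TYPE('a) then mkl (\<ominus>\<^bsub>bad_alg\<^esub> cl x) else mkr (- cr x))" for x :: "'a calg"
definition "0 = (if bad TYPE('a) then mkl \<zero>[bad_alg] else mkr 0 :: 'a calg)"
definition "1 = (if bad TYPE('a) then mkl \<one>[bad_alg] else mkr 1 :: 'a calg)"
definition "r *R x = (if bad TYPE('a) then mkl (complex_of_real r \<odot>[bad_alg] cl x) else mkr (complex_of_real r * cr x))" for x :: "'a calg"
definition "norm x = (if bad TYPE('a) then N[bad_alg] (cl x) else norm (cr x))" for x :: "'a calg"
definition "sgn x = inverse (norm x) *R x" for x :: "'a calg"
definition "dist x y = norm (x - y)" for x y :: "'a calg"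
definition "uniformity = (INF e\<in>{0 <..}. principal {(x::'a calg, y). dist x y < e})"
definition "open U = (ALL x:U. \<forall>\<^sub>F (x', y) in uniformity. x' = x --> y : U)" for U :: "'a calg set"

lemma cl_hom: fixes x y :: "'a calg" assumes "bad TYPE('a)"
 shows "cl (x + y) = cl x +[bad_alg] cl y" "cl (x * y) = cl x *[bad_alg] cl y" "cl (x - y) = cl x -[bad_alg] cl y"
  "cl (- x) = \<ominus>\<^bsub>bad_alg\<^esub> cl x" "cl (0 :: 'a calg) = \<zero>[bad_alg]" "cl (1 :: 'a calg) = \<one>[bad_alg]"
  "cl (r *R x) = complex_of_real r \<odot>[bad_alg] cl x" "norm x = N[bad_alg] (cl x)"
proof -
 interpret cstar_algebra "bad_alg :: 'a cstar" by (rule bad_cstar[OF assms])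
 show "cl (x + y) = cl x +[bad_alg] cl y" "cl (x * y) = cl x *[bad_alg] cl y" "cl (x - y) = cl x -[bad_alg] cl y"
  "cl (- x) = \<ominus>\<^bsub>bad_alg\<^esub> cl x" "cl (0 :: 'a calg) = \<zero>[bad_alg]" "cl (1 :: 'a calg) = \<one>[bad_alg]"
  "cl (r *R x) = complex_of_real r \<odot>[bad_alg] cl x" "norm x = N[bad_alg] (cl x)" for x y :: "'a calg"
  using assms cl(1)[OF assms] ucs_one(1)[OF bad_alg(1)[OF assms]]
  by (auto simp: plus_calg_def times_calg_def minus_calg_def uminus_calg_def zero_calg_def one_calg_def scaleR_calg_def norm_calg_def cl(3))
qed

lemma cr_hom: fixes x y :: "'a calg" assumes "~ bad TYPE('a)"
 shows "cr (x + y) = cr x + cr y" "cr (x * y) = cr x * cr y" "cr (x - y) = cr x - cr y"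
  "cr (- x) = - cr x" "cr (0 :: 'a calg) = 0" "cr (1 :: 'a calg) = 1"
  "cr (r *R x) = complex_of_real r * cr x" "norm x = cmod (cr x)"
 using assms
 by (auto simp: plus_calg_def times_calg_def minus_calg_def uminus_calg_def zero_calg_def one_calg_def scaleR_calg_def norm_calg_def cr(2))

instance
proof
 fix a b c x y :: "'a calg" and r s :: real
 note B = bad_cstar[where 'a='a] and c1 = cl(1)[where 'a='a]
 note M = module.axioms(2)[OF cstar_algebra.axioms(1)[OF B]]
 note ag = abelian_group.axioms(1)
 note alg = cl_hom cr_hom algebra_simps cstar_algebra.distr_left[OF B] cstar_algebra.distr_right[OF B] cstar_algebra.mult_assoc[OF B]
  cstar_algebra.smult_mult_left[OF B] cstar_algebra.smult_mult_right[OF B] cstar_algebra.sm_add_left[OF B] cstar_algebra.sm_add_right[OF B]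
  cstar_algebra.sm_assoc[OF B] cstar_algebra.sm_1[OF B] ucs_one[OF bad_alg(1)[where 'a='a]] c1
  abelian_monoid.a_assoc[OF ag[OF M]] abelian_monoid.a_comm[OF ag[OF M]] abelian_monoid.l_zero[OF ag[OF M]] abelian_group.l_neg[OF M] abelian_group.r_neg[OF M]
  a_minus_def cstar_algebra.sm_closed[OF B] abelian_group.a_inv_closed[OF M]
  cstar_algebra.norm_triangle[OF B] cstar_algebra.norm_mult[OF B] cstar_algebra.norm_smult[OF B]
 show "a + b + c = a + (b + c)" by (rule calg_eqI) (simp_all add: alg)
 show "a + b = b + a" by (rule calg_eqI) (simp_all add: alg)
 show "0 + a = a" by (rule calg_eqI) (simp_all add: alg)
 show "- a + a = 0" by (rule calg_eqI) (simp_all add: alg)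
 show "a - b = a + - b" by (rule calg_eqI) (simp_all add: alg)
 show "r *R (x + y) = r *R x + r *R y" by (rule calg_eqI) (simp_all add: alg)
 show "(r + s) *R x = r *R x + s *R x" by (rule calg_eqI) (simp_all add: alg)
 show "r *R s *R x = (r * s) *R x" by (rule calg_eqI) (simp_all add: alg flip: cstar_algebra.sm_assoc[OF B])
 show "1 *R x = x" by (rule calg_eqI) (simp_all add: alg)
 show "a * b * c = a * (b * c)" by (rule calg_eqI) (simp_all add: alg)
 show "(a + b) * c = a * c + b * c" by (rule calg_eqI) (simp_all add: alg)
 show "a * (b + c) = a * b + a * c" by (rule calg_eqI) (simp_all add: alg)
 show "r *R x * y = r *R (x * y)" by (rule calg_eqI) (simp_all add: alg)
 show "x * r *R y = r *R (x * y)" by (rule calg_eqI) (simp_all add: alg)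
 show "1 * a = a" "a * 1 = a" by (rule calg_eqI; simp add: alg)+
 show "(0::'a calg) ~= 1"
 proof
  assume "0 = (1 :: 'a calg)"
  hence "cl (0::'a calg) = cl 1" "cr (0::'a calg) = cr 1" by simp_all
  thus False by (cases "bad TYPE('a)") (simp_all add: cl_hom cr_hom ucs_one(5)[OF bad_alg(1)[where 'a='a], symmetric])
 qed
 show "sgn x = inverse (norm x) *R x" by (rule sgn_calg_def)
 show "dist x y = norm (x - y)" by (rule dist_calg_def)
 show "uniformity = (INF e\<in>{0 <..}. principal {(x::'a calg, y). dist x y < e})" by (rule uniformity_calg_def)
 show "open U = (ALL x:U. \<forall>\<^sub>F (x', y) in uniformity. x' = x --> y : U)" for U :: "'a calg set" by (rule open_calg_def)
 show "norm x = 0 \<longleftrightarrow> x = 0"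
 proof (cases "bad TYPE('a)")
  case True
  thus ?thesis using cstar_algebra.norm_eq_zero[OF B[OF True] c1[OF True], of x] by (metis calg_eqI cl_hom(5,8))
 next
  case False
  thus ?thesis using calg_eqI[of x 0] by (auto simp: cr_hom)
 qed
 show "norm (x + y) <= norm x + norm y" by (cases "bad TYPE('a)") (simp_all add: alg norm_triangle_ineq)
 show "norm (r *R x) = \<bar>r\<bar> * norm x" by (cases "bad TYPE('a)") (simp_all add: alg Real_Vector_Spaces.norm_mult)
 show "norm (x * y) <= norm x * norm y" by (cases "bad TYPE('a)") (simp_all add: alg Real_Vector_Spaces.norm_mult)
 show "norm (1 :: 'a calg) = 1" by (cases "bad TYPE('a)") (simp_all add: alg)
qed

end

lemma calg_complete: "Cauchy (s :: nat => 'a calg) ==> convergent s"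
proof (cases "bad TYPE('a)")
 case True
 interpret cstar_algebra "bad_alg :: 'a cstar" by (rule bad_cstar[OF True])
 note c = cl(1)[OF True]
 assume "Cauchy s"
 hence "EX x:C[bad_alg]. (%n. N[bad_alg] (cl (s n) -[bad_alg] x)) ~~> 0"
  by (intro cauchy_limit) (auto simp: c Cauchy_def dist_norm cl_hom[OF True])
 then obtain x where "x : C[bad_alg]" "(%n. N[bad_alg] (cl (s n) -[bad_alg] x)) ~~> 0" by blast
 hence "(%n. norm (s n - mkl x)) ~~> 0" by (simp add: cl_hom[OF True] cl(3)[OF True])
 hence "s ~~> mkl x" using LIM_zero_iff tendsto_norm_zero_iff by blast
 thus ?thesis by (auto simp: convergent_def)
next
 case False
 assume "Cauchy s"
 hence "Cauchy (%n. cr (s n))" by (simp add: Cauchy_def dist_norm cr_hom[OF False])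
 then obtain x where "(%n. cr (s n)) ~~> x" using Cauchy_convergent convergent_def by blast
 hence "(%n. norm (s n - mkr x)) ~~> 0"
  using LIM_zero_iff tendsto_norm_zero_iff by (fastforce simp: cr_hom[OF False] cr(2)[OF False])
 hence "s ~~> mkr x" using LIM_zero_iff tendsto_norm_zero_iff by blast
 thus ?thesis by (auto simp: convergent_def)
qed

instantiation calg :: (type) ucstar
begin

definition "adj x = (if bad TYPE('a) then mkl (star bad_alg (cl x)) else mkr (cnj (cr x)))" for x :: "'a calg"
definition "iu = (if bad TYPE('a) then mkl (\<i> \<odot>[bad_alg] \<one>[bad_alg]) else mkr \<i> :: 'a calg)"

lemma cl_adj: fixes x :: "'a calg" assumes "bad TYPE('a)" shows "cl (adj x) = star bad_alg (cl x)" "cl (iu :: 'a calg) = \<i> \<odot>[bad_alg] \<one>[bad_alg]"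
 using assms cstar_algebra.star_closed[OF bad_cstar[OF assms] cl(1)[OF assms]] cstar_algebra.sm_closed[OF bad_cstar[OF assms] ucs_one(1)[OF bad_alg(1)[OF assms]]]
 by (auto simp: adj_calg_def iu_calg_def cl(3))
lemma cr_adj: fixes x :: "'a calg" assumes "~ bad TYPE('a)" shows "cr (adj x) = cnj (cr x)" "cr (iu :: 'a calg) = \<i>"
 using assms by (auto simp: adj_calg_def iu_calg_def cr(2))

instance
proof
 show "Cauchy s ==> convergent s" for s :: "nat => 'a calg" by (rule calg_complete)
 fix x y :: "'a calg" and r :: real
 note B = bad_cstar[where 'a='a] and c1 = cl(1)[where 'a='a]
 note u = ucs_one[OF bad_alg(1)[where 'a='a]]
 note alg = cl_hom cr_hom cl_adj cr_adj c1 u cstar_algebra.star_add[OF B] cstar_algebra.star_mult[OF B] cstar_algebra.star_smult[OF B]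
  cstar_algebra.star_star[OF B] cstar_algebra.smult_mult_left[OF B] cstar_algebra.smult_mult_right[OF B] cstar_algebra.cstar_identity[OF B]
  cstar_algebra.sm_closed[OF B] cstar_algebra.sm_neg1[OF B, symmetric]
 show "adj (x + y) = adj x + adj y" by (rule calg_eqI) (simp_all add: alg)
 show "adj (r *R x) = r *R adj x" by (rule calg_eqI) (simp_all add: alg)
 show "adj (x * y) = adj y * adj x" by (rule calg_eqI) (simp_all add: alg)
 show "adj (adj x) = x" by (rule calg_eqI) (simp_all add: alg)
 show "adj (iu :: 'a calg) = - iu" by (rule calg_eqI) (simp_all add: alg flip: cstar_algebra.sm_assoc[OF B])
 show "iu * iu = (- 1 :: 'a calg)" by (rule calg_eqI) (simp_all add: alg flip: cstar_algebra.sm_assoc[OF B])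
 show "iu * x = x * iu" by (rule calg_eqI) (simp_all add: alg)
 show "norm (adj x * x) = (norm x)^2" by (cases "bad TYPE('a)") (simp_all add: alg Real_Vector_Spaces.norm_mult power2_eq_square)
qed

end

text \<open>If A violated the facts, so would \<open>bad_alg\<close>, and \<open>'a calg\<close>
  would be an isomorphic copy of it in the type class; there the facts are theorems, and the
  isomorphism carries them back.\<close>

theorem ucs_facts: assumes "ucs (A :: 'a cstar)" shows "cstar_facts A"
proof (rule ccontr)
 assume "~ cstar_facts A"
 hence b: "bad TYPE('a)" using assms by (auto simp: bad_def)
 interpret cstar_algebra "bad_alg :: 'a cstar" by (rule bad_cstar[OF b])
 note u = ucs_one[OF bad_alg(1)[OF b]]
 have "calg_iso (bad_alg :: 'a cstar) (mkl :: 'a => 'a calg) cl"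
 proof
  have inj: "mkl x = y \<longleftrightarrow> x = cl y" if "x : C[bad_alg]" for x and y :: "'a calg"
   using that cl(2,3)[OF b] by metis
  have e: "cl (emb c :: 'a calg) = c \<odot>[bad_alg] \<one>[bad_alg]" for c
  proof -
   have "cl (emb c :: 'a calg) = complex_of_real (Re c) \<odot>[bad_alg] \<one>[bad_alg] +[bad_alg] (complex_of_real (Im c) * \<i>) \<odot>[bad_alg] \<one>[bad_alg]"
    using u(1-3) by (simp add: emb_def of_real_def[where 'a="'a calg"] cl_hom[OF b] cl_adj[OF b] sm_assoc)
   also have "... = (complex_of_real (Re c) + complex_of_real (Im c) * \<i>) \<odot>[bad_alg] \<one>[bad_alg]"
    using u(1) by (simp add: sm_add_left)
   finally show ?thesis by (metis complex_eq mult.commute)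
  qed
  fix x y :: 'a and z :: "'a calg" and c :: complex
  show "ucs (bad_alg :: 'a cstar)" by (rule bad_alg(1)[OF b])
  show "cl z : C[bad_alg]" "mkl (cl z) = z" by (rule cl[OF b])+
  show "mkl \<one>[bad_alg] = (1 :: 'a calg)" using u by (simp add: inj cl_hom[OF b])
  assume x: "x : C[bad_alg]"
  let ?a = "mkl x :: 'a calg"
  show "cl ?a = x" by (rule cl(3)[OF b x])
  show "mkl (c \<odot>[bad_alg] x) = emb c * ?a" using x u by (simp add: inj e cl_hom[OF b] cl(3)[OF b] smult_mult_left)
  show "mkl (star bad_alg x) = adj ?a" using x by (simp add: inj cl_adj[OF b] cl(3)[OF b])
  show "norm ?a = N[bad_alg] x" using x by (simp add: cl_hom[OF b] cl(3)[OF b])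
  assume y: "y : C[bad_alg]"
  show "mkl (x +[bad_alg] y) = mkl x + (mkl y :: 'a calg)" "mkl (x *[bad_alg] y) = mkl x * (mkl y :: 'a calg)"
   using x y by (simp_all add: inj cl_hom[OF b] cl(3)[OF b])
 qed
 thus False using calg_iso.cstar_facts bad_alg(2)[OF b] by blast
qed

section \<open>Compact operators on the sequence space\<close>

text \<open>Insert for z a negative multiple of cnj \<beta>: the minimiser if \<gamma> > 0, and
  arbitrarily large multiples if \<gamma> = 0.\<close>

lemma quadratic_cs:
 fixes \<beta> :: complex
 assumes q: "!!z. 0 <= \<alpha> + 2 * Re (z * \<beta>) + (cmod z)^2 * \<gamma>" and a: "\<alpha> >= 0" and g: "\<gamma> >= 0"
 shows "(cmod \<beta>)^2 <= \<alpha> * \<gamma>"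
proof (cases "\<gamma> = 0")
 case True
 have b: "cmod \<beta> ^ 2 * t <= \<alpha>" for t :: real
 proof -
  have "Re (of_real (- (t/2)) * cnj \<beta> * \<beta>) = - (t/2) * (cmod \<beta>)^2"
   by (simp add: cmod_power2) (simp add: power2_eq_square algebra_simps)
  thus ?thesis using q[of "of_real (- (t/2)) * cnj \<beta>"] True by (simp add: mult.commute)
 qed
 have "cmod \<beta> = 0"
 proof (rule ccontr)
  assume "cmod \<beta> ~= 0"
  thus False using b[of "(\<alpha> + 1) / (cmod \<beta>)^2"] by simp
 qed
 thus ?thesis using True by simp
next
 case False
 have "Re (of_real (- (1/\<gamma>)) * cnj \<beta> * \<beta>) = - (1/\<gamma>) * (cmod \<beta>)^2"
  by (simp add: cmod_power2) (simp add: power2_eq_square field_simps)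
 hence "0 <= \<alpha> - 2 * ((cmod \<beta>)^2 / \<gamma>) + ((cmod \<beta>)^2 / \<gamma>)"
  using q[of "of_real (- (1/\<gamma>)) * cnj \<beta>"] g False by (simp add: norm_mult norm_divide power_mult_distrib power_divide power2_eq_square)
 thus ?thesis using g False by (simp add: field_simps)
qed

section \<open>Inner product, norm and completeness of the sequence space\<close>

lemma ell2D: "x : ell2 ==> summable (%i. (cmod (x i))^2)" by (simp add: ell2_def)

lemma ell2_ip_summable: assumes "x : ell2" "y : ell2" shows "summable (%i. cmod (x i * cnj (y i)))" "summable (%i. x i * cnj (y i))"
proof -
 show 1: "summable (%i. cmod (x i * cnj (y i)))"
 proof (rule summable_comparison_test')
  show "summable (%i. (cmod (x i))^2 + (cmod (y i))^2)" using assms by (intro summable_add ell2D)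
  show "norm (cmod (x n * cnj (y n))) <= (cmod (x n))^2 + (cmod (y n))^2" for n
  proof -
   have "0 <= cmod (x n) * cmod (y n)" by simp
   thus ?thesis using sum_squares_bound[of "cmod (x n)" "cmod (y n)"] unfolding norm_mult complex_mod_cnj real_norm_def by linarith
  qed
 qed
 show "summable (%i. x i * cnj (y i))" by (rule summable_norm_cancel[OF 1])
qed

lemma ell2_add [simp]: assumes "x : ell2" "y : ell2" shows "(%i. x i + y i) : ell2"
 unfolding ell2_def mem_Collect_eq
proof (rule summable_comparison_test')
 show "summable (%i. 2 * (cmod (x i))^2 + 2 * (cmod (y i))^2)" using assms by (intro summable_add summable_mult ell2D)
 show "norm ((cmod (x n + y n))^2) <= 2 * (cmod (x n))^2 + 2 * (cmod (y n))^2" for n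
 proof -
  have "(cmod (x n + y n))^2 <= (cmod (x n) + cmod (y n))^2" by (intro power_mono norm_triangle_ineq) auto
  also have "... <= 2 * (cmod (x n))^2 + 2 * (cmod (y n))^2"
   using sum_squares_bound[of "cmod (x n)" "cmod (y n)"] by (simp add: power2_sum)
  finally show ?thesis by simp
 qed
qed

lemma ell2_scale [simp]: "x : ell2 ==> (%i. c * x i) : ell2"
 unfolding ell2_def by (simp add: norm_mult power_mult_distrib summable_mult)
lemma ell2_uminus [simp]: "x : ell2 ==> (%i. - x i) : ell2" using ell2_scale[of x "-1"] by simp
lemma ell2_diff [simp]: "x : ell2 ==> y : ell2 ==> (%i. x i - y i) : ell2"
 using ell2_add[of x "%i. - y i"] by simp
lemma ell2_zero [simp]: "(%i. 0) : ell2" by (simp add: ell2_def)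

lemma ip_add: "x : ell2 ==> y : ell2 ==> z : ell2 ==> l2_ip (%i. x i + y i) z = l2_ip x z + l2_ip y z"
  "x : ell2 ==> y : ell2 ==> z : ell2 ==> l2_ip z (%i. x i + y i) = l2_ip z x + l2_ip z y"
 unfolding l2_ip_def by (simp_all add: suminf_add ell2_ip_summable algebra_simps)
lemma ip_diff: "x : ell2 ==> y : ell2 ==> z : ell2 ==> l2_ip (%i. x i - y i) z = l2_ip x z - l2_ip y z"
  "x : ell2 ==> y : ell2 ==> z : ell2 ==> l2_ip z (%i. x i - y i) = l2_ip z x - l2_ip z y"
 unfolding l2_ip_def by (simp_all add: suminf_diff ell2_ip_summable algebra_simps)
lemma ip_scale: "x : ell2 ==> z : ell2 ==> l2_ip (%i. c * x i) z = c * l2_ip x z"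
  "x : ell2 ==> z : ell2 ==> l2_ip z (%i. c * x i) = cnj c * l2_ip z x"
 unfolding l2_ip_def by (simp_all add: suminf_mult ell2_ip_summable mult.assoc mult.left_commute[of _ "cnj c"])
lemma ip_cnj: assumes "x : ell2" "y : ell2" shows "cnj (l2_ip x y) = l2_ip y x"
proof -
 have "(%i. cnj (x i * cnj (y i))) sums cnj (\<Sum>i. x i * cnj (y i))"
  using summable_sums[OF ell2_ip_summable(2)[OF assms]] by (simp only: sums_cnj)
 from sums_unique[OF this] show ?thesis by (simp add: l2_ip_def mult.commute)
qed
lemma norm_nonneg2 [simp]: "x : ell2 ==> l2_norm x >= 0"
 by (simp add: l2_norm_def suminf_nonneg ell2D)
lemma norm_sq: "x : ell2 ==> (l2_norm x)^2 = (\<Sum>i. (cmod (x i))^2)"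
 by (simp add: l2_norm_def suminf_nonneg ell2D)
lemma ip_self: assumes "x : ell2" shows "l2_ip x x = of_real ((l2_norm x)^2)"
proof -
 have "(%i. of_real ((cmod (x i))^2)) sums complex_of_real (\<Sum>i. (cmod (x i))^2)"
  by (intro sums_of_real summable_sums ell2D assms)
 from sums_unique[OF this] show ?thesis by (simp add: l2_ip_def norm_sq[OF assms] complex_norm_square[symmetric])
qed
lemma coord_le: assumes "x : ell2" shows "cmod (x i) <= l2_norm x"
proof -
 have "(cmod (x i))^2 <= (l2_norm x)^2"
  unfolding norm_sq[OF assms] using sum_le_suminf[OF ell2D[OF assms], of "{i}"] by simp
 thus ?thesis by (rule power2_le_imp_le[OF _ norm_nonneg2[OF assms]])
qed

lemma ip_cs: assumes "x : ell2" "y : ell2" shows "cmod (l2_ip x y) <= l2_norm x * l2_norm y"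
proof -
 have "(cmod (l2_ip y x))^2 <= (l2_norm x)^2 * (l2_norm y)^2"
 proof (rule quadratic_cs)
  fix z
  let ?a = "%i. x i + z * y i"
  have 1: "l2_ip ?a ?a = l2_ip x x + cnj z * cnj (l2_ip y x) + z * l2_ip y x + z * cnj z * l2_ip y y"
   using assms by (simp add: ip_add ip_scale ip_cnj algebra_simps)
  have "(l2_norm ?a)^2 = Re (l2_ip x x + cnj z * cnj (l2_ip y x) + z * l2_ip y x + z * cnj z * l2_ip y y)"
   using arg_cong[OF 1, of Re] assms by (subst (asm) ip_self) auto
  also have "... = (l2_norm x)^2 + 2 * Re (z * l2_ip y x) + (cmod z)^2 * (l2_norm y)^2"
   using assms by (simp add: ip_self complex_norm_square[symmetric])
  finally show "0 <= (l2_norm x)^2 + 2 * Re (z * l2_ip y x) + (cmod z)^2 * (l2_norm y)^2" by (metis zero_le_power2)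
 qed (use assms in auto)
 hence "cmod (l2_ip y x) <= l2_norm x * l2_norm y" using assms by (rule_tac power2_le_imp_le) (auto simp: power_mult_distrib)
 thus ?thesis using assms by (metis complex_mod_cnj ip_cnj)
qed

lemma l2_norm_zero [simp]: "l2_norm (%i. 0) = 0" by (simp add: l2_norm_def)
lemma l2_norm_scale: "x : ell2 ==> l2_norm (%i. c * x i) = cmod c * l2_norm x"
 unfolding l2_norm_def by (simp add: norm_mult power_mult_distrib suminf_mult ell2D real_sqrt_mult)
lemma l2_norm_minus: "l2_norm (%i. x i - y i) = l2_norm (%i. y i - x i)"
 unfolding l2_norm_def by (simp add: norm_minus_commute)
lemma l2_triangle: assumes "x : ell2" "y : ell2" shows "l2_norm (%i. x i + y i) <= l2_norm x + l2_norm y"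
proof -
 let ?a = "%i. x i + y i"
 have "(l2_norm ?a)^2 = Re (l2_ip ?a ?a)" using assms by (simp add: ip_self)
 also have "... = (l2_norm x)^2 + (l2_norm y)^2 + Re (l2_ip x y) + Re (l2_ip y x)"
  using assms by (simp only: ip_add ell2_add) (simp add: ip_self)
 also have "... <= (l2_norm x + l2_norm y)^2"
  using ip_cs[OF assms] ip_cs[OF assms(2,1)] complex_Re_le_cmod[of "l2_ip x y"] complex_Re_le_cmod[of "l2_ip y x"]
  by (simp add: power2_sum algebra_simps)
 finally show ?thesis using assms by simp
qed
lemma l2_eq_zero: "x : ell2 ==> l2_norm x = 0 ==> x = (%i. 0)"
 using coord_le[of x] by fastforce
lemma ell2_eqI: assumes "x : ell2" "y : ell2" "!!z. z : ell2 ==> l2_ip z x = l2_ip z y" shows "x = y"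
proof -
 let ?a = "%i. x i - y i"
 have "l2_ip ?a ?a = 0" using assms by (simp add: ip_diff)
 hence "l2_norm ?a = 0" using assms by (simp add: ip_self)
 from l2_eq_zero[OF _ this] show ?thesis using assms by (simp add: fun_eq_iff)
qed

lemma ell2_partial: assumes "!!n. (\<Sum>i<n. (cmod (x i))^2) <= c" shows "x : ell2" "l2_norm x <= sqrt c"
proof -
 have s: "summable (%i. (cmod (x i))^2)" using assms by (intro summableI_nonneg_bounded) auto
 thus "x : ell2" by (simp add: ell2_def)
 show "l2_norm x <= sqrt c" using suminf_le_const[OF s assms] by (simp add: l2_norm_def)
qed

text \<open>The limit is taken coordinatewise; bounds on finite partial sums pass to the limit and
  then to the whole series.\<close>

lemma ell2_complete:
 assumes s: "!!n. s n : ell2" and c: "!!e. e > 0 ==> EX N. ALL m>=N. ALL n>=N. l2_norm (%i. s m i - s n i) < e"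
 shows "EX y:ell2. (%n. l2_norm (%i. s n i - y i)) ~~> 0"
proof -
 have "Cauchy (%n. s n i)" for i
  unfolding Cauchy_def dist_norm
 proof (intro allI impI)
  fix e :: real assume "e > 0"
  then obtain N where N: "ALL m>=N. ALL n>=N. l2_norm (%i. s m i - s n i) < e" using c by blast
  show "EX M. ALL m>=M. ALL n>=M. cmod (s m i - s n i) < e"
  proof (intro exI[of _ N] allI impI)
   fix m n assume "m >= N" "n >= N"
   thus "cmod (s m i - s n i) < e" using N coord_le[OF ell2_diff[OF s[of m] s[of n]], of i] by fastforce
  qed
 qed
 hence "ALL i. EX l. (%n. s n i) ~~> l" using Cauchy_convergent convergent_def by blast
 then obtain y where y: "!!i. (%n. s n i) ~~> y i" by metis
 have k: "(%i. s m i - y i) : ell2 & l2_norm (%i. s m i - y i) <= e" if N: "ALL m>=N. ALL n>=N. l2_norm (%i. s m i - s n i) < e" "m >= N" "e > 0" for m N e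
 proof -
  have "(\<Sum>i<k. (cmod (s m i - y i))^2) <= e^2" for k
  proof (rule LIMSEQ_le_const2)
   show "(%n. \<Sum>i<k. (cmod (s m i - s n i))^2) ~~> (\<Sum>i<k. (cmod (s m i - y i))^2)" by (intro tendsto_intros y)
   show "EX N. ALL n>=N. (\<Sum>i<k. (cmod (s m i - s n i))^2) <= e^2"
   proof (intro exI[of _ N] allI impI)
    fix n assume "n >= N"
    have "(\<Sum>i<k. (cmod (s m i - s n i))^2) <= (l2_norm (%i. s m i - s n i))^2"
     unfolding norm_sq[OF ell2_diff[OF s s]] by (rule sum_le_suminf) (auto intro!: ell2D ell2_diff s)
    also have "... <= e^2" using N \<open>n >= N\<close> norm_nonneg2[OF ell2_diff[OF s s]] by (intro power_mono) (auto simp: less_imp_le)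
    finally show "(\<Sum>i<k. (cmod (s m i - s n i))^2) <= e^2" .
   qed
  qed
  from ell2_partial[of "%i. s m i - y i", OF this] show ?thesis using N by simp
 qed
 obtain N where "ALL m>=N. ALL n>=N. l2_norm (%i. s m i - s n i) < 1" using c[of 1] by auto
 from k[OF this order_refl] have "(%i. s N i - y i) : ell2" by simp
 from ell2_diff[OF s this, of N] have "y : ell2" by simp
 moreover have "(%n. l2_norm (%i. s n i - y i)) ~~> 0"
 proof (rule LIMSEQ_I)
  fix r :: real assume "r > 0"
  then obtain N where "ALL m>=N. ALL n>=N. l2_norm (%i. s m i - s n i) < r/2" using c[of "r/2"] by auto
  from k[OF this] have "l2_norm (%i. s n i - y i) < r" if "n >= N" for n using that \<open>r > 0\<close> by fastforce
  thus "EX no. ALL n>=no. norm (l2_norm (%i. s n i - y i) - 0) < r"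
   using \<open>y : ell2\<close> s by auto
 qed
 ultimately show ?thesis by blast
qed

definition trunc :: "nat => (nat => complex) => nat => complex" where
 "trunc n x = (%i. if i < n then x i else 0)"

lemma trunc_ell2 [simp]: "trunc n x : ell2"
 unfolding ell2_def mem_Collect_eq by (rule summable_finite[of "{..<n}"]) (auto simp: trunc_def)

lemma trunc_norm: "l2_norm (trunc n x) = sqrt (\<Sum>i<n. (cmod (x i))^2)"
 unfolding l2_norm_def by (subst suminf_finite[of "{..<n}"]) (auto simp: trunc_def)

lemma trunc_diff_norm_le: assumes "x : ell2" shows "l2_norm (%i. trunc n x i - x i) <= l2_norm x"
proof -
 have "(\<Sum>i<k. (cmod (trunc n x i - x i))^2) <= (l2_norm x)^2" for k
 proof -
  have "(\<Sum>i<k. (cmod (trunc n x i - x i))^2) <= (\<Sum>i<k. (cmod (x i))^2)" by (rule sum_mono) (auto simp: trunc_def)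
  also have "... <= (l2_norm x)^2" unfolding norm_sq[OF assms] by (rule sum_le_suminf) (auto intro!: ell2D assms)
  finally show ?thesis .
 qed
 from ell2_partial(2)[of "%i. trunc n x i - x i", OF this] show ?thesis using assms by simp
qed

lemma trunc_lim: assumes x: "x : ell2" shows "(%n. l2_norm (%i. trunc n x i - x i)) ~~> 0"
proof -
 let ?a = "\<Sum>i. (cmod (x i))^2"
 have "(l2_norm (%i. trunc n x i - x i))^2 = ?a - (\<Sum>i<n. (cmod (x i))^2)" for n
 proof -
  let ?b = "\<Sum>i. if i < n then (cmod (x i))^2 else 0"
  have "(l2_norm (%i. trunc n x i - x i))^2 = (\<Sum>i. (cmod (x i))^2 - (if i < n then (cmod (x i))^2 else 0))"
   using x by (subst norm_sq) (simp_all, auto simp: trunc_def intro!: suminf_cong)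
  also have "... = ?a - ?b"
   by (rule suminf_diff[symmetric]) (auto intro!: ell2D x summable_finite[of "{..<n}"])
  also have "?b = (\<Sum>i<n. (cmod (x i))^2)"
   by (subst suminf_finite[of "{..<n}"]) auto
  finally show ?thesis .
 qed
 moreover have "(%n. ?a - (\<Sum>i<n. (cmod (x i))^2)) ~~> ?a - ?a"
  by (intro tendsto_diff tendsto_const summable_LIMSEQ ell2D x)
 ultimately have "(%n. (l2_norm (%i. trunc n x i - x i))^2) ~~> 0" by simp
 thus ?thesis by simp
qed

section \<open>Compact operators and their adjoints\<close>

definition l2_lin :: "l2_op set" where
 "l2_lin = {T : ell2 \<rightarrow>\<^sub>E ell2. (ALL x : ell2. ALL y : ell2. T (%i. x i + y i) = (%i. T x i + T y i)) &
  (ALL c. ALL x : ell2. T (%i. c * x i) = (%i. c * T x i))}"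

definition l2_cvg :: "(nat => nat => complex) => (nat => complex) => bool" where
 "l2_cvg s y \<longleftrightarrow> y : ell2 & (%n. l2_norm (%i. s n i - y i)) ~~> 0"

lemma compact_ops_iff: "T : compact_ops \<longleftrightarrow> T : l2_lin &
  (ALL s. (ALL n. s n : ell2 & l2_norm (s n) <= 1) --> (EX r y. strict_mono (r :: nat => nat) & l2_cvg (%n. T (s (r n))) y))"
 unfolding compact_ops_def l2_lin_def l2_cvg_def by blast

lemma lin_closed [simp]: "T : l2_lin ==> x : ell2 ==> T x : ell2" by (auto simp: l2_lin_def)
lemma lin_add: "T : l2_lin ==> x : ell2 ==> y : ell2 ==> T (%i. x i + y i) = (%i. T x i + T y i)" by (auto simp: l2_lin_def)
lemma lin_scale: "T : l2_lin ==> x : ell2 ==> T (%i. c * x i) = (%i. c * T x i)" by (auto simp: l2_lin_def)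
lemma lin_diff: "T : l2_lin ==> x : ell2 ==> y : ell2 ==> T (%i. x i - y i) = (%i. T x i - T y i)"
 using lin_add[of T x "%i. - 1 * y i"] lin_scale[of T y "-1"] by simp
lemma lin_ext: "T : l2_lin ==> T : extensional ell2" unfolding l2_lin_def PiE_def by simp
lemma lin_eqI: "S : l2_lin ==> T : l2_lin ==> (!!x. x : ell2 ==> S x = T x) ==> S = T"
 by (rule extensionalityI[OF lin_ext lin_ext])
lemma linI: "(!!x. x : ell2 ==> F x : ell2) ==> (!!x y. x : ell2 ==> y : ell2 ==> F (%i. x i + y i) = (%i. F x i + F y i)) ==>
  (!!c x. x : ell2 ==> F (%i. c * x i) = (%i. c * F x i)) ==> (\<lambda>x\<in>ell2. F x) : l2_lin"
 by (auto simp: l2_lin_def)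

lemma compact_bounded: assumes T: "T : compact_ops"
 shows "EX c>=0. ALL x:ell2. l2_norm x <= 1 --> l2_norm (T x) <= c"
proof (rule ccontr)
 assume "~ ?thesis"
 then obtain s where s: "!!n. s n : ell2" "!!n. l2_norm (s n) <= 1" "!!n. real n < l2_norm (T (s n))" by (meson not_le of_nat_0_le_iff)
 obtain r y where r: "strict_mono (r :: nat => nat)" and y: "y : ell2" and lim: "(%n. l2_norm (%i. T (s (r n)) i - y i)) ~~> 0"
  using T s unfolding compact_ops_iff l2_cvg_def by meson
 obtain N where N: "!!n. n >= N ==> l2_norm (%i. T (s (r n)) i - y i) < 1"
  using order_tendstoD(2)[OF lim, of 1] unfolding eventually_sequentially by auto
 define n where "n = max N (nat \<lceil>1 + l2_norm y\<rceil>)"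
 have "l2_norm (%i. (T (s (r n)) i - y i) + y i) <= l2_norm (%i. T (s (r n)) i - y i) + l2_norm y"
  using T compact_ops_iff s y by (intro l2_triangle) auto
 hence "l2_norm (T (s (r n))) < 1 + l2_norm y" using N[of n] by (simp add: n_def)
 moreover have "real n >= 1 + l2_norm y" using real_nat_ceiling_ge[of "1 + l2_norm y"] by (simp add: n_def)
 moreover have "real n <= real (r n)" using seq_suble[OF r] by simp
 ultimately show False using s(3)[of "r n"] by linarith
qed

lemma compact_lin [simp]: "T : compact_ops ==> T : l2_lin" using compact_ops_iff by blast

lemma K_norm_bdd: assumes T: "T : compact_ops" shows "bdd_above {l2_norm (T x) | x. x : ell2 & l2_norm x <= 1}"
using compact_bounded[OF T] by auto

lemma K_norm_le: assumes "T : compact_ops" "!!x. x : ell2 ==> l2_norm x <= 1 ==> l2_norm (T x) <= c" shows "N[K_alg] T <= c"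
 unfolding K_alg_def by simp (rule cSup_least, use assms(2) in \<open>auto intro: exI[of _ "%i. 0"]\<close>)

lemma K_norm_ge1: assumes T: "T : compact_ops" "x : ell2" "l2_norm x <= 1" shows "l2_norm (T x) <= N[K_alg] T"
 unfolding K_alg_def by simp (rule cSup_upper[OF _ K_norm_bdd[OF T(1)]], use T in blast)

lemma K_norm_nonneg: "T : compact_ops ==> 0 <= N[K_alg] T"
 by (rule order_trans[OF norm_nonneg2 K_norm_ge1[of T "%i. 0"]]) auto

lemma K_norm_ge: assumes T: "T : compact_ops" "x : ell2" shows "l2_norm (T x) <= N[K_alg] T * l2_norm x"
proof (cases "l2_norm x = 0")
 case True
 thus ?thesis using l2_eq_zero[OF T(2)] lin_scale[of T x 0] T by simp
next
 case False
 define c where "c = l2_norm x"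
 have c: "c > 0" using False norm_nonneg2[OF T(2)] by (simp add: c_def)
 let ?a = "T (%i. of_real (1/c) * x i)"
 let ?b = "%i. of_real (1/c) * T x i"
 have "l2_norm (?a) <= N[K_alg] T"
  by (rule K_norm_ge1) (use T c in "auto simp: l2_norm_scale c_def[symmetric] norm_divide simp del: of_real_divide")
 also have "?a = ?b" using T by (intro lin_scale) auto
 also have "l2_norm ?b = 1/c * l2_norm (T x)" using c T by (subst l2_norm_scale) (auto simp: norm_divide)
 finally show ?thesis using c by (simp add: field_simps c_def)
qed

lemma cvg_comp: "strict_mono (r :: nat => nat) ==> l2_cvg s y ==> l2_cvg (%n. s (r n)) y"
 unfolding l2_cvg_def using LIMSEQ_subseq_LIMSEQ[of _ 0 r] by (auto simp: o_def)

lemma cvg_lin: assumes T: "T : l2_lin" and b: "c >= 0" "!!x. x : ell2 ==> l2_norm (T x) <= c * l2_norm x"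
  and s: "!!n. s n : ell2" "l2_cvg s y"
 shows "l2_cvg (%n. T (s n)) (T y)"
 unfolding l2_cvg_def
proof (intro conjI)
 have y: "y : ell2" and l: "(%n. l2_norm (%i. s n i - y i)) ~~> 0" using s(2) by (auto simp: l2_cvg_def)
 show "T y : ell2" using T y by simp
 have "l2_norm (%i. T (s n) i - T y i) <= c * l2_norm (%i. s n i - y i)" for n
  using b(2)[of "%i. s n i - y i"] s(1) y T by (simp add: lin_diff)
 moreover have "(%n. c * l2_norm (%i. s n i - y i)) ~~> 0" using tendsto_mult_right_zero[OF l] .
 ultimately show "(%n. l2_norm (%i. T (s n) i - T y i)) ~~> 0"
  by (rule_tac real_tendsto_sandwich[OF _ _ tendsto_const]) (use T y s in "auto intro!: always_eventually")
qed

lemma cvg_add: assumes "l2_cvg s y" "l2_cvg t z" "!!n. s n : ell2" "!!n. t n : ell2" shows "l2_cvg (%n i. s n i + t n i) (%i. y i + z i)"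
 unfolding l2_cvg_def
proof (intro conjI)
 have y: "y : ell2" "z : ell2" and l: "(%n. l2_norm (%i. s n i - y i)) ~~> 0" "(%n. l2_norm (%i. t n i - z i)) ~~> 0"
  using assms by (auto simp: l2_cvg_def)
 show "(%i. y i + z i) : ell2" using y by simp
 have "l2_norm (%i. s n i + t n i - (y i + z i)) <= l2_norm (%i. s n i - y i) + l2_norm (%i. t n i - z i)" for n
  using l2_triangle[of "%i. s n i - y i" "%i. t n i - z i"] assms(3,4) y by (simp add: algebra_simps)
 moreover have "(%n. l2_norm (%i. s n i - y i) + l2_norm (%i. t n i - z i)) ~~> 0" using tendsto_add_zero[OF l] .
 ultimately show "(%n. l2_norm (%i. s n i + t n i - (y i + z i))) ~~> 0"
  by (rule_tac real_tendsto_sandwich[OF _ _ tendsto_const]) (use y assms(3,4) in "auto intro!: always_eventually")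
qed

lemma K_carrier: "C[K_alg] = compact_ops" by (simp add: K_alg_def)

lemma K_add: assumes "S : compact_ops" "T : compact_ops" shows "S +[K_alg] T : compact_ops" "x : ell2 ==> (S +[K_alg] T) x = (%i. S x i + T x i)"
proof -
 have e: "S +[K_alg] T = (\<lambda>x\<in>ell2. %i. S x i + T x i)" by (simp add: K_alg_def)
 thus "x : ell2 ==> (S +[K_alg] T) x = (%i. S x i + T x i)" by simp
 have "S +[K_alg] T : l2_lin" unfolding e by (rule linI) (use assms in "auto simp: lin_add lin_scale algebra_simps")
 moreover have "EX r y. strict_mono (r :: nat => nat) & l2_cvg (%n. (S +[K_alg] T) (s (r n))) y" if s: "ALL n. s n : ell2 & l2_norm (s n) <= 1" for s
 proof -
  obtain r y where r: "strict_mono (r :: nat => nat)" "l2_cvg (%n. S (s (r n))) y" using assms(1) s unfolding compact_ops_iff by meson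
  obtain r' y' where r': "strict_mono (r' :: nat => nat)" "l2_cvg (%n. T (s (r (r' n)))) y'"
   using assms(2)[unfolded compact_ops_iff, THEN conjunct2, rule_format, of "%n. s (r n)"] s by auto
  have "l2_cvg (%n i. S (s (r (r' n))) i + T (s (r (r' n))) i) (%i. y i + y' i)" using cvg_comp[OF r'(1) r(2)] r'(2) s assms by (intro cvg_add) auto
  thus ?thesis using s strict_mono_o[OF r(1) r'(1)] by (intro exI[of _ "r \<circ> r'"] exI[of _ "%i. y i + y' i"]) (simp add: e)
 qed
 ultimately show "S +[K_alg] T : compact_ops" by (simp add: compact_ops_iff)
qed

lemma comp_compact: assumes S: "S : l2_lin" "c >= 0" "!!x. x : ell2 ==> l2_norm (S x) <= c * l2_norm x" and T: "T : compact_ops"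
 shows "(\<lambda>x\<in>ell2. S (T x)) : compact_ops"
proof -
 let ?a = "\<lambda>x\<in>ell2. S (T x)"
 have "?a : l2_lin" by (rule linI) (use S(1) T in "auto simp: lin_add lin_scale")
 moreover have "EX r y. strict_mono (r :: nat => nat) & l2_cvg (%n. ?a (s (r n))) y" if s: "ALL n. s n : ell2 & l2_norm (s n) <= 1" for s
 proof -
  obtain r y where r: "strict_mono (r :: nat => nat)" "l2_cvg (%n. T (s (r n))) y" using T s unfolding compact_ops_iff by meson
  have "l2_cvg (%n. S (T (s (r n)))) (S y)" using s T by (intro cvg_lin[OF S _ r(2)]) auto
  thus ?thesis using s r by auto
 qed
 ultimately show ?thesis by (simp add: compact_ops_iff)
qed

lemma K_mult: assumes "S : compact_ops" "T : compact_ops" shows "S *[K_alg] T : compact_ops" "x : ell2 ==> (S *[K_alg] T) x = S (T x)"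
 using comp_compact[OF compact_lin[OF assms(1)] K_norm_nonneg[OF assms(1)] K_norm_ge[OF assms(1)] assms(2)] by (simp_all add: K_alg_def)

lemma K_smult: assumes "T : compact_ops" shows "c \<odot>[K_alg] T : compact_ops" "x : ell2 ==> (c \<odot>[K_alg] T) x = (%i. c * T x i)"
proof -
 define M where "M = (\<lambda>x\<in>ell2. %i::nat. c * x i)"
 have e: "c \<odot>[K_alg] T = (\<lambda>x\<in>ell2. M (T x))"
  using assms by (auto simp: K_alg_def restrict_def fun_eq_iff M_def)
 have "M : l2_lin" unfolding M_def by (rule linI) (auto simp: algebra_simps)
 thus "c \<odot>[K_alg] T : compact_ops" unfolding e
  by (rule comp_compact[where c="cmod c"]) (auto simp: l2_norm_scale assms M_def)
 show "x : ell2 ==> (c \<odot>[K_alg] T) x = (%i. c * T x i)" by (simp add: K_alg_def)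
qed

lemma K_zero: "\<zero>[K_alg] : compact_ops" "x : ell2 ==> \<zero>[K_alg] x = (%i. 0)"
proof -
 let ?a = "\<lambda>x\<in>ell2. %i. 0"
 have "?a : compact_ops" unfolding compact_ops_iff
 proof (intro conjI allI impI)
  show "?a : l2_lin" by (rule linI) auto
  show "EX r y. strict_mono (r::nat=>nat) & l2_cvg (%n. ?a (s (r n))) y" if "ALL n. s n : ell2 & l2_norm (s n) <= 1" for s
   using that by (intro exI[of _ "%n. n"] exI[of _ "%i. 0"]) (auto simp: l2_cvg_def strict_mono_def)
 qed
 thus "\<zero>[K_alg] : compact_ops" by (simp add: K_alg_def)
 show "x : ell2 ==> \<zero>[K_alg] x = (%i. 0)" by (simp add: K_alg_def)
qed

text \<open>The adjoint S is written down by its coordinates; testing T against truncations of S y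
  bounds it. Compactness is Schauder's argument: the squared norm of S d is the inner product of T
  (S d) and d, so convergence of T S along a subsequence forces convergence of S.\<close>

lemma K_adjoint_exists:
 assumes T: "T : compact_ops"
 shows "EX S:compact_ops. ALL x:ell2. ALL y:ell2. l2_ip (T x) y = l2_ip x (S y)"
proof -
 define \<delta> :: "nat => nat => complex" where "\<delta> n = (%i. if i = n then 1 else 0)" for n
 have \<delta>2 [simp]: "\<delta> n : ell2" for n
 proof -
  have "trunc (Suc n) (\<delta> n) = \<delta> n" by (auto simp: trunc_def \<delta>_def)
  thus ?thesis by (metis trunc_ell2)
 qed
 have Tl: "T : l2_lin" using T by simp
 define C where "C = N[K_alg] T"
 have C: "C >= 0" "!!x. x : ell2 ==> l2_norm (T x) <= C * l2_norm x" using K_norm_nonneg[OF T] K_norm_ge[OF T] by (auto simp: C_def)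
 define S where "S y i = cnj (l2_ip (T (\<delta> i)) y)" for y i
 have fin: "l2_ip (T (trunc n x)) y = (\<Sum>i<n. x i * cnj (S y i))" if y: "y : ell2" for x y n
 proof (induction n)
  case 0
  show ?case using lin_scale[OF Tl \<delta>2, of 0] by (simp add: trunc_def l2_ip_def)
 next
  case (Suc n)
  have "trunc (Suc n) x = (%i. trunc n x i + x n * \<delta> n i)" by (auto simp: trunc_def \<delta>_def fun_eq_iff less_Suc_eq)
  thus ?case using lin_add[OF Tl, of "trunc n x" "%i. x n * \<delta> n i"] lin_scale[OF Tl \<delta>2] Suc y Tl by (simp add: ip_add ip_scale S_def)
 qed
 have Sb: "S y : ell2 & l2_norm (S y) <= C * l2_norm y" if y: "y : ell2" for y
 proof -
  let ?f = "C * l2_norm y"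
  have "(\<Sum>i<n. (cmod (S y i))^2) <= ?f^2" for n
  proof -
   let ?c = "trunc n (S y)"
   define q where "q = l2_norm ?c"
   have q: "q >= 0" "q^2 = (\<Sum>i<n. (cmod (S y i))^2)" by (simp_all add: q_def trunc_norm sum_nonneg)
   have "complex_of_real (q^2) = l2_ip (T ?c) y" unfolding fin[OF y] q(2) by (simp only: of_real_sum complex_norm_square)
   hence "q^2 = cmod (l2_ip (T ?c) y)" by (metis abs_of_nonneg norm_of_real zero_le_power2)
   also have "... <= l2_norm (T ?c) * l2_norm y" using y Tl by (intro ip_cs) auto
   also have "... <= (C * q) * l2_norm y" using C(2)[of "trunc n (S y)"] y by (intro mult_right_mono) (auto simp: q_def)
   finally have "q * q <= ?f * q" by (simp add: power2_eq_square mult_ac)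
   hence "q^2 <= ?f^2" using q(1) by (cases "q = 0") auto
   thus ?thesis using q(2) by simp
  qed
  from ell2_partial[of "S y", OF this] show ?thesis using C(1) y by simp
 qed
 have adj: "l2_ip (T x) y = l2_ip x (S y)" if x: "x : ell2" and y: "y : ell2" for x y
 proof -
  have "l2_cvg (%n. T (trunc n x)) (T x)" using trunc_lim[OF x] x by (intro cvg_lin[OF Tl C]) (auto simp: l2_cvg_def)
  hence l: "(%n. l2_norm (%i. T (trunc n x) i - T x i) * l2_norm y) ~~> 0" unfolding l2_cvg_def using tendsto_mult_left_zero by blast
  let ?b = "%n. \<Sum>i<n. x i * cnj (S y i)"
  have "(%n. l2_ip (T (trunc n x)) y - l2_ip (T x) y) ~~> 0"
   by (rule Lim_null_comparison[OF _ l]) (use ip_cs[OF ell2_diff[OF lin_closed[OF Tl] lin_closed[OF Tl]] y] x y Tl in "auto intro!: always_eventually simp: ip_diff[symmetric]")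
  hence "?b ~~> l2_ip (T x) y" unfolding fin[OF y] LIM_zero_iff .
  moreover have "?b ~~> l2_ip x (S y)" unfolding l2_ip_def
   using x Sb[OF y] by (intro summable_LIMSEQ ell2_ip_summable) auto
  ultimately show ?thesis using LIMSEQ_unique by blast
 qed
 define S' where "S' = (\<lambda>y\<in>ell2. S y)"
 have S'l: "S' : l2_lin" unfolding S'_def by (rule linI) (use Tl Sb in "auto simp: S_def ip_add ip_scale fun_eq_iff")
 have "EX r y. strict_mono (r :: nat => nat) & l2_cvg (%n. S' (s (r n))) y" if s: "ALL n. s n : ell2 & l2_norm (s n) <= 1" for s
 proof -
  \<comment> \<open>S (s n) scaled into the unit ball, where compactness of T yields a subsequence;
    C + 1 rather than C avoids dividing by 0.\<close>
  define t where "t n = (%i. of_real (1 / (C + 1)) * S (s n) i)" for n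
  have t2: "t n : ell2" for n using s Sb unfolding t_def by (intro ell2_scale) auto
  have "l2_norm (t n) <= 1" for n
  proof -
   let ?d = "l2_norm (S (s n))"
   have "?d <= C * l2_norm (s n)" using s Sb by simp
   also have "... <= C * 1" using s C(1) by (intro mult_left_mono) auto
   finally have "?d <= C + 1" by simp
   moreover have "l2_norm (t n) = 1 / (C + 1) * ?d"
   proof -
    have "cmod (complex_of_real (1 / (C + 1))) = 1 / (C + 1)" unfolding norm_of_real using C(1) by simp
    thus ?thesis unfolding t_def by (subst l2_norm_scale) (use s Sb in auto)
   qed
   ultimately show ?thesis using C(1) by simp
  qed
  then obtain r y where r: "strict_mono (r :: nat => nat)" "l2_cvg (%n. T (t (r n))) y" using T t2 unfolding compact_ops_iff by meson
  have y: "y : ell2" and l: "(%n. l2_norm (%i. T (t (r n)) i - y i)) ~~> 0" using r(2) by (auto simp: l2_cvg_def)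
  have key: "(l2_norm (%i. S (s m) i - S (s n) i))^2 <= 2 * (C + 1) * l2_norm (%i. T (t m) i - T (t n) i)" for m n
  proof -
   define d where "d = (%i. s m i - s n i)"
   have d: "d : ell2" using s by (simp add: d_def)
   have "l2_norm d <= l2_norm (s m) + l2_norm (s n)"
    using s l2_triangle[of "s m" "%i. - 1 * s n i"] l2_norm_scale[of "s n" "-1"] by (simp add: d_def)
   hence d': "l2_norm d <= 2" using s[rule_format, of m] s[rule_format, of n] by linarith
   have Sd: "(%i. S (s m) i - S (s n) i) = S d" using s Tl by (auto simp: S_def d_def ip_diff fun_eq_iff)
   let ?e = "%i. t m i - t n i"
   have tt: "?e = (%i. of_real (1/(C+1)) * S d i)" by (simp add: t_def Sd[symmetric] algebra_simps fun_eq_iff)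
   let ?a = "l2_norm (T (S d))"
   have "T ?e = (%i. of_real (1/(C+1)) * T (S d) i)" unfolding tt using Sb[OF d] by (intro lin_scale[OF Tl]) auto
   hence e: "l2_norm (%i. T (t m) i - T (t n) i) = 1/(C+1) * ?a"
    using C(1) Sb[OF d] Tl t2 by (simp add: lin_diff[OF Tl, symmetric] l2_norm_scale norm_divide del: of_real_divide)
   have "complex_of_real ((l2_norm (S d))^2) = l2_ip (S d) (S d)" using Sb[OF d] by (simp add: ip_self)
   also have "... = l2_ip (T (S d)) d" using adj[of "S d" d] Sb[OF d] d by simp
   finally have "(l2_norm (S d))^2 = cmod (l2_ip (T (S d)) d)" by (metis abs_of_nonneg norm_of_real zero_le_power2)
   also have "... <= ?a * l2_norm d" using Sb[OF d] d Tl by (intro ip_cs) auto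
   also have "... <= ?a * 2" using Sb[OF d] d' Tl by (intro mult_left_mono) auto
   also have "... = 2 * (C + 1) * (1 / (C + 1) * ?a)"
   using C(1) by (simp add: field_simps)
   finally show ?thesis unfolding Sd e .
  qed
  have "EX N. ALL m>=N. ALL n>=N. l2_norm (%i. S (s (r m)) i - S (s (r n)) i) < e" if e: "e > 0" for e
  proof -
   \<comment> \<open>Chosen so that 2 (C + 1) times 2 h, the bound on the squared norm from
     \<open>key\<close>, equals e^2.\<close>
   define h where "h = e^2 / (4 * (C + 1))"
   have h: "h > 0" using e C(1) by (simp add: h_def)
   obtain N where N: "!!n. n >= N ==> l2_norm (%i. T (t (r n)) i - y i) < h"
    using order_tendstoD(2)[OF l h] unfolding eventually_sequentially by auto
   have "l2_norm (%i. S (s (r m)) i - S (s (r n)) i) < e" if "m >= N" "n >= N" for m n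
   proof -
    have "2 * (C+1) * l2_norm (%i. T (t (r m)) i - T (t (r n)) i) < 2 * (C+1) * (2 * h)" using l2_triangle[of "%i. T (t (r m)) i - y i" "%i. y i - T (t (r n)) i"] y t2 Tl N[OF that(1)] N[OF that(2)] l2_norm_minus[of y] C(1) by simp
    also have "... = e^2" using C(1) by (simp add: h_def field_simps)
    finally have "(l2_norm (%i. S (s (r m)) i - S (s (r n)) i))^2 < e^2" using key[of "r m" "r n"] by linarith
    thus ?thesis using e by (rule_tac power2_less_imp_less) auto
   qed
   thus ?thesis by blast
  qed
  then obtain z where "z : ell2" "(%n. l2_norm (%i. S (s (r n)) i - z i)) ~~> 0"
   using ell2_complete[of "%n. S (s (r n))"] s Sb by blast
  thus ?thesis using r s by (intro exI[of _ r] exI[of _ z]) (auto simp: l2_cvg_def S'_def)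
 qed
 hence "S' : compact_ops" using S'l by (simp add: compact_ops_iff)
 thus ?thesis using adj by (intro bexI[of _ S']) (auto simp: S'_def)
qed

lemma K_star: assumes T: "T : compact_ops"
 shows "star K_alg T : compact_ops" "x : ell2 ==> y : ell2 ==> l2_ip (T x) y = l2_ip x (star K_alg T y)"
  "S : compact_ops ==> (!!x y. x : ell2 ==> y : ell2 ==> l2_ip (T x) y = l2_ip x (S y)) ==> star K_alg T = S"
proof -
 define P where "P S \<longleftrightarrow> S : compact_ops & (ALL x : ell2. ALL y : ell2. l2_ip (T x) y = l2_ip x (S y))" for S
 have u: "S = S'" if "P S" "P S'" for S S'
 proof (rule lin_eqI)
  show "S y = S' y" if "y : ell2" for y
   using \<open>P S\<close> \<open>P S'\<close> that by (intro ell2_eqI) (auto simp: P_def)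
 qed (use that in "auto simp: P_def")
 obtain S0 where S0: "P S0" using K_adjoint_exists[OF T] unfolding P_def by blast
 have e: "star K_alg T = (THE S. P S)" by (simp add: K_alg_def P_def)
 have eq: "star K_alg T = S" if "P S" for S unfolding e using that u by blast
 show "star K_alg T : compact_ops" "x : ell2 ==> y : ell2 ==> l2_ip (T x) y = l2_ip x (star K_alg T y)" using eq[OF S0] S0 by (auto simp: P_def)
 show "S : compact_ops ==> (!!x y. x : ell2 ==> y : ell2 ==> l2_ip (T x) y = l2_ip x (S y)) ==> star K_alg T = S"
  by (rule eq) (simp add: P_def)
qed

text \<open>The properties of a factor that the tensor norm draws on, so that A and the compact
  operators are treated alike.\<close>

locale pre_star =
 fixes B :: "('b, 'm) cstar_scheme" (structure)
 assumes p_add [simp, intro]: "x : C[B] ==> y : C[B] ==> x +[B] y : C[B]"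
  and p_smult [simp, intro]: "x : C[B] ==> c \<odot> x : C[B]"
  and p_mult [simp, intro]: "x : C[B] ==> y : C[B] ==> x *[B] y : C[B]"
  and p_star [simp, intro]: "x : C[B] ==> star B x : C[B]"
  and p_zero [simp, intro]: "\<zero> : C[B]"
  and p_smult0: "x : C[B] ==> 0 \<odot> x = \<zero>"
  and p_smult1: "x : C[B] ==> 1 \<odot> x = x"
  and p_mult_assoc: "x : C[B] ==> y : C[B] ==> z : C[B] ==> (x *[B] y) *[B] z = x *[B] (y *[B] z)"
  and p_distr_left: "x : C[B] ==> y : C[B] ==> z : C[B] ==> (x +[B] y) *[B] z = x *[B] z +[B] y *[B] z"
  and p_distr_right: "x : C[B] ==> y : C[B] ==> z : C[B] ==> x *[B] (y +[B] z) = x *[B] y +[B] x *[B] z"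
  and p_smult_left: "x : C[B] ==> y : C[B] ==> (c \<odot> x) *[B] y = c \<odot> (x *[B] y)"
  and p_smult_right: "x : C[B] ==> y : C[B] ==> x *[B] (c \<odot> y) = c \<odot> (x *[B] y)"
  and p_star_star [simp]: "x : C[B] ==> star B (star B x) = x"
  and p_star_add: "x : C[B] ==> y : C[B] ==> star B (x +[B] y) = star B x +[B] star B y"
  and p_star_smult: "x : C[B] ==> star B (c \<odot> x) = cnj c \<odot> star B x"
  and p_star_mult: "x : C[B] ==> y : C[B] ==> star B (x *[B] y) = star B y *[B] star B x"
  and p_norm_nonneg [simp]: "x : C[B] ==> 0 <= N[B] x"
  and p_norm_smult: "x : C[B] ==> N[B] (c \<odot> x) = cmod c * N[B] x"
  and p_norm_mult: "x : C[B] ==> y : C[B] ==> N[B] (x *[B] y) <= N[B] x * N[B] y"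
  and p_norm_star [simp]: "x : C[B] ==> N[B] (star B x) = N[B] x"

lemmas K_simps = K_add K_mult K_smult K_zero K_star(1)

lemma K_eqI: "S : compact_ops ==> T : compact_ops ==> (!!x. x : ell2 ==> S x = T x) ==> S = T"
 by (rule lin_eqI) auto

lemma K_star2: "T : compact_ops ==> x : ell2 ==> y : ell2 ==> l2_ip (star K_alg T y) x = l2_ip y (T x)"
 using K_star(2)[of T x y] ip_cnj[of "T x" y] ip_cnj[of x "star K_alg T y"] by (simp add: K_star(1) compact_lin lin_closed)

lemma K_norm_star_le: assumes T: "T : compact_ops" shows "N[K_alg] (star K_alg T) <= N[K_alg] T"
proof (rule K_norm_le[OF K_star(1)[OF T]])
 fix y assume y: "y : ell2" "l2_norm y <= 1"
 define z where "z = star K_alg T y"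
 have z: "z : ell2" using K_star(1)[OF T] y by (simp add: z_def)
 have "complex_of_real ((l2_norm z)^2) = l2_ip y (T z)" using ip_self[OF z] K_star2[OF T z y(1)] by (simp add: z_def)
 hence "(l2_norm z)^2 = cmod (l2_ip y (T z))" by (metis abs_of_nonneg norm_of_real zero_le_power2)
 also have "... <= l2_norm y * l2_norm (T z)" using T y z by (intro ip_cs) auto
 also have "... <= 1 * (N[K_alg] T * l2_norm z)" using T y z K_norm_ge[OF T z] by (intro mult_mono) auto
 finally have "l2_norm z * l2_norm z <= N[K_alg] T * l2_norm z" by (simp add: power2_eq_square)
 thus "l2_norm (star K_alg T y) <= N[K_alg] T" using K_norm_nonneg[OF T] norm_nonneg2[OF z] by (cases "l2_norm z = 0") (auto simp: z_def)
qed

lemma K_norm_smult_le: assumes T: "T : compact_ops" shows "N[K_alg] (c \<odot>[K_alg] T) <= cmod c * N[K_alg] T"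
 by (rule K_norm_le) (use T K_norm_ge1[OF T] in "auto simp: K_simps l2_norm_scale intro: mult_left_mono")

lemma K_norm_add: assumes "S : compact_ops" "T : compact_ops" shows "N[K_alg] (S +[K_alg] T) <= N[K_alg] S + N[K_alg] T"
proof (rule K_norm_le)
 fix x assume x: "x : ell2" "l2_norm x <= 1"
 have "l2_norm (%i. S x i + T x i) <= l2_norm (S x) + l2_norm (T x)" using assms x by (intro l2_triangle) auto
 also have "... <= N[K_alg] S + N[K_alg] T" using assms x by (intro add_mono K_norm_ge1)
 finally show "l2_norm ((S +[K_alg] T) x) <= N[K_alg] S + N[K_alg] T" using assms x by (simp add: K_simps)
qed (use assms in "simp add: K_simps")

lemma K_norm_mult: assumes "S : compact_ops" "T : compact_ops" shows "N[K_alg] (S *[K_alg] T) <= N[K_alg] S * N[K_alg] T"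
proof (rule K_norm_le)
 fix x assume x: "x : ell2" "l2_norm x <= 1"
 have "l2_norm (S (T x)) <= N[K_alg] S * l2_norm (T x)" using assms x by (intro K_norm_ge) auto
 also have "... <= N[K_alg] S * N[K_alg] T" using assms x by (intro mult_left_mono K_norm_ge1 K_norm_nonneg)
 finally show "l2_norm ((S *[K_alg] T) x) <= N[K_alg] S * N[K_alg] T" using assms x by (simp add: K_simps)
qed (use assms in "simp add: K_simps")

lemma K_pre_star: "pre_star K_alg"
proof
 fix x y z :: l2_op and c :: complex
 show "\<zero>[K_alg] : C[K_alg]" by (simp add: K_carrier K_simps)
 assume "x : C[K_alg]"
 hence x: "x : compact_ops" by (simp add: K_carrier)
 show "c \<odot>[K_alg] x : C[K_alg]" "star K_alg x : C[K_alg]" "0 <= N[K_alg] x" using x by (simp_all add: K_carrier K_simps K_norm_nonneg)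
 show "0 \<odot>[K_alg] x = \<zero>[K_alg]" "1 \<odot>[K_alg] x = x" by (rule K_eqI; use x in "simp add: K_simps")+
 show ss: "star K_alg (star K_alg x) = x" by (rule K_star(3)) (use x in "auto simp: K_simps K_star2")
 let ?a = "c \<odot>[K_alg] x"
 show "star K_alg ?a = cnj c \<odot>[K_alg] star K_alg x"
  by (rule K_star(3)) (use x in "auto simp: K_simps K_star(2) ip_scale")
 show "N[K_alg] (star K_alg x) = N[K_alg] x" using K_norm_star_le[OF x] K_norm_star_le[OF K_star(1)[OF x]] ss by simp
 show "N[K_alg] ?a = cmod c * N[K_alg] x"
 proof (cases "c = 0")
  case True
  thus ?thesis using K_norm_smult_le[OF x, of 0] K_norm_nonneg[OF K_smult(1)[OF x, of 0]] by simp
 next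
  case False
  have "(1/c) \<odot>[K_alg] ?a = x" by (rule K_eqI) (use x False in "auto simp: K_simps")
  thus ?thesis using K_norm_smult_le[OF K_smult(1)[OF x], of "1/c" c] False K_norm_smult_le[OF x, of c] by (simp add: norm_divide field_simps)
 qed
 assume "y : C[K_alg]"
 hence y: "y : compact_ops" by (simp add: K_carrier)
 show "x +[K_alg] y : C[K_alg]" "x *[K_alg] y : C[K_alg]" using x y by (simp_all add: K_carrier K_simps)
 let ?b = "x *[K_alg] y"
 show "c \<odot>[K_alg] x *[K_alg] y = c \<odot>[K_alg] ?b" "x *[K_alg] (c \<odot>[K_alg] y) = c \<odot>[K_alg] ?b"
  by (rule K_eqI; use x y in "simp add: K_simps lin_scale")+
 show "star K_alg (x +[K_alg] y) = star K_alg x +[K_alg] star K_alg y"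
  by (rule K_star(3)) (use x y in "auto simp: K_simps K_star(2) ip_add")
 show "star K_alg ?b = star K_alg y *[K_alg] star K_alg x"
  by (rule K_star(3)) (use x y in "auto simp: K_simps K_star(2)")
 show "N[K_alg] ?b <= N[K_alg] x * N[K_alg] y" by (rule K_norm_mult[OF x y])
 assume "z : C[K_alg]"
 hence z: "z : compact_ops" by (simp add: K_carrier)
 show "x *[K_alg] y *[K_alg] z = x *[K_alg] (y *[K_alg] z)"
  "(x +[K_alg] y) *[K_alg] z = x *[K_alg] z +[K_alg] y *[K_alg] z"
  "x *[K_alg] (y +[K_alg] z) = x *[K_alg] y +[K_alg] x *[K_alg] z"
  by (rule K_eqI; use x y z in "simp add: K_simps lin_add")+
qed

text \<open>The partial isometry that carries the k coordinates from r on to those from l on.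
  \<open>win 0 0 k\<close> is the projection onto the first k coordinates, and
  \<open>win m 0 k\<close> moves them clear of the first m.\<close>

definition win :: "nat => nat => nat => l2_op" where
 "win l r k = (\<lambda>x\<in>ell2. %j. if l <= j & j < l + k then x (j - l + r) else 0)"

lemma win_ell2: assumes "x : ell2" shows "win l r k x : ell2"
proof -
 have "win l r k x = trunc (l + k) (%j. if l <= j then x (j - l + r) else 0)" using assms by (auto simp: win_def trunc_def fun_eq_iff)
 thus ?thesis by simp
qed

lemma win_apply: "x : ell2 ==> win l r k x = (%j. if l <= j & j < l + k then x (j - l + r) else 0)"
 by (simp add: win_def)

lemma win_norm: assumes x: "x : ell2" shows "l2_norm (win l r k x) <= l2_norm x"
proof -
 have "win l r k x = trunc (l + k) (%j. if l <= j then x (j - l + r) else 0)" using assms by (auto simp: win_def trunc_def fun_eq_iff)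
 hence "(l2_norm (win l r k x))^2 = (\<Sum>j<l + k. (cmod (if l <= j then x (j - l + r) else 0))^2)" by (simp add: trunc_norm sum_nonneg)
 also have "... = (\<Sum>j\<in>{l..<l + k}. (cmod (x (j - l + r)))^2)" by (rule sum.mono_neutral_cong_right) auto
 also have "... = (\<Sum>i\<in>{r..<r + k}. (cmod (x i))^2)"
  by (rule sum.reindex_bij_witness[of _ "%i. i - r + l" "%j. j - l + r"]) auto
 also have "... <= (l2_norm x)^2" unfolding norm_sq[OF x] by (rule sum_le_suminf) (auto intro!: ell2D x)
 finally show ?thesis using x by (rule_tac power2_le_imp_le) auto
qed

lemma win_lin: "win l r k : l2_lin"
 unfolding win_def by (rule linI) (use win_ell2 in "auto simp: win_def fun_eq_iff")

text \<open>Built up one coordinate at a time: a single coordinate of bounded vectors is a bounded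
  sequence of complex numbers and has a convergent subsequence.\<close>

lemma win_compact: "win l r k : compact_ops"
proof (induction k)
 case 0
 have "win l r 0 = \<zero>[K_alg]" by (rule lin_eqI[OF win_lin]) (auto simp: K_zero compact_lin, auto simp: win_def fun_eq_iff)
 thus ?case by (simp add: K_zero)
next
 case (Suc k)
 have "win (l + k) (r + k) 1 : compact_ops" unfolding compact_ops_iff
 proof (intro conjI win_lin allI impI)
  fix s :: "nat => nat => complex" assume s: "ALL n. s n : ell2 & l2_norm (s n) <= 1"
  have "bounded (range (%n. s n (r + k)))"
   using s coord_le by (intro boundedI[of _ 1]) (auto intro: order_trans)
  then obtain c q where q: "strict_mono (q :: nat => nat)" "((%n. s n (r + k)) \<circ> q) ~~> c"
   using bounded_imp_convergent_subsequence by blast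
  define y where "y = (%j. if j = l + k then c else 0)"
  have "y = trunc (Suc (l + k)) y" by (auto simp: y_def trunc_def)
  hence y: "y : ell2" by (metis trunc_ell2)
  have "l2_norm (%i. win (l + k) (r + k) 1 (s (q n)) i - y i) = cmod (s (q n) (r + k) - c)" for n
  proof -
   have "(%i. win (l + k) (r + k) 1 (s (q n)) i - y i) = trunc (Suc (l + k)) (%i. if i = l + k then s (q n) (r + k) - c else 0)"
    using s by (auto simp: win_def y_def trunc_def fun_eq_iff)
   thus ?thesis by (simp add: trunc_norm)
  qed
  moreover have "(%n. cmod (s (q n) (r + k) - c)) ~~> 0" using q(2) by (simp add: o_def LIM_zero tendsto_norm_zero)
  ultimately show "EX r' y. strict_mono (r' :: nat => nat) & l2_cvg (%n. win (l + k) (r + k) 1 (s (r' n))) y"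
   using q(1) y by (intro exI[of _ q] exI[of _ y]) (simp add: l2_cvg_def)
 qed
 hence "win l r k +[K_alg] win (l + k) (r + k) 1 : compact_ops" using Suc by (simp add: K_add)
 moreover have "win l r (Suc k) = win l r k +[K_alg] win (l + k) (r + k) 1"
  by (rule lin_eqI[OF win_lin]) (use calculation in "simp_all add: K_alg_def", auto simp: win_def fun_eq_iff less_Suc_eq add.commute)
 ultimately show ?case by simp
qed

lemma win_star: "star K_alg (win l r k) = win r l k"
proof (rule K_star(3)[OF win_compact win_compact])
 fix x y assume xy: "x : ell2" "y : ell2"
 have "l2_ip (win l r k x) y = (\<Sum>j\<in>{l..<l + k}. x (j - l + r) * cnj (y j))"
  unfolding l2_ip_def using xy by (subst suminf_finite[of "{l..<l + k}"]) (auto simp: win_def)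
 also have "... = (\<Sum>i\<in>{r..<r + k}. x i * cnj (y (i - r + l)))"
  by (rule sum.reindex_bij_witness[of _ "%i. i - r + l" "%j. j - l + r"]) auto
 also have "... = l2_ip x (win r l k y)"
  unfolding l2_ip_def using xy by (subst suminf_finite[of "{r..<r + k}"]) (auto simp: win_def)
 finally show "l2_ip (win l r k x) y = l2_ip x (win r l k y)" .
qed

lemma win_mult: "win l r k *[K_alg] win r s k = win l s k"
 by (rule K_eqI) (simp_all add: K_mult win_compact win_apply[OF win_ell2], auto simp: win_apply fun_eq_iff)

lemma win_trunc_mult: "l + k <= m ==> win 0 0 m *[K_alg] win l r k = win l r k" "m <= l ==> win 0 0 m *[K_alg] win l r k = \<zero>[K_alg]"
proof -
 show "win 0 0 m *[K_alg] win l r k = win l r k" if "l + k <= m"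
  by (rule K_eqI) (simp_all add: K_simps win_compact win_apply[OF win_ell2], use that in "auto simp: win_apply fun_eq_iff")
 show "win 0 0 m *[K_alg] win l r k = \<zero>[K_alg]" if "m <= l"
  by (rule K_eqI) (simp_all add: K_simps win_compact win_apply[OF win_ell2], use that in "auto simp: win_apply fun_eq_iff")
qed

lemma win_norm_le: "N[K_alg] (win l r k) <= 1"
 by (rule K_norm_le[OF win_compact]) (rule order_trans[OF win_norm])

lemma e11_win: "e11 = win 0 0 1"
 by (auto simp: e11_def win_def fun_eq_iff restrict_def)

lemma win_trunc: "x : ell2 ==> win 0 0 k x = trunc k x"
 by (auto simp: win_def trunc_def)

text \<open>Otherwise there are vectors of the unit ball whose images have tails above e beyond
  arbitrarily late cutoffs. These images converge along a subsequence to some y, whose own tails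
  tend to 0.\<close>

lemma K_trunc_left: assumes T: "T : compact_ops"
 shows "(%k. N[K_alg] (T +[K_alg] (-1) \<odot>[K_alg] (win 0 0 k *[K_alg] T))) ~~> 0"
proof -
 define D where "D k = T +[K_alg] (-1) \<odot>[K_alg] (win 0 0 k *[K_alg] T)" for k
 have Dc: "D k : compact_ops" for k using T by (simp add: D_def K_simps win_compact)
 have Dx: "D k x = (%i. T x i - trunc k (T x) i)" if "x : ell2" for k x using T that by (simp add: D_def K_simps win_compact win_trunc)
 have "EX N. ALL k>=N. N[K_alg] (D k) <= e" if e: "e > 0" for e
 proof (rule ccontr)
  assume "~ ?thesis"
  then obtain k x where kx: "!!n. k n >= n" "!!n. x n : ell2 & l2_norm (x n) <= 1" "!!n. l2_norm (D (k n) (x n)) > e" using K_norm_le[OF Dc] by (meson not_le)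
  obtain r y where r: "strict_mono (r :: nat => nat)" "l2_cvg (%n. T (x (r n))) y" using T kx(2) unfolding compact_ops_iff by meson
  have y: "y : ell2" and l: "(%n. l2_norm (%i. T (x (r n)) i - y i)) ~~> 0" using r(2) by (auto simp: l2_cvg_def)
  have "filterlim (%n. k (r n)) at_top sequentially"
   using seq_suble[OF r(1)] kx(1) by (intro filterlim_at_top_mono[OF filterlim_ident always_eventually]) (auto intro: order_trans)
  hence l2: "(%n. l2_norm (%i. trunc (k (r n)) y i - y i)) ~~> 0" by (rule filterlim_compose[OF trunc_lim[OF y]])
  have "e < l2_norm (%i. T (x (r n)) i - y i) + l2_norm (%i. trunc (k (r n)) y i - y i)" for n
  proof -
   define d where "d = (%i. T (x (r n)) i - y i)"
   define m where "m = k (r n)"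
   have d: "d : ell2" using T kx y by (simp add: d_def)
   let ?a = "%i. (d i - trunc m d i) + (y i - trunc m y i)"
   have "D m (x (r n)) = ?a" unfolding Dx[OF conjunct1[OF kx(2)]] by (auto simp: d_def trunc_def fun_eq_iff)
   hence "e < l2_norm ?a" using kx(3)[of "r n"] by (simp add: m_def)
   also have "... <= l2_norm (%i. d i - trunc m d i) + l2_norm (%i. y i - trunc m y i)" using d y by (intro l2_triangle) auto
   also have "... <= l2_norm d + l2_norm (%i. trunc m y i - y i)" using trunc_diff_norm_le[OF d, of m] l2_norm_minus[of d] l2_norm_minus[of y] by simp
   finally show ?thesis by (simp add: d_def m_def)
  qed
  moreover obtain n where "l2_norm (%i. T (x (r n)) i - y i) + l2_norm (%i. trunc (k (r n)) y i - y i) < e"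
   using order_tendstoD(2)[OF tendsto_add_zero[OF l l2] e] by force
  ultimately show False by (meson not_less_iff_gr_or_eq)
 qed
 hence "(%k. N[K_alg] (D k)) ~~> 0"
  by (intro LIMSEQ_I) (metis K_norm_nonneg[OF Dc] abs_of_nonneg diff_zero field_lbound_gt_zero le_less_trans real_norm_def)
 thus ?thesis by (simp add: D_def)
qed

text \<open>Truncation on the right is the adjoint of truncating the adjoint on the left, so both
  sides reduce to \<open>K_trunc_left\<close>.\<close>

lemma K_trunc: assumes T: "T : compact_ops"
 shows "(%k. N[K_alg] (T +[K_alg] (-1) \<odot>[K_alg] (win 0 0 k *[K_alg] T *[K_alg] win 0 0 k))) ~~> 0"
proof -
 interpret pre_star K_alg by (rule K_pre_star)
 note Kc = K_carrier
 define D where "D T k = T +[K_alg] (-1) \<odot>[K_alg] (win 0 0 k *[K_alg] T)" for k T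
 define E where "E k = T +[K_alg] (-1) \<odot>[K_alg] (T *[K_alg] win 0 0 k)" for k
 have W: "win 0 0 k : compact_ops" for k by (rule win_compact)
 let ?a = "D (star K_alg T)"
 have Dc: "D T k : compact_ops" "?a k : compact_ops" "E k : compact_ops" for k using T by (simp_all add: D_def E_def K_simps win_compact)
 have "T +[K_alg] (-1) \<odot>[K_alg] (win 0 0 k *[K_alg] T *[K_alg] win 0 0 k) = D T k +[K_alg] win 0 0 k *[K_alg] E k" for k
  by (rule K_eqI) (use T W in "auto simp: D_def E_def K_simps lin_diff[OF win_lin] fun_eq_iff")
 hence le: "N[K_alg] (T +[K_alg] (-1) \<odot>[K_alg] (win 0 0 k *[K_alg] T *[K_alg] win 0 0 k)) <= N[K_alg] (D T k) + N[K_alg] (?a k)" for k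
  using T W p_norm_star[unfolded K_carrier, OF Dc(3)] K_norm_add[OF Dc(1) K_mult(1)[OF W Dc(3)], of k k k] K_norm_mult[OF W Dc(3), of k k] mult_right_mono[OF win_norm_le[of 0 0 k] K_norm_nonneg[OF Dc(3)], of k] by (simp add: E_def D_def p_star_add p_star_smult p_star_mult win_star K_carrier K_simps)
 have "(%k. N[K_alg] (D T k) + N[K_alg] (?a k)) ~~> 0"
  unfolding D_def by (intro tendsto_add_zero K_trunc_left T K_star)
 thus ?thesis
  by (rule real_tendsto_sandwich[OF _ _ tendsto_const, rotated 2]) (use le T W in "auto intro!: always_eventually K_norm_nonneg simp: K_simps")
qed

text \<open>The vector state of the first basis vector; slicing the second tensor factor by it
  recovers A from its stabilisation.\<close>

definition vstate :: "l2_op => complex" where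
 "vstate T = T (%i. if i = 0 then 1 else 0) 0"

lemma e11_sandwich: assumes T: "T : compact_ops" shows "e11 *[K_alg] T *[K_alg] e11 = vstate T \<odot>[K_alg] e11"
proof (rule K_eqI)
 fix x assume x: "x : ell2"
 define \<delta> :: "nat => complex" where "\<delta> = (%i. if i = 0 then 1 else 0)"
 have "\<delta> = trunc 1 \<delta>" by (auto simp: \<delta>_def trunc_def)
 hence d: "\<delta> : ell2" by (metis trunc_ell2)
 have "trunc 1 x = (%i. x 0 * \<delta> i)" by (auto simp: \<delta>_def trunc_def)
 thus "(e11 *[K_alg] T *[K_alg] e11) x = (vstate T \<odot>[K_alg] e11) x"
  using lin_scale[OF compact_lin[OF T] d] x T d by (simp add: K_simps e11_win win_compact win_trunc[unfolded One_nat_def]) (auto simp: trunc_def vstate_def \<delta>_def fun_eq_iff)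
qed (use T in "auto simp: K_simps e11_win win_compact")

lemma vstate_state: "state K_alg vstate"
proof -
 define \<delta> :: "nat => complex" where "\<delta> = (%i. if i = 0 then 1 else 0)"
 have td: "\<delta> = trunc 1 \<delta>" by (auto simp: \<delta>_def trunc_def)
 hence d: "\<delta> : ell2" by (metis trunc_ell2)
 have nd: "l2_norm \<delta> = 1" by (subst td) (simp add: trunc_norm \<delta>_def)
 have v: "vstate T = T \<delta> 0" for T by (simp add: vstate_def \<delta>_def)
 have ip: "l2_ip x \<delta> = x 0" for x
  unfolding l2_ip_def by (subst suminf_finite[of "{0}"]) (auto simp: \<delta>_def)
 have b: "cmod (vstate T) <= 1" if "T : compact_ops" "N[K_alg] T <= 1" for T
  using coord_le[of "T \<delta>" 0] K_norm_ge1[OF that(1) d] nd that d by (simp add: v)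
 have "N[K_alg] e11 <= 1" "vstate e11 = 1" using win_norm_le by (simp_all add: e11_win) (simp add: v win_def d, simp add: \<delta>_def)
 hence "Sup {cmod (vstate x) |x. x : compact_ops & N[K_alg] x <= 1} = 1"
  using b win_compact[of 0 0 1] by (intro cSup_eq_maximum) (auto intro!: exI[of _ e11], simp add: e11_win)
 moreover have "vstate (star K_alg y *[K_alg] y) : \<real>\<^sub>\<ge>\<^sub>0" if y: "y : compact_ops" for y
 proof -
  show ?thesis using K_star2[OF y d, of "y \<delta>"] y d ip_self[of "y \<delta>"] by (simp add: v K_simps flip: ip)
 qed
 ultimately show ?thesis
  unfolding state_def K_carrier pos_def using b by (auto simp: v K_simps d intro!: bdd_aboveI[of _ 1])
qed

section \<open>Positive semidefinite matrices and a quadratic iteration\<close>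

lemma psd2:
 fixes \<alpha> \<beta> \<beta>' \<gamma> :: complex
 assumes q: "!!z. \<alpha> + z * \<beta> + cnj z * \<beta>' + z * cnj z * \<gamma> : \<real>\<^sub>\<ge>\<^sub>0" and a: "\<alpha> : \<real>\<^sub>\<ge>\<^sub>0" and g: "\<gamma> : \<real>\<^sub>\<ge>\<^sub>0"
 shows "\<beta>' = cnj \<beta>" "(cmod \<beta>)^2 <= Re \<alpha> * Re \<gamma>"
proof -
 have ag: "Im \<alpha> = 0" "Im \<gamma> = 0" "Re \<alpha> >= 0" "Re \<gamma> >= 0" using a g by (auto simp: complex_nonneg_Reals_iff)
 show e: "\<beta>' = cnj \<beta>" using q[of 1] q[of \<i>] ag by (simp add: complex_nonneg_Reals_iff complex_eq_iff)
 show "(cmod \<beta>)^2 <= Re \<alpha> * Re \<gamma>"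
 proof (rule quadratic_cs)
  fix z
  have "Re (\<alpha> + z * \<beta> + cnj z * \<beta>' + z * cnj z * \<gamma>) = Re \<alpha> + 2 * Re (z * \<beta>) + (cmod z)^2 * Re \<gamma>"
   unfolding e complex_norm_square[symmetric] by simp
  thus "0 <= Re \<alpha> + 2 * Re (z * \<beta>) + (cmod z)^2 * Re \<gamma>" using q[of z] by (metis complex_nonneg_Reals_iff)
 qed (use ag in auto)
qed

definition psd :: "'i set => ('i => 'i => complex) => bool" where
 "psd S M = (ALL c. (\<Sum>i\<in>S. \<Sum>j\<in>S. cnj (c i) * c j * M i j) : \<real>\<^sub>\<ge>\<^sub>0)"

lemma psd_subset: assumes "psd S M" "T <= S" "finite S" shows "psd T M"
 unfolding psd_def
proof
 fix c :: "'a => complex"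
 define c' where "c' i = (if i : T then c i else 0)" for i
 let ?a = "\<Sum>i\<in>T. \<Sum>j\<in>T. cnj (c i) * c j * M i j"
 have "(\<Sum>i\<in>S. \<Sum>j\<in>S. cnj (c' i) * c' j * M i j) = (\<Sum>i\<in>T. \<Sum>j\<in>S. cnj (c' i) * c' j * M i j)"
  by (rule sum.mono_neutral_right) (use assms in "auto simp: c'_def")
 also have "... = ?a"
  by (intro sum.cong refl sum.mono_neutral_cong_right) (use assms in "auto simp: c'_def")
 finally show "?a : \<real>\<^sub>\<ge>\<^sub>0" using assms(1)[unfolded psd_def, rule_format, of c'] by simp
qed

lemma psd_diag: assumes "psd S M" "finite S" "i : S" shows "M i i : \<real>\<^sub>\<ge>\<^sub>0"
 using psd_subset[OF assms(1) _ assms(2), of "{i}"] assms(3) unfolding psd_def by (auto dest: spec[of _ "%_. 1"])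

lemma psd_pair: assumes "psd S M" "finite S" "i : S" "j : S" shows "M j i = cnj (M i j)" "(cmod (M i j))^2 <= Re (M i i) * Re (M j j)"
proof -
 have "M j i = cnj (M i j) & (cmod (M i j))^2 <= Re (M i i) * Re (M j j)"
 proof (cases "i = j")
  case True
  thus ?thesis using psd_diag[OF assms(1-3)] by (auto simp: complex_nonneg_Reals_iff complex_eq_iff cmod_def power2_eq_square)
 next
  case False
  have p: "psd {i, j} M" by (rule psd_subset[OF assms(1) _ assms(2)]) (use assms in auto)
  have "M i i + z * M i j + cnj z * M j i + z * cnj z * M j j : \<real>\<^sub>\<ge>\<^sub>0" for z
   using p[unfolded psd_def, rule_format, of "%k. if k = i then 1 else z"] False by (simp add: algebra_simps)
  from psd2[OF this psd_diag[OF assms(1-3)] psd_diag[OF assms(1,2,4)]] show ?thesis by blast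
 qed
 thus "M j i = cnj (M i j)" "(cmod (M i j))^2 <= Re (M i i) * Re (M j j)" by auto
qed

text \<open>One row is eliminated at a time: M is its Schur complement M' plus a matrix of rank one.
  M' is again positive semidefinite, and the rank-one part contributes a positive multiple of the
  form of N at the k-th row of M.\<close>

lemma schur_product:
 assumes "finite S" "psd S M" "psd S N"
 shows "(\<Sum>i\<in>S. \<Sum>j\<in>S. M i j * N i j) : \<real>\<^sub>\<ge>\<^sub>0"
 using assms
proof (induction S arbitrary: M N rule: finite_induct)
 case (insert k S)
 let ?I = "insert k S"
 have fI: "finite ?I" using insert by simp
 have N: "psd S N" using psd_subset[OF insert.prems(2)] fI by blast
 note herm = psd_pair(1)[OF insert.prems(1) fI]
 show ?case
 proof (cases "M k k = 0")
  case True
  \<comment> \<open>A vanishing diagonal entry forces its row and column to vanish, by the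
    two-by-two minors.\<close>
  have z: "M k j = 0" "M j k = 0" if "j : ?I" for j using psd_pair(2)[OF insert.prems(1) fI _ that, of k] True that herm[of k j] by auto
  show ?thesis using insert(1,2) z insert.IH[OF psd_subset[OF insert.prems(1) _ fI] N] by auto
 next
  case False
  define m where "m = M k k"
  have m: "m ~= 0" "m : \<real>\<^sub>\<ge>\<^sub>0" using False psd_diag[OF insert.prems(1) fI, of k] by (auto simp: m_def)
  hence mr: "1 / m : \<real>\<^sub>\<ge>\<^sub>0" by simp
  define M' where "M' i j = M i j - M i k * M k j / m" for i j
  let ?i = "\<Sum>i\<in>S. \<Sum>j\<in>S. M' i j * N i j"
  have "psd S M'" unfolding psd_def
  proof
   fix c
   let ?g = "\<Sum>j\<in>S. c j * M k j"
   \<comment> \<open>The k-th coordinate that minimises the form of M; at the completed vector this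
     form equals the form of M' at c.\<close>
   define d where "d = - ?g / m"
   define c' where "c' i = (if i = k then d else c i)" for i
   have cm: "cnj m = m" using m(2) by (auto simp: complex_nonneg_Reals_iff complex_eq_iff)
   let ?c = "\<Sum>i\<in>S. cnj (c i) * M i k"
   have cd: "cnj d = - ?c / m"
   proof -
    have "(\<Sum>x\<in>S. cnj (c x) * cnj (M k x)) = ?c" by (rule sum.cong) (use herm[of k] in auto)
    thus ?thesis unfolding d_def by (simp add: cm)
   qed
   let ?a = "\<Sum>i\<in>?I. \<Sum>j\<in>?I. cnj (c' i) * c' j * M i j"
   let ?b = "\<Sum>i\<in>S. \<Sum>j\<in>S. cnj (c i) * c j * M' i j"
   let ?f = "\<Sum>i\<in>S. \<Sum>j\<in>S. cnj (c i) * c j * M i j"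
   have "?a =
     cnj d * d * m + cnj d * ?g + d * ?c + ?f"
   proof -
    have "i ~= k" if "i : S" for i using that insert(2) by auto
    hence "?a = cnj d * d * m + (\<Sum>j\<in>S. cnj d * c j * M k j) + (\<Sum>i\<in>S. cnj (c i) * d * M i k + (\<Sum>j\<in>S. cnj (c i) * c j * M i j))"
     using insert(1,2) by (simp add: c'_def m_def cong: sum.cong)
    thus ?thesis by (simp add: sum.distrib sum_distrib_left mult_ac)
   qed
   also have "... = ?f - ?c * ?g / m"
    unfolding cd d_def by simp
   also have "... = ?b"
    by (simp add: M'_def sum_product right_diff_distrib sum_subtractf sum_divide_distrib mult_ac) (rule sum.swap)
   finally have "?b = ?a" ..
   thus "?b : \<real>\<^sub>\<ge>\<^sub>0"
    using insert.prems(1)[unfolded psd_def, rule_format, of c'] by simp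
  qed
  hence 1: "?i : \<real>\<^sub>\<ge>\<^sub>0" using insert.IH N by blast
  let ?d = "\<Sum>i\<in>?I. \<Sum>j\<in>?I. cnj (M k i) * M k j * N i j"
  have 2: "?d : \<real>\<^sub>\<ge>\<^sub>0" using insert.prems(2) unfolding psd_def by blast
  let ?e = "\<Sum>i\<in>?I. \<Sum>j\<in>?I. M i k * M k j / m * N i j"
  let ?h = "\<Sum>i\<in>?I. \<Sum>j\<in>?I. M' i j * N i j"
  have "(\<Sum>i\<in>?I. \<Sum>j\<in>?I. M i j * N i j) = ?h + ?e"
   by (simp add: M'_def algebra_simps flip: sum.distrib)
  also have "?h = ?i"
   using insert(1,2) m by (simp add: M'_def m_def)
  also have "?e = 1 / m * ?d"
   unfolding sum_distrib_left using herm[of k] by simp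
  finally show ?thesis using nonneg_Reals_add_I[OF 1 nonneg_Reals_mult_I[OF mr 2]] by simp
 qed
qed simp

text \<open>Iterating gives (r 0 / Q)^(2^n) <= (C / Q) K^(2^n). If r 0 / Q exceeded K, the quotient
  of the powers would outgrow C / Q.\<close>

lemma doubling_bound:
 fixes r :: "nat => real"
 assumes r: "!!n. (r n)^2 <= Q * r (Suc n)" and b: "!!n. r n <= C * K ^ (2 ^ n)" and "Q >= 0" "K >= 0"
 shows "r 0 <= Q * K"
proof (cases "Q = 0")
 case True
 thus ?thesis using r[of 0] by simp
next
 case False
 hence Q: "Q > 0" using assms by simp
 show ?thesis
 proof (rule ccontr)
  assume "~ ?thesis"
  hence g: "r 0 / Q > K" using Q by (simp add: field_simps)
  have s: "(r n / Q)^2 <= r (Suc n) / Q" for n using r[of n] by (simp add: power_divide power2_eq_square divide_simps mult.commute)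
  have i: "(r 0 / Q) ^ (2 ^ n) <= r n / Q" for n
  proof (induction n)
   case (Suc n)
   have "(r 0 / Q) ^ (2 ^ Suc n) = ((r 0 / Q) ^ (2 ^ n))^2" by (simp add: power_mult[symmetric] mult.commute)
   also have "... <= (r n / Q)^2" using Suc g assms(4) by (intro power_mono zero_le_power) auto
   also have "... <= r (Suc n) / Q" by (rule s)
   finally show ?case .
  qed simp
  have j: "(r 0 / Q) ^ (2 ^ n) <= C / Q * K ^ (2 ^ n)" for n
   using order_trans[OF i divide_right_mono[OF b]] Q by simp
  show False
  proof (cases "K = 0")
   case True
   thus False using j[of 0] g by simp
  next
   case Kn: False
   define h where "h = r 0 / Q / K"
   have Kp: "K > 0" using Kn assms(4) by simp
   have h: "h > 1" unfolding h_def less_divide_eq_1 using g Kp by simp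
   have "h ^ (2 ^ n) <= C / Q" for n
    using j[of n] Kp unfolding h_def power_divide[of "r 0 / Q" K] by (simp add: pos_divide_le_eq)
   moreover obtain n where "C / Q < h ^ n" using real_arch_pow[OF h] by blast
   moreover have "h ^ n <= h ^ (2 ^ n)" using h by simp
   ultimately show False by (meson le_less_trans not_less)
  qed
 qed
qed

context pre_star begin

definition stfun :: "('b => complex) => bool" where
 "stfun \<phi> \<longleftrightarrow> (ALL x : C[B]. ALL y : C[B]. \<phi> (x +[B] y) = \<phi> x + \<phi> y) & (ALL c. ALL x : C[B]. \<phi> (c \<odot> x) = c * \<phi> x) &
  (ALL x:C[B]. \<phi> (star B x *[B] x) : \<real>\<^sub>\<ge>\<^sub>0) & (ALL x:C[B]. cmod (\<phi> x) <= N[B] x)"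

lemma state_stfun: assumes "state B \<phi>" shows "stfun \<phi>"
proof -
 define U where "U = {cmod (\<phi> x) | x. x : C[B] & N[B] x <= 1}"
 have h: "\<phi> (c \<odot> x) = c * \<phi> x" if "x : C[B]" for c x using assms that unfolding state_def by blast
 have U: "bdd_above U" "Sup U = 1" using assms unfolding state_def U_def by auto
 have 1: "cmod (\<phi> x) <= 1" if "x : C[B]" "N[B] x <= 1" for x
  using cSup_upper[OF _ U(1), of "cmod (\<phi> x)"] U(2) that by (auto simp: U_def)
 have "cmod (\<phi> x) <= N[B] x" if x: "x : C[B]" for x
 proof (cases "N[B] x = 0")
  case True
  have "cmod (\<phi> x) * t <= 1" if "t > 0" for t :: real
   using 1[of "complex_of_real t \<odot> x"] x True that by (simp add: p_norm_smult h norm_mult mult.commute)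
  from this[of "2 / cmod (\<phi> x)"] show ?thesis using True by auto
 next
  case False
  define t where "t = N[B] x"
  have t: "t > 0" using False p_norm_nonneg[OF x] by (simp add: t_def)
  have "cmod (\<phi> (complex_of_real (1/t) \<odot> x)) <= 1" by (rule 1) (use x t in "auto simp: p_norm_smult norm_divide t_def[symmetric]")
  thus ?thesis using t x by (simp add: h norm_mult norm_divide field_simps t_def)
 qed
 thus ?thesis using assms unfolding state_def stfun_def pos_def by blast
qed

primrec comb :: "(nat => complex) => (nat => 'b) => nat => 'b" where
 "comb c a 0 = \<zero>"
| "comb c a (Suc n) = comb c a n +[B] c n \<odot> a n"

lemma stfun_psd: fixes a :: "nat => 'b" assumes \<phi>: "stfun \<phi>" and a: "!!i. i < n ==> a i : C[B]"
 shows "psd {..<n} (%i j. \<phi> (star B (a i) *[B] a j))"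
 unfolding psd_def
proof
 fix c :: "nat => complex"
 have add: "\<phi> (x +[B] y) = \<phi> x + \<phi> y" and sm: "\<phi> (d \<odot> x) = d * \<phi> x" if "x : C[B]" "y : C[B]" for d x y
  using \<phi> that unfolding stfun_def by auto
 have z: "\<zero> = 0 \<odot> \<zero>" using p_smult0[OF p_zero] by simp
 have cc: "comb c a k : C[B]" if "k <= n" for k using that by (induction k) (auto simp: a)
 have r: "\<phi> (x *[B] comb c a k) = (\<Sum>j<k. c j * \<phi> (x *[B] a j))" if x: "x : C[B]" and k: "k <= n" for x k
  using k
 proof (induction k)
  case 0
  show ?case using p_smult_right[of x \<zero> 0] x z sm[of "x *[B] \<zero>" x 0] by simp
 qed (use x a cc in "simp add: p_distr_right p_smult_right add sm")
 have l: "\<phi> (star B (comb c a k) *[B] x) = (\<Sum>i<k. cnj (c i) * \<phi> (star B (a i) *[B] x))" if x: "x : C[B]" and k: "k <= n" for x k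
  using k
 proof (induction k)
  case 0
  show ?case using p_star_smult[of \<zero> 0] z p_smult_left[of "star B \<zero>" x 0] x sm[of "star B \<zero> *[B] x" x 0] by simp
 qed (use x a cc in "simp add: p_distr_left p_smult_left p_star_add p_star_smult add sm")
 let ?a = "\<Sum>i<n. \<Sum>j<n. cnj (c i) * c j * \<phi> (star B (a i) *[B] a j)"
 let ?b = "\<phi> (star B (comb c a n) *[B] comb c a n)"
 have "?b = ?a"
  using cc a by (simp add: l r sum_distrib_left mult.assoc) (rule trans[OF sum.swap], simp add: mult_ac)
 moreover have "?b : \<real>\<^sub>\<ge>\<^sub>0" using \<phi> cc unfolding stfun_def by blast
 ultimately show "?a : \<real>\<^sub>\<ge>\<^sub>0" by simp
qed

end

section \<open>The tensor product as a C*-algebra\<close>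

lemma sum_list_swap: "(\<Sum>p\<leftarrow>xs. \<Sum>q\<leftarrow>ys. f p q) = (\<Sum>q\<leftarrow>ys. \<Sum>p\<leftarrow>xs. f p q :: 'c::comm_monoid_add)"
 by (induction xs) (simp_all add: sum_list_addf)

definition ev :: "('a => 'b => complex) => ('a, 'b) formal => complex" where
 "ev \<beta> x = (\<Sum>p\<leftarrow>x. \<beta> (fst p) (snd p))"

lemma ev_simps [simp]: "ev \<beta> [] = 0" "ev \<beta> (p # x) = \<beta> (fst p) (snd p) + ev \<beta> x" "ev \<beta> (x @ y) = ev \<beta> x + ev \<beta> y"
 by (simp_all add: ev_def)

lemma ev_linear: "ev (%a b. \<beta> a b + \<gamma> a b) x = ev \<beta> x + ev \<gamma> x" "ev (%a b. c * \<beta> a b) x = c * ev \<beta> x" "ev (%a b. cnj (\<beta> a b)) x = cnj (ev \<beta> x)"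
 by (induction x) (simp_all add: algebra_simps)

lemma prod_functional_ev: "prod_functional \<phi> \<psi> x = ev (%a b. \<phi> a * \<psi> b) x"
 by (simp add: prod_functional_def ev_def case_prod_unfold)

locale tensor = A: pre_star A + B: pre_star B for A :: "('a, 'm) cstar_scheme" and B :: "('b, 'n) cstar_scheme"
begin

abbreviation "F == formals A B"
abbreviation "mul == fmult A B"
abbreviation "st == fstar A B"

lemma formals_iff: "x : F \<longleftrightarrow> (ALL p:set x. fst p : C[A] & snd p : C[B])"
 unfolding formals_def in_lists_conv_set by auto

lemma F_simps [simp]: "[] : F" "p # x : F \<longleftrightarrow> (fst p : C[A] & snd p : C[B]) & x : F" "x @ y : F \<longleftrightarrow> x : F & y : F"
 by (auto simp: formals_iff)
lemma F_fsmult [simp]: "x : F ==> fsmult A c x : F" by (auto simp: formals_iff fsmult_def)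
lemma F_mul [simp]: "x : F ==> y : F ==> mul x y : F" by (fastforce simp: formals_iff fmult_def)
lemma F_st [simp]: "x : F ==> st x : F" by (auto simp: formals_iff fstar_def)
lemma F_fdiff [simp]: "x : F ==> y : F ==> fdiff A x y : F" by (simp add: fdiff_def)

definition bilin :: "('a => 'b => complex) => bool" where
 "bilin \<beta> = (ALL a:C[A]. ALL b:C[B]. (ALL a':C[A]. \<beta> (a +[A] a') b = \<beta> a b + \<beta> a' b) & (ALL b':C[B]. \<beta> a (b +[B] b') = \<beta> a b + \<beta> a b') &
  (ALL c. \<beta> (c \<odot>[A] a) b = c * \<beta> a b & \<beta> a (c \<odot>[B] b) = c * \<beta> a b))"

text \<open>Equality in the algebraic tensor product, tested by all bilinear functionals, so that
  formal sums can be used without forming a quotient.\<close>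

definition teq :: "('a, 'b) formal => ('a, 'b) formal => bool" where
 "teq x y = (ALL \<beta>. bilin \<beta> --> ev \<beta> x = ev \<beta> y)"

lemma ev_cong: "x : F ==> (!!a b. a : C[A] ==> b : C[B] ==> \<beta> a b = \<gamma> a b) ==> ev \<beta> x = ev \<gamma> x"
 unfolding ev_def formals_iff by (intro arg_cong[where f=sum_list] map_cong) auto

lemma ev_fsmult: "bilin \<beta> ==> x : F ==> ev \<beta> (fsmult A c x) = c * ev \<beta> x"
 by (induction x) (auto simp: fsmult_def bilin_def algebra_simps)

lemma ev_mul: "ev \<beta> (mul x y) = ev (%a b. ev (%a' b'. \<beta> (a *[A] a') (b *[B] b')) y) x"
proof (induction x)
 case (Cons p x)
 show ?case using Cons by (simp add: ev_def case_prod_beta o_def fmult_def)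
qed (simp add: fmult_def)

lemma ev_st: "ev \<beta> (st x) = ev (%a b. \<beta> (star A a) (star B b)) x"
 by (simp add: fstar_def ev_def case_prod_beta o_def)

lemma ev_swap: "ev (%a b. ev (%a' b'. \<beta> a b a' b') y) x = ev (%a' b'. ev (%a b. \<beta> a b a' b') x) y"
 unfolding ev_def by (rule sum_list_swap)

lemma bilin_left: assumes "bilin \<beta>" "y : F" shows "bilin (%a b. ev (%a' b'. \<beta> (a *[A] a') (b *[B] b')) y)"
 unfolding bilin_def ev_linear[symmetric]
 by (intro ballI conjI allI ev_cong[OF assms(2)])
  (use assms(1) in "auto simp: bilin_def A.p_distr_left B.p_distr_left A.p_smult_left B.p_smult_left")

lemma bilin_right: assumes "bilin \<beta>" "y : F" shows "bilin (%a b. ev (%a' b'. \<beta> (a' *[A] a) (b' *[B] b)) y)"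
 unfolding bilin_def ev_linear[symmetric]
 by (intro ballI conjI allI ev_cong[OF assms(2)])
  (use assms(1) in "auto simp: bilin_def A.p_distr_right B.p_distr_right A.p_smult_right B.p_smult_right")

lemma bilin_star: assumes "bilin \<beta>" shows "bilin (%a b. cnj (\<beta> (star A a) (star B b)))"
 using assms unfolding bilin_def by (auto simp: A.p_star_add B.p_star_add A.p_star_smult B.p_star_smult)

lemma teq_refl [simp]: "teq x x" by (simp add: teq_def)
lemma teq_sym: "teq x y ==> teq y x" by (simp add: teq_def)
lemma teq_trans: "teq x y ==> teq y z ==> teq x z" by (simp add: teq_def)
lemma teq_mul1: assumes "teq x x'" "y : F" shows "teq (mul x y) (mul x' y)"
 using assms(1) bilin_left[OF _ assms(2)] unfolding teq_def ev_mul by blast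
lemma teq_mul2: assumes "teq x x'" "y : F" shows "teq (mul y x) (mul y x')"
 unfolding teq_def ev_mul
proof (intro allI impI)
 fix \<beta> assume b: "bilin \<beta>"
 have "ev (%a b. ev (%a' b'. \<beta> (a *[A] a') (b *[B] b')) z) y = ev (%a' b'. ev (%a b. \<beta> (a *[A] a') (b *[B] b')) y) z" for z
  by (rule ev_swap)
 thus "ev (%a b. ev (%a' b'. \<beta> (a *[A] a') (b *[B] b')) x) y = ev (%a b. ev (%a' b'. \<beta> (a *[A] a') (b *[B] b')) x') y"
  using assms(1) bilin_right[OF b assms(2)] unfolding teq_def by simp
qed
lemma teq_mul: "teq x x' ==> teq y y' ==> x' : F ==> y : F ==> teq (mul x y) (mul x' y')"
 by (meson teq_mul1 teq_mul2 teq_trans)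
lemma teq_st: assumes "teq x x'" shows "teq (st x) (st x')"
proof -
 have "ev \<beta> (st z) = cnj (ev (%a b. cnj (\<beta> (star A a) (star B b))) z)" for \<beta> z by (simp add: ev_st ev_linear)
 thus ?thesis using assms bilin_star unfolding teq_def by simp
qed

lemma teq_mul_assoc: assumes "x : F" "y : F" "z : F" shows "teq (mul (mul x y) z) (mul x (mul y z))"
 unfolding teq_def ev_mul by (intro allI impI ev_cong[OF assms(1)] ev_cong[OF assms(2)] ev_cong[OF assms(3)]) (simp add: A.p_mult_assoc B.p_mult_assoc)
lemma teq_st_mul: assumes "x : F" "y : F" shows "teq (st (mul x y)) (mul (st y) (st x))"
 unfolding teq_def
proof (intro allI impI)
 fix \<beta>
 have "ev \<beta> (st (mul x y)) = ev (%a b. ev (%a' b'. \<beta> (star A a' *[A] star A a) (star B b' *[B] star B b)) y) x"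
  unfolding ev_st ev_mul by (intro ev_cong[OF assms(1)] ev_cong[OF assms(2)]) (simp add: A.p_star_mult B.p_star_mult)
 thus "ev \<beta> (st (mul x y)) = ev \<beta> (mul (st y) (st x))" unfolding ev_mul ev_st by (subst (asm) ev_swap)
qed
lemma teq_st_st: assumes "x : F" shows "teq (st (st x)) x"
 unfolding teq_def ev_st by (intro allI impI ev_cong[OF assms]) simp
lemma teq_comm: "teq (x @ y) (y @ x)" by (simp add: teq_def)

text \<open>The semi-inner product of the GNS construction for the product functional, on formal
  sums.\<close>

definition ip :: "('a => complex) => ('b => complex) => ('a, 'b) formal => ('a, 'b) formal => complex" where
 "ip \<phi> \<psi> y z = prod_functional \<phi> \<psi> (mul (st y) z)"
definition sp :: "('a => complex) => ('b => complex) => bool" where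
 "sp \<phi> \<psi> \<longleftrightarrow> A.stfun \<phi> & B.stfun \<psi>"
definition qn :: "('a => complex) => ('b => complex) => ('a, 'b) formal => real" where
 "qn \<phi> \<psi> y = sqrt (Re (ip \<phi> \<psi> y y))"
definition n1 :: "('a, 'b) formal => real" where
 "n1 x = (\<Sum>p\<leftarrow>x. N[A] (fst p) * N[B] (snd p))"

lemma sp_bilin: "sp \<phi> \<psi> ==> bilin (%a b. \<phi> a * \<psi> b)"
 unfolding sp_def bilin_def A.stfun_def B.stfun_def by (auto simp: algebra_simps)

context
 fixes \<phi> \<psi> assumes sp: "sp \<phi> \<psi>"
begin

abbreviation "I == ip \<phi> \<psi>"
abbreviation "q == qn \<phi> \<psi>"

lemma I_ev: "I y z = ev (%a b. ev (%a' b'. \<phi> (star A a *[A] a') * \<psi> (star B b *[B] b')) z) y"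
 unfolding ip_def prod_functional_ev ev_mul ev_st ..

lemma I_add1: "I (x @ y) z = I x z + I y z" by (simp add: I_ev)
lemma I_add2: "I z (x @ y) = I z x + I z y" by (simp add: I_ev ev_linear)
lemma I_teq2: assumes "teq x x'" "y : F" shows "I y x = I y x'"
 using teq_mul2[OF assms(1) F_st[OF assms(2)]] sp_bilin[OF sp] unfolding ip_def prod_functional_ev teq_def by blast
lemma I_teq1: assumes "teq x x'" "y : F" shows "I x y = I x' y"
 using teq_mul1[OF teq_st[OF assms(1)] assms(2)] sp_bilin[OF sp] unfolding ip_def prod_functional_ev teq_def by blast
lemma I_smult2: assumes "x : F" "y : F" shows "I y (fsmult A c x) = c * I y x"
proof -
 have "I y z = ev (%a' b'. ev (%a b. \<phi> (a *[A] a') * \<psi> (b *[B] b')) (st y)) z" for z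
  unfolding I_ev ev_st by (rule ev_swap)
 thus ?thesis using ev_fsmult[OF bilin_right[OF sp_bilin[OF sp] F_st[OF assms(2)]] assms(1)] by simp
qed
lemma I_smult1: assumes "x : F" "y : F" shows "I (fsmult A c x) y = cnj c * I x y"
proof -
 have b: "bilin (%a b. ev (%a' b'. \<phi> (a *[A] a') * \<psi> (b *[B] b')) y)" by (rule bilin_left[OF sp_bilin[OF sp] assms(2)])
 have e: "I z y = cnj (ev (%a b. cnj (ev (%a' b'. \<phi> (star A a *[A] a') * \<psi> (star B b *[B] b')) y)) z)" for z
  unfolding I_ev ev_linear by simp
 show ?thesis unfolding e ev_fsmult[OF bilin_star[OF b] assms(1)] by simp
qed

text \<open>Over the entries of y the Gram matrices of \<phi> and \<psi> are positive semidefinite,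
  and the value is the sum of all entries of their entrywise product.\<close>

lemma I_pos: assumes y: "y : F" shows "I y y : \<real>\<^sub>\<ge>\<^sub>0"
proof -
 define n where "n = length y"
 have c: "fst (y ! i) : C[A]" "snd (y ! i) : C[B]" if "i < n" for i using y that by (auto simp: formals_iff n_def)
 have "I y y = (\<Sum>i<n. \<Sum>j<n. \<phi> (star A (fst (y ! i)) *[A] fst (y ! j)) * \<psi> (star B (snd (y ! i)) *[B] snd (y ! j)))"
  unfolding I_ev ev_def by (simp add: sum_list_sum_nth n_def atLeast0LessThan)
 also have "... : \<real>\<^sub>\<ge>\<^sub>0"
  by (rule schur_product[OF _ A.stfun_psd B.stfun_psd]) (use sp c in "auto simp: sp_def")
 finally show ?thesis .
qed

lemma I_cs: assumes y: "y : F" and z: "z : F" shows "I z y = cnj (I y z)" "cmod (I y z) <= q y * q z"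
proof -
 have "I y y + t * I y z + cnj t * I z y + t * cnj t * I z z : \<real>\<^sub>\<ge>\<^sub>0" for t
  using I_pos[of "y @ fsmult A t z"] y z by (simp add: I_add1 I_add2 I_smult1 I_smult2 algebra_simps)
 from psd2[OF this I_pos[OF y] I_pos[OF z]]
 show "I z y = cnj (I y z)" and "cmod (I y z) <= q y * q z"
  by (auto simp: qn_def real_sqrt_mult[symmetric] intro: real_le_rsqrt)
qed

lemma q_sq: "y : F ==> (q y)^2 = Re (I y y)" "y : F ==> I y y = of_real ((q y)^2)" "y : F ==> 0 <= q y"
 using I_pos[of y] by (auto simp: qn_def complex_nonneg_Reals_iff complex_eq_iff)

lemma q_teq: "teq x y ==> x : F ==> y : F ==> q x = q y"
 unfolding qn_def using I_teq1[of x y x] I_teq2[of x y y] by simp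
lemma q_append: assumes "x : F" "y : F" shows "q (x @ y) <= q x + q y"
proof -
 have "(q (x @ y))^2 = (q x)^2 + (q y)^2 + Re (I x y) + Re (I y x)" using assms by (simp add: q_sq(1) I_add1 I_add2)
 also have "... <= (q x + q y)^2"
  using I_cs(2)[OF assms] I_cs(2)[OF assms(2,1)] complex_Re_le_cmod[of "I x y"] complex_Re_le_cmod[of "I y x"]
  by (simp add: power2_sum algebra_simps)
 finally show ?thesis using assms q_sq(3) by simp
qed
lemma q_smult: assumes "x : F" shows "q (fsmult A c x) = cmod c * q x"
proof -
 have "I (fsmult A c x) (fsmult A c x) = (c * cnj c) * I x x" using assms by (simp add: I_smult1 I_smult2)
 also have "... = of_real ((cmod c)^2 * (q x)^2)" using assms by (simp add: q_sq(2) complex_norm_square[symmetric])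
 finally have "(q (fsmult A c x))^2 = (cmod c * q x)^2" using assms by (simp add: q_sq(1) power_mult_distrib)
 thus ?thesis using assms q_sq(3) by simp
qed

lemma I_adj: assumes "x : F" "y : F" "z : F" shows "I y (mul x z) = I (mul (st x) y) z"
proof -
 let ?a = "prod_functional \<phi> \<psi> (mul (mul (st y) x) z)"
 have "I y (mul x z) = ?a"
  using teq_mul_assoc[of "st y" x z] sp_bilin[OF sp] assms unfolding ip_def prod_functional_ev teq_def by simp
 also have t: "teq (st (mul (st x) y)) (mul (st y) x)"
  by (rule teq_trans[OF teq_st_mul]) (use assms in "auto intro: teq_mul2 teq_st_st")
 have "?a = I (mul (st x) y) z"
  using teq_mul1[OF t assms(3)] sp_bilin[OF sp] unfolding ip_def prod_functional_ev teq_def by simp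
 finally show ?thesis .
qed

lemma F_le_n1: "z : F ==> cmod (prod_functional \<phi> \<psi> z) <= n1 z"
proof (induction z)
 case (Cons p z)
 have "cmod (\<phi> (fst p) * \<psi> (snd p)) <= N[A] (fst p) * N[B] (snd p)" unfolding norm_mult
  using sp Cons.prems by (intro mult_mono) (auto simp: sp_def A.stfun_def B.stfun_def)
 thus ?case using Cons norm_triangle_ineq[of "\<phi> (fst p) * \<psi> (snd p)" "prod_functional \<phi> \<psi> z"] by (simp add: prod_functional_ev n1_def)
qed (simp add: prod_functional_ev n1_def)

end

section \<open>Boundedness of left multiplication and the minimal norm\<close>

lemma n1_nonneg: "x : F ==> 0 <= n1 x"
 unfolding n1_def by (rule sum_list_nonneg) (auto simp: formals_iff)
lemma n1_mul: "x : F ==> y : F ==> n1 (mul x y) <= n1 x * n1 y"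
proof (induction x)
 case (Cons p x)
 let ?a = "N[A] (fst p) * N[B] (snd p)"
 let ?b = "n1 (map (%(a', b'). (fst p *[A] a', snd p *[B] b')) y)"
 have "?b <= (\<Sum>r\<leftarrow>y. ?a * (N[A] (fst r) * N[B] (snd r)))"
  unfolding n1_def map_map
 proof (rule sum_list_mono)
  fix r assume "r : set y"
  hence r: "fst r : C[A]" "snd r : C[B]" using Cons.prems by (auto simp: formals_iff)
  have "N[A] (fst p *[A] fst r) * N[B] (snd p *[B] snd r) <= (N[A] (fst p) * N[A] (fst r)) * (N[B] (snd p) * N[B] (snd r))"
   using Cons.prems r by (intro mult_mono A.p_norm_mult B.p_norm_mult mult_nonneg_nonneg) auto
  thus "((%p. N[A] (fst p) * N[B] (snd p)) \<circ> (%(a', b'). (fst p *[A] a', snd p *[B] b'))) r <= N[A] (fst p) * N[B] (snd p) * (N[A] (fst r) * N[B] (snd r))"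
   by (simp add: case_prod_beta mult_ac)
 qed
 also have "... = ?a * n1 y" by (simp add: n1_def sum_list_const_mult)
 finally have "?b <= ?a * n1 y" .
 thus ?case using Cons by (simp add: fmult_def n1_def case_prod_beta algebra_simps)
qed (simp add: fmult_def n1_def)
lemma n1_st: "x : F ==> n1 (st x) = n1 x"
 unfolding n1_def fstar_def by (simp add: case_prod_beta o_def) (intro arg_cong[where f=sum_list] map_cong, auto simp: formals_iff)

primrec sqpow :: "('a, 'b) formal => nat => ('a, 'b) formal" where
 "sqpow w 0 = w" | "sqpow w (Suc n) = mul (sqpow w n) (sqpow w n)"

text \<open>Makes the supremum in \<open>min_norm\<close> finite. With w the product of the adjoint
  of x and x, Cauchy-Schwarz bounds the square of the inner product of y and w^(2^n) y by the
  squared seminorm of y times the next such inner product; \<open>doubling_bound\<close> turns the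
  crude bound by \<open>n1\<close> at late stages into the sharp one at the first.\<close>

lemma q_mul_n1: assumes sp: "sp \<phi> \<psi>" and x: "x : F" and y: "y : F" shows "qn \<phi> \<psi> (mul x y) <= n1 x * qn \<phi> \<psi> y"
proof -
 define w where "w = mul (st x) x"
 have w: "w : F" using x by (simp add: w_def)
 have W: "sqpow w n : F" for n by (induction n) (auto simp: w)
 have sa: "teq (st (sqpow w n)) (sqpow w n)" for n
 proof (induction n)
  case 0
  show ?case unfolding sqpow.simps w_def
   by (rule teq_trans[OF teq_st_mul]) (use x in "auto intro: teq_mul2 teq_st_st")
 next
  case (Suc n)
  show ?case unfolding sqpow.simps by (rule teq_trans[OF teq_st_mul[OF W W]]) (intro teq_mul Suc W F_st)
 qed
 have n1W: "n1 (sqpow w n) <= n1 w ^ (2 ^ n)" for n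
 proof (induction n)
  case (Suc n)
  have "n1 (sqpow w (Suc n)) <= n1 (sqpow w n) * n1 (sqpow w n)" using n1_mul[OF W W] by simp
  also have "... <= n1 w ^ (2 ^ n) * n1 w ^ (2 ^ n)" using Suc n1_nonneg[OF W] n1_nonneg[OF w] by (intro mult_mono) auto
  finally show ?case by (simp add: power_mult[symmetric] power2_eq_square flip: power_add mult_2)
 qed simp
 define r where "r n = Re (ip \<phi> \<psi> y (mul (sqpow w n) y))" for n
 have rS: "r (Suc n) = (qn \<phi> \<psi> (mul (sqpow w n) y))^2" for n
 proof -
  have "ip \<phi> \<psi> y (mul (sqpow w (Suc n)) y) = ip \<phi> \<psi> y (mul (sqpow w n) (mul (sqpow w n) y))"
   using I_teq2[OF sp teq_mul_assoc[OF W W y] y] by simp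
  also have "... = ip \<phi> \<psi> (mul (st (sqpow w n)) y) (mul (sqpow w n) y)" using W y by (intro I_adj[OF sp]) auto
  also have "... = ip \<phi> \<psi> (mul (sqpow w n) y) (mul (sqpow w n) y)" using W y by (intro I_teq1[OF sp teq_mul1[OF sa]]) auto
  finally show ?thesis using W y by (simp add: r_def q_sq(1)[OF sp])
 qed
 let ?a = "qn \<phi> \<psi> y"
 let ?b = "qn \<phi> \<psi> (mul x y)"
 have "r 0 <= ?a^2 * n1 w"
 proof (rule doubling_bound)
  show "(r n)^2 <= ?a^2 * r (Suc n)" for n
  proof -
   have "\<bar>r n\<bar> <= cmod (ip \<phi> \<psi> y (mul (sqpow w n) y))" unfolding r_def by (rule abs_Re_le_cmod)
   also have "... <= qn \<phi> \<psi> y * qn \<phi> \<psi> (mul (sqpow w n) y)" using W y by (intro I_cs(2)[OF sp]) auto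
   finally have "\<bar>r n\<bar>^2 <= (qn \<phi> \<psi> y * qn \<phi> \<psi> (mul (sqpow w n) y))^2" by (intro power_mono) auto
   thus ?thesis unfolding rS by (simp add: power_mult_distrib)
  qed
  show "r n <= (n1 y)^2 * n1 w ^ (2 ^ n)" for n
  proof -
   have "r n <= cmod (ip \<phi> \<psi> y (mul (sqpow w n) y))" unfolding r_def by (rule complex_Re_le_cmod)
   also have "... <= n1 (mul (st y) (mul (sqpow w n) y))" unfolding ip_def using W y by (intro F_le_n1[OF sp]) auto
   also have "... <= n1 y * n1 (mul (sqpow w n) y)" using n1_mul[of "st y" "mul (sqpow w n) y"] W y n1_st[OF y] by simp
   also have "... <= n1 y * (n1 (sqpow w n) * n1 y)" using W y n1_nonneg by (intro mult_left_mono n1_mul) auto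
   also have "... <= n1 y * (n1 w ^ (2 ^ n) * n1 y)" using y n1_nonneg n1W by (intro mult_left_mono mult_right_mono) auto
   finally show ?thesis by (simp add: power2_eq_square mult_ac)
  qed
 qed (use n1_nonneg w in auto)
 also have "r 0 = ?b^2"
 proof -
  have "ip \<phi> \<psi> y (mul w y) = ip \<phi> \<psi> y (mul (st x) (mul x y))" unfolding w_def using x y by (intro I_teq2[OF sp teq_mul_assoc]) auto
  also have "... = ip \<phi> \<psi> (mul (st (st x)) y) (mul x y)" using x y by (intro I_adj[OF sp]) auto
  also have "... = ip \<phi> \<psi> (mul x y) (mul x y)" using x y by (intro I_teq1[OF sp teq_mul1[OF teq_st_st]]) auto
  finally show ?thesis using x y by (simp add: r_def q_sq(1)[OF sp])
 qed
 also have "?a^2 * n1 w <= ?a^2 * (n1 x * n1 x)" using n1_mul[of "st x" x] x n1_st[OF x] by (intro mult_left_mono) (auto simp: w_def)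
 finally have "?b^2 <= (n1 x * qn \<phi> \<psi> y)^2" by (simp add: power_mult_distrib power2_eq_square mult_ac)
 thus ?thesis using n1_nonneg[OF x] q_sq(3)[OF sp] x y by simp
qed

abbreviation "\<nu> == min_norm A B"

lemma nu_set: "\<nu> x = Sup (insert 0 {qn \<phi> \<psi> (mul x y) / qn \<phi> \<psi> y | \<phi> \<psi> y. state A \<phi> & state B \<psi> & y : F & 0 < Re (ip \<phi> \<psi> y y)})"
 unfolding min_norm_def qn_def ip_def real_sqrt_divide ..

lemma sp_state: "state A \<phi> ==> state B \<psi> ==> sp \<phi> \<psi>"
 by (simp add: sp_def A.state_stfun B.state_stfun)

lemma nu_bdd: assumes x: "x : F"
 shows "bdd_above (insert 0 {qn \<phi> \<psi> (mul x y) / qn \<phi> \<psi> y | \<phi> \<psi> y. state A \<phi> & state B \<psi> & y : F & 0 < Re (ip \<phi> \<psi> y y)})"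
proof (rule bdd_aboveI)
 fix r assume "r : insert 0 {qn \<phi> \<psi> (mul x y) / qn \<phi> \<psi> y | \<phi> \<psi> y. state A \<phi> & state B \<psi> & y : F & 0 < Re (ip \<phi> \<psi> y y)}"
 thus "r <= n1 x"
 proof
  assume "r : {qn \<phi> \<psi> (mul x y) / qn \<phi> \<psi> y | \<phi> \<psi> y. state A \<phi> & state B \<psi> & y : F & 0 < Re (ip \<phi> \<psi> y y)}"
  then obtain \<phi> \<psi> y where *: "r = qn \<phi> \<psi> (mul x y) / qn \<phi> \<psi> y" "state A \<phi>" "state B \<psi>" "y : F" "0 < Re (ip \<phi> \<psi> y y)" by blast
  thus ?thesis using q_mul_n1[OF sp_state[OF *(2,3)] x *(4)] by (simp add: qn_def pos_divide_le_eq)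
 qed (use n1_nonneg[OF x] in simp)
qed

lemma nu_nonneg: "x : F ==> 0 <= \<nu> x"
 unfolding nu_set by (rule cSup_upper[OF _ nu_bdd]) auto

lemma nu_bound: assumes st: "state A \<phi>" "state B \<psi>" and x: "x : F" and y: "y : F" shows "qn \<phi> \<psi> (mul x y) <= \<nu> x * qn \<phi> \<psi> y"
proof (cases "0 < Re (ip \<phi> \<psi> y y)")
 case True
 have "qn \<phi> \<psi> (mul x y) / qn \<phi> \<psi> y <= \<nu> x" unfolding nu_set by (rule cSup_upper[OF _ nu_bdd[OF x]]) (use True st y in blast)
 thus ?thesis using True by (simp add: qn_def pos_divide_le_eq)
next
 case False
 \<comment> \<open>The supremum ranges over y of nonzero seminorm only; for the others
   \<open>q_mul_n1\<close> gives 0 on the left.\<close>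
 thus ?thesis using q_sq(3)[OF sp_state[OF st] y] q_mul_n1[OF sp_state[OF st] x y] by (simp add: qn_def)
qed

lemma nu_le: assumes "0 <= c" "!!\<phi> \<psi> y. state A \<phi> ==> state B \<psi> ==> y : F ==> qn \<phi> \<psi> (mul x y) <= c * qn \<phi> \<psi> y" shows "\<nu> x <= c"
 unfolding nu_set
proof (rule cSup_least)
 fix r assume "r : insert 0 {qn \<phi> \<psi> (mul x y) / qn \<phi> \<psi> y | \<phi> \<psi> y. state A \<phi> & state B \<psi> & y : F & 0 < Re (ip \<phi> \<psi> y y)}"
 thus "r <= c" using assms by (auto simp: divide_le_eq qn_def)
qed simp

lemma nu_append: assumes "x : F" "y : F" shows "\<nu> (x @ y) <= \<nu> x + \<nu> y"
proof (rule nu_le)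
 fix \<phi> \<psi> z assume s: "state A \<phi>" "state B \<psi>" and z: "z : F"
 have "mul (x @ y) z = mul x z @ mul y z" by (simp add: fmult_def)
 thus "qn \<phi> \<psi> (mul (x @ y) z) <= (\<nu> x + \<nu> y) * qn \<phi> \<psi> z"
  using q_append[OF sp_state[OF s], of "mul x z" "mul y z"] nu_bound[OF s assms(1) z] nu_bound[OF s assms(2) z] assms z by (simp add: distrib_right)
qed (use assms nu_nonneg in auto)

lemma teq_smult_mul: assumes "x : F" "y : F" shows "teq (mul (fsmult A c x) y) (fsmult A c (mul x y))" "teq (mul x (fsmult A c y)) (fsmult A c (mul x y))"
proof -
 show "teq (mul (fsmult A c x) y) (fsmult A c (mul x y))"
  unfolding teq_def using assms by (auto simp: ev_mul[of _ _ y] ev_fsmult bilin_left)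
 have "ev \<beta> (mul x z) = ev (%a' b'. ev (%a b. \<beta> (a *[A] a') (b *[B] b')) x) z" for \<beta> z
  unfolding ev_mul by (rule ev_swap)
 thus "teq (mul x (fsmult A c y)) (fsmult A c (mul x y))"
  unfolding teq_def using assms ev_fsmult[OF bilin_right[OF _ assms(1)] assms(2)] ev_fsmult[of _ "mul x y"] by simp
qed

lemma nu_teq_le: assumes "teq x x'" "x : F" "x' : F" shows "\<nu> x <= \<nu> x'"
proof (rule nu_le[OF nu_nonneg[OF assms(3)]])
 fix \<phi> \<psi> y assume s: "state A \<phi>" "state B \<psi>" and y: "y : F"
 let ?a = "qn \<phi> \<psi> (mul x y)"
 have "?a = qn \<phi> \<psi> (mul x' y)" using assms y by (intro q_teq[OF sp_state[OF s]] teq_mul1) auto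
 thus "?a <= \<nu> x' * qn \<phi> \<psi> y" using nu_bound[OF s assms(3) y] by simp
qed

lemma nu_teq: "teq x x' ==> x : F ==> x' : F ==> \<nu> x = \<nu> x'"
 using nu_teq_le teq_sym by (intro antisym) auto

lemma nu_smult: assumes x: "x : F" shows "\<nu> (fsmult A c x) = cmod c * \<nu> x"
proof -
 have le: "\<nu> (fsmult A c x) <= cmod c * \<nu> x" if x: "x : F" for c x
 proof (rule nu_le)
  fix \<phi> \<psi> y assume s: "state A \<phi>" "state B \<psi>" and y: "y : F"
  show "qn \<phi> \<psi> (mul (fsmult A c x) y) <= cmod c * \<nu> x * qn \<phi> \<psi> y" using q_teq[OF sp_state[OF s] teq_smult_mul(1)[OF x y]] x y nu_bound[OF s x y] by (simp add: q_smult[OF sp_state[OF s]] mult.assoc mult_left_mono)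
 qed (use nu_nonneg[OF x] in auto)
 show ?thesis
 proof (cases "c = 0")
  case True
  thus ?thesis using le[OF x, of 0] nu_nonneg[OF F_fsmult[OF x, of 0]] by simp
 next
  case False
  show ?thesis using x False nu_teq[of "fsmult A (1/c) (fsmult A c x)" x] le[OF F_fsmult[OF x], of "1/c" c] le[OF x, of c] by (simp add: ev_fsmult teq_def norm_divide field_simps)
 qed
qed

lemma nu_mul: assumes "x : F" "y : F" shows "\<nu> (mul x y) <= \<nu> x * \<nu> y"
proof (rule nu_le)
 fix \<phi> \<psi> z assume s: "state A \<phi>" "state B \<psi>" and z: "z : F"
 let ?a = "qn \<phi> \<psi> (mul (mul x y) z)"
 have "?a = qn \<phi> \<psi> (mul x (mul y z))" using assms z by (intro q_teq[OF sp_state[OF s]] teq_mul_assoc) auto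
 also have "... <= \<nu> x * qn \<phi> \<psi> (mul y z)" using assms z by (intro nu_bound[OF s]) auto
 also have "... <= \<nu> x * (\<nu> y * qn \<phi> \<psi> z)" using assms z nu_nonneg by (intro mult_left_mono nu_bound[OF s]) auto
 finally show "?a <= \<nu> x * \<nu> y * qn \<phi> \<psi> z" by simp
qed (use assms nu_nonneg in auto)

lemma nu_st_le: assumes x: "x : F" shows "\<nu> (st x) <= \<nu> x"
proof (rule nu_le[OF nu_nonneg[OF x]])
 fix \<phi> \<psi> y assume s: "state A \<phi>" "state B \<psi>" and y: "y : F"
 note sp = sp_state[OF s]
 define u where "u = mul (st x) y"
 have u: "u : F" using x y by (simp add: u_def)
 let ?a = "ip \<phi> \<psi> y (mul x u)"
 have "ip \<phi> \<psi> u u = ?a" using I_adj[OF sp x y u] by (simp add: u_def)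
 hence "(qn \<phi> \<psi> u)^2 <= cmod (?a)" using complex_Re_le_cmod[of "ip \<phi> \<psi> u u"] by (simp add: q_sq(1)[OF sp u])
 also have "... <= qn \<phi> \<psi> y * qn \<phi> \<psi> (mul x u)" using x y u by (intro I_cs(2)[OF sp]) auto
 also have "... <= qn \<phi> \<psi> y * (\<nu> x * qn \<phi> \<psi> u)" using q_sq(3)[OF sp y] x u by (intro mult_left_mono nu_bound[OF s]) auto
 finally have "qn \<phi> \<psi> u * qn \<phi> \<psi> u <= (\<nu> x * qn \<phi> \<psi> y) * qn \<phi> \<psi> u" by (simp add: power2_eq_square mult_ac)
 thus "qn \<phi> \<psi> (mul (st x) y) <= \<nu> x * qn \<phi> \<psi> y"
  using q_sq(3)[OF sp u] q_sq(3)[OF sp y] nu_nonneg[OF x] by (cases "qn \<phi> \<psi> u = 0") (auto simp: u_def)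
qed

lemma nu_st: assumes x: "x : F" shows "\<nu> (st x) = \<nu> x"
 using nu_st_le[OF x] nu_st_le[OF F_st[OF x]] nu_teq[OF teq_st_st[OF x]] x by simp

text \<open>The squared seminorm of x y is the inner product of y and w y, so Cauchy-Schwarz bounds
  it by the norm of w.\<close>

lemma nu_cstar: assumes x: "x : F" shows "\<nu> (mul (st x) x) = (\<nu> x)^2"
proof (rule antisym)
 show "\<nu> (mul (st x) x) <= (\<nu> x)^2" using nu_mul[of "st x" x] x by (simp add: nu_st power2_eq_square)
 define w where "w = mul (st x) x"
 have w: "w : F" using x by (simp add: w_def)
 let ?a = "sqrt (\<nu> w)"
 have "\<nu> x <= ?a"
 proof (rule nu_le)
  fix \<phi> \<psi> y assume s: "state A \<phi>" "state B \<psi>" and y: "y : F"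
  note sp = sp_state[OF s]
  let ?b = "ip \<phi> \<psi> y (mul w y)"
  let ?c = "qn \<phi> \<psi> (mul x y)"
  have "ip \<phi> \<psi> (mul x y) (mul x y) = ip \<phi> \<psi> (mul (st (st x)) y) (mul x y)"
   using x y by (intro I_teq1[OF sp teq_mul1[OF teq_sym[OF teq_st_st]]]) auto
  also have "... = ip \<phi> \<psi> y (mul (st x) (mul x y))" using x y by (intro I_adj[OF sp, symmetric]) auto
  also have "... = ?b" unfolding w_def using x y by (intro I_teq2[OF sp teq_sym[OF teq_mul_assoc]]) auto
  finally have "(?c)^2 <= cmod (?b)" using x y complex_Re_le_cmod by (simp add: q_sq(1)[OF sp])
  also have "... <= qn \<phi> \<psi> y * qn \<phi> \<psi> (mul w y)" using w y by (intro I_cs(2)[OF sp]) auto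
  also have "... <= qn \<phi> \<psi> y * (\<nu> w * qn \<phi> \<psi> y)" using q_sq(3)[OF sp y] y w by (intro mult_left_mono nu_bound[OF s]) auto
  also have "... = (?a * qn \<phi> \<psi> y)^2" using nu_nonneg[OF w] by (simp add: power_mult_distrib) (simp add: power2_eq_square)
  finally show "?c <= ?a * qn \<phi> \<psi> y"
   using nu_nonneg[OF w] q_sq(3)[OF sp y] by (rule_tac power2_le_imp_le) auto
 qed (use nu_nonneg[OF w] in auto)
 hence "(\<nu> x)^2 <= (?a)^2" using nu_nonneg[OF x] by (rule power_mono)
 thus "(\<nu> x)^2 <= \<nu> (mul (st x) x)" using nu_nonneg[OF w] by (simp add: w_def)
qed

lemma nu_nil [simp]: "\<nu> [] = 0"
 using nu_smult[of "[]" 0] by (simp add: fsmult_def)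

lemma nu_single_le: assumes "a : C[A]" "b : C[B]" shows "\<nu> [(a, b)] <= N[A] a * N[B] b"
 by (rule nu_le) (use assms q_mul_n1[OF sp_state, of _ _ "[(a, b)]"] in "auto simp: n1_def")

definition td :: "('a, 'b) formal => ('a, 'b) formal => real" where "td x y = \<nu> (fdiff A x y)"

lemma ev_fdiff: "bilin \<beta> ==> x : F ==> y : F ==> ev \<beta> (fdiff A x y) = ev \<beta> x - ev \<beta> y"
 by (simp add: fdiff_def ev_fsmult)

lemma td_teq: assumes "teq x y" "x : F" "y : F" shows "td x y = 0"
proof -
 show ?thesis using assms nu_teq[of "fdiff A x y" "[]"] by (simp add: ev_fdiff teq_def td_def)
qed
lemma td_nonneg: "x : F ==> y : F ==> 0 <= td x y" by (simp add: td_def nu_nonneg)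
lemma td_sym: assumes "x : F" "y : F" shows "td x y = td y x"
proof -
 show ?thesis using assms nu_smult[of "fdiff A y x" "-1"] nu_teq[of "fdiff A x y" "fsmult A (-1) (fdiff A y x)"] unfolding td_def by (simp add: ev_fdiff ev_fsmult teq_def)
qed
lemma nu_le_td: assumes "x : F" "y : F" shows "\<nu> x <= \<nu> y + td x y"
proof -
 show ?thesis using assms nu_append[of y "fdiff A x y"] nu_teq[of x "y @ fdiff A x y"] unfolding td_def by (simp add: ev_fdiff teq_def)
qed
lemma td_triangle: assumes "x : F" "y : F" "z : F" shows "td x z <= td x y + td y z"
proof -
 show ?thesis using assms nu_append[of "fdiff A x y" "fdiff A y z"] nu_teq[of "fdiff A x z" "fdiff A x y @ fdiff A y z"] unfolding td_def by (simp add: ev_fdiff teq_def)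
qed
lemma td_append: assumes "x : F" "y : F" "x' : F" "y' : F" shows "td (x @ y) (x' @ y') <= td x x' + td y y'"
proof -
 have "teq (fdiff A (x @ y) (x' @ y')) (fdiff A x x' @ fdiff A y y')" unfolding teq_def using assms by (simp add: ev_fdiff)
 thus ?thesis unfolding td_def using assms nu_append[of "fdiff A x x'" "fdiff A y y'"] nu_teq[of "fdiff A (x @ y) (x' @ y')"] by simp
qed
lemma td_smult: assumes "x : F" "y : F" shows "td (fsmult A c x) (fsmult A c y) = cmod c * td x y"
proof -
 have "teq (fdiff A (fsmult A c x) (fsmult A c y)) (fsmult A c (fdiff A x y))" unfolding teq_def using assms by (simp add: ev_fdiff ev_fsmult algebra_simps)
 thus ?thesis unfolding td_def using assms by (simp add: nu_teq nu_smult)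
qed
lemma td_st: assumes "x : F" "y : F" shows "td (st x) (st y) = td x y"
proof -
 have e: "ev \<beta> (st z) = cnj (ev (%a b. cnj (\<beta> (star A a) (star B b))) z)" for \<beta> z by (simp add: ev_st ev_linear)
 have "teq (fdiff A (st x) (st y)) (st (fdiff A x y))" unfolding teq_def using assms by (simp add: ev_fdiff e bilin_star)
 thus ?thesis unfolding td_def using assms by (simp add: nu_teq nu_st)
qed
lemma td_mul: assumes "x : F" "y : F" "x' : F" "y' : F" shows "td (mul x y) (mul x' y') <= td x x' * \<nu> y + \<nu> x' * td y y'"
proof -
 have s: "ev \<beta> (mul x z) = ev (%a' b'. ev (%a b. \<beta> (a *[A] a') (b *[B] b')) x) z" for \<beta> x z
  unfolding ev_mul by (rule ev_swap)
 let ?b = "mul (fdiff A x x')"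
 have m1: "ev \<beta> (?b y) = ev \<beta> (mul x y) - ev \<beta> (mul x' y)" if "bilin \<beta>" for \<beta>
  unfolding ev_mul using assms ev_fdiff[OF bilin_left[OF that assms(2)]] by simp
 let ?a = "mul x' (fdiff A y y')"
 have m2: "ev \<beta> (?a) = ev \<beta> (mul x' y) - ev \<beta> (mul x' y')" if "bilin \<beta>" for \<beta>
  unfolding s using assms ev_fdiff[OF bilin_right[OF that assms(3)]] by simp
 have "teq (fdiff A (mul x y) (mul x' y')) (?b y @ ?a)"
  unfolding teq_def using assms by (simp add: ev_fdiff m1 m2)
 hence "td (mul x y) (mul x' y') = \<nu> (?b y @ ?a)" unfolding td_def using assms by (intro nu_teq) auto
 also have "... <= \<nu> (?b y) + \<nu> (?a)" using assms by (intro nu_append) auto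
 also have "... <= td x x' * \<nu> y + \<nu> x' * td y y'" unfolding td_def using assms by (intro add_mono nu_mul) auto
 finally show ?thesis .
qed

end

section \<open>The completion of the formal sums\<close>

context tensor begin

definition tc :: "(nat => ('a, 'b) formal) => bool" where
 "tc s \<longleftrightarrow> (ALL n. s n : F) & (ALL e>0. EX N. ALL m>=N. ALL n>=N. td (s m) (s n) < e)"
definition sim :: "(nat => ('a, 'b) formal) => (nat => ('a, 'b) formal) => bool" where
 "sim s t \<longleftrightarrow> (%n. td (s n) (t n)) ~~> 0"
abbreviation "tcl == tclass A B"
abbreviation "T == tens A B"

lemma fcauchy_iff: "s : fcauchy A B \<longleftrightarrow> tc s" by (simp add: fcauchy_def tc_def td_def)
lemma tclass_eq: "tcl s = {t. tc t & sim s t}" unfolding tclass_def fcauchy_iff by (simp add: sim_def td_def)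
lemma tcF [simp]: "tc s ==> s n : F" by (simp add: tc_def)

lemma squeeze0: "(!!n. (0::real) <= f n) ==> (!!n. f n <= g n) ==> g ~~> 0 ==> f ~~> 0"
 by (rule real_tendsto_sandwich[of "%_. 0" f sequentially g 0]) auto

lemma sim_refl: "tc s ==> sim s s" by (simp add: sim_def td_teq)
lemma sim_sym: "tc s ==> tc t ==> sim s t ==> sim t s" by (simp add: sim_def td_sym[of "t _" "s _"])
lemma sim_trans: assumes "tc s" "tc t" "tc u" "sim s t" "sim t u" shows "sim s u"
 unfolding sim_def
 by (rule squeeze0[OF _ _ tendsto_add_zero[OF assms(4)[unfolded sim_def] assms(5)[unfolded sim_def]]]) (use assms in "auto intro: td_nonneg td_triangle")

lemma cls_eq_iff: assumes "tc s" "tc t" shows "tcl s = tcl t \<longleftrightarrow> sim s t"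
proof
 assume "tcl s = tcl t"
 moreover have "t : tcl t" using assms sim_refl by (simp add: tclass_eq)
 ultimately show "sim s t" by (auto simp: tclass_eq)
next
 assume st: "sim s t"
 show "tcl s = tcl t" unfolding tclass_eq using assms st sim_trans sim_sym by blast
qed

lemma trep_cls: assumes "tc s" shows "tc (trep (tcl s))" "sim s (trep (tcl s))"
proof -
 show "tc (trep (tcl s))" "sim s (trep (tcl s))" using assms sim_refl someI[of "%t. t : tcl s"] by (auto simp: trep_def tclass_eq)
qed

lemma T_carrier: "X : C[T] \<longleftrightarrow> (EX s. tc s & X = tcl s)"
 by (auto simp: tens_def fcauchy_iff image_iff)

lemma cls_carrier [simp]: "tc s ==> tcl s : C[T]" using T_carrier by blast

lemma cls_teq: "tc s ==> tc t ==> (!!n. teq (s n) (t n)) ==> tcl s = tcl t"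
 by (simp add: cls_eq_iff sim_def td_teq)

lemma tcI: "(!!n. s n : F) ==> (!!e. e > 0 ==> EX N. ALL m>=N. ALL n>=N. td (s m) (s n) < e) ==> tc s"
 by (simp add: tc_def)

lemma tc_append [simp]: assumes "tc s" "tc t" shows "tc (%n. s n @ t n)"
proof (rule tcI)
 fix e :: real assume e: "e > 0"
 obtain N where N: "!!m n. m >= N ==> n >= N ==> td (s m) (s n) < e/2" using assms(1) e unfolding tc_def by (meson half_gt_zero)
 obtain M where M: "!!m n. m >= M ==> n >= M ==> td (t m) (t n) < e/2" using assms(2) e unfolding tc_def by (meson half_gt_zero)
 have "td (s m @ t m) (s n @ t n) < e" if "m >= max N M" "n >= max N M" for m n
  using td_append[of "s m" "t m" "s n" "t n"] N[of m n] M[of m n] assms that by simp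
 thus "EX N. ALL m>=N. ALL n>=N. td (s m @ t m) (s n @ t n) < e" by blast
qed (use assms in simp)

lemma tc_smult [simp]: assumes "tc s" shows "tc (%n. fsmult A c (s n))"
proof (rule tcI)
 fix e :: real assume e: "e > 0"
 have "e / (cmod c + 1) > 0" using e by (simp add: add_nonneg_pos)
 then obtain N where N: "!!m n. m >= N ==> n >= N ==> td (s m) (s n) < e / (cmod c + 1)" using assms unfolding tc_def by meson
 have "td (fsmult A c (s m)) (fsmult A c (s n)) < e" if "m >= N" "n >= N" for m n
 proof -
  have "td (fsmult A c (s m)) (fsmult A c (s n)) <= (cmod c + 1) * td (s m) (s n)" using assms by (simp add: td_smult td_nonneg distrib_right)
  also have "... < e" using N[OF that] by (simp add: pos_less_divide_eq add_nonneg_pos mult.commute)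
  finally show ?thesis .
 qed
 thus "EX N. ALL m>=N. ALL n>=N. td (fsmult A c (s m)) (fsmult A c (s n)) < e" by blast
qed (use assms in simp)

lemma tc_st [simp]: assumes "tc s" shows "tc (%n. st (s n))"
 using assms unfolding tc_def by (simp add: td_st)

lemma tc_bounded: assumes s: "tc s" shows "EX M>0. ALL n. \<nu> (s n) <= M"
proof -
 obtain N where N: "!!m n. m >= N ==> n >= N ==> td (s m) (s n) < 1" using s unfolding tc_def by (meson zero_less_one)
 let ?a = "\<Sum>i\<le>N. \<nu> (s i)"
 have "\<nu> (s n) <= ?a + 1" for n
 proof (cases "n <= N")
  case True
  hence "\<nu> (s n) <= ?a" using s by (intro member_le_sum) (auto intro: nu_nonneg)
  thus ?thesis by simp
 next
  case False
  have "\<nu> (s N) <= ?a" using s by (intro member_le_sum) (auto intro: nu_nonneg)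
  thus ?thesis using nu_le_td[of "s n" "s N"] N[of n N] False s by simp
 qed
 moreover have "0 <= ?a" using s by (intro sum_nonneg) (auto intro: nu_nonneg)
 ultimately show ?thesis by (intro exI[of _ "?a + 1"]) auto
qed

lemma tc_mul [simp]: assumes "tc s" "tc t" shows "tc (%n. mul (s n) (t n))"
proof (rule tcI)
 obtain M where M: "M > 0" "!!n. \<nu> (s n) <= M" using tc_bounded[OF assms(1)] by blast
 obtain M' where M': "M' > 0" "!!n. \<nu> (t n) <= M'" using tc_bounded[OF assms(2)] by blast
 fix e :: real assume e: "e > 0"
 obtain N N' where N: "!!m n. m >= N ==> n >= N ==> td (s m) (s n) < e / (2 * M')" and N': "!!m n. m >= N' ==> n >= N' ==> td (t m) (t n) < e / (2 * M)"
  using e M M' assms unfolding tc_def by fastforce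
 have "td (mul (s m) (t m)) (mul (s n) (t n)) < e" if "m >= max N N'" "n >= max N N'" for m n
 proof -
  have "td (mul (s m) (t m)) (mul (s n) (t n)) <= td (s m) (s n) * \<nu> (t m) + \<nu> (s n) * td (t m) (t n)" using assms by (intro td_mul) auto
  also have "... <= td (s m) (s n) * M' + M * td (t m) (t n)" using assms M M' by (intro add_mono mult_left_mono mult_right_mono td_nonneg) auto
  also have "... < e / (2 * M') * M' + M * (e / (2 * M))" using N[of m n] N'[of m n] that M M' by (intro add_strict_mono mult_strict_left_mono mult_strict_right_mono) auto
  also have "... = e" using M M' by simp
  finally show ?thesis .
 qed
 thus "EX N. ALL m>=N. ALL n>=N. td (mul (s m) (t m)) (mul (s n) (t n)) < e" by blast
qed (use assms in simp)

lemma tc_const [simp]: "x : F ==> tc (%n. x)" by (simp add: tc_def td_teq)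

lemma tc_diff [simp]: "tc s ==> tc t ==> tc (%n. fdiff A (s n) (t n))" unfolding fdiff_def by simp

text \<open>The operations of \<open>tens\<close> act on chosen representatives; here and in the
  next lemmas any Cauchy representatives are shown to do.\<close>

lemma T_add: assumes "tc s" "tc t" shows "tcl s +[T] tcl t = tcl (%n. s n @ t n)"
proof -
 note r = trep_cls[OF assms(1)] trep_cls[OF assms(2)]
 let ?a = "%n. trep (tcl s) n @ trep (tcl t) n"
 have "sim (%n. s n @ t n) ?a" unfolding sim_def
  by (rule squeeze0[OF _ _ tendsto_add_zero[OF r(2)[unfolded sim_def] r(4)[unfolded sim_def]]]) (use assms r in "auto intro!: td_nonneg td_append")
 hence "tcl (%n. s n @ t n) = tcl ?a" using assms r by (simp add: cls_eq_iff)
 thus ?thesis by (simp add: tens_def)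
qed

lemma T_smult: assumes "tc s" shows "c \<odot>[T] tcl s = tcl (%n. fsmult A c (s n))"
proof -
 note r = trep_cls[OF assms(1)]
 have "tcl (%n. fsmult A c (s n)) = tcl (%n. fsmult A c (trep (tcl s) n))" using tendsto_mult_right_zero[OF r(2)[unfolded sim_def], of "cmod c"] assms r by (simp add: td_smult sim_def cls_eq_iff)
 thus ?thesis by (simp add: tens_def)
qed

lemma T_star: assumes "tc s" shows "star T (tcl s) = tcl (%n. st (s n))"
proof -
 note r = trep_cls[OF assms(1)]
 have "tcl (%n. st (s n)) = tcl (%n. st (trep (tcl s) n))" using assms r by (simp add: td_st sim_def cls_eq_iff)
 thus ?thesis by (simp add: tens_def)
qed

lemma T_mult: assumes "tc s" "tc t" shows "tcl s *[T] tcl t = tcl (%n. mul (s n) (t n))"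
proof -
 note r = trep_cls[OF assms(1)] trep_cls[OF assms(2)]
 obtain M where M: "M > 0" "!!n. \<nu> (t n) <= M" using tc_bounded[OF assms(2)] by blast
 obtain M' where M': "M' > 0" "!!n. \<nu> (trep (tcl s) n) <= M'" using tc_bounded[OF r(1)] by blast
 let ?a = "%n. mul (trep (tcl s) n) (trep (tcl t) n)"
 let ?b = "%n. mul (s n) (t n)"
 have "sim ?b ?a" unfolding sim_def
 proof (rule squeeze0)
  show "(%n. td (s n) (trep (tcl s) n) * M + M' * td (t n) (trep (tcl t) n)) ~~> 0"
   using r(2,4) unfolding sim_def by (intro tendsto_add_zero tendsto_mult_left_zero tendsto_mult_right_zero)
  show "td (mul (s n) (t n)) (mul (trep (tcl s) n) (trep (tcl t) n)) <= td (s n) (trep (tcl s) n) * M + M' * td (t n) (trep (tcl t) n)" for n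
   by (rule order_trans[OF td_mul]) (use assms r M M' in "auto intro!: add_mono mult_left_mono mult_right_mono td_nonneg")
 qed (use assms r in "auto intro!: td_nonneg")
 hence "tcl ?b = tcl ?a" using assms r by (simp add: cls_eq_iff)
 thus ?thesis by (simp add: tens_def)
qed

lemma nu_diff_le: "x : F ==> y : F ==> \<bar>\<nu> x - \<nu> y\<bar> <= td x y"
 using nu_le_td[of x y] nu_le_td[of y x] td_sym[of x y] by linarith

lemma T_norm_lim: assumes s: "tc s" shows "(%n. \<nu> (s n)) ~~> N[T] (tcl s)"
proof -
 note r = trep_cls[OF s]
 let ?a = "%n. \<nu> (trep (tcl s) n)"
 have "Cauchy ?a"
 proof (rule metric_CauchyI)
  fix e :: real assume "e > 0"
  then obtain N where N: "!!m n. m >= N ==> n >= N ==> td (trep (tcl s) m) (trep (tcl s) n) < e" using r(1) unfolding tc_def by meson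
  have "dist (\<nu> (trep (tcl s) m)) (\<nu> (trep (tcl s) n)) < e" if "m >= N" "n >= N" for m n
   using le_less_trans[OF nu_diff_le[OF tcF[OF r(1), of m] tcF[OF r(1), of n]] N[OF that]] by (simp add: dist_real_def)
  thus "EX M. ALL m>=M. ALL n>=M. dist (\<nu> (trep (tcl s) m)) (\<nu> (trep (tcl s) n)) < e" by blast
 qed
 hence 1: "?a ~~> N[T] (tcl s)" using Cauchy_convergent convergent_LIMSEQ_iff by (auto simp: tens_def)
 have "(%n. \<nu> (s n) - \<nu> (trep (tcl s) n)) ~~> 0"
  by (rule Lim_null_comparison[OF _ r(2)[unfolded sim_def]]) (use nu_diff_le s r(1) in "auto intro!: always_eventually")
 from tendsto_add[OF this 1] show ?thesis by simp
qed

lemma T_norm_eq: "tc s ==> (%n. \<nu> (s n)) ~~> l ==> N[T] (tcl s) = l"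
 using T_norm_lim LIMSEQ_unique by blast

lemma T_norm_mono: "tc s ==> (!!n. \<nu> (s n) <= f n) ==> f ~~> l ==> N[T] (tcl s) <= l"
 using LIMSEQ_le[OF T_norm_lim] by blast

lemma T_zero: "\<zero>[T] = tcl (%n. [])" by (simp add: tens_def)

lemma T_norm_zero_iff: assumes "tc s" shows "N[T] (tcl s) = 0 \<longleftrightarrow> tcl s = \<zero>[T]"
proof -
 have "teq (fdiff A (s n) []) (s n)" for n unfolding teq_def using assms by (simp add: ev_fdiff)
 hence e: "td (s n) [] = \<nu> (s n)" for n unfolding td_def using assms by (intro nu_teq) auto
 show ?thesis using assms T_norm_lim[OF assms] T_norm_eq[OF assms, of 0] by (auto simp: cls_eq_iff sim_def e T_zero)
qed

lemma T_abelian: "abelian_group T"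
proof (rule abelian_groupI)
 note all = T_carrier
 show "X +[T] Y : C[T]" if "X : C[T]" "Y : C[T]" for X Y
  using that[unfolded T_carrier] by (elim exE conjE) (simp add: T_add)
 show "\<zero>[T] : C[T]" unfolding T_zero by simp
 show "X +[T] Y +[T] Z = X +[T] (Y +[T] Z)" if "X : C[T]" "Y : C[T]" "Z : C[T]" for X Y Z
  using that by (auto simp: all T_add)
 show "X +[T] Y = Y +[T] X" if "X : C[T]" "Y : C[T]" for X Y
  using that[unfolded T_carrier] by (elim exE conjE) (simp add: T_add, rule cls_teq, auto intro: teq_comm)
 show "\<zero>[T] +[T] X = X" if "X : C[T]" for X using that by (auto simp: all T_add T_zero)
 show "EX Y:C[T]. Y +[T] X = \<zero>[T]" if X: "X : C[T]" for X
 proof -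
  obtain s where s: "tc s" "X = tcl s" using X all by blast
  have "tcl (%n. fsmult A (-1) (s n)) +[T] X = \<zero>[T]" unfolding s(2) T_zero using s(1)
   by (simp add: T_add) (rule cls_teq, auto simp: teq_def ev_fsmult)
  thus ?thesis using s(1) by auto
 qed
qed

lemma T_minus: assumes "tc s" "tc t" shows "tcl s -[T] tcl t = tcl (%n. fdiff A (s n) (t n))"
proof -
 interpret abelian_group T by (rule T_abelian)
 let ?a = "tcl (%n. fsmult A (-1) (t n))"
 have "?a +[T] tcl t = \<zero>[T]" unfolding T_zero using assms
  by (simp add: T_add) (rule cls_teq, auto simp: teq_def ev_fsmult)
 hence "\<ominus>\<^bsub>T\<^esub> tcl t = ?a" using assms by (intro minus_equality) auto
 thus ?thesis using assms by (simp add: a_minus_def T_add fdiff_def)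
qed

lemma T_dist_lim: "tc s ==> tc t ==> (%n. td (s n) (t n)) ~~> N[T] (tcl s -[T] tcl t)"
 unfolding td_def using T_norm_lim[of "%n. fdiff A (s n) (t n)"] by (simp add: T_minus)

lemma T_norm_nonneg: "X : C[T] ==> 0 <= N[T] X"
 unfolding T_carrier by (elim exE conjE, simp, rule LIMSEQ_le_const[OF T_norm_lim]) (auto intro!: nu_nonneg exI[of _ 0])

lemma T_dist_triangle: assumes "X : C[T]" "Y : C[T]" "Z : C[T]"
 shows "N[T] (X -[T] Z) <= N[T] (X -[T] Y) + N[T] (Y -[T] Z)"
proof -
 obtain s t u where h: "tc s" "tc t" "tc u" "X = tcl s" "Y = tcl t" "Z = tcl u" using assms T_carrier by metis
 show ?thesis unfolding h(4-6)
  by (rule LIMSEQ_le[OF T_dist_lim[OF h(1,3)] tendsto_add[OF T_dist_lim[OF h(1,2)] T_dist_lim[OF h(2,3)]]]) (use h in "auto intro!: td_triangle")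
qed

lemma T_metric: "Metric_space (C[T]) (%X Y. if X : C[T] & Y : C[T] then N[T] (X -[T] Y) else 0)"
proof
 interpret abelian_group T by (rule T_abelian)
 fix X Y Z
 let ?a = "if X : C[T] & Y : C[T] then N[T] (X -[T] Y) else 0"
 show "0 <= ?a" using T_norm_nonneg by simp
 show "?a = (if Y : C[T] & X : C[T] then N[T] (Y -[T] X) else 0)"
 proof -
  have "N[T] (tcl s -[T] tcl t) = N[T] (tcl t -[T] tcl s)" if "tc s" "tc t" for s t
   using T_dist_lim[OF that] T_dist_lim[OF that(2,1)] LIMSEQ_unique td_sym[of "s _" "t _"] that by simp
  thus ?thesis using T_carrier by auto
 qed
 assume X: "X : C[T]" and Y: "Y : C[T]"
 obtain s t where h: "tc s" "tc t" "X = tcl s" "Y = tcl t" using X Y T_carrier by metis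
 show "(?a = 0) = (X = Y)" using T_dist_lim[OF h(1,2)] LIMSEQ_unique h by (auto simp: cls_eq_iff sim_def)
 assume Z: "Z : C[T]"
 show "(if X : C[T] & Z : C[T] then N[T] (X -[T] Z) else 0) <= ?a + (if Y : C[T] & Z : C[T] then N[T] (Y -[T] Z) else 0)"
  using T_dist_triangle X Y Z by simp
qed

lemma T_dense: assumes X: "X : C[T]" and e: "e > 0" shows "EX x:F. N[T] (X -[T] tcl (%n. x)) < e"
proof -
 obtain s where s: "tc s" "X = tcl s" using X T_carrier by blast
 obtain N where N: "!!m n. m >= N ==> n >= N ==> td (s m) (s n) < e/2" using s(1) e unfolding tc_def by (meson half_gt_zero)
 have "N[T] (X -[T] tcl (%n. s N)) <= e/2" unfolding s(2)
  by (rule LIMSEQ_le_const2[OF T_dist_lim]) (use s N in "auto intro!: exI[of _ N] less_imp_le")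
 thus ?thesis using s(1) e by (intro bexI[of _ "s N"]) auto
qed

text \<open>Each term of a Cauchy sequence of classes is replaced by a single formal sum within 1 /
  (n + 1). These formal sums form a Cauchy sequence themselves, and its class is the limit.\<close>

lemma T_complete: "mcomplete_of (cmetric T)"
proof -
 interpret MS: Metric_space "C[T]" "%X Y. if X : C[T] & Y : C[T] then N[T] (X -[T] Y) else 0" by (rule T_metric)
 interpret abelian_group T by (rule T_abelian)
 have "MS.mcomplete" unfolding MS.mcomplete_def
 proof (intro allI impI)
  fix S assume "MS.MCauchy S"
  hence Sc: "!!n. S n : C[T]" and SC: "!!e. e > 0 ==> EX N. ALL n n'. n >= N --> n' >= N --> N[T] (S n -[T] S n') < e"
  proof -
   have *: "range S <= C[T]" "ALL e>0. EX N. ALL n n'. n >= N --> n' >= N --> (if S n : C[T] & S n' : C[T] then N[T] (S n -[T] S n') else 0) < e"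
    using \<open>MS.MCauchy S\<close> unfolding MS.MCauchy_def by auto
   thus "S n : C[T]" for n by blast
   thus "EX N. ALL n n'. n >= N --> n' >= N --> N[T] (S n -[T] S n') < e" if "e > 0" for e using *(2) that by simp
  qed
  have "ALL n. EX x:F. N[T] (S n -[T] tcl (%n. x)) < inverse (real (Suc n))" using T_dense[OF Sc] by simp
  then obtain x where x: "!!n. x n : F" "!!n. N[T] (S n -[T] tcl (%k. x n)) < inverse (real (Suc n))" by metis
  have xc: "tcl (%k. x n) : C[T]" for n using x by simp
  have sym: "N[T] (X -[T] Y) = N[T] (Y -[T] X)" if "X : C[T]" "Y : C[T]" for X Y
   using MS.commute[of X Y] that by simp
  have td: "td (x m) (x n) = N[T] (tcl (%k. x m) -[T] tcl (%k. x n))" for m n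
   by (rule LIMSEQ_unique[OF tendsto_const T_dist_lim[of "%k. x m" "%k. x n"]]) (use x in auto)
  have tcx: "tc x"
  proof (rule tcI)
   fix e :: real assume e: "e > 0"
   obtain N where N: "!!n n'. n >= N ==> n' >= N ==> N[T] (S n -[T] S n') < e/3" using SC[of "e/3"] e by auto
   obtain M where M: "inverse (real (Suc M)) < e/3" using reals_Archimedean[of "e/3"] e by auto
   have i: "inverse (real (Suc m)) < e/3" if "m >= M" for m
    using le_less_trans[OF le_imp_inverse_le M, of "real (Suc m)"] that by simp
   have "td (x m) (x n) < e" if "m >= max N M" "n >= max N M" for m n
   proof -
    show ?thesis using T_dist_triangle[OF xc[of m] Sc[of m] xc[of n]] T_dist_triangle[OF Sc[of m] Sc[of n] xc[of n]] sym[OF xc Sc, of m m] x(2)[of m] x(2)[of n] N[of m n] i[of m] i[of n] that unfolding td by simp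
   qed
   thus "EX N. ALL m>=N. ALL n>=N. td (x m) (x n) < e" by blast
  qed (rule x)
  have lim: "(%n. N[T] (S n -[T] tcl x)) ~~> 0"
  proof (rule LIMSEQ_I)
   fix e :: real assume e: "e > 0"
   obtain N where N: "!!m n. m >= N ==> n >= N ==> td (x m) (x n) < e/3" using tcx e unfolding tc_def by (meson divide_pos_pos zero_less_numeral)
   obtain M where M: "inverse (real (Suc M)) < e/3" using reals_Archimedean[of "e/3"] e by auto
   have i: "inverse (real (Suc m)) < e/3" if "m >= M" for m
    using le_less_trans[OF le_imp_inverse_le M, of "real (Suc m)"] that by simp
   have "N[T] (S n -[T] tcl x) < e" if "n >= max N M" for n
   proof -
    have "N[T] (tcl (%k. x n) -[T] tcl x) <= e/3"
     by (rule LIMSEQ_le_const2[OF T_dist_lim]) (use tcx x N that in "auto intro!: exI[of _ N] less_imp_le")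
    thus ?thesis using T_dist_triangle[OF Sc xc cls_carrier[OF tcx], of n n] x(2)[of n] i[of n] e that by simp
   qed
   thus "EX no. ALL n>=no. norm (N[T] (S n -[T] tcl x) - 0) < e"
    using T_norm_nonneg[OF minus_closed[OF Sc cls_carrier[OF tcx]]] by (auto intro!: exI[of _ "max N M"])
  qed
  show "EX X. limitin MS.mtopology S X sequentially"
   unfolding MS.limitin_metric_dist_null using Sc tcx lim by (intro exI[of _ "tcl x"]) auto
 qed
 thus ?thesis by (simp add: mcomplete_of_def cmetric_def)
qed

lemma complex_cring: "cring complex_ring"
 by (intro cringI abelian_groupI comm_monoidI) (auto simp: complex_ring_def algebra_simps intro: exI[of _ "- _"])

text \<open>Algebraic laws hold termwise up to \<open>teq\<close>; norm identities and inequalities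
  pass to the limit from \<open>min_norm\<close>.\<close>

theorem T_cstar: "cstar_algebra T"
proof (intro cstar_algebra.intro cstar_algebra_axioms.intro)
 note E = T_carrier
 note ops = T_add T_smult T_star T_mult
 show "Module.module complex_ring T"
 proof (rule moduleI[OF complex_cring T_abelian])
  fix a b X Y assume X: "X : C[T]"
  then obtain s where s: "tc s" "X = tcl s" using E by blast
  show "a \<odot>[T] X : C[T]" using s by (simp add: T_smult)
  show "(a +[complex_ring] b) \<odot>[T] X = a \<odot>[T] X +[T] b \<odot>[T] X"
   using s by (simp add: ops complex_ring_def) (rule cls_teq, auto simp: teq_def ev_fsmult distrib_right)
  show "(a *[complex_ring] b) \<odot>[T] X = a \<odot>[T] (b \<odot>[T] X)"
   using s by (simp add: ops complex_ring_def) (rule cls_teq, auto simp: teq_def ev_fsmult)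
  show "\<one>[complex_ring] \<odot>[T] X = X"
   using s by (simp add: ops complex_ring_def) (rule cls_teq, auto simp: teq_def ev_fsmult)
  assume "Y : C[T]"
  then obtain t where t: "tc t" "Y = tcl t" using E by blast
  show "a \<odot>[T] (X +[T] Y) = a \<odot>[T] X +[T] a \<odot>[T] Y"
   using s t by (simp add: ops) (rule cls_teq, auto simp: teq_def ev_fsmult distrib_left)
 qed
 have ev_mul_add: "ev \<beta> (mul (x @ y) z) = ev \<beta> (mul x z) + ev \<beta> (mul y z)" "ev \<beta> (mul z (x @ y)) = ev \<beta> (mul z x) + ev \<beta> (mul z y)" for \<beta> x y z
  by (simp_all add: ev_mul ev_linear)
 fix X Y Z c assume "X : C[T]"
 then obtain s where s: "tc s" "X = tcl s" using E by blast
 show "star T X : C[T]" using s by (simp add: T_star)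
 show "star T (star T X) = X" unfolding s using s by (simp add: ops) (rule cls_teq, auto intro: teq_st_st)
 let ?a = "c \<odot>[T] X"
 show "star T ?a = cnj c \<odot>[T] star T X"
 proof -
  have e: "ev \<beta> (st z) = cnj (ev (%a b. cnj (\<beta> (star A a) (star B b))) z)" for \<beta> z by (simp add: ev_st ev_linear)
  have "teq (st (fsmult A c (s n))) (fsmult A (cnj c) (st (s n)))" for n unfolding teq_def using s by (simp add: ev_fsmult e bilin_star)
  thus ?thesis unfolding s using s by (simp add: ops) (rule cls_teq, auto)
 qed
 show "0 <= N[T] X" using s by (simp add: T_norm_nonneg)
 show "(N[T] X = 0) = (X = \<zero>[T])" unfolding s(2) by (rule T_norm_zero_iff[OF s(1)])
 show "N[T] ?a = cmod c * N[T] X" unfolding s(2) T_smult[OF s(1)]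
  by (rule T_norm_eq) (use s tendsto_mult_left[OF T_norm_lim[OF s(1)], of "cmod c"] in "auto simp: nu_smult")
 show "N[T] (star T X *[T] X) = (N[T] X)^2" unfolding s(2) T_star[OF s(1)] T_mult[OF tc_st[OF s(1)] s(1)]
  by (rule T_norm_eq) (use s tendsto_power[OF T_norm_lim[OF s(1)], of 2] in "auto simp: nu_cstar")
 assume "Y : C[T]"
 then obtain t where t: "tc t" "Y = tcl t" using E by blast
 show "X *[T] Y : C[T]" using s t by (simp add: T_mult)
 show "?a *[T] Y = c \<odot>[T] (X *[T] Y)" unfolding s t using s t by (simp add: ops) (rule cls_teq, auto intro!: teq_smult_mul)
 show "X *[T] (c \<odot>[T] Y) = c \<odot>[T] (X *[T] Y)" unfolding s t using s t by (simp add: ops) (rule cls_teq, auto intro!: teq_smult_mul)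
 show "star T (X +[T] Y) = star T X +[T] star T Y" unfolding s t using s t by (simp add: ops) (rule cls_teq, auto, simp add: fstar_def)
 show "star T (X *[T] Y) = star T Y *[T] star T X" unfolding s t using s t by (simp add: ops) (rule cls_teq, auto intro!: teq_st_mul)
 show "N[T] (X +[T] Y) <= N[T] X + N[T] Y" unfolding s(2) t(2) T_add[OF s(1) t(1)]
  by (rule T_norm_mono[OF _ _ tendsto_add[OF T_norm_lim[OF s(1)] T_norm_lim[OF t(1)]]]) (use s t in "auto intro: nu_append")
 show "N[T] (X *[T] Y) <= N[T] X * N[T] Y" unfolding s(2) t(2) T_mult[OF s(1) t(1)]
  by (rule T_norm_mono[OF _ _ tendsto_mult[OF T_norm_lim[OF s(1)] T_norm_lim[OF t(1)]]]) (use s t in "auto intro: nu_mul")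
 assume "Z : C[T]"
 then obtain u where u: "tc u" "Z = tcl u" using E by blast
 show "X *[T] Y *[T] Z = X *[T] (Y *[T] Z)" unfolding s t u using s t u by (simp add: ops) (rule cls_teq, auto intro!: teq_mul_assoc)
 show "(X +[T] Y) *[T] Z = X *[T] Z +[T] Y *[T] Z" unfolding s t u using s t u by (simp add: ops) (rule cls_teq, auto simp: teq_def ev_mul_add)
 show "X *[T] (Y +[T] Z) = X *[T] Y +[T] X *[T] Z" unfolding s t u using s t u by (simp add: ops) (rule cls_teq, auto simp: teq_def ev_mul_add)
qed (rule T_complete)

end

section \<open>Cuntz classes in the stabilisation\<close>

context cstar_algebra begin

lemma diff_split: "x : C[A] ==> y : C[A] ==> z : C[A] ==> x -[A] z = (x -[A] y) +[A] (y -[A] z)"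
 by (simp add: a_minus_def M.a_assoc M.r_neg1 M.r_neg2)
lemma diff_add: "x : C[A] ==> y : C[A] ==> (x -[A] y) +[A] y = x"
 by (simp add: a_minus_def M.a_assoc M.l_neg)
lemma diff_add2: assumes "x : C[A]" "y : C[A]" "x' : C[A]" "y' : C[A]"
 shows "(x +[A] y) -[A] (x' +[A] y') = (x -[A] x') +[A] (y -[A] y')"
 using assms by (simp add: a_minus_def M.minus_add M.a_ac)
lemma smult_diff: "x : C[A] ==> y : C[A] ==> c \<odot> (x -[A] y) = c \<odot> x -[A] c \<odot> y"
 by (simp add: a_minus_def sm_add_right sm_neg1[symmetric] mult.commute flip: sm_assoc)
lemma mult_diff: assumes "x : C[A]" "y : C[A]" "x' : C[A]" "y' : C[A]"
 shows "x *[A] y -[A] x' *[A] y' = (x -[A] x') *[A] y +[A] x' *[A] (y -[A] y')"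
 using diff_split[of "x *[A] y" "x' *[A] y" "x' *[A] y'"] assms by (simp add: diff_distr)
lemma norm_diff3: "x : C[A] ==> y : C[A] ==> \<bar>N[A] x - N[A] y\<bar> <= N[A] (x -[A] y)"
 using norm_triangle[of "x -[A] y" y] norm_triangle[of "y -[A] x" x] norm_minus_commute[of x y] by (simp add: diff_add)

definition cvg :: "(nat => 'a) => 'a => bool" where
 "cvg s x \<longleftrightarrow> (ALL n. s n : C[A]) & x : C[A] & (%n. N[A] (s n -[A] x)) ~~> 0"

lemma cvgD: "cvg s x ==> s n : C[A]" "cvg s x ==> x : C[A]" by (auto simp: cvg_def)

lemma cvgI: assumes "!!n. s n : C[A]" "x : C[A]" "!!n. N[A] (s n -[A] x) <= f n" "f ~~> 0" shows "cvg s x"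
proof -
 have "(%n. N[A] (s n -[A] x)) ~~> 0"
  by (rule real_tendsto_sandwich[OF _ _ tendsto_const assms(4)]) (use assms norm_nonneg in "auto intro!: always_eventually")
 thus ?thesis using assms by (simp add: cvg_def)
qed

lemma cvg_const: "x : C[A] ==> cvg (%n. x) x" by (simp add: cvg_def)

lemma cvg_add: assumes "cvg s x" "cvg t y" shows "cvg (%n. s n +[A] t n) (x +[A] y)"
proof (rule cvgI)
 show "N[A] ((s n +[A] t n) -[A] (x +[A] y)) <= N[A] (s n -[A] x) + N[A] (t n -[A] y)" for n
  using norm_triangle[of "s n -[A] x" "t n -[A] y"] cvgD[OF assms(1)] cvgD[OF assms(2)] by (simp add: diff_add2)
 show "(%n. N[A] (s n -[A] x) + N[A] (t n -[A] y)) ~~> 0" using assms by (intro tendsto_add_zero) (auto simp: cvg_def)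
qed (use cvgD[OF assms(1)] cvgD[OF assms(2)] in auto)

lemma cvg_smult: assumes "cvg s x" shows "cvg (%n. c \<odot> s n) (c \<odot> x)"
proof (rule cvgI)
 show "N[A] (c \<odot> s n -[A] c \<odot> x) <= cmod c * N[A] (s n -[A] x)" for n
  using cvgD[OF assms] by (simp add: norm_smult flip: smult_diff)
 show "(%n. cmod c * N[A] (s n -[A] x)) ~~> 0" using assms by (intro tendsto_mult_right_zero) (auto simp: cvg_def)
qed (use cvgD[OF assms] in auto)

lemma cvg_diff: assumes "cvg s x" "cvg t y" shows "cvg (%n. s n -[A] t n) (x -[A] y)"
 using cvg_add[OF assms(1) cvg_smult[OF assms(2), of "-1"]] cvgD[OF assms(2)] by (simp add: sm_neg1 a_minus_def)

lemma cvg_star: assumes "cvg s x" shows "cvg (%n. star A (s n)) (star A x)"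
proof -
 have "N[A] (star A (s n) -[A] star A x) = N[A] (s n -[A] x)" for n
  using cvgD[OF assms] norm_star[of "s n -[A] x"] by (simp add: star_diff)
 thus ?thesis using assms by (simp add: cvg_def)
qed

lemma cvg_norm: assumes "cvg s x" shows "(%n. N[A] (s n)) ~~> N[A] x"
proof -
 have "(%n. N[A] (s n) - N[A] x) ~~> 0"
  by (rule Lim_null_comparison[of _ "%n. N[A] (s n -[A] x)"]) (use assms norm_diff3 in "auto simp: cvg_def")
 thus ?thesis by (simp add: LIM_zero_iff)
qed

lemma cvg_mult: assumes "cvg s x" "cvg t y" shows "cvg (%n. s n *[A] t n) (x *[A] y)"
proof (rule cvgI)
 note c = cvgD[OF assms(1)] cvgD[OF assms(2)]
 show "N[A] (s n *[A] t n -[A] x *[A] y) <= N[A] (s n -[A] x) * N[A] (t n) + N[A] x * N[A] (t n -[A] y)" for n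
 proof -
  let ?a = "x *[A] (t n -[A] y)"
  have "N[A] (s n *[A] t n -[A] x *[A] y) <= N[A] ((s n -[A] x) *[A] t n) + N[A] (?a)"
   using mult_diff[of "s n" "t n" x y] norm_triangle[of "(s n -[A] x) *[A] t n" "?a"] c by simp
  also have "... <= N[A] (s n -[A] x) * N[A] (t n) + N[A] x * N[A] (t n -[A] y)" using c by (intro add_mono norm_mult) auto
  finally show ?thesis .
 qed
 show "(%n. N[A] (s n -[A] x) * N[A] (t n) + N[A] x * N[A] (t n -[A] y)) ~~> 0"
 proof (rule tendsto_add_zero)
  show "(%n. N[A] (s n -[A] x) * N[A] (t n)) ~~> 0" using tendsto_mult[OF _ cvg_norm[OF assms(2)], of _ 0] assms(1) by (simp add: cvg_def)
  show "(%n. N[A] x * N[A] (t n -[A] y)) ~~> 0" using assms(2) by (intro tendsto_mult_right_zero) (simp add: cvg_def)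
 qed
qed (use cvgD[OF assms(1)] cvgD[OF assms(2)] in auto)

lemma cvg_unique: assumes "cvg s x" "cvg s y" shows "x = y"
proof -
 have "N[A] (x -[A] y) = 0" using cvg_norm[OF cvg_diff[OF assms(1) cvg_const[OF cvgD(2)[OF assms(2)]]]] assms(2) LIMSEQ_unique by (auto simp: cvg_def)
 thus ?thesis using assms by (simp add: diff_zero_iff cvg_def)
qed

lemma cvg_norm_le: assumes "cvg s x" "!!n. n >= N ==> N[A] (s n) <= c" shows "N[A] x <= c"
 by (rule LIMSEQ_le_const2[OF cvg_norm[OF assms(1)]]) (use assms in blast)

lemma cvg_sq_iter: "cvg s x ==> cvg (%n. sq_iter A (s n) m) (sq_iter A x m)"
 by (induction m) (simp_all add: cvg_const, intro cvg_add cvg_smult cvg_diff cvg_mult)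

lemma sq_iter_closed [simp]: "x : C[A] ==> sq_iter A x m : C[A]" by (induction m) auto

text \<open>The square-root bounds as a condition on x. Unlike the defining form star y y of
  positive elements it passes to norm limits at once, and \<open>sqb_pos\<close> leads back to
  positivity.\<close>

definition sqb :: "'a => bool" where
 "sqb x = (ALL m>=1. star A (sq_iter A x m) = sq_iter A x m &
  N[A] (sq_iter A x m *[A] sq_iter A x m -[A] x) <= 4 / m &
  (ALL l>=m. N[A] (sq_iter A x l -[A] sq_iter A x m) <= 4 / m))"

lemma sqb_limit: assumes "cvg s x" "!!n. sqb (s n)" shows "sqb x"
 unfolding sqb_def
proof (intro allI impI conjI)
 fix m :: nat assume m: "m >= 1"
 note c = cvg_sq_iter[OF assms(1)]
 show "star A (sq_iter A x m) = sq_iter A x m" using assms(2) m cvg_star[OF c[of m]] c[of m] cvg_unique by (simp add: sqb_def)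
 show "N[A] (sq_iter A x m *[A] sq_iter A x m -[A] x) <= 4 / m"
  by (rule cvg_norm_le[OF cvg_diff[OF cvg_mult[OF c c] assms(1)]]) (use assms(2) m in "auto simp: sqb_def")
 show "N[A] (sq_iter A x l -[A] sq_iter A x m) <= 4 / m" if "l >= m" for l
  by (rule cvg_norm_le[OF cvg_diff[OF c c]]) (use assms(2) m that in "auto simp: sqb_def")
qed

lemma inv_nat_small: "e > 0 ==> EX N::nat>=1. ALL m>=N. c / real m < e"
proof -
 assume e: "e > 0"
 obtain N where N: "real N > c / e" using reals_Archimedean2 by blast
 have "c / real m < e" if "m >= max 1 N" for m
 proof -
  have "c / e < real m" "real m > 0" using that N by auto
  thus ?thesis using e by (simp add: pos_divide_less_eq mult.commute)
 qed
 thus ?thesis by (intro exI[of _ "max 1 N"]) auto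
qed

definition rt :: "'a => 'a" where "rt x = (SOME r. cvg (sq_iter A x) r)"

lemma sqb_rt: assumes x: "x : C[A]" and "sqb x"
 shows "cvg (sq_iter A x) (rt x)" "star A (rt x) = rt x" "rt x *[A] rt x = x" "m >= 1 ==> N[A] (rt x -[A] sq_iter A x m) <= 4 / m"
proof -
 have h: "star A (sq_iter A x m) = sq_iter A x m" "N[A] (sq_iter A x m *[A] sq_iter A x m -[A] x) <= 4 / m" "l >= m ==> N[A] (sq_iter A x l -[A] sq_iter A x m) <= 4 / m"
  if "m >= 1" for m l using assms(2) that by (auto simp: sqb_def)
 have "EX r:C[A]. (%n. N[A] (sq_iter A x n -[A] r)) ~~> 0"
 proof (rule cauchy_limit)
  fix e :: real assume "e > 0"
  then obtain N :: nat where N: "N >= 1" "!!m. m >= N ==> 4 / real m < e" using inv_nat_small by blast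
  have "N[A] (sq_iter A x m -[A] sq_iter A x n) < e" if "m >= N" "n >= N" for m n
  proof (cases "m >= n")
   case True
   thus ?thesis using h(3)[of n m] N(2)[of n] N(1) that by simp
  next
   case False
   thus ?thesis using h(3)[of m n] N(2)[of m] N(1) that norm_minus_commute[of "sq_iter A x m" "sq_iter A x n"] x by simp
  qed
  thus "EX N. ALL m>=N. ALL n>=N. N[A] (sq_iter A x m -[A] sq_iter A x n) < e" by blast
 qed (use x in simp)
 hence "EX r. cvg (sq_iter A x) r" using x by (auto simp: cvg_def)
 thus c: "cvg (sq_iter A x) (rt x)" unfolding rt_def by (rule someI_ex)
 define s where "s n = sq_iter A x (Suc n)" for n
 have cs: "cvg s (rt x)" using c LIMSEQ_Suc[of "%n. N[A] (sq_iter A x n -[A] rt x)" 0] unfolding cvg_def s_def by blast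
 have "(%n. star A (s n)) = s" using h(1) by (auto simp: s_def fun_eq_iff simp del: sq_iter.simps)
 thus "star A (rt x) = rt x" using cs cvg_star[OF cs] cvg_unique by simp
 have "cvg (%n. s n *[A] s n) x"
 proof (rule cvgI)
  show "N[A] (s n *[A] s n -[A] x) <= 4 * inverse (real (Suc n))" for n using h(2)[of "Suc n"] by (simp add: s_def divide_inverse del: sq_iter.simps)
  show "(%n. 4 * inverse (real (Suc n))) ~~> 0" by (intro tendsto_mult_right_zero LIMSEQ_inverse_real_of_nat)
 qed (use x in "simp_all add: s_def del: sq_iter.simps")
 thus "rt x *[A] rt x = x" using cvg_mult[OF cs cs] cvg_unique by blast
 show "N[A] (rt x -[A] sq_iter A x m) <= 4 / m" if "m >= 1"
  by (rule cvg_norm_le[OF cvg_diff[OF c cvg_const], of _ m]) (use h(3) that x in auto)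
qed

lemma sqb_pos: assumes "x : C[A]" "sqb x" shows "x : pos A"
 using sqb_rt[OF assms] cvgD(2)[OF sqb_rt(1)[OF assms]] unfolding pos_def by force

text \<open>The root is a uniform limit, with error 4 / m, of the continuous maps
  \<open>sq_iter\<close>, hence continuous.\<close>

lemma cvg_rt: assumes "cvg s x" "!!n. sqb (s n)" shows "cvg (%n. rt (s n)) (rt x)"
proof -
 have sc: "s n : C[A]" and xc: "x : C[A]" for n using cvgD[OF assms(1)] by auto
 have x: "sqb x" by (rule sqb_limit[OF assms])
 note rs = sqb_rt[OF sc assms(2)] and rx = sqb_rt[OF xc x]
 have rc: "rt (s n) : C[A]" "rt x : C[A]" for n using cvgD(2)[OF rs(1)] cvgD(2)[OF rx(1)] by auto
 have "(%n. N[A] (rt (s n) -[A] rt x)) ~~> 0"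
 proof (rule LIMSEQ_I)
  fix e :: real assume e: "e > 0"
  then obtain m :: nat where m: "m >= 1" "4 / real m < e / 3" using inv_nat_small[of "e/3" 4] by auto
  obtain N where N: "!!n. n >= N ==> N[A] (sq_iter A (s n) m -[A] sq_iter A x m) < e / 3"
   using cvg_sq_iter[OF assms(1), of m] order_tendstoD(2)[of "%n. N[A] (sq_iter A (s n) m -[A] sq_iter A x m)" 0 sequentially "e/3"] e unfolding eventually_sequentially by (auto simp: cvg_def)
  have "N[A] (rt (s n) -[A] rt x) < e" if "n >= N" for n
  using dist_triangle[of "rt (s n)" "sq_iter A (s n) m" "rt x"] dist_triangle[of "sq_iter A (s n) m" "sq_iter A x m" "rt x"] rc sc xc rs(4)[of m n] rx(4)[of m] m N[OF that] norm_minus_commute[of "sq_iter A x m" "rt x"] by auto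
  thus "EX no. ALL n>=no. norm (N[A] (rt (s n) -[A] rt x) - 0) < e" using norm_nonneg rc by auto
 qed
 thus ?thesis using rc by (simp add: cvg_def)
qed

lemma pos_closed: "x : pos A ==> x : C[A]" by (auto simp: pos_def)

lemma pos_star: "x : pos A ==> star A x = x" by (auto simp: pos_def star_mult star_star)

lemma pos_conj: assumes "b : pos A" "w : C[A]" shows "w *[A] b *[A] star A w : pos A"
proof -
 obtain c where c: "c : C[A]" "b = star A c *[A] c" using assms by (auto simp: pos_def)
 have "w *[A] b *[A] star A w = star A (c *[A] star A w) *[A] (c *[A] star A w)" using c assms by (simp add: star_mult star_star mult_assoc)
 thus ?thesis using c assms unfolding pos_def by blast
qed

lemma pos_scale: assumes "x : pos A" "t >= 0" shows "complex_of_real t \<odot> x : pos A"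
proof -
 obtain c where c: "c : C[A]" "x = star A c *[A] c" using assms by (auto simp: pos_def)
 let ?a = "complex_of_real (sqrt t) \<odot> c"
 have "complex_of_real t \<odot> x = star A ?a *[A] ?a"
  using c assms by (simp add: star_smult smult_mult_left smult_mult_right flip: sm_assoc of_real_mult)
 thus ?thesis using c unfolding pos_def by blast
qed

lemma cuntz_le_iff: assumes "a : C[A]" "b : C[A]"
 shows "cuntz_le A a b = (ALL e>0. EX v:C[A]. N[A] (v *[A] b *[A] star A v -[A] a) < e)"
proof
 assume "cuntz_le A a b"
 then obtain v where v: "!!n::nat. v n : C[A]" "(%n. N[A] ((v n *[A] b *[A] star A (v n)) -[A] a)) ~~> 0" by (auto simp: cuntz_le_def)
 show "ALL e>0. EX v:C[A]. N[A] (v *[A] b *[A] star A v -[A] a) < e"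
 proof (intro allI impI)
  fix e :: real assume "e > 0"
  thus "EX v:C[A]. N[A] (v *[A] b *[A] star A v -[A] a) < e" using order_tendstoD(2)[OF v(2)] v(1) eventually_happens by force
 qed
next
 assume h: "ALL e>0. EX v:C[A]. N[A] (v *[A] b *[A] star A v -[A] a) < e"
 have "EX v:C[A]. N[A] (v *[A] b *[A] star A v -[A] a) < inverse (real (Suc n))" for n using h by simp
 then obtain v where v: "!!n. v n : C[A]" "!!n. N[A] (v n *[A] b *[A] star A (v n) -[A] a) < inverse (real (Suc n))" by metis
 have "cvg (%n. v n *[A] b *[A] star A (v n)) a"
  by (rule cvgI[OF _ assms(1) less_imp_le[OF v(2)] LIMSEQ_inverse_real_of_nat]) (use v(1) assms in auto)
 thus "cuntz_le A a b" using v(1) unfolding cuntz_le_def cvg_def by blast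
qed

lemma conj_norm_le: assumes "u : C[A]" "x : C[A]" "y : C[A]"
 shows "N[A] (u *[A] x *[A] star A u -[A] u *[A] y *[A] star A u) <= (N[A] u)^2 * N[A] (x -[A] y)"
proof -
 let ?a = "u *[A] (x -[A] y)"
 have "u *[A] x *[A] star A u -[A] u *[A] y *[A] star A u = ?a *[A] star A u" using assms by (simp add: diff_distr)
 also have "N[A] ... <= N[A] (?a) * N[A] u" using assms norm_mult[of "?a" "star A u"] by simp
 also have "... <= (N[A] u * N[A] (x -[A] y)) * N[A] u" using assms by (intro mult_right_mono norm_mult norm_nonneg) auto
 finally show ?thesis by (simp add: power2_eq_square mult_ac)
qed

lemma cuntz_trans: assumes "a : C[A]" "b : C[A]" "c : C[A]" "cuntz_le A a b" "cuntz_le A b c" shows "cuntz_le A a c"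
 unfolding cuntz_le_iff[OF assms(1,3)]
proof (intro allI impI)
 fix e :: real assume e: "e > 0"
 then obtain v where v: "v : C[A]" "N[A] (v *[A] b *[A] star A v -[A] a) < e/2" using assms(4) unfolding cuntz_le_iff[OF assms(1,2)] by (meson half_gt_zero)
 define d where "d = e / (2 * ((N[A] v)^2 + 1))"
 have p: "(N[A] v)^2 + 1 > 0" by (simp add: add_nonneg_pos)
 hence "d > 0" using e by (simp add: d_def)
 then obtain u where u: "u : C[A]" "N[A] (u *[A] c *[A] star A u -[A] b) < d" using assms(5) unfolding cuntz_le_iff[OF assms(2,3)] by blast
 let ?b = "v *[A] u"
 have "N[A] (?b *[A] c *[A] star A ?b -[A] a) < e"
 proof -
  let ?a = "v *[A] (u *[A] c *[A] star A u)"
  have eq: "?b *[A] c *[A] star A ?b = ?a *[A] star A v" using u v assms by (simp add: star_mult mult_assoc)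
  have "N[A] (?a *[A] star A v -[A] v *[A] b *[A] star A v) <= (N[A] v)^2 * N[A] (u *[A] c *[A] star A u -[A] b)"
   using u v assms by (intro conj_norm_le) auto
  also have "... <= ((N[A] v)^2 + 1) * d" using u assms by (intro mult_mono) (auto intro: norm_nonneg)
  also have "... = e/2"
  proof -
   have "P * (e / (2 * P)) = e/2" if "P > 0" for P using that by simp
   from this[OF p] show ?thesis by (simp only: d_def)
  qed
  finally show ?thesis unfolding eq using dist_triangle[of "?a *[A] star A v" "v *[A] b *[A] star A v" a] u v assms by simp
 qed
 thus "EX v:C[A]. N[A] (v *[A] c *[A] star A v -[A] a) < e" using u v by blast
qed

lemma cuntz_conj: assumes "b : C[A]" "w : C[A]" shows "cuntz_le A (w *[A] b *[A] star A w) b"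
 unfolding cuntz_le_def using assms by auto

end

section \<open>Corners by projections\<close>

lemma normed_metric:
 assumes "abelian_group R" "!!x. x : C[R] ==> 0 <= N x" "!!x. x : C[R] ==> N x = 0 \<longleftrightarrow> x = \<zero>[R]"
  "!!x y. x : C[R] ==> y : C[R] ==> N (x +[R] y) <= N x + N y" "!!x. x : C[R] ==> N (\<ominus>\<^bsub>R\<^esub> x) = (N x :: real)"
 shows "Metric_space (C[R]) (%x y. if x : C[R] & y : C[R] then N (x -[R] y) else 0)"
proof
 interpret abelian_group R by (rule assms(1))
 show "0 <= (if x : C[R] & y : C[R] then N (x -[R] y) else 0)" for x y using assms(2) by simp
 show "(if x : C[R] & y : C[R] then N (x -[R] y) else 0) = (if y : C[R] & x : C[R] then N (y -[R] x) else 0)" for x y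
 proof (cases "x : C[R] & y : C[R]")
  case True
  thus ?thesis using assms(5)[of "x -[R] y"] by (simp add: minus_minus a_minus_def minus_add a_comm)
 qed auto
 fix x y assume x: "x : C[R]" and y: "y : C[R]"
 have "x = y" if "x -[R] y = \<zero>[R]"
 proof -
  have "x = (x -[R] y) +[R] y" using x y by (simp add: a_minus_def a_assoc l_neg)
  thus ?thesis using that y by simp
 qed
 moreover have "x -[R] x = \<zero>[R]" using x by (simp add: a_minus_def r_neg)
 ultimately show "((if x : C[R] & y : C[R] then N (x -[R] y) else 0) = 0) = (x = y)" using assms(3) x y by auto
 fix z assume z: "z : C[R]"
 show "(if x : C[R] & z : C[R] then N (x -[R] z) else 0) <= (if x : C[R] & y : C[R] then N (x -[R] y) else 0) + (if y : C[R] & z : C[R] then N (y -[R] z) else 0)"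
  using x y z assms(4)[of "x -[R] y" "y -[R] z"] by (simp add: a_minus_def a_assoc r_neg1 r_neg2)
qed

text \<open>A unital algebra with unit q inside an algebra that may have none, with the same
  operations and norm, so that \<open>ucs_facts\<close> can be applied to it.\<close>

definition corner :: "'a cstar => 'a => 'a cstar" where
 "corner A q = A\<lparr>carrier := {x : C[A]. q *[A] x = x & x *[A] q = x}, one := q\<rparr>"

lemma corner_simps [simp]: "x +[corner A q] y = x +[A] y" "x *[corner A q] y = x *[A] y" "\<zero>[corner A q] = \<zero>[A]" "\<one>[corner A q] = q"
  "c \<odot>[corner A q] x = c \<odot>[A] x" "star (corner A q) = star A" "N[corner A q] = N[A]"
 by (simp_all add: corner_def)

lemma corner_carrier: "x : C[corner A q] \<longleftrightarrow> x : C[A] & q *[A] x = x & x *[A] q = x"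
 by (simp add: corner_def)

lemma corner_ucs:
 fixes B :: "'x cstar"
 assumes B: "cstar_algebra B" and q: "q : C[B]" "star B q = q" "q *[B] q = q" "q ~= \<zero>[B]"
 shows "ucs (corner B q)" "x : C[corner B q] ==> y : C[corner B q] ==> x -[corner B q] y = x -[B] y"
proof -
 interpret B: cstar_algebra B by (rule B)
 let ?C = "corner B q"
 note cc = corner_carrier
 have ab: "abelian_group ?C"
 proof (rule abelian_groupI)
  show "EX y:C[?C]. y +[?C] x = \<zero>[?C]" if "x : C[?C]" for x
   using that q by (intro bexI[of _ "\<ominus>\<^bsub>B\<^esub> x"]) (auto simp: cc B.M.l_neg B.minus_mult)
 qed (use q in "auto simp: cc B.distr_left B.distr_right B.M.a_ac")
 interpret C: abelian_group ?C by (rule ab)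
 have neg: "\<ominus>\<^bsub>?C\<^esub> x = \<ominus>\<^bsub>B\<^esub> x" if "x : C[?C]" for x
  using that q C.minus_equality[of "\<ominus>\<^bsub>B\<^esub> x" x] by (auto simp: cc B.M.l_neg B.minus_mult)
 show diff: "x -[?C] y = x -[B] y" if "x : C[?C]" "y : C[?C]" for x y
  using that neg by (simp add: a_minus_def)
 have sub: "x : C[B]" if "x : C[?C]" for x using that by (simp add: cc)
 have met: "Metric_space (C[?C]) (%x y. if x : C[?C] & y : C[?C] then N[?C] (x -[?C] y) else 0)"
  by (rule normed_metric[OF ab]) (auto simp: neg sub B.norm_nonneg B.norm_eq_zero B.norm_triangle)
 interpret MC: Metric_space "C[?C]" "%x y. if x : C[?C] & y : C[?C] then N[?C] (x -[?C] y) else 0" by (rule met)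
 have comp: "mcomplete_of (cmetric ?C)"
 proof -
  have "MC.mcomplete" unfolding MC.mcomplete_def
  proof (intro allI impI)
   fix s assume "MC.MCauchy s"
   hence r: "range s <= C[?C]" "ALL e>0. EX N. ALL n n'. N <= n --> N <= n' --> (if s n : C[?C] & s n' : C[?C] then N[?C] (s n -[?C] s n') else 0) < e" by (auto simp: MC.MCauchy_def)
   hence sc: "s n : C[?C]" for n by blast
   have "EX x:C[B]. (%n. N[B] (s n -[B] x)) ~~> 0"
    by (rule B.cauchy_limit) (use r(2) sc sub in "simp_all add: diff")
   then obtain x where x: "B.cvg s x" using sc sub by (auto simp: B.cvg_def)
   have "B.cvg (%n. q *[B] s n) (q *[B] x)" "B.cvg (%n. s n *[B] q) (x *[B] q)" using x q by (auto intro: B.cvg_mult B.cvg_const)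
   hence "B.cvg s (q *[B] x)" "B.cvg s (x *[B] q)" using sc by (simp_all add: cc)
   hence xC: "x : C[?C]" using B.cvg_unique[OF x] B.cvgD(2)[OF x] unfolding cc by metis
   show "EX x. limitin MC.mtopology s x sequentially"
    unfolding MC.limitin_metric_dist_null using xC sc x by (intro exI[of _ x]) (auto simp: diff B.cvg_def)
  qed
  thus ?thesis by (simp add: mcomplete_of_def cmetric_def)
 qed
 have "cstar_algebra ?C"
 proof (intro cstar_algebra.intro cstar_algebra_axioms.intro)
  show "Module.module complex_ring ?C"
   by (rule moduleI[OF module.axioms(1)[OF cstar_algebra.axioms(1)[OF B]] ab]) (auto simp: cc B.smult_mult_left B.smult_mult_right B.sm_add_left B.sm_add_right B.sm_assoc q)
  show "mcomplete_of (cmetric ?C)" by (rule comp)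
  fix x y z c
  show "x : C[?C] ==> star ?C x : C[?C]" using B.star_mult[of q x] B.star_mult[of x q] q by (auto simp: cc)
  show "x : C[?C] ==> y : C[?C] ==> x *[?C] y : C[?C]" using q by (auto simp: cc B.mult_assoc simp flip: B.mult_assoc[of q])
 qed (auto simp: cc B.mult_assoc B.distr_left B.distr_right B.smult_mult_left B.smult_mult_right B.star_star B.star_add B.star_smult B.star_mult
   B.norm_nonneg B.norm_eq_zero B.norm_triangle B.norm_smult B.norm_mult B.cstar_identity)
 moreover have "Group.monoid ?C" by (rule monoidI) (use q in "auto simp: cc B.mult_assoc simp flip: B.mult_assoc[of q]")
 moreover have "q : C[?C]" using q by (simp add: cc)
 ultimately show "ucs ?C" using q(4) by (auto simp: ucs_def unital_def)
qed

lemma cstar_pre_star: assumes "cstar_algebra A" shows "pre_star A"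
proof -
 interpret cstar_algebra A by (rule assms)
 show ?thesis
  by unfold_locales (auto simp: mult_assoc distr_left distr_right smult_mult_left smult_mult_right star_star star_add star_smult star_mult norm_nonneg norm_smult norm_mult)
qed

locale stable_alg =
 fixes A :: "'a cstar"
 assumes ucsA: "ucs A"
begin

sublocale CA: cstar_algebra A using ucsA by (simp add: ucs_def)
sublocale tensor A K_alg by (rule tensor.intro[OF cstar_pre_star[OF CA.cstar_algebra_axioms] K_pre_star])
sublocale S: cstar_algebra "tens A K_alg" by (rule T_cstar)

abbreviation "E a X == elem_tensor A K_alg a X"
abbreviation iota where "iota a == E a e11"

lemmas one = ucs_one[OF ucsA]

declare K_carrier [simp]

lemma E_closed [simp]: "a : C[A] ==> X : compact_ops ==> E a X : C[T]"
 unfolding elem_tensor_def by simp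

lemma E_mult: "a : C[A] ==> X : compact_ops ==> b : C[A] ==> Y : compact_ops ==> E a X *[T] E b Y = E (a *[A] b) (X *[K_alg] Y)"
 unfolding elem_tensor_def by (simp add: T_mult) (simp add: fmult_def)

lemma E_star: "a : C[A] ==> X : compact_ops ==> star T (E a X) = E (star A a) (star K_alg X)"
 unfolding elem_tensor_def by (simp add: T_star) (simp add: fstar_def)

lemma E_norm_le: "a : C[A] ==> X : compact_ops ==> N[T] (E a X) <= N[A] a * N[K_alg] X"
 unfolding elem_tensor_def by (rule T_norm_mono[OF _ _ tendsto_const]) (auto intro: nu_single_le simp: K_carrier)

lemma E_eqI: "x : F ==> y : F ==> teq x y ==> tcl (%n. x) = tcl (%n. y)" by (rule cls_teq) auto

lemma E_add1: assumes "a : C[A]" "b : C[A]" "X : compact_ops" shows "E a X +[T] E b X = E (a +[A] b) X"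
 unfolding elem_tensor_def using assms by (simp add: T_add) (rule E_eqI, auto simp: K_carrier teq_def bilin_def)

lemma E_minus1: assumes "a : C[A]" "b : C[A]" "X : compact_ops" shows "E a X -[T] E b X = E (a -[A] b) X"
proof -
 have e: "a -[A] b = a +[A] (-1) \<odot>[A] b" using assms by (simp add: a_minus_def CA.sm_neg1)
 show ?thesis unfolding elem_tensor_def e using assms
  by (simp add: T_minus) (rule E_eqI, auto simp: K_carrier teq_def ev_fdiff, auto simp: bilin_def K_carrier)
qed

lemma E_minus2: assumes "a : C[A]" "X : compact_ops" "Y : compact_ops" shows "E a X -[T] E a Y = E a (X +[K_alg] (-1) \<odot>[K_alg] Y)"
 unfolding elem_tensor_def using assms
 by (simp add: T_minus K_simps) (rule E_eqI, auto simp: K_carrier K_simps teq_def ev_fdiff, auto simp: bilin_def K_carrier K_simps)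

lemma E_smult: assumes "a : C[A]" "X : compact_ops" shows "E a (c \<odot>[K_alg] X) = E (c \<odot>[A] a) X"
 unfolding elem_tensor_def using assms by (intro E_eqI) (auto simp: K_carrier K_simps teq_def bilin_def)

lemma E_zero: "a : C[A] ==> E a \<zero>[K_alg] = \<zero>[T]" "X : compact_ops ==> E \<zero>[A] X = \<zero>[T]"
proof -
 have b: "\<beta> a \<zero>[K_alg] = 0" if "bilin \<beta>" "a : C[A]" for \<beta> a
  using B.p_smult0 B.p_zero that unfolding bilin_def by (metis mult_zero_left)
 have b2: "\<beta> \<zero>[A] X = 0" if "bilin \<beta>" "X : C[K_alg]" for \<beta> X
  using that CA.M.zero_closed unfolding bilin_def by fastforce
 show "E a \<zero>[K_alg] = \<zero>[T]" if "a : C[A]"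
  unfolding elem_tensor_def T_zero using that by (intro E_eqI) (auto simp: K_carrier K_simps teq_def b)
 show "E \<zero>[A] X = \<zero>[T]" if "X : compact_ops"
  unfolding elem_tensor_def T_zero using that by (intro E_eqI) (auto simp: K_carrier K_simps teq_def b2)
qed

lemma tcl_Cons: assumes "p # z : F" shows "tcl (%n. p # z) = E (fst p) (snd p) +[T] tcl (%n. z)"
 unfolding elem_tensor_def using assms by (subst T_add) auto

lemma e11_props: "e11 : compact_ops" "e11 *[K_alg] e11 = e11" "star K_alg e11 = e11" "N[K_alg] e11 <= 1" "vstate e11 = 1"
 unfolding e11_win by (simp_all add: win_compact win_mult win_star win_norm_le[unfolded One_nat_def])
  (use trunc_ell2[of 1 "%i. 1"] in "simp add: vstate_def win_def trunc_def")

text \<open>For the lower bound, a state of A that attains the norm at the product of star a and a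
  is combined with \<open>vstate\<close> and tested on the vector 1 tensor e11.\<close>

lemma iota_norm: assumes a: "a : C[A]" shows "N[T] (iota a) = N[A] a"
proof (rule antisym)
 show "N[T] (iota a) <= N[A] a"
  using E_norm_le[OF a e11_props(1)] mult_left_mono[OF e11_props(4) CA.norm_nonneg[OF a]] by simp
 obtain \<phi> where p: "state A \<phi>" "\<phi> \<one>[A] = 1" "\<phi> (star A a *[A] a) = (N[A] a)^2"
  using ucs_facts[OF ucsA] a unfolding cstar_facts_def state_facts_def by blast
 define y where "y = [(\<one>[A], e11)]"
 have y: "y : F" using one e11_props by (simp add: y_def)
 have x: "[(a, e11)] : F" using a e11_props by simp
 have "ip \<phi> vstate y y = 1" using one e11_props p by (simp add: ip_def y_def fmult_def fstar_def prod_functional_def)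
 moreover have "ip \<phi> vstate (mul [(a, e11)] y) (mul [(a, e11)] y) = (N[A] a)^2"
  using one a e11_props p by (simp add: ip_def y_def fmult_def fstar_def prod_functional_def)
 ultimately have "N[A] a <= \<nu> [(a, e11)]"
  using nu_bound[OF p(1) vstate_state x y] by (simp add: qn_def)
 thus "N[A] a <= N[T] (iota a)"
  using T_norm_lim[of "%n. [(a, e11)]"] x LIMSEQ_unique[OF tendsto_const] unfolding elem_tensor_def by fastforce
qed

definition pr :: "nat => (nat => ('a, l2_op) formal) set" where "pr k = E \<one>[A] (win 0 0 k)"
text \<open>A partial isometry from \<open>pr k\<close> to a projection orthogonal to
  \<open>pr m\<close>: room for a copy of what lives below \<open>pr k\<close>, clear of the first m
  coordinates.\<close>

definition sh :: "nat => nat => (nat => ('a, l2_op) formal) set" where "sh m k = E \<one>[A] (win m 0 k)"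

lemma pr_props: "pr k : C[T]" "star T (pr k) = pr k" "k <= m ==> pr m *[T] pr k = pr k" "N[T] (pr k) <= 1"
 using E_norm_le[OF one(1) win_compact, of 0 0 k] win_norm_le[of 0 0 k]
 by (simp_all add: pr_def one win_compact E_star win_star E_mult win_trunc_mult)

lemma sh_props: "sh m k : C[T]" "star T (sh m k) *[T] sh m k = pr k" "pr m *[T] sh m k = \<zero>[T]" "pr (m + k) *[T] sh m k = sh m k" "N[T] (sh m k) <= 1"
 using E_norm_le[OF one(1) win_compact, of m 0 k] win_norm_le[of m 0 k]
 by (simp_all add: pr_def sh_def one win_compact E_star win_star E_mult win_trunc_mult win_mult E_zero)

lemma pr_lim_formal: "z : F ==> S.cvg (%k. pr k *[T] tcl (%n. z) *[T] pr k) (tcl (%n. z))"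
proof (induction z)
 case Nil
 thus ?case using S.cvg_const[of "\<zero>[T]"] by (simp add: pr_props flip: T_zero)
next
 case (Cons p z)
 define a X where "a = fst p" and "X = snd p"
 have c: "a : C[A]" "X : compact_ops" using Cons.prems by (auto simp: a_def X_def K_carrier)
 have "S.cvg (%k. pr k *[T] E a X *[T] pr k) (E a X)"
 proof (rule S.cvgI)
  show "(%k. N[A] a * N[K_alg] (X +[K_alg] (-1) \<odot>[K_alg] (win 0 0 k *[K_alg] X *[K_alg] win 0 0 k))) ~~> 0"
   by (intro tendsto_mult_right_zero K_trunc c)
  show "N[T] (pr k *[T] E a X *[T] pr k -[T] E a X) <= N[A] a * N[K_alg] (X +[K_alg] (-1) \<odot>[K_alg] (win 0 0 k *[K_alg] X *[K_alg] win 0 0 k))" for k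
  using c one S.norm_minus_commute[of "pr k *[T] E a X *[T] pr k" "E a X"] by (simp add: pr_def E_mult win_compact K_simps E_minus2 E_norm_le)
 qed (use c in "auto simp: pr_props")
 hence "S.cvg (%k. pr k *[T] E a X *[T] pr k +[T] pr k *[T] tcl (%n. z) *[T] pr k) (E a X +[T] tcl (%n. z))"
  using Cons by (intro S.cvg_add) auto
 thus ?case using Cons.prems pr_props unfolding tcl_Cons[OF Cons.prems] by (simp add: S.distr_left S.distr_right a_def X_def)
qed

lemma conj_contract: assumes "u : C[T]" "N[T] u <= 1" "star T u = u" "x : C[T]" "y : C[T]"
 shows "N[T] (u *[T] x *[T] u -[T] u *[T] y *[T] u) <= N[T] (x -[T] y)"
using assms S.norm_nonneg S.conj_norm_le[OF assms(1,4,5)] mult_right_mono[of "(N[T] u)^2" 1 "N[T] (x -[T] y)"] by (simp add: power_le_one)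

text \<open>The \<open>pr k\<close> are contractive, so convergence on the dense set of formal sums
  is enough.\<close>

lemma pr_lim: assumes x: "x : C[T]" shows "S.cvg (%k. pr k *[T] x *[T] pr k) x"
proof -
 have "(%k. N[T] (pr k *[T] x *[T] pr k -[T] x)) ~~> 0"
 proof (rule LIMSEQ_I)
  fix e :: real assume e: "e > 0"
  obtain z where z: "z : F" "N[T] (x -[T] tcl (%n. z)) < e / 3" using T_dense[OF x, of "e/3"] e by auto
  define y where "y = tcl (%n. z)"
  have y: "y : C[T]" using z by (simp add: y_def)
  obtain N where N: "!!k. k >= N ==> N[T] (pr k *[T] y *[T] pr k -[T] y) < e/3"
   using pr_lim_formal[OF z(1)] order_tendstoD(2)[of "%k. N[T] (pr k *[T] y *[T] pr k -[T] y)" 0 sequentially "e/3"] e unfolding eventually_sequentially by (auto simp: S.cvg_def y_def)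
  have "N[T] (pr k *[T] x *[T] pr k -[T] x) < e" if "k >= N" for k
  using conj_contract[of "pr k" x y] pr_props(1,2,4)[of k] x y z(2) S.dist_triangle[of "pr k *[T] x *[T] pr k" "pr k *[T] y *[T] pr k" x] S.dist_triangle[of "pr k *[T] y *[T] pr k" y x] N[OF that] S.norm_minus_commute[OF x y] by (simp add: y_def)
  thus "EX N. ALL k>=N. norm (N[T] (pr k *[T] x *[T] pr k -[T] x) - 0) < e"
   using x pr_props S.norm_nonneg by auto
 qed
 thus ?thesis using x pr_props by (simp add: S.cvg_def)
qed

lemma iota_corner_formal: "z : F ==> EX a:C[A]. iota \<one>[A] *[T] tcl (%n. z) *[T] iota \<one>[A] = iota a"
proof (induction z)
 case Nil
 thus ?case using e11_props one by (intro bexI[of _ "\<zero>[A]"]) (auto simp: E_zero simp flip: T_zero)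
next
 case (Cons p z)
 define a X where "a = fst p" and "X = snd p"
 have c: "a : C[A]" "X : compact_ops" using Cons.prems by (auto simp: a_def X_def K_carrier)
 obtain b where b: "b : C[A]" "iota \<one>[A] *[T] tcl (%n. z) *[T] iota \<one>[A] = iota b" using Cons by auto
 have "iota \<one>[A] *[T] E a X *[T] iota \<one>[A] = E a (e11 *[K_alg] X *[K_alg] e11)"
  using c one e11_props by (simp add: E_mult K_simps)
 also have "... = iota (vstate X \<odot>[A] a)" using c e11_props by (simp add: e11_sandwich E_smult)
 finally have "iota \<one>[A] *[T] tcl (%n. p # z) *[T] iota \<one>[A] = iota (vstate X \<odot>[A] a +[A] b)"
  using Cons.prems b one e11_props unfolding tcl_Cons[OF Cons.prems] by (simp add: S.distr_left S.distr_right a_def X_def E_add1)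
 thus ?case using b c by auto
qed

text \<open>The corner by 1 tensor e11 is the copy of A: formal sums are sliced into it by
  \<open>e11_sandwich\<close>, and the copy is closed because \<open>iota\<close> is
  isometric.\<close>

lemma iota_corner: assumes x: "x : C[T]" shows "EX a:C[A]. iota \<one>[A] *[T] x *[T] iota \<one>[A] = iota a"
proof -
 define e where "e = iota \<one>[A]"
 have e: "e : C[T]" using one e11_props by (simp add: e_def)
 have "ALL n. EX z:F. N[T] (x -[T] tcl (%k. z)) < inverse (real (Suc n))" using T_dense[OF x] by simp
 then obtain z where z: "!!n. z n : F" "!!n. N[T] (x -[T] tcl (%k. z n)) < inverse (real (Suc n))" by metis
 have zc: "tcl (%k. z n) : C[T]" for n using z by simp
 have "S.cvg (%n. tcl (%k. z n)) x"
  by (rule S.cvgI[OF zc x _ LIMSEQ_inverse_real_of_nat]) (use z(2) S.norm_minus_commute[OF x zc] in "simp add: less_imp_le")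
 hence 1: "S.cvg (%n. e *[T] tcl (%k. z n) *[T] e) (e *[T] x *[T] e)" using e by (intro S.cvg_mult S.cvg_const)
 obtain a where a: "!!n. a n : C[A]" "!!n. e *[T] tcl (%k. z n) *[T] e = iota (a n)" using iota_corner_formal[OF z(1)] unfolding e_def by metis
 let ?a = "S.cvg (%n. iota (a n))"
 have 2: "?a (e *[T] x *[T] e)" using 1 a(2) by simp
 have d: "N[A] (b -[A] c) = N[T] (iota b -[T] iota c)" if "b : C[A]" "c : C[A]" for b c
  using that e11_props by (simp add: E_minus1 iota_norm)
 have "EX b:C[A]. (%n. N[A] (a n -[A] b)) ~~> 0"
 proof (rule CA.cauchy_limit[OF a(1)])
  fix r :: real assume r: "r > 0"
  have l: "(%n. N[T] (iota (a n) -[T] e *[T] x *[T] e)) ~~> 0" using 2 by (simp add: S.cvg_def)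
  then obtain N where N: "!!n. n >= N ==> N[T] (iota (a n) -[T] e *[T] x *[T] e) < r/2"
   using order_tendstoD(2)[OF l, of "r/2"] r unfolding eventually_sequentially by auto
  have "N[A] (a m -[A] a n) < r" if "m >= N" "n >= N" for m n
   using N[OF that(1)] N[OF that(2)] S.dist_triangle[of "iota (a m)" "e *[T] x *[T] e" "iota (a n)"] S.norm_minus_commute[of "iota (a n)" "e *[T] x *[T] e"]
    a e x e11_props by (simp add: d)
  thus "EX N. ALL m>=N. ALL n>=N. N[A] (a m -[A] a n) < r" by blast
 qed
 then obtain b where b: "b : C[A]" "(%n. N[A] (a n -[A] b)) ~~> 0" by blast
 hence "?a (iota b)" using a e11_props by (simp add: S.cvg_def d)
 thus ?thesis using 2 S.cvg_unique b e_def by blast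
qed

lemma iota_hom: "a : C[A] ==> b : C[A] ==> iota (a *[A] b) = iota a *[T] iota b" "a : C[A] ==> iota (star A a) = star T (iota a)"
  "a : C[A] ==> b : C[A] ==> iota (a -[A] b) = iota a -[T] iota b" "a : C[A] ==> iota a : C[T]"
 using e11_props by (simp_all add: E_mult E_star E_minus1)

lemma iota_pos: "a : pos A ==> iota a : pos T"
 unfolding pos_def using iota_hom by fastforce

text \<open>Both elements lie in the corner by e, so an implementing v in the stabilisation may be
  compressed to e v e, which comes from A.\<close>

lemma iota_cuntz: assumes a: "a : C[A]" and b: "b : C[A]" shows "cuntz_le T (iota a) (iota b) \<longleftrightarrow> cuntz_le A a b"
proof
 assume "cuntz_le A a b"
 then obtain v where v: "!!n::nat. v n : C[A]" "(%n. N[A] ((v n *[A] b *[A] star A (v n)) -[A] a)) ~~> 0" by (auto simp: cuntz_le_def)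
 have "N[T] (iota (v n) *[T] iota b *[T] star T (iota (v n)) -[T] iota a) = N[A] ((v n *[A] b *[A] star A (v n)) -[A] a)" for n
  using v(1) a b by (simp add: iota_norm flip: iota_hom(1-3))
 thus "cuntz_le T (iota a) (iota b)" unfolding cuntz_le_def using v by (intro exI[of _ "%n. iota (v n)"]) (auto simp: iota_hom)
next
 assume h: "cuntz_le T (iota a) (iota b)"
 define e where "e = iota \<one>[A]"
 have e: "e : C[T]" "star T e = e" "N[T] e <= 1" using one by (auto simp: e_def iota_hom(4) iota_norm simp flip: iota_hom(1-3))
 have ee: "e *[T] iota c = iota c" "iota c *[T] e = iota c" if "c : C[A]" for c using that one by (simp_all add: e_def flip: iota_hom(1-3))
 show "cuntz_le A a b" unfolding CA.cuntz_le_iff[OF a b]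
 proof (intro allI impI)
  fix r :: real assume "r > 0"
  then obtain v where v: "v : C[T]" "N[T] (v *[T] iota b *[T] star T v -[T] iota a) < r"
   using h unfolding S.cuntz_le_iff[OF iota_hom(4)[OF a] iota_hom(4)[OF b]] by blast
  obtain w where w: "w : C[A]" "e *[T] v *[T] e = iota w" using iota_corner[OF v(1)] unfolding e_def by blast
  have bc: "iota b : C[T]" "iota a : C[T]" using a b iota_hom by auto
  let ?a = "iota (w *[A] b *[A] star A w)"
  let ?b = "v *[T] iota b *[T] star T v"
  have "?a = (e *[T] v *[T] e) *[T] iota b *[T] star T (e *[T] v *[T] e)" using w b by (simp add: iota_hom)
  also have "... = e *[T] (v *[T] (e *[T] iota b *[T] e) *[T] star T v) *[T] e" using e v bc by (simp add: S.star_mult S.mult_assoc)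
  also have "... = e *[T] ?b *[T] e" using ee b by simp
  finally have 1: "?a = e *[T] ?b *[T] e" .
  have "N[A] (w *[A] b *[A] star A w -[A] a) = N[T] (?a -[T] iota a)"
   using w a b by (simp add: iota_norm flip: iota_hom(1-3))
  also have "... = N[T] (e *[T] ?b *[T] e -[T] e *[T] iota a *[T] e)" using ee a 1 by simp
  also have "... <= N[T] (v *[T] iota b *[T] star T v -[T] iota a)" using e v bc by (intro conj_contract) auto
  finally show "EX w:C[A]. N[A] (w *[A] b *[A] star A w -[A] a) < r" using w v(2) by (intro bexI[of _ w]) auto
 qed
qed

end

lemma corner_sq_iter:
 assumes B: "cstar_algebra (B :: 'x cstar)" and q: "q : C[B]" "star B q = q" "q *[B] q = q" "q ~= \<zero>[B]" and x: "x : C[corner B q]"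
 shows "sq_iter (corner B q) x m = sq_iter B x m" "sq_iter B x m : C[corner B q]"
proof -
 interpret C: cstar_algebra "corner B q" using corner_ucs(1)[OF B q] by (simp add: ucs_def)
 let ?a = "sq_iter (corner B q)"
 let ?b = "C[corner B q]"
 have "?a x m = sq_iter B x m & ?a x m : ?b"
 proof (induction m)
  case (Suc m)
  hence "sq_iter B x m : ?b" by metis
  hence "x -[corner B q] sq_iter B x m *[B] sq_iter B x m = x -[B] sq_iter B x m *[B] sq_iter B x m"
   using C.mult_closed[of "sq_iter B x m" "sq_iter B x m"] by (intro corner_ucs(2)[OF B q x]) simp
  thus ?case using Suc C.sq_iter_closed[OF x, of "Suc m"] by simp
 qed (use C.M.zero_closed in simp)
 thus "?a x m = sq_iter B x m" "sq_iter B x m : ?b" by auto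
qed

lemma (in cstar_algebra) proj_pos: assumes "p : C[A]" "star A p = p" "p *[A] p = p" shows "p : pos A"
proof -
 have "p = star A p *[A] p" using assms by simp
 thus ?thesis using assms(1) unfolding pos_def by blast
qed

section \<open>Positivity, suprema and projections in the stabilisation\<close>

context stable_alg begin

lemma pr_nonzero: "pr (Suc m) ~= \<zero>[T]"
proof
 assume "pr (Suc m) = \<zero>[T]"
 hence "pr 1 = \<zero>[T]" using pr_props(3)[of 1 "Suc m"] pr_props(1)[of 1] by simp
 moreover have "N[T] (pr 1) = 1" using iota_norm[OF one(1)] one by (simp add: pr_def e11_win)
 ultimately show False by simp
qed

text \<open>Write x as star y times y and compress y by \<open>pr\<close>. The compressions lie in
  unital corners, where the bounds are known, and the bounds survive the limit since they do not
  depend on the corner.\<close>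

lemma pos_sqb: assumes x: "x : pos T" "N[T] x <= 1" shows "S.sqb x"
proof -
 obtain y where y: "y : C[T]" "x = star T y *[T] y" using x by (auto simp: pos_def)
 \<comment> \<open>\<open>Suc m\<close> keeps the projection nonzero, so that the corner satisfies
   \<open>ucs\<close>.\<close>
 define z where "z m = pr (Suc m) *[T] y *[T] pr (Suc m)" for m
 have zc: "z m : C[T]" for m using y pr_props by (simp add: z_def)
 have "S.cvg z y" using pr_lim[OF y(1)] LIMSEQ_Suc[of "%k. N[T] (pr k *[T] y *[T] pr k -[T] y)" 0] unfolding S.cvg_def z_def by blast
 hence lim: "S.cvg (%m. star T (z m) *[T] z m) x" unfolding y(2) by (intro S.cvg_mult S.cvg_star)
 have "S.sqb (star T (z m) *[T] z m)" for m
 proof -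
  define q where "q = pr (Suc m)"
  have q: "q : C[T]" "star T q = q" "q *[T] q = q" "q ~= \<zero>[T]" "N[T] q <= 1" using pr_props pr_nonzero by (auto simp: q_def)
  note C = corner_ucs[OF T_cstar q(1-4)]
  interpret C: cstar_algebra "corner T q" using C(1) by (simp add: ucs_def)
  let ?b = "C[corner T q]"
  have zC: "z m : ?b" unfolding corner_carrier z_def q_def[symmetric] using q y by (simp add: S.mult_assoc) (simp add: q flip: S.mult_assoc)
  define h where "h = star T (z m) *[T] z m"
  have hC: "h : ?b" using C.mult_closed[OF C.star_closed[OF zC] zC] by (simp add: h_def)
  let ?a = "sq_iter (corner T q)"
  let ?c = "N[corner T q]"
  have "h : pos (corner T q)" using zC unfolding pos_def h_def by auto
  moreover have "?c h <= 1"
  proof -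
   have "N[T] (z m) <= N[T] q * N[T] y * N[T] q" unfolding z_def q_def[symmetric]
    using S.norm_mult[of "q *[T] y" q] mult_right_mono[OF S.norm_mult[of q y] S.norm_nonneg[OF q(1)]] q y by simp
   also have "... <= 1 * N[T] y * 1" using q y S.norm_nonneg by (intro mult_mono) auto
   finally have "(N[T] (z m))^2 <= (N[T] y)^2" using S.norm_nonneg[OF zc] by (simp add: power_mono)
   thus ?thesis using x y S.cstar_identity[OF y(1)] S.cstar_identity[OF zc[of m]] by (simp add: h_def)
  qed
  ultimately have f: "ALL m>=1. star (corner T q) (?a h m) = ?a h m &
   ?c (?a h m *[corner T q] ?a h m -[corner T q] h) <= 4 / m &
   (ALL l>=m. ?c (?a h l -[corner T q] ?a h m) <= 4 / m)"
   using ucs_facts[OF C(1)] unfolding cstar_facts_def sq_facts_def by blast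
  note si = corner_sq_iter[OF T_cstar q(1-4) hC]
  have mc: "sq_iter T h m *[T] sq_iter T h m : ?b" for m using C.mult_closed[OF si(2)[of m] si(2)[of m]] by simp
  show ?thesis using f unfolding S.sqb_def h_def[symmetric] by (simp add: si C(2) hC mc)
 qed
 from S.sqb_limit[OF lim this] show ?thesis .
qed

text \<open>After scaling into the unit ball, the square-root bounds are a closed condition that
  implies positivity.\<close>

lemma pos_limit: assumes "S.cvg s x" "!!n. s n : pos T" shows "x : pos T"
proof -
 have "Bseq (%n. N[T] (s n))" using S.cvg_norm[OF assms(1)] convergentI convergent_imp_Bseq by blast
 then obtain M where M: "M > 0" "!!n. N[T] (s n) <= M" unfolding Bseq_def by (auto simp: abs_le_iff)
 define c where "c = 1 / M"
 have c: "c > 0" using M by (simp add: c_def)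
 have sc: "s n : C[T]" and xc: "x : C[T]" for n using S.cvgD[OF assms(1)] by auto
 let ?a = "complex_of_real c \<odot>[T] x"
 have "S.sqb (complex_of_real c \<odot>[T] s n)" for n
 proof (rule pos_sqb)
  show "complex_of_real c \<odot>[T] s n : pos T" using assms(2) c by (intro S.pos_scale) auto
  show "N[T] (complex_of_real c \<odot>[T] s n) <= 1" using sc[of n] M(2)[of n] c by (simp add: S.norm_smult) (simp add: c_def)
 qed
 hence "complex_of_real c \<odot>[T] x : pos T" using S.sqb_limit[OF S.cvg_smult[OF assms(1)]] xc by (intro S.sqb_pos) auto
 hence "complex_of_real M \<odot>[T] ?a : pos T" by (rule S.pos_scale) (use M in auto)
 moreover have "complex_of_real M \<odot>[T] ?a = x"
  using xc M by (simp add: c_def flip: S.sm_assoc of_real_mult)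
 ultimately show ?thesis by simp
qed

text \<open>There is no unit to conjugate with; the approximate unit \<open>pr\<close> takes its
  place.\<close>

lemma cuntz_refl: assumes "x : C[T]" shows "cuntz_le T x x"
 unfolding cuntz_le_def using pr_lim[OF assms] pr_props by (intro exI[of _ pr]) (auto simp: S.cvg_def)

text \<open>Adding a small multiple of a shift to w makes b recoverable from w' b w'*, so that the limit of the recursion is an upper bound.\<close>
lemma sup_step:
 assumes w: "w : C[T]" "pr K *[T] w = w" and \<theta>: "\<theta> > 0" and J: "finite J" and \<eta>: "\<eta> > 0"
  and c: "c : C[T]" and b: "b : C[T]" "cuntz_le T c b"
  and d: "!!j. j : J ==> d j : C[T] & cuntz_le T (d j) b"
 shows "EX w':C[T]. EX K'. EX \<theta>'>0. pr K' *[T] w' = w' & \<theta>' <= \<theta> / 2 &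
  N[T] (w' *[T] b *[T] star T w' -[T] w *[T] c *[T] star T w) <= \<theta> / 2 &
  (ALL j:J. EX r:C[T]. ALL x:C[T]. N[T] (x -[T] w' *[T] b *[T] star T w') <= \<theta>' --> N[T] (r *[T] x *[T] star T r -[T] d j) < 2 * \<eta>)"
proof -
 have "EX u. ALL j:J. u j : C[T] & N[T] (u j *[T] b *[T] star T (u j) -[T] d j) < \<eta>"
  by (rule bchoice) (use d \<eta> S.cuntz_le_iff[OF _ b(1)] in blast)
 then obtain u where u: "!!j. j : J ==> u j : C[T]" "!!j. j : J ==> N[T] (u j *[T] b *[T] star T (u j) -[T] d j) < \<eta>" by blast
 have "\<forall>\<^sub>F k in sequentially. ALL j:J. N[T] (u j *[T] (pr k *[T] b *[T] pr k) *[T] star T (u j) -[T] d j) < \<eta>"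
 proof (rule eventually_ball_finite[OF J], rule ballI)
  fix j assume j: "j : J"
  have "S.cvg (%k. u j *[T] (pr k *[T] b *[T] pr k) *[T] star T (u j) -[T] d j) (u j *[T] b *[T] star T (u j) -[T] d j)"
   using u(1)[OF j] d[OF j] b by (intro S.cvg_diff S.cvg_mult S.cvg_const pr_lim) auto
  from order_tendstoD(2)[OF S.cvg_norm[OF this] u(2)[OF j]]
  show "\<forall>\<^sub>F k in sequentially. N[T] (u j *[T] (pr k *[T] b *[T] pr k) *[T] star T (u j) -[T] d j) < \<eta>" .
 qed
 then obtain k where k: "!!j. j : J ==> N[T] (u j *[T] (pr k *[T] b *[T] pr k) *[T] star T (u j) -[T] d j) < \<eta>"
  using eventually_happens by force
 define P where "P = (N[T] w)^2 + 1"
 have P: "P > 0" "(N[T] w)^2 <= P" by (simp_all add: P_def add_nonneg_pos)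
 have "\<theta> / (4 * P) > 0" using \<theta> P by simp
 then obtain v where v: "v : C[T]" "N[T] (v *[T] b *[T] star T v -[T] c) < \<theta> / (4 * P)" using b(2) unfolding S.cuntz_le_iff[OF c b(1)] by blast
 define w0 where "w0 = w *[T] v"
 \<comment> \<open>w lives below \<open>pr K\<close>, so the range of \<sigma> is orthogonal to that
   of w0. Hence the adjoint of \<sigma> kills w0 and extracts \<epsilon> \<open>pr k\<close> from
   w', which makes b, cut down by \<open>pr k\<close>, recoverable.\<close>
 define \<sigma> where "\<sigma> = sh K k"
 have w0: "w0 : C[T]" "pr K *[T] w0 = w0" using w v pr_props(1)[of K] by (auto simp: w0_def simp flip: S.mult_assoc)
 have sg: "\<sigma> : C[T]" "star T \<sigma> *[T] \<sigma> = pr k" "pr (K + k) *[T] \<sigma> = \<sigma>" using sh_props by (auto simp: \<sigma>_def)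
 have "star T \<sigma> *[T] pr K = star T (pr K *[T] \<sigma>)" using sg pr_props(1,2) by (simp add: S.star_mult)
 hence sp: "star T \<sigma> *[T] pr K = \<zero>[T]" by (simp add: \<sigma>_def sh_props)
 have "star T \<sigma> *[T] w0 = (star T \<sigma> *[T] pr K) *[T] w0" using sg w0 pr_props(1)[of K] by (simp add: S.mult_assoc)
 hence sw: "star T \<sigma> *[T] w0 = \<zero>[T]" using sp w0 by simp
 \<comment> \<open>The coefficient of the shift tends to 0; a late enough i keeps the conjugate of b
   by W i within \<theta> / 4 of that by w0.\<close>
 define W where "W i = w0 +[T] complex_of_real (inverse (real (Suc i))) \<odot>[T] \<sigma>" for i
 have "S.cvg (%i. complex_of_real (inverse (real (Suc i))) \<odot>[T] \<sigma>) \<zero>[T]"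
 proof (rule S.cvgI)
  show "(%i. inverse (real (Suc i)) * N[T] \<sigma>) ~~> 0" by (intro tendsto_mult_left_zero LIMSEQ_inverse_real_of_nat)
  show "N[T] (complex_of_real (inverse (real (Suc i))) \<odot>[T] \<sigma> -[T] \<zero>[T]) <= inverse (real (Suc i)) * N[T] \<sigma>" for i
  proof -
   have "y -[T] \<zero>[T] = y" if "y : C[T]" for y using S.diff_add[of y "\<zero>[T]"] that by simp
   thus ?thesis using sg by (simp add: S.norm_smult norm_inverse del: of_nat_Suc of_real_inverse)
  qed
 qed (use sg in auto)
 from S.cvg_add[OF S.cvg_const[OF w0(1)] this] have "S.cvg W w0" using w0 by (simp add: W_def[abs_def])
 hence "S.cvg (%i. W i *[T] b *[T] star T (W i)) (w0 *[T] b *[T] star T w0)" using b by (intro S.cvg_mult S.cvg_star S.cvg_const)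
 hence l: "(%i. N[T] (W i *[T] b *[T] star T (W i) -[T] w0 *[T] b *[T] star T w0)) ~~> 0" by (simp add: S.cvg_def)
 have "\<theta> / 4 > 0" using \<theta> by simp
 then obtain i where i: "N[T] (W i *[T] b *[T] star T (W i) -[T] w0 *[T] b *[T] star T w0) < \<theta> / 4"
  using order_tendstoD(2)[OF l \<open>\<theta> / 4 > 0\<close>] by force
 define w' where "w' = W i"
 define \<epsilon> where "\<epsilon> = inverse (real (Suc i))"
 have \<epsilon>: "\<epsilon> > 0" by (simp add: \<epsilon>_def)
 have w': "w' : C[T]" "w' = w0 +[T] complex_of_real \<epsilon> \<odot>[T] \<sigma>" using w0 sg by (auto simp: w'_def W_def \<epsilon>_def)
 have "pr (K + k) *[T] w0 = w0"
 proof -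
  have "pr (K + k) *[T] w0 = (pr (K + k) *[T] pr K) *[T] w0" using w0 pr_props(1) by (simp add: S.mult_assoc)
  thus ?thesis using pr_props(3)[of K "K + k"] w0 by simp
 qed
 hence pw: "pr (K + k) *[T] w' = w'" unfolding w'(2) using w0 sg pr_props(1) by (simp add: S.distr_right S.smult_mult_right)
 have near: "N[T] (w' *[T] b *[T] star T w' -[T] w *[T] c *[T] star T w) <= \<theta> / 2"
 proof -
  have e: "w0 *[T] b *[T] star T w0 = w *[T] (v *[T] b *[T] star T v) *[T] star T w" using w v b by (simp add: w0_def S.star_mult S.mult_assoc)
  have "N[T] (w0 *[T] b *[T] star T w0 -[T] w *[T] c *[T] star T w) <= (N[T] w)^2 * N[T] (v *[T] b *[T] star T v -[T] c)"
   unfolding e using w v b c by (intro S.conj_norm_le) auto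
  also have "... <= P * (\<theta> / (4 * P))" using P v b c by (intro mult_mono) (auto intro: S.norm_nonneg)
  also have "... = \<theta> / 4" using P by simp
  finally show ?thesis using i S.dist_triangle[of "w' *[T] b *[T] star T w'" "w0 *[T] b *[T] star T w0" "w *[T] c *[T] star T w"] w' w0 w b c by (simp add: w'_def[symmetric])
 qed
 \<comment> \<open>Undoes the scaled shift and then applies u j, so that r j w' = u j
   \<open>pr k\<close>.\<close>
 define r where "r j = u j *[T] (complex_of_real (1 / \<epsilon>) \<odot>[T] star T \<sigma>)" for j
 define R where "R = (\<Sum>j\<in>J. (N[T] (r j))^2) + 1"
 have R: "R > 0" by (simp add: R_def add_nonneg_pos sum_nonneg)
 \<comment> \<open>The tolerance left to later steps: a change of at most \<eta> / R is enlarged by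
   conjugation with any r j to at most \<eta>.\<close>
 define \<theta>' where "\<theta>' = min (\<theta> / 2) (\<eta> / R)"
 have \<theta>': "\<theta>' > 0" "\<theta>' <= \<theta> / 2" "\<theta>' <= \<eta> / R" unfolding \<theta>'_def using \<theta> \<eta> R min.cobounded1[of "\<theta> / 2"] by auto
 have "EX r:C[T]. ALL x:C[T]. N[T] (x -[T] w' *[T] b *[T] star T w') <= \<theta>' --> N[T] (r *[T] x *[T] star T r -[T] d j) < 2 * \<eta>" if j: "j : J" for j
 proof (intro bexI[of _ "r j"] ballI impI)
  have uj: "u j : C[T]" using u j by blast
  show rj: "r j : C[T]" using uj sg by (simp add: r_def)
  fix x assume x: "x : C[T]" "N[T] (x -[T] w' *[T] b *[T] star T w') <= \<theta>'"
  let ?b = "complex_of_real \<epsilon> \<odot>[T] pr k"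
  let ?c = "complex_of_real (1/\<epsilon>)"
  have "star T \<sigma> *[T] w' = complex_of_real \<epsilon> \<odot>[T] pr k" unfolding w'(2) using sg w0 pr_props(1)[of k] by (simp add: S.distr_right S.smult_mult_right sw)
  hence "r j *[T] w' = u j *[T] (?c \<odot>[T] ?b)" using uj sg w'(1) by (simp add: r_def S.mult_assoc S.smult_mult_left)
  also have "?c \<odot>[T] ?b = pr k" using \<epsilon> pr_props(1)[of k] by (simp flip: S.sm_assoc of_real_mult)
  finally have rw: "r j *[T] w' = u j *[T] pr k" .
  let ?a = "w' *[T] b *[T] star T w'"
  have "r j *[T] ?a *[T] star T (r j) = (r j *[T] w') *[T] b *[T] star T (r j *[T] w')"
   using rj w'(1) b by (simp add: S.star_mult S.mult_assoc)
  also have "... = u j *[T] (pr k *[T] b *[T] pr k) *[T] star T (u j)" unfolding rw using uj b pr_props(1,2) by (simp add: S.star_mult S.mult_assoc)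
  finally have "N[T] (r j *[T] ?a *[T] star T (r j) -[T] d j) < \<eta>" using k[OF j] by simp
  moreover have "N[T] (r j *[T] x *[T] star T (r j) -[T] r j *[T] ?a *[T] star T (r j)) <= \<eta>"
  proof -
   have "(N[T] (r j))^2 <= R" using member_le_sum[OF j, of "%j. (N[T] (r j))^2"] J by (simp add: R_def)
   hence "(N[T] (r j))^2 * N[T] (x -[T] w' *[T] b *[T] star T w') <= R * (\<eta> / R)"
    using x R \<theta>'(3) w'(1) b S.norm_nonneg by (intro mult_mono) auto
   thus ?thesis using S.conj_norm_le[OF rj x(1), of "w' *[T] b *[T] star T w'"] w'(1) b R by simp
  qed
  ultimately show "N[T] (r j *[T] x *[T] star T (r j) -[T] d j) < 2 * \<eta>"
   using S.dist_triangle[of "r j *[T] x *[T] star T (r j)" "r j *[T] ?a *[T] star T (r j)" "d j"] rj x(1) w'(1) b d[OF j] by simp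
 qed
 thus ?thesis using w'(1) pw \<theta>' near by blast
qed

text \<open>The tolerances \<theta> at least halve and each step moves by at most half the current
  one, so the limit stays within the tolerance of every stage. Step n recovers all b j with j <= n +
  1 up to 2 / (n + 1), so each b j is below the limit.\<close>

lemma cuntz_sup:
 assumes b: "!!n::nat. b n : pos T" "!!n. cuntz_le T (b n) (b (Suc n))"
 shows "EX x:pos T. EX w. (ALL n. w n : C[T]) & S.cvg (%n. w n *[T] b n *[T] star T (w n)) x & (ALL n. cuntz_le T (b n) x)"
proof -
 have bc: "b n : C[T]" for n using b(1) S.pos_closed by blast
 have mono: "m <= n ==> cuntz_le T (b m) (b n)" for m n
 proof (induction n rule: dec_induct)
  case base show ?case by (rule cuntz_refl[OF bc])
 next
  case (step n) thus ?case using S.cuntz_trans[OF bc bc bc _ b(2)] by blast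
 qed
 \<comment> \<open>A stage of the recursion is a triple: the conjugating element w, a cutoff K below
   which its range lies, and the tolerance \<theta> left for all later changes.\<close>
 define Q where "Q n s t = (case s of (w, K :: nat, \<theta>) => case t of (w', K' :: nat, \<theta>') => \<theta>' <= \<theta> / 2 &
   N[T] (w' *[T] b (Suc n) *[T] star T w' -[T] w *[T] b n *[T] star T w) <= \<theta> / 2 &
   (ALL j:{..Suc n}. EX r:C[T]. ALL x:C[T]. N[T] (x -[T] w' *[T] b (Suc n) *[T] star T w') <= \<theta>' --> N[T] (r *[T] x *[T] star T r -[T] b j) < 2 * inverse (real (Suc n))))" for n s t
 define P where "P s = (case s of (w, K, \<theta>) => w : C[T] & pr K *[T] w = w & \<theta> > (0::real))" for s
 have "EX f. f 0 = (\<zero>[T], 0, 1) & (ALL n. P (f n) & Q n (f n) (f (Suc n)))"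
 proof -
  have "EX f. ALL n. (P (f n) & (n = 0 --> f n = (\<zero>[T], 0, 1))) & Q n (f n) (f (Suc n))"
  proof (rule dependent_nat_choice)
   show "EX s. P s & (0 = 0 --> s = (\<zero>[T], 0, 1))" using pr_props(1)[of 0] by (auto simp: P_def)
   fix s and n :: nat assume "P s & (n = 0 --> s = (\<zero>[T], 0, 1))"
   then obtain w K \<theta> where s: "s = (w, K, \<theta>)" "w : C[T]" "pr K *[T] w = w" "\<theta> > 0" by (auto simp: P_def)
   have "EX w':C[T]. EX K'. EX \<theta>'>0. pr K' *[T] w' = w' & \<theta>' <= \<theta> / 2 &
    N[T] (w' *[T] b (Suc n) *[T] star T w' -[T] w *[T] b n *[T] star T w) <= \<theta> / 2 &
    (ALL j:{..Suc n}. EX r:C[T]. ALL x:C[T]. N[T] (x -[T] w' *[T] b (Suc n) *[T] star T w') <= \<theta>' --> N[T] (r *[T] x *[T] star T r -[T] b j) < 2 * inverse (real (Suc n)))"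
    by (rule sup_step[OF s(2-4)]) (use bc b(2) mono in auto)
   then obtain w' K' \<theta>' where "w' : C[T]" "\<theta>' > 0" "pr K' *[T] w' = w'" "Q n s (w', K', \<theta>')" unfolding Q_def s(1) by auto
   thus "EX t. (P t & (Suc n = 0 --> t = (\<zero>[T], 0, 1))) & Q n s t" by (auto simp: P_def)
  qed
  thus ?thesis by blast
 qed
 then obtain f where f: "f 0 = (\<zero>[T], 0, 1)" "!!n. P (f n)" "!!n. Q n (f n) (f (Suc n))" by blast
 define w where "w n = fst (f n)" for n
 define \<theta> where "\<theta> n = snd (snd (f n))" for n
 have fe: "f n = (w n, fst (snd (f n)), \<theta> n)" for n by (simp add: w_def \<theta>_def)
 have w: "w n : C[T]" "\<theta> n > 0" for n using f(2)[of n] by (subst (asm) fe, simp add: P_def)+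
 define x where "x n = w n *[T] b n *[T] star T (w n)" for n
 have xc: "x n : C[T]" for n using w bc by (simp add: x_def)
 have Q: "\<theta> (Suc n) <= \<theta> n / 2" "N[T] (x (Suc n) -[T] x n) <= \<theta> n / 2"
  "j <= Suc n ==> EX r:C[T]. ALL y:C[T]. N[T] (y -[T] x (Suc n)) <= \<theta> (Suc n) --> N[T] (r *[T] y *[T] star T r -[T] b j) < 2 * inverse (real (Suc n))" for n j
  using f(3)[of n] by (subst (asm) (1 2) fe, simp add: Q_def x_def)+
 have \<theta>b: "\<theta> n <= (1/2) ^ n" for n
 proof (induction n)
  case 0 thus ?case using f(1) by (simp add: \<theta>_def)
 next
  case (Suc n) thus ?case using Q(1)[of n] by simp
 qed
 have dist: "N[T] (x m -[T] x n) <= \<theta> n - \<theta> m" if "n <= m" for m n using that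
 proof (induction m rule: dec_induct)
  case base thus ?case using xc by simp
 next
  case (step m)
  thus ?case using S.dist_triangle[OF xc[of "Suc m"] xc[of m] xc[of n]] Q(1)[of m] Q(2)[of m] by simp
 qed
 have "EX y:C[T]. (%n. N[T] (x n -[T] y)) ~~> 0"
 proof (rule S.cauchy_limit[OF xc])
  fix e :: real assume "e > 0"
  then obtain N where N: "(1/2) ^ N < e" using real_arch_pow_inv[of e "1/2"] by auto
  have le: "N[T] (x m -[T] x n) < e" if "n >= N" "n <= m" for m n
  proof -
   have "(1/2::real) ^ n <= (1/2) ^ N" using that by simp
   thus ?thesis using dist[OF that(2)] \<theta>b[of n] w(2)[of m] N by linarith
  qed
  have "N[T] (x m -[T] x n) < e" if "m >= N" "n >= N" for m n
   using le[of n m] le[of m n] that S.norm_minus_commute[OF xc[of m] xc[of n]] by (cases "n <= m") auto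
  thus "EX N. ALL m>=N. ALL n>=N. N[T] (x m -[T] x n) < e" by blast
 qed
 then obtain y where "S.cvg x y" using xc by (auto simp: S.cvg_def)
 have y: "y : C[T]" using \<open>S.cvg x y\<close> S.cvgD by blast
 have "y : pos T" by (rule pos_limit[OF \<open>S.cvg x y\<close>]) (use b w S.pos_conj in "simp add: x_def")
 moreover have yd: "N[T] (y -[T] x n) <= \<theta> n" for n
 proof (rule S.cvg_norm_le[OF S.cvg_diff[OF \<open>S.cvg x y\<close> S.cvg_const[OF xc]]])
  show "N[T] (x m -[T] x n) <= \<theta> n" if "m >= n" for m using dist[OF that] w(2)[of m] by simp
 qed
 have "cuntz_le T (b j) y" for j unfolding S.cuntz_le_iff[OF bc y]
 proof (intro allI impI)
  fix e :: real assume "e > 0"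
  then obtain N where N: "inverse (real (Suc N)) < e / 2" using reals_Archimedean[of "e/2"] by auto
  define n where "n = max N j"
  obtain r where r: "r : C[T]" "N[T] (r *[T] y *[T] star T r -[T] b j) < 2 * inverse (real (Suc n))" using Q(3)[of j n] y yd[of "Suc n"] by (metis le_SucI max.cobounded2 n_def)
  have "inverse (real (Suc n)) <= inverse (real (Suc N))" by (simp add: n_def)
  hence "N[T] (r *[T] y *[T] star T r -[T] b j) < e" using r N by linarith
  thus "EX v:C[T]. N[T] (v *[T] y *[T] star T v -[T] b j) < e" using r by blast
 qed
 ultimately show ?thesis using w \<open>S.cvg x y\<close> unfolding x_def by blast
qed

text \<open>Approximation of q is improved to an exact conjugate in the corner by q: there h is
  within distance 1 of the unit, so some c conjugates it to q.\<close>

lemma proj_below: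
 fixes q :: "(nat => ('a, l2_op) formal) set"
 assumes q: "q : C[T]" "star T q = q" "q *[T] q = q" and b: "!!n::nat. b n : pos T" "!!n. w n : C[T]"
  and x: "S.cvg (%n. w n *[T] b n *[T] star T (w n)) x" and le: "cuntz_le T q x"
 shows "EX n. cuntz_le T q (b n)"
proof (cases "q = \<zero>[T]")
 case True
 have "cuntz_le T q (b 0)" unfolding cuntz_le_def using S.pos_closed[OF b(1)] True by auto
 thus ?thesis ..
next
 case False
 have bc: "b n : C[T]" for n using b(1) S.pos_closed by blast
 define t where "t n = w n *[T] b n *[T] star T (w n)" for n
 have tc: "t n : C[T]" and tp: "t n : pos T" for n using b bc S.pos_conj by (auto simp: t_def)
 have xc: "x : C[T]" using S.cvgD(2)[OF x] .
 have half: "(1/2::real) > 0" by simp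
 obtain v where v: "v : C[T]" "N[T] (v *[T] x *[T] star T v -[T] q) < 1/2" using le half unfolding S.cuntz_le_iff[OF q(1) xc] by blast
 have "S.cvg (%n. v *[T] t n *[T] star T v -[T] q) (v *[T] x *[T] star T v -[T] q)"
  unfolding t_def using x v q by (intro S.cvg_diff S.cvg_mult S.cvg_const) auto
 from order_tendstoD(2)[OF S.cvg_norm[OF this] v(2)] obtain n where n: "N[T] (v *[T] t n *[T] star T v -[T] q) < 1/2"
  by force
 define h where "h = q *[T] (v *[T] t n *[T] star T v) *[T] q"
 have hT: "h : C[T]" using q v tc by (simp add: h_def)
 have hq: "q *[T] h = h" "h *[T] q = h"
  using q v tc[of n] by (simp_all add: h_def S.mult_assoc) (simp add: q flip: S.mult_assoc)
 have nq: "N[T] q <= 1"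
 using S.cstar_identity[OF q(1)] q by (auto simp: power2_eq_square)
 have "N[T] (q -[T] h) < 1"
 proof -
  have "N[T] (h -[T] q *[T] q *[T] q) <= N[T] (v *[T] t n *[T] star T v -[T] q)" unfolding h_def using q nq v tc by (intro conj_contract) auto
  thus ?thesis using n S.norm_minus_commute[OF q(1) hT] q by simp
 qed
 moreover have "star T h = h" using q v tc[of n] S.pos_star[OF tp[of n]] by (simp add: h_def S.star_mult S.star_star S.mult_assoc)
 moreover have hC: "h : C[corner T q]" and qC: "q : C[corner T q]" using hT hq q by (auto simp: corner_carrier)
 moreover note C = corner_ucs[OF T_cstar q False]
 ultimately obtain c where "c : C[corner T q]" "c *[T] h *[T] star T c = q"
  using ucs_facts[OF C(1)] unfolding cstar_facts_def near_one_facts_def by auto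
 hence c: "c : C[T]" "c *[T] h *[T] star T c = q" by (auto simp: corner_carrier)
 define z where "z = c *[T] (q *[T] (v *[T] w n))"
 have z: "z : C[T]" using c q v b by (simp add: z_def)
 have "z *[T] b n *[T] star T z = q" using c(1) q(1,2) v(1) b(2) bc c(2) by (simp add: S.star_mult S.mult_assoc z_def h_def t_def)
 thus ?thesis using S.cuntz_conj[OF bc z] by auto
qed

section \<open>From elements to classes in the Cuntz semigroup\<close>

lemma Cu_rep: "X : Cu A ==> EX x:pos T. X = cuntz_rel T `` {x}"
 unfolding Cu_def by (elim quotientE) blast

lemma rel_iff: "y : cuntz_rel T `` {x} \<longleftrightarrow> x : pos T & y : pos T & cuntz_le T x y & cuntz_le T y x"
 by (auto simp: cuntz_rel_def)

lemma cu_le_iff: assumes x: "x : pos T" and y: "y : pos T"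
 shows "cu_le A (cuntz_rel T `` {x}) (cuntz_rel T `` {y}) \<longleftrightarrow> cuntz_le T x y"
proof
 assume "cu_le A (cuntz_rel T `` {x}) (cuntz_rel T `` {y})"
 then obtain a b where ab: "a : cuntz_rel T `` {x}" "b : cuntz_rel T `` {y}" "cuntz_le T a b" unfolding cu_le_def by blast
 note c = ab(1,2)[unfolded rel_iff]
 show "cuntz_le T x y" using c ab(3) S.cuntz_trans[of x a b] S.pos_closed S.cuntz_trans[of x b y] by blast
next
 assume "cuntz_le T x y"
 thus "cu_le A (cuntz_rel T `` {x}) (cuntz_rel T `` {y})"
  unfolding cu_le_def using x y cuntz_refl S.pos_closed rel_iff by metis
qed

text \<open>The supremum X is given only by its universal property. It lies below the upper bound x
  constructed by \<open>cuntz_sup\<close>, and x comes with an explicit approximation by conjugates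
  of the c n, to which \<open>proj_below\<close> applies.\<close>

lemma proj_compact:
 fixes q :: "(nat => ('a, l2_op) formal) set"
 assumes q: "q : C[T]" "star T q = q" "q *[T] q = q"
 shows "cu_compact A (cuntz_rel T `` {q})"
 unfolding cu_compact_def cu_way_below_def
proof (intro allI impI, elim conjE)
 fix b X assume b: "ALL i. b i : Cu A & cu_le A (b i) (b (Suc i))" and X: "cu_is_sup A b X" and le: "cu_le A (cuntz_rel T `` {q}) X"
 have qp: "q : pos T" using S.proj_pos q .
 have "ALL i. EX c. c : pos T & b i = cuntz_rel T `` {c}" using b Cu_rep by blast
 from choice[OF this] obtain c where c': "ALL i. c i : pos T & b i = cuntz_rel T `` {c i}" ..
 have c: "c i : pos T" "b i = cuntz_rel T `` {c i}" for i using c' by auto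
 have "cuntz_le T (c i) (c (Suc i))" for i using b unfolding c(2) cu_le_iff[OF c(1) c(1)] by blast
 from cuntz_sup[of c, OF c(1) this] obtain x w where x: "x : pos T" "!!n. w n : C[T]" "S.cvg (%n. w n *[T] c n *[T] star T (w n)) x" "!!n. cuntz_le T (c n) x" by blast
 have "cuntz_rel T `` {x} : Cu A" unfolding Cu_def by (rule quotientI[OF x(1)])
 moreover have "cu_le A (b i) (cuntz_rel T `` {x})" for i unfolding c(2) cu_le_iff[OF c(1) x(1)] by (rule x(4))
 ultimately have 1: "cu_le A X (cuntz_rel T `` {x})" using X unfolding cu_is_sup_def by blast
 obtain s where s: "s : pos T" "X = cuntz_rel T `` {s}" using X Cu_rep unfolding cu_is_sup_def by blast
 have "cuntz_le T q x" using le 1 s qp x cu_le_iff S.cuntz_trans[of q s x] S.pos_closed by blast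
 from proj_below[OF q c(1) x(2) x(3) this] obtain n where "cuntz_le T q (c n)" ..
 thus "EX i. cu_le A (cuntz_rel T `` {q}) (b i)" by (auto simp: c(2) cu_le_iff[OF qp c(1)])
qed

lemma cu_class_eq: assumes "x : pos A" "a : pos A" shows "cu_class A x = cu_class A a \<longleftrightarrow> x : ccls A a"
proof -
 note c = CA.pos_closed[OF assms(1)] CA.pos_closed[OF assms(2)]
 have p: "iota x : pos T" "iota a : pos T" using assms iota_pos by auto
 have "cu_class A x = cu_class A a \<longleftrightarrow> cuntz_le T (iota x) (iota a) & cuntz_le T (iota a) (iota x)"
 proof
  assume "cu_class A x = cu_class A a"
  moreover have "iota x : cu_class A x" unfolding cu_class_def rel_iff using p cuntz_refl S.pos_closed by blast
  ultimately have "iota x : cu_class A a" by simp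
  thus "cuntz_le T (iota x) (iota a) & cuntz_le T (iota a) (iota x)" unfolding cu_class_def rel_iff by blast
 next
  assume h: "cuntz_le T (iota x) (iota a) & cuntz_le T (iota a) (iota x)"
  have "y : cu_class A x \<longleftrightarrow> y : cu_class A a" for y
   unfolding cu_class_def rel_iff using h p S.cuntz_trans S.pos_closed by meson
  thus "cu_class A x = cu_class A a" by blast
 qed
 thus ?thesis using c assms by (simp add: iota_cuntz ccls_def)
qed

lemma noncompact_not_proj: assumes a: "a : pos A" "~ cu_compact A (cu_class A a)" and p: "p : C[A]" "star A p = p" "p *[A] p = p"
 shows "~ (cuntz_le A a p & cuntz_le A p a)"
proof
 assume h: "cuntz_le A a p & cuntz_le A p a"
 have pp: "p : pos A" using CA.proj_pos p .
 have "cu_class A a = cu_class A p" using cu_class_eq[OF a(1) pp] h a by (simp add: ccls_def)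
 moreover have "cu_compact A (cu_class A p)" unfolding cu_class_def
  by (rule proj_compact) (use p iota_hom(4) in "simp_all flip: iota_hom(1-3)")
 ultimately show False using a by simp
qed

end

section \<open>Paths of continuous functions\<close>

locale cfun_space = cstar_algebra A for A :: "'a cstar" (structure) and X :: "'x metric" +
 assumes ucsA: "ucs A" and cX: "compact_space (mtopology_of X)"
begin

abbreviation "C == cfun_alg X A"

lemma cont_metric: "continuous_map (mtopology_of X) (mtopology_of (cmetric A)) f \<longleftrightarrow>
 f ` mspace X <= C[A] & (ALL x:mspace X. ALL e>0. EX d>0. ALL y. y : mspace X & mdist X x y < d -->
  (if f x : C[A] & f y : C[A] then N[A] (f x -[A] f y) else 0) < e)"
 unfolding cm_topology unfolding mtopology_of_def by (rule Metric_space.metric_continuous_map[OF Metric_space_mspace_mdist MS.Metric_space_axioms])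

lemma cont_seq: "continuous_map (mtopology_of X) (mtopology_of (cmetric A)) f \<longleftrightarrow>
 (ALL x:mspace X. f x : C[A]) & (ALL s x. (ALL n. s n : mspace X) & x : mspace X & (%n. mdist X x (s n)) ~~> 0 --> cvg (%n. f (s n)) (f x))"
 (is "?L \<longleftrightarrow> ?R")
proof
 assume L: ?L
 have c: "f x : C[A]" if "x : mspace X" for x using L that unfolding cont_metric by blast
 have "cvg (%n. f (s n)) (f x)" if s: "ALL n. s n : mspace X" "x : mspace X" "(%n. mdist X x (s n)) ~~> 0" for s x
  unfolding cvg_def
 proof (intro conjI allI LIMSEQ_I)
  fix e :: real assume "e > 0"
  then obtain d where "d > 0" "ALL y. y : mspace X & mdist X x y < d --> (if f x : C[A] & f y : C[A] then N[A] (f x -[A] f y) else 0) < e"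
   using L[unfolded cont_metric] s(2) by blast
  hence d: "d > 0" "!!y. y : mspace X ==> mdist X x y < d ==> N[A] (f x -[A] f y) < e"
   using c s(2) by auto
  obtain N where "!!n. n >= N ==> mdist X x (s n) < d" using order_tendstoD(2)[OF s(3) d(1)] unfolding eventually_sequentially by blast
  hence "N[A] (f (s n) -[A] f x) < e" if "n >= N" for n using d(2)[of "s n"] s norm_minus_commute[OF c c, of "s n" x] that by simp
  thus "EX no. ALL n>=no. norm (N[A] (f (s n) -[A] f x) - 0) < e" using c s by (intro exI[of _ N]) (simp add: norm_nonneg)
 qed (use c s in auto)
 thus ?R using c by blast
next
 assume R: ?R
 hence c: "f x : C[A]" if "x : mspace X" for x using that by blast
 have "EX d>0. ALL y. y : mspace X & mdist X x y < d --> N[A] (f x -[A] f y) < e" if x: "x : mspace X" and e: "e > 0" for x e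
 proof (rule ccontr)
  assume "~ ?thesis"
  hence "EX y. y : mspace X & mdist X x y < inverse (real (Suc n)) & ~ N[A] (f x -[A] f y) < e" for n by simp
  then obtain s where s: "!!n. s n : mspace X" "!!n. mdist X x (s n) < inverse (real (Suc n))" "!!n. ~ N[A] (f x -[A] f (s n)) < e" by metis
  have "(%n. mdist X x (s n)) ~~> 0"
   by (rule real_tendsto_sandwich[OF _ _ tendsto_const LIMSEQ_inverse_real_of_nat]) (use s(2) in "auto intro!: always_eventually less_imp_le")
  hence "(%n. N[A] (f (s n) -[A] f x)) ~~> 0" using R s(1) x unfolding cvg_def by blast
  then obtain n where "N[A] (f (s n) -[A] f x) < e" using order_tendstoD(2)[OF _ e] by force
  thus False using s(1,3) norm_minus_commute[OF c c, of "s n" x] x by simp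
 qed
 thus ?L unfolding cont_metric using c by auto
qed

lemma C_carrier: "f : C[C] \<longleftrightarrow> f : extensional (mspace X) & (ALL x:mspace X. f x : C[A]) &
  (ALL s x. (ALL n. s n : mspace X) & x : mspace X & (%n. mdist X x (s n)) ~~> 0 --> cvg (%n. f (s n)) (f x))"
 unfolding cont_seq[symmetric] by (simp add: cfun_alg_def)

lemma C_closed: "f : C[C] ==> x : mspace X ==> f x : C[A]" by (simp add: C_carrier)
lemma C_ext: "f : C[C] ==> f : extensional (mspace X)" by (simp add: C_carrier)
lemma C_eqI: "f : C[C] ==> g : C[C] ==> (!!x. x : mspace X ==> f x = g x) ==> f = g"
 by (rule extensionalityI[OF C_ext C_ext])
lemma C_I: "(!!x. x : mspace X ==> F x : C[A]) ==>
  (!!s x. (!!n. s n : mspace X) ==> x : mspace X ==> (%n. mdist X x (s n)) ~~> 0 ==> cvg (%n. F (s n)) (F x)) ==> (\<lambda>x\<in>mspace X. F x) : C[C]"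
 unfolding C_carrier by simp
lemma C_cvg: "f : C[C] ==> (!!n. s n : mspace X) ==> x : mspace X ==> (%n. mdist X x (s n)) ~~> 0 ==> cvg (%n. f (s n)) (f x)"
 unfolding C_carrier by blast

lemma C_ops: "f +[C] g = (\<lambda>x\<in>mspace X. f x +[A] g x)" "f *[C] g = (\<lambda>x\<in>mspace X. f x *[A] g x)" "star C f = (\<lambda>x\<in>mspace X. star A (f x))" "\<zero>[C] = (\<lambda>x\<in>mspace X. \<zero>)"
 by (simp_all add: cfun_alg_def)

lemma C_image_compact: assumes "f : C[C]" shows "compactin (mtopology_of (cmetric A)) (f ` mspace X)"
proof -
 have "continuous_map (mtopology_of X) (mtopology_of (cmetric A)) f" using assms by (simp add: cfun_alg_def)
 from image_compactin[OF _ this, of "mspace X"] show ?thesis using cX by (simp add: compact_space_def)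
qed

lemma C_bdd: assumes f: "f : C[C]" shows "EX B>0. ALL x:mspace X. N[A] (f x) <= B"
proof (cases "mspace X = {}")
 case False
 then obtain x0 where x0: "x0 : mspace X" by blast
 have "MS.mbounded (f ` mspace X)" using C_image_compact[OF f] unfolding cm_topology by (rule MS.compactin_imp_mbounded)
 then obtain B where B: "!!x y. x : f ` mspace X ==> y : f ` mspace X ==> (if x : C[A] & y : C[A] then N[A] (x -[A] y) else 0) <= B"
  unfolding MS.mbounded_alt by blast
 have "N[A] (f x) <= \<bar>B\<bar> + N[A] (f x0) + 1" if "x : mspace X" for x
  using B[of "f x" "f x0"] that x0 norm_diff3[OF C_closed[OF f that] C_closed[OF f x0]] C_closed[OF f] by auto
 moreover have "\<bar>B\<bar> + N[A] (f x0) + 1 > 0" using norm_nonneg[OF C_closed[OF f x0]] by linarith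
 ultimately show ?thesis by blast
qed (auto intro: exI[of _ 1])

lemma C_norm: "N[C] f = Sup (insert 0 {N[A] (f x) | x. x : mspace X})" by (simp add: cfun_alg_def)
lemma C_norm_le: "0 <= c ==> (!!x. x : mspace X ==> N[A] (f x) <= c) ==> N[C] f <= c"
 unfolding C_norm by (rule cSup_least) auto
lemma C_norm_bdd: assumes "f : C[C]" shows "bdd_above (insert 0 {N[A] (f x) | x. x : mspace X})"
using C_bdd[OF assms] by auto
lemma C_norm_ge: "f : C[C] ==> x : mspace X ==> N[A] (f x) <= N[C] f"
 unfolding C_norm by (rule cSup_upper[OF _ C_norm_bdd]) auto
lemma C_norm_nonneg: "f : C[C] ==> 0 <= N[C] f"
 unfolding C_norm by (rule cSup_upper[OF _ C_norm_bdd]) auto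

lemma C_add: "f : C[C] ==> g : C[C] ==> f +[C] g : C[C]"
 unfolding C_ops by (rule C_I) (auto intro: C_closed intro!: cvg_add C_cvg)

lemma C_abelian: "abelian_group C"
proof (rule abelian_groupI)
 show z: "\<zero>[C] : C[C]" unfolding C_ops by (rule C_I) (auto intro: cvg_const)
 fix f g h assume f: "f : C[C]"
 note fx = C_closed[OF f]
 show "\<zero>[C] +[C] f = f" by (rule C_eqI[OF C_add[OF z f] f]) (simp add: C_ops fx)
 let ?a = "\<lambda>x\<in>mspace X. (-1) \<odot> f x"
 have n: "?a : C[C]" by (rule C_I) (auto intro: fx intro!: cvg_smult C_cvg[OF f])
 have "?a +[C] f = \<zero>[C]"
  by (rule C_eqI[OF C_add[OF n f] z]) (simp add: C_ops fx sm_neg1 M.l_neg)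
 thus "EX g:C[C]. g +[C] f = \<zero>[C]" using n by blast
 assume g: "g : C[C]"
 show "f +[C] g : C[C]" by (rule C_add[OF f g])
 show "f +[C] g = g +[C] f" by (rule C_eqI[OF C_add[OF f g] C_add[OF g f]]) (simp add: C_ops fx C_closed[OF g] M.a_comm)
 assume h: "h : C[C]"
 show "f +[C] g +[C] h = f +[C] (g +[C] h)"
  by (rule C_eqI[OF C_add[OF C_add[OF f g] h] C_add[OF f C_add[OF g h]]]) (simp add: C_ops fx C_closed[OF g] C_closed[OF h] M.a_assoc)
qed

lemma C_minus: assumes f: "f : C[C]" shows "x : mspace X ==> (\<ominus>\<^bsub>C\<^esub> f) x = \<ominus> f x"
proof -
 interpret CG: abelian_group C by (rule C_abelian)
 assume x: "x : mspace X"
 have "(\<ominus>\<^bsub>C\<^esub> f +[C] f) x = \<zero>[C] x" using CG.l_neg[OF f] by simp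
 thus ?thesis using x M.minus_equality[of "(\<ominus>\<^bsub>C\<^esub> f) x" "f x"] C_closed[OF CG.a_inv_closed[OF f] x] C_closed[OF f x] by (simp add: C_ops)
qed

lemma C_diff: "f : C[C] ==> g : C[C] ==> x : mspace X ==> (f -[C] g) x = f x -[A] g x"
 using C_minus[of g x] by (simp add: a_minus_def C_ops)

lemma C_metric: "Metric_space (C[C]) (%f g. if f : C[C] & g : C[C] then N[C] (f -[C] g) else 0)"
proof (rule normed_metric[OF C_abelian])
 interpret CG: abelian_group C by (rule C_abelian)
 fix f g assume f: "f : C[C]"
 show "0 <= N[C] f" by (rule C_norm_nonneg[OF f])
 show "N[C] f = 0 \<longleftrightarrow> f = \<zero>[C]"
 proof
  assume z: "N[C] f = 0"
  have "f x = \<zero>" if "x : mspace X" for x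
   using C_norm_ge[OF f that] norm_nonneg[OF C_closed[OF f that]] norm_eq_zero[OF C_closed[OF f that]] z by simp
  thus "f = \<zero>[C]" by (intro C_eqI[OF f CG.zero_closed]) (simp add: C_ops)
 next
  assume e: "f = \<zero>[C]"
  have "N[C] f <= 0" by (rule C_norm_le) (simp_all add: e C_ops)
  thus "N[C] f = 0" using C_norm_nonneg[OF f] by simp
 qed
 let ?a = "\<ominus>\<^bsub>C\<^esub> f"
 show "N[C] ?a = N[C] f"
 proof -
  have "{N[A] (?a x) | x. x : mspace X} = {N[A] (f x) | x. x : mspace X}"
   by (rule Collect_cong) (metis C_minus[OF f] C_closed[OF f] norm_minus)
  thus ?thesis by (simp add: C_norm)
 qed
 assume g: "g : C[C]"
 show "N[C] (f +[C] g) <= N[C] f + N[C] g"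
 proof (rule C_norm_le)
  fix x assume x: "x : mspace X"
  show "N[A] ((f +[C] g) x) <= N[C] f + N[C] g"
   using norm_triangle[OF C_closed[OF f x] C_closed[OF g x]] C_norm_ge[OF f x] C_norm_ge[OF g x] x by (simp add: C_ops)
 qed (use C_norm_nonneg f g in simp)
qed

text \<open>Pointwise positivity provides pointwise square roots; after scaling f into the unit ball
  they depend continuously on the point by \<open>cvg_rt\<close>.\<close>

lemma C_pos: assumes f: "f : C[C]" and p: "!!x. x : mspace X ==> f x : pos A" shows "f : pos C"
proof -
 obtain B where B: "B > 0" "!!x. x : mspace X ==> N[A] (f x) <= B" using C_bdd[OF f] by blast
 define c where "c = 1 / B"
 have c: "c > 0" using B by (simp add: c_def)
 define u where "u x = complex_of_real c \<odot> f x" for x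
 have uc: "u x : C[A]" if "x : mspace X" for x using C_closed[OF f that] by (simp add: u_def)
 have us: "sqb (u x)" if x: "x : mspace X" for x
 proof -
  have "u x : pos A" unfolding u_def by (rule pos_scale[OF p[OF x]]) (use c in simp)
  moreover have "N[A] (u x) <= 1"
   using B(2)[OF x] C_closed[OF f x] c by (simp add: u_def norm_smult) (simp add: c_def)
  ultimately show ?thesis using ucs_facts[OF ucsA] unfolding cstar_facts_def sq_facts_def sqb_def by blast
 qed
 note r = sqb_rt[OF uc us]
 let ?a = "complex_of_real (sqrt B)"
 define y where "y = (\<lambda>x\<in>mspace X. ?a \<odot> rt (u x))"
 have rc: "rt (u x) : C[A]" if "x : mspace X" for x using cvgD(2)[OF r(1)[OF that that]] .
 have yC: "y : C[C]" unfolding y_def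
 proof (rule C_I)
  fix s x assume s: "!!n. s n : mspace X" "x : mspace X" "(%n. mdist X x (s n)) ~~> 0"
  have "cvg (%n. u (s n)) (u x)" unfolding u_def by (rule cvg_smult[OF C_cvg[OF f s]])
  thus "cvg (%n. ?a \<odot> rt (u (s n))) (?a \<odot> rt (u x))"
   by (intro cvg_smult cvg_rt us s)
 qed (use rc in auto)
 have "star C y *[C] y = f"
 proof (rule extensionalityI[OF _ C_ext[OF f]])
  show "star C y *[C] y : extensional (mspace X)" by (simp add: C_ops)
  fix x assume x: "x : mspace X"
  have "(star C y *[C] y) x = ?a \<odot> (?a \<odot> (rt (u x) *[A] rt (u x)))"
   using x rc[OF x] r(2)[OF x x] by (simp add: C_ops y_def star_smult smult_mult_left smult_mult_right)
  also have "... = f x" using r(3)[OF x x] B(1) C_closed[OF f x] by (simp add: u_def c_def flip: sm_assoc of_real_mult)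
  finally show "(star C y *[C] y) x = f x" .
 qed
 thus ?thesis using yC unfolding pos_def by blast
qed

lemma C_posD: assumes "f : pos C" shows "f : C[C]" "x : mspace X ==> f x : pos A"
proof -
 obtain y where y: "y : C[C]" "f = star C y *[C] y" using assms by (auto simp: pos_def)
 let ?a = "\<lambda>x\<in>mspace X. star A (y x) *[A] y x"
 have "?a : C[C]"
  by (rule C_I) (auto intro!: C_closed[OF y(1)] cvg_mult cvg_star C_cvg[OF y(1)])
 moreover have "f = ?a" unfolding y(2) C_ops by auto
 ultimately show "f : C[C]" by simp
 show "f x : pos A" if "x : mspace X"
  using that C_closed[OF y(1) that] \<open>f = (\<lambda>x\<in>mspace X. star A (y x) *[A] y x)\<close> by (auto simp: pos_def)
qed

end

text \<open>The points of a failing sequence accumulate in the compact Y, where joint continuity is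
  contradicted. Uniformity over Y is what makes the path of functions continuous in the supremum
  norm.\<close>

lemma uniform_homotopy:
 assumes A: "cstar_algebra (A :: 'a cstar)" and Y: "compactin (mtopology_of (cmetric A)) Y" and t: "t : {0..1::real}" and e: "e > 0"
  and Hc: "!!t y. t : {0..1} ==> y : Y ==> H t y : C[A]"
  and H: "!!y e. y : Y ==> e > 0 ==> EX d>0. ALL t':{0..1}. ALL y':Y. \<bar>t' - t\<bar> < d & N[A] (y' -[A] y) < d --> N[A] (H t' y' -[A] H t y) < e"
 shows "EX d>0. ALL t':{0..1}. \<bar>t' - t\<bar> < d --> (ALL y:Y. N[A] (H t' y -[A] H t y) < e)"
proof (rule ccontr)
 interpret cstar_algebra A by (rule A)
 assume "~ ?thesis"
 hence "EX t':{0..1}. \<bar>t' - t\<bar> < d & (EX y:Y. ~ N[A] (H t' y -[A] H t y) < e)" if "d > 0" for d using that by blast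
 from this[OF positive_imp_inverse_positive[OF of_nat_0_less_iff[THEN iffD2, OF zero_less_Suc]]]
 obtain s y where s: "!!n. s n : {0..1}" "!!n. y n : Y" "!!n. \<bar>s n - t\<bar> < inverse (real (Suc n))" "!!n. ~ N[A] (H (s n) (y n) -[A] H t (y n)) < e" by metis
 obtain l r where l: "l : Y" "strict_mono (r :: nat => nat)" "limitin MS.mtopology (y \<circ> r) l sequentially"
  using Y s(2) unfolding cm_topology MS.compactin_sequentially by blast
 obtain d where d: "d > 0" "!!t' y'. t' : {0..1} ==> y' : Y ==> \<bar>t' - t\<bar> < d ==> N[A] (y' -[A] l) < d ==> N[A] (H t' y' -[A] H t l) < e / 2"
  using H[OF l(1), of "e/2"] e by auto
 have yl: "(%n. N[A] (y (r n) -[A] l)) ~~> 0" using l(3) Y s(2) l(1) by (simp add: MS.limitin_metric_dist_null cm_topology MS.compactin_sequentially subset_iff)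
 obtain N where N: "!!n. n >= N ==> N[A] (y (r n) -[A] l) < d" using order_tendstoD(2)[OF yl d(1)] unfolding eventually_sequentially by blast
 obtain M where M: "inverse (real (Suc M)) < d" using reals_Archimedean[OF d(1)] by blast
 define n where "n = max N M"
 have "inverse (real (Suc (r n))) <= inverse (real (Suc M))" using seq_suble[OF l(2), of n] by (simp add: n_def)
 hence st: "\<bar>s (r n) - t\<bar> < d" using s(3)[of "r n"] M by linarith
 have yn: "N[A] (y (r n) -[A] l) < d" using N[of n] by (simp add: n_def)
 have "N[A] (H (s (r n)) (y (r n)) -[A] H t l) < e / 2" by (rule d(2)[OF s(1,2) st yn])
 moreover have "N[A] (H t (y (r n)) -[A] H t l) < e / 2" by (rule d(2)[OF t s(2) _ yn]) (use d in simp)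
 ultimately have "N[A] (H (s (r n)) (y (r n)) -[A] H t (y (r n))) < e"
  using dist_triangle[of "H (s (r n)) (y (r n))" "H t l" "H t (y (r n))"] norm_minus_commute[of "H t (y (r n))" "H t l"]
   Hc[OF s(1,2), of "r n" "r n"] Hc[OF t l(1)] Hc[OF t s(2), of "r n"] by simp
 thus False using s(4) by blast
qed

context cfun_space begin

text \<open>The homotopy lives on the compact set f(X) rather than on X; composing it with f gives a
  path of functions, continuous in x because the homotopy is continuous in y.\<close>

lemma D_path:
 assumes a: "a : pos A" and s: "simple A"
  and h: "approximately_divisible A & (ALL p:C[A]. star A p = p & p *[A] p = p --> ~ (cuntz_le A a p & cuntz_le A p a)) | purely_infinite A & a ~= \<zero>"
  and f: "f : pos C" "!!x. x : mspace X ==> f x : ccls A a"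
 shows "EX \<gamma>. pathin (mtopology_of (cmetric C)) \<gamma> & (ALL t:{0..1}. \<gamma> t : pos C & (ALL x:mspace X. \<gamma> t x : ccls A a)) & \<gamma> 0 = f & \<gamma> 1 = (\<lambda>x\<in>mspace X. a)"
proof -
 have fC: "f : C[C]" using C_posD[OF f(1)] by blast
 define Y where "Y = f ` mspace X"
 have Y: "compactin (mtopology_of (cmetric A)) Y" "Y <= ccls A a" using C_image_compact[OF fC] f(2) by (auto simp: Y_def)
 have hf: "homotopy_facts A" using ucs_facts[OF ucsA] by (simp add: cstar_facts_def)
 obtain H :: "real => 'a => 'a" where "ALL t:{0..1}. ALL y:Y. H t y : ccls A a & H 0 y = y & H 1 y = a &
   (ALL e>0. EX d>0. ALL t':{0..1}. ALL y':Y. \<bar>t' - t\<bar> < d & N[A] (y' -[A] y) < d --> N[A] (H t' y' -[A] H t y) < e)"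
  by (rule exE[OF hf[unfolded homotopy_facts_def, THEN bspec, OF a, THEN mp, OF conjI[OF s h], THEN spec, THEN mp, OF conjI[OF Y]]])
 hence H: "!!t y. t : {0..1} ==> y : Y ==> H t y : ccls A a" "!!y. y : Y ==> H 0 y = y" "!!y. y : Y ==> H 1 y = a"
   and Hcont: "!!t y e. t : {0..1} ==> y : Y ==> e > 0 ==> EX d>0. ALL t':{0..1}. ALL y':Y. \<bar>t' - t\<bar> < d & N[A] (y' -[A] y) < d --> N[A] (H t' y' -[A] H t y) < e"
  by (meson atLeastAtMost_iff order_refl zero_le_one)+
 have Hp: "H t y : pos A" and Hc: "H t y : C[A]" if "t : {0..1}" "y : Y" for t y
  using H(1)[OF that] pos_closed by (auto simp: ccls_def)
 have fY: "f x : Y" if "x : mspace X" for x using that by (simp add: Y_def)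
 define \<gamma> where "\<gamma> t = (\<lambda>x\<in>mspace X. H t (f x))" for t
 have \<gamma>C: "\<gamma> t : C[C]" if t: "t : {0..1}" for t unfolding \<gamma>_def
 proof (rule C_I)
  fix q x assume q: "!!n. q n : mspace X" "x : mspace X" "(%n. mdist X x (q n)) ~~> 0"
  have "(%n. N[A] (H t (f (q n)) -[A] H t (f x))) ~~> 0"
  proof (rule LIMSEQ_I)
   fix e :: real assume "e > 0"
   then obtain d where d: "d > 0" "!!t' y'. t' : {0..1} ==> y' : Y ==> \<bar>t' - t\<bar> < d ==> N[A] (y' -[A] f x) < d ==> N[A] (H t' y' -[A] H t (f x)) < e"
    using Hcont[OF t fY[OF q(2)]] by blast
   have l: "(%n. N[A] (f (q n) -[A] f x)) ~~> 0" using C_cvg[OF fC q] by (simp add: cvg_def)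
   obtain N where "!!n. n >= N ==> N[A] (f (q n) -[A] f x) < d" using order_tendstoD(2)[OF l d(1)] unfolding eventually_sequentially by blast
   hence "N[A] (H t (f (q n)) -[A] H t (f x)) < e" if "n >= N" for n using d(1) d(2)[OF t fY[OF q(1)]] that by simp
   thus "EX no. ALL n>=no. norm (N[A] (H t (f (q n)) -[A] H t (f x)) - 0) < e"
    using Hc[OF t fY[OF q(1)]] Hc[OF t fY[OF q(2)]] by (intro exI[of _ N]) (simp add: norm_nonneg)
  qed
  thus "cvg (%n. H t (f (q n))) (H t (f x))" using Hc[OF t fY] q by (simp add: cvg_def)
 qed (use Hc[OF t fY] in auto)
 interpret MC: Metric_space "C[C]" "%f g. if f : C[C] & g : C[C] then N[C] (f -[C] g) else 0" by (rule C_metric)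
 interpret CG: abelian_group C by (rule C_abelian)
 have topC: "mtopology_of (cmetric C) = MC.mtopology" by (simp add: cmetric_def)
 have "pathin (mtopology_of (cmetric C)) \<gamma>"
  unfolding pathin_def topC MC.continuous_map_to_metric
 proof (intro ballI allI impI)
  fix t e :: real assume "t : topspace (top_of_set {0..1})" and e: "e > 0"
  hence t: "t : {0..1}" by simp
  \<comment> \<open>Half of e, because strict pointwise bounds give only a weak bound on the
    supremum.\<close>
  have "EX d>0. ALL t':{0..1}. \<bar>t' - t\<bar> < d --> (ALL y:Y. N[A] (H t' y -[A] H t y) < e / 2)"
   by (rule uniform_homotopy[OF cstar_algebra_axioms Y(1) t]) (use e Hc Hcont[OF t] in auto)
  then obtain d where d: "d > 0" "!!t' y. t' : {0..1} ==> \<bar>t' - t\<bar> < d ==> y : Y ==> N[A] (H t' y -[A] H t y) < e / 2" by blast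
  have "\<gamma> t' : MC.mball (\<gamma> t) e" if t': "t' : {0..1} \<inter> ball t d" for t'
  proof -
   have tt: "t' : {0..1}" "\<bar>t' - t\<bar> < d" using t' by (auto simp: dist_real_def)
   have "N[C] (\<gamma> t' -[C] \<gamma> t) <= e / 2"
    by (rule C_norm_le) (use e d(2)[OF tt fY] in "auto simp: C_diff[OF \<gamma>C[OF tt(1)] \<gamma>C[OF t]] less_imp_le, auto simp: \<gamma>_def less_imp_le")
   thus ?thesis using e \<gamma>C[OF t] \<gamma>C[OF tt(1)] MC.commute[of "\<gamma> t" "\<gamma> t'"] by (simp add: MC.in_mball)
  qed
  moreover have "openin (top_of_set {0..1}) ({0..1} \<inter> ball t d)" by (simp add: openin_open_Int)
  moreover have "t : {0..1} \<inter> ball t d" using t d by simp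
  ultimately show "EX U. openin (top_of_set {0..1}) U & t : U & (ALL t':U. \<gamma> t' : MC.mball (\<gamma> t) e)" by blast
 qed
 moreover have "\<gamma> t : pos C & (ALL x:mspace X. \<gamma> t x : ccls A a)" if t: "t : {0..1}" for t
  using C_pos[OF \<gamma>C[OF t]] Hp[OF t fY] H(1)[OF t fY] by (simp add: \<gamma>_def)
 moreover have "\<gamma> 0 = f"
  by (rule extensionalityI[OF _ C_ext[OF fC]]) (use H(2)[OF fY] in "auto simp: \<gamma>_def")
 moreover have "\<gamma> 1 = (\<lambda>x\<in>mspace X. a)" using H(3)[OF fY] by (auto simp: \<gamma>_def)
 ultimately show ?thesis by blast
qed

lemma D_path_connected:
 assumes a: "a : pos A" and s: "simple A"
  and h: "approximately_divisible A & (ALL p:C[A]. star A p = p & p *[A] p = p --> ~ (cuntz_le A a p & cuntz_le A p a)) | purely_infinite A & a ~= \<zero>"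
 shows "path_connectedin (mtopology_of (cmetric C)) (D_set A X a)"
proof -
 interpret stable_alg A by unfold_locales (rule ucsA)
 have D: "D_set A X a = {f : pos C. ALL x:mspace X. f x : ccls A a}"
  unfolding D_set_def using cu_class_eq[OF _ a] C_posD(2) by blast
 let ?T = "mtopology_of (cmetric C)" and ?D = "D_set A X a"
 let ?a = "path_component_of (subtopology ?T ?D)"
 let ?b = "\<lambda>x\<in>mspace X. a"
 have path: "?a f ?b" if f: "f : ?D" for f
 proof -
  obtain \<gamma> where "pathin ?T \<gamma>" "ALL t:{0..1}. \<gamma> t : pos C & (ALL x:mspace X. \<gamma> t x : ccls A a)" "\<gamma> 0 = f" "\<gamma> 1 = ?b"
   using D_path[OF a s h, of f] f unfolding D by blast
  thus ?thesis unfolding path_component_of_def D by (intro exI[of _ \<gamma>]) (simp add: pathin_subtopology)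
 qed
 have "?D <= topspace ?T"
  using C_posD(1) Metric_space.mspace_metric[OF C_metric] unfolding D by (auto simp: cmetric_def)
 moreover have "?a f g" if "f : ?D" "g : ?D" for f g
  by (rule path_component_of_trans[OF path[OF that(1)] path_component_of_sym[OF path[OF that(2)]]])
 hence "path_connected_space (subtopology ?T ?D)"
  unfolding path_connected_space_iff_path_component by simp
 ultimately show ?thesis by (simp add: path_connectedin_def)
qed

end

theorem theorem1p2:
  fixes A :: "'a cstar" and a :: 'a and X :: "'x metric"
  assumes "cstar_algebra A" and "unital A" and "simple A" and "separable A" and "exact A"
    and "approximately_divisible A" and "real_rank_zero A"
    and "a \<in> pos A"
    and "(stably_finite A \<and> \<not> cu_compact A (cu_class A a)) \<or>
         (purely_infinite A \<and> cu_class A a \<noteq> cu_class A \<zero>\<^bsub>A\<^esub>)"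
    and "compact_space (mtopology_of X)"
  shows "path_connectedin (mtopology_of (cmetric (cfun_alg X A))) (D_set A X a)"
proof -
 interpret cstar_algebra A by fact
 \<comment> \<open>Simplicity rules out the zero algebra.\<close>
 have u: "ucs A"
  using assms(1-3) by (simp add: ucs_def simple_def)
 interpret cfun_space A X by unfold_locales (use u assms in auto)
 interpret stable_alg A by unfold_locales (rule u)
 have "approximately_divisible A & (ALL p:C[A]. star A p = p & p \<otimes>\<^bsub>A\<^esub> p = p --> ~ (cuntz_le A a p & cuntz_le A p a)) \<or>
   purely_infinite A & a ~= \<zero>\<^bsub>A\<^esub>"
  using assms(9)
 proof
  assume "stably_finite A & ~ cu_compact A (cu_class A a)"
  thus ?thesis using noncompact_not_proj[OF assms(8)] assms(6) by blast
 \<comment> \<open>In the purely infinite case a differs from 0 because its class does.\<close>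
 qed auto
 thus ?thesis by (rule D_path_connected[OF assms(8,3)])
qed

end
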